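(* Let $\Lambda\subset\mathbb{Z}^2$ be a lattice, let $\mathcal{R}\subset\mathbb{R}^2$ be a region, and let $L_1,\dots,L_4\in\mathbb{Q}[x_1,x_2]$ be linear forms, no two of which are proportional, such that $L_i(\mathbf{x})\in\mathbb{Z}$ for all $\mathbf{x}\in\Lambda$ and $L_i(\mathbf{x})\ge0$ for all $\mathbf{x}\in\mathcal{R}$ $(i=1,2,3,4)$. Put $r=\sup_{\mathbf{x}\in\mathcal{R}}\{L_1(\mathbf{x}),L_2(\mathbf{x}),L_3(\mathbf{x}),L_4(\mathbf{x}),|x_1|,|x_2|\}$. Let $X\ge1$, assume that $|\partial X\mathcal{R}|\ll rX$, and let $V=V(X)\subset[0,1]^4$ be a non-empty compact set that is cut out by a bounded number of hyperplanes each with bounded coefficients. Let $$S(X;V)=\sum_{\mathbf{x}\in\Lambda\cap X\mathcal{R}}\#\left\{\mathbf{d}\in\mathbb{N}^4:\ d_i\mid L_i(\mathbf{x})\ (i=1,2,3,4),\ \left(\frac{\log d_i}{\log rX}\right)_{i=1,2,3,4}\in V\right\}.$$ Then $$S(X;V)=\frac{C_\infty\prod_pC_p}{\det\Lambda}X^2(\log X)^4+O_{L_1,L_2,L_3,L_4,r,\Lambda}\left(X^2(\log X)^3\log\log X\right)$$ as $X\to\infty$, where $$C_\infty=\operatorname{vol}\mathcal{R}\,\operatorname{vol}V,\qquad C_p=\left(1-\frac1p\right)^4\left(\sum_{\mathbf{k}\in\mathbb{Z}_{\ge0}^4}\frac1{\rho(p^{k_1},p^{k_2},p^{k_3},p^{k_4})}\right).$$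 Moreover $\prod_p|C_p|\ll_\varepsilon(\Delta\det\Lambda)^\varepsilon$ for any $\varepsilon>0$.
   Context: A region is a compact set with a continuous piecewise differentiable boundary; $|\partial\mathcal{R}|$ denotes the length of the boundary, and $X\mathcal{R}=\{\mathbf{x}\in\mathbb{R}^2:\mathbf{x}/X\in\mathcal{R}\}$. The lattice $\Lambda$ is equipped with the usual Euclidean inner product, and the determinant of a lattice is the measure of any fundamental domain. The error term is independent of $V$. For $\mathbf{d}\in\mathbb{N}^4$, $$\Lambda(\mathbf{d})=\{\mathbf{x}\in\Lambda:d_i\mid L_i(\mathbf{x}),\ i=1,2,3,4\},\qquad\rho(\mathbf{d})=\frac{\det\Lambda(\mathbf{d})}{\det\Lambda}.$$ Let $c_i\in\mathbb{N}$ be minimal such that $L_i(\mathbf{x})=\ell_i(\mathbf{x})/c_i$ with $\ell_i\in\mathbb{Z}[x_1,x_2]$; $\Delta\in\mathbb{Z}$ is the product of the resultants of the pairs of linear forms $\ell_i$ and $\ell_j$ for $i\ne j$. Products over $p$ are over all primes.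
   Formalization: S(X;V) runs only over lattice points with all L_i(x) nonzero (if 0 lies in R and V=[0,1]^4, x=0 alone contributes about (rX)^4); the boundary of R is a union of at most m curves, and the error constant may depend on m and on the implied constant in |∂XR|≪rX. *)

theory Defs
  imports "HOL-Analysis.Analysis"
begin

section \<open>Lattices in the plane\<close>

definition is_lattice :: "(real^2) set \<Rightarrow> bool" where
  "is_lattice \<Lambda> \<longleftrightarrow>
     (\<exists>u v. u \<noteq> v \<and> independent {u, v} \<and>
        \<Lambda> = {of_int m *\<^sub>R u + of_int n *\<^sub>R v | (m::int) (n::int). True})"

definition integral_points :: "(real^2) set" where
  "integral_points = {x. \<forall>i. x $ i \<in> \<int>}"

definition fundamental_domain :: "(real^2) set \<Rightarrow> (real^2) set \<Rightarrow> bool" where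
  "fundamental_domain \<Lambda> F \<longleftrightarrow> F \<in> sets lebesgue \<and> (\<forall>y. \<exists>!l. l \<in> \<Lambda> \<and> y - l \<in> F)"

text \<open>All measurable fundamental domains of a lattice have the same finite measure, and one exists,
  so the description below determines a number.\<close>

definition lattice_det :: "(real^2) set \<Rightarrow> real" where
  "lattice_det \<Lambda> = (THE D. \<forall>F. fundamental_domain \<Lambda> F \<longrightarrow> measure lebesgue F = D)"


section \<open>Quadruples of rational linear forms\<close>

text \<open>The entry \<open>L $ i $ j\<close> is the coefficient of the \<open>j\<close>-th variable in the \<open>i\<close>-th form.\<close>

definition lform :: "rat^2 \<Rightarrow> real^2 \<Rightarrow> real" where
  "lform a x = (\<Sum>j\<in>UNIV. of_rat (a $ j) * x $ j)"

text \<open>The zero form is proportional to every form, so the forms below are nonzero.\<close>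

definition pairwise_nonproportional :: "rat^2^4 \<Rightarrow> bool" where
  "pairwise_nonproportional L \<longleftrightarrow> (\<forall>i j. i \<noteq> j \<longrightarrow> \<not> (\<exists>t. L $ i = t *s L $ j))"

definition admissible :: "(real^2) set \<Rightarrow> rat^2^4 \<Rightarrow> bool" where
  "admissible \<Lambda> L \<longleftrightarrow>
     is_lattice \<Lambda> \<and> \<Lambda> \<subseteq> integral_points \<and> pairwise_nonproportional L \<and>
     (\<forall>i. \<forall>x\<in>\<Lambda>. lform (L $ i) x \<in> \<int>)"

definition form_denom :: "rat^2 \<Rightarrow> nat" where
  "form_denom a = (LEAST c. c > 0 \<and> (\<forall>j. of_nat c * a $ j \<in> \<int>))"

definition integral_form :: "rat^2 \<Rightarrow> int^2" where
  "integral_form a = (\<chi> j. \<lfloor>of_nat (form_denom a) * a $ j\<rfloor>)"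

text \<open>The resultant of two binary linear forms is the determinant of their coefficients (their
  \<open>2 \<times> 2\<close> Sylvester matrix).\<close>

definition form_resultant :: "int^2 \<Rightarrow> int^2 \<Rightarrow> int" where
  "form_resultant a b = a $ 1 * b $ 2 - a $ 2 * b $ 1"

text \<open>The product runs over ordered pairs, so it is the square of the product over unordered
  pairs; in particular it is positive for pairwise nonproportional forms.\<close>

definition form_Delta :: "rat^2^4 \<Rightarrow> int" where
  "form_Delta L =
     (\<Prod>(i, j)\<in>{(i, j). i \<noteq> j}. form_resultant (integral_form (L $ i)) (integral_form (L $ j)))"


section \<open>Local densities\<close>

text \<open>The forms take integer values on \<open>\<Lambda>\<close>, where the floor only converts the type.\<close>

definition divisor_sublattice :: "(real^2) set \<Rightarrow> rat^2^4 \<Rightarrow> nat^4 \<Rightarrow> (real^2) set" where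
  "divisor_sublattice \<Lambda> L d = {x\<in>\<Lambda>. \<forall>i. int (d $ i) dvd \<lfloor>lform (L $ i) x\<rfloor>}"

definition rho :: "(real^2) set \<Rightarrow> rat^2^4 \<Rightarrow> nat^4 \<Rightarrow> real" where
  "rho \<Lambda> L d = lattice_det (divisor_sublattice \<Lambda> L d) / lattice_det \<Lambda>"

definition local_term :: "(real^2) set \<Rightarrow> rat^2^4 \<Rightarrow> nat \<Rightarrow> nat^4 \<Rightarrow> real" where
  "local_term \<Lambda> L p k = 1 / rho \<Lambda> L (\<chi> i. p ^ (k $ i))"

definition local_factor :: "(real^2) set \<Rightarrow> rat^2^4 \<Rightarrow> nat \<Rightarrow> real" where
  "local_factor \<Lambda> L p = (1 - 1 / real p) ^ 4 * (\<Sum>\<^sub>\<infinity>k\<in>UNIV. local_term \<Lambda> L p k)"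

text \<open>A product over the primes is an infinite product over all natural numbers whose factors
  at the other indices are 1.\<close>

definition at_primes :: "(nat \<Rightarrow> real) \<Rightarrow> nat \<Rightarrow> real" where
  "at_primes f n = (if prime n then f n else 1)"


section \<open>Regions\<close>

text \<open>Length of a plane set, as its one-dimensional Hausdorff measure; for a rectifiable arc or
  simple closed curve this is the length of the curve.\<close>

definition set_length :: "(real^2) set \<Rightarrow> ennreal" where
  "set_length A =
     (SUP \<delta>\<in>{0<..}. INF U\<in>{U. A \<subseteq> (\<Union>n::nat. U n) \<and> (\<forall>n. bounded (U n) \<and> diameter (U n) \<le> \<delta>)}.
        (\<Sum>n. ennreal (diameter (U n))))"

text \<open>The boundary consists of at most \<open>m\<close> continuous piecewise differentiable curves (\<open>m = 1\<close>: a
  single curve). Estimates that are uniform in the region need a bound for this number: tiny discs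
  around all points of \<open>X\<^sup>-\<^sup>1\<Lambda>\<close> in a fixed box have arbitrarily small total boundary length and area,
  but their dilate by \<open>X\<close> contains about \<open>X\<^sup>2\<close> points of \<open>\<Lambda>\<close>.\<close>

definition region :: "nat \<Rightarrow> (real^2) set \<Rightarrow> bool" where
  "region m R \<longleftrightarrow>
     compact R \<and>
     (\<exists>gs :: (real \<Rightarrow> real^2) list. length gs \<le> m \<and>
        (\<forall>g\<in>set gs. g piecewise_differentiable_on {0..1}) \<and>
        frontier R = (\<Union>g\<in>set gs. path_image g))"

definition dilate :: "real \<Rightarrow> (real^2) set \<Rightarrow> (real^2) set" where
  "dilate X R = {x. x /\<^sub>R X \<in> R}"

definition region_size :: "rat^2^4 \<Rightarrow> (real^2) set \<Rightarrow> real" where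
  "region_size L R = Sup (\<Union>x\<in>R. range (\<lambda>i. lform (L $ i) x) \<union> range (\<lambda>j. \<bar>x $ j\<bar>))"


section \<open>The set of exponents\<close>

text \<open>At most \<open>N\<close> hyperplanes \<open>a \<bullet> v = b\<close> with coefficients bounded by \<open>B\<close> cut the unit cube
  into cells, and \<open>V\<close> is a union of such cells of any dimension. Intersections of the cube with at
  most \<open>N\<close> half-spaces are the convex instances.\<close>

definition cut_out :: "nat \<Rightarrow> real \<Rightarrow> (real^4) set \<Rightarrow> bool" where
  "cut_out N B V \<longleftrightarrow>
     V \<subseteq> cbox 0 1 \<and>
     (\<exists>H :: ((real^4) \<times> real) set. finite H \<and> card H \<le> N \<and>
        (\<forall>(a, b)\<in>H. a \<noteq> 0 \<and> (\<forall>i. \<bar>a $ i\<bar> \<le> B) \<and> \<bar>b\<bar> \<le> B) \<and>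
        (\<forall>v\<in>cbox 0 1. \<forall>w\<in>cbox 0 1.
           (\<forall>(a, b)\<in>H. sgn (a \<bullet> v - b) = sgn (a \<bullet> w - b)) \<longrightarrow> (v \<in> V \<longleftrightarrow> w \<in> V)))"


section \<open>The divisor sum\<close>

definition divisor_quadruples ::
    "rat^2^4 \<Rightarrow> (real^2) set \<Rightarrow> real \<Rightarrow> (real^4) set \<Rightarrow> real^2 \<Rightarrow> (nat^4) set" where
  "divisor_quadruples L R X V x =
     {d. (\<forall>i. d $ i > 0 \<and> int (d $ i) dvd \<lfloor>lform (L $ i) x\<rfloor>) \<and>
         (\<chi> i. ln (real (d $ i)) / ln (region_size L R * X)) \<in> V}"

text \<open>Divisors are only counted for nonzero values: lattice points at which some form vanishes are
  left out. Such points can only lie on the boundary of the cone where all forms are nonnegative.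
  With the convention that every \<open>d\<close> divides 0, the origin alone would contribute about
  \<open>(r X)\<^sup>4\<close> for \<open>V = [0,1]\<^sup>4\<close>, which exceeds the main term. If the forms are positive on \<open>R\<close>, the
  extra condition is void.\<close>

definition divisor_sum ::
    "(real^2) set \<Rightarrow> rat^2^4 \<Rightarrow> (real^2) set \<Rightarrow> real \<Rightarrow> (real^4) set \<Rightarrow> real" where
  "divisor_sum \<Lambda> L R X V =
     (\<Sum>x\<in>{x \<in> \<Lambda> \<inter> dilate X R. \<forall>i. lform (L $ i) x \<noteq> 0}.
        real (card (divisor_quadruples L R X V x)))"

definition main_term ::
    "(real^2) set \<Rightarrow> rat^2^4 \<Rightarrow> (real^2) set \<Rightarrow> real \<Rightarrow> (real^4) set \<Rightarrow> real" where
  "main_term \<Lambda> L R X V =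
     (measure lebesgue R * measure lebesgue V) * prodinf (at_primes (local_factor \<Lambda> L))
       / lattice_det \<Lambda> * X\<^sup>2 * (ln X) ^ 4"

end

theory Submission
  imports Defs "HOL-Computational_Algebra.Squarefree"
begin

text \<open>The inner count is turned into a sum over \<open>d\<close> of the number of points of \<open>\<Lambda>(d)\<close> in \<open>X R\<close>. This number is
  \<open>vol(X R) / det \<Lambda>(d)\<close> up to an error bounded by the length of the boundary over the length of a shortest
  vector of \<open>\<Lambda>(d)\<close>, and summing over \<open>d\<close> amounts to counting divisors of the values of the forms at short
  vectors; this is admissible as long as \<open>\<Prod>d\<^sub>i\<close> is at most \<open>(r X)\<^sup>2\<close> divided by a power of \<open>ln X\<close>. To stay in
  this range, a divisor \<open>d\<^sub>i\<close> larger than the square root of the value is switched with the complementary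
  divisor. The divisors near the square root, the points with many divisors and those with small values
  contribute only \<open>X\<^sup>2 (ln X)\<^sup>3 ln (ln X)\<close>: a divisor function is bounded by a constant times the number of
  divisors below a smaller power, so the count for the remaining coordinates can be kept in the admissible range.
  The main term is a sum of the multiplicative function \<open>1 / \<rho>(d)\<close> over \<open>d\<close> with logarithms in a
  dilate of \<open>V\<close>; writing \<open>1 / \<rho>\<close> as a convolution of \<open>1 / \<Prod>d\<^sub>i\<close> with an absolutely summable function gives the
  volume of \<open>V\<close> times the Euler product.\<close>

section \<open>Divisors of an integer\<close>

text \<open>Write \<open>l = ln (r * X)\<close>. Folding only brings each coordinate down to
  \<open>exp (l / 2)\<close>, so the product can still reach \<open>exp (2 * l)\<close>, which is
  just where the counting error ceases to be negligible. Hence every coordinate is cut at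
  \<open>exp (l / 2) / T\<close> with \<open>T = l ^ 128\<close>. In logarithmic coordinates the
  strip lost at \<open>1 / 2\<close> has width \<open>ln T / l\<close>; its share of the main term
  is the source of the double logarithm. The strip must itself be counted, with one coordinate up to
  \<open>exp (l / 2)\<close> and the others unrestricted. Moving the others to divisors below the
  cut lowers the product to \<open>exp (2 * l) / T ^ 3\<close>. This works for a value with a prime
  power component above \<open>T ^ 4\<close>, and such a component is forced if the value has at
  most \<open>l ^ 32\<close> divisors and is at least \<open>exp l / T\<close>. A fifth moment of
  the divisor function loses \<open>l ^ 32\<close>, which fixes the first exponent;
  \<open>128 = 4 * 32\<close> then pays for the points with a small value. Apart from
  \<open>r\<close>, the region and \<open>V\<close> enter the constants only through the number of
  boundary curves, the bound for the boundary length and the number of hyperplanes; this is the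
  uniformity of the error term.\<close>

definition tau :: "nat \<Rightarrow> nat" where
  "tau n = card {d. d dvd n}"

lemma finite_divisors: "n > 0 \<Longrightarrow> finite {d. d dvd (n::nat)}"
  by (rule finite_subset[of _ "{..n}"]) (auto dest: dvd_imp_le)

lemma tau_pos: "n > 0 \<Longrightarrow> tau n \<ge> 1"
proof -
  assume n: "n > 0"
  have "{1} \<subseteq> {d. d dvd n}" by auto
  from card_mono[OF finite_divisors[OF n] this] show ?thesis by (simp add: tau_def)
qed

lemma tau_mult_le:
  assumes "a > 0" "b > 0"
  shows "tau (a * b) \<le> tau a * tau b"
proof -
  have "{d. d dvd a * b} \<subseteq> (\<lambda>(x,y). x * y) ` ({d. d dvd a} \<times> {d. d dvd b})"
    using division_decomp by force
  then have "card {d. d dvd a * b} \<le> card ({d. d dvd a} \<times> {d. d dvd b})"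
    using assms by (intro surj_card_le) (auto simp: finite_divisors)
  then show ?thesis by (simp add: tau_def card_cartesian_product)
qed

lemma inj_on_coprime_divisors:
  assumes "coprime a (b::nat)"
  shows "inj_on (\<lambda>(x,y). x * y) ({d. d dvd a} \<times> {d. d dvd b})"
proof (rule inj_onI, clarsimp)
  fix x y x' y' assume h: "x dvd a" "y dvd b" "x' dvd a" "y' dvd b" "x * y = x' * y'"
  have c: "coprime x y'" "coprime x' y" using assms h by (meson coprime_divisors)+
  have "x dvd x'" using h(5) c(1) by (metis coprime_dvd_mult_left_iff dvd_triv_left)
  moreover have "x' dvd x" using h(5) c(2) by (metis coprime_dvd_mult_left_iff dvd_triv_left)
  ultimately have xx: "x = x'" by (simp add: dvd_antisym)
  have "y dvd y'" using h(5) c(2) by (metis coprime_commute coprime_dvd_mult_right_iff dvd_triv_right)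
  moreover have "y' dvd y" using h(5) c(1) by (metis coprime_commute coprime_dvd_mult_right_iff dvd_triv_right)
  ultimately show "x = x' \<and> y = y'" using xx by (simp add: dvd_antisym)
qed

lemma tau_mult_coprime:
  assumes "a > 0" "b > 0" "coprime a b"
  shows "tau (a * b) = tau a * tau b"
proof -
  have "{d. d dvd a * b} = (\<lambda>(x,y). x * y) ` ({d. d dvd a} \<times> {d. d dvd b})"
    using division_decomp by (force intro: mult_dvd_mono)
  then have "card {d. d dvd a * b} = card ({d. d dvd a} \<times> {d. d dvd b})"
    by (simp add: card_image inj_on_coprime_divisors[OF assms(3)])
  then show ?thesis by (simp add: tau_def card_cartesian_product)
qed

lemma tau_prime_power:
  assumes "prime p" shows "tau (p ^ a) = a + 1"
proof -
  have "{d. d dvd p ^ a} = (\<lambda>i. p ^ i) ` {..a}"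
    using divides_primepow_nat[OF assms] by auto
  moreover have "inj_on (\<lambda>i. p ^ i) {..a}"
    using prime_gt_1_nat[OF assms] by (auto intro!: inj_onI)
  ultimately show ?thesis by (simp add: tau_def card_image)
qed

text \<open>Of a divisor and its complementary divisor at least one has square at most
  \<open>m\<close>, so the small divisors and their complements exhaust all divisors.\<close>

lemma tau_le_twice_small:
  assumes "m > 0"
  shows "tau m \<le> 2 * card {d. d dvd m \<and> d * d \<le> m}"
proof -
  let ?A = "{d. d dvd m \<and> d * d \<le> m}"
  have fin: "finite ?A" using finite_divisors[OF assms] by simp
  have "{d. d dvd m} \<subseteq> ?A \<union> (\<lambda>d. m div d) ` ?A"
  proof (rule subsetI, clarsimp)
    fix d assume d: "d dvd m" "d \<notin> (\<lambda>d. m div d) ` {d. d dvd m \<and> d * d \<le> m}"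
    show "d * d \<le> m"
    proof (rule ccontr)
      assume g: "\<not> d * d \<le> m"
      obtain e where e: "m = d * e" using d by auto
      have "e * e \<le> m" using g e by (metis less_le_not_le linear mult_le_mono nat_le_linear)
      moreover have "e dvd m" "m div e = d" using e assms by auto
      ultimately show False using d(2) by (metis (mono_tags, lifting) image_eqI mem_Collect_eq)
    qed
  qed
  then have "tau m \<le> card (?A \<union> (\<lambda>d. m div d) ` ?A)"
    unfolding tau_def using fin by (intro card_mono) auto
  also have "\<dots> \<le> card ?A + card ((\<lambda>d. m div d) ` ?A)" by (rule card_Un_le)
  also have "\<dots> \<le> card ?A + card ?A" using card_image_le[OF fin] by simp
  finally show ?thesis by simp
qed

text \<open>A prime power \<open>p ^ a\<close> exactly dividing \<open>n\<close> forces a positive proportion of the divisors of \<open>n\<close>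
  to lie below \<open>sqrt n / p powr (a / 4)\<close>: take the exponent of \<open>p\<close> at most \<open>a / 4\<close> and
  the remaining cofactor at most its square root.\<close>

lemma tau_le_eight_small:
  assumes p: "prime p" and m: "m > 0" "coprime p m" and n: "n = p ^ a * m"
  shows "tau n \<le> 8 * card {d. d dvd n \<and> d ^ 4 * p ^ a \<le> n ^ 2}"
proof -
  let ?A = "{d. d dvd m \<and> d * d \<le> m}" and ?B = "{d. d dvd n \<and> d ^ 4 * p ^ a \<le> n ^ 2}"
  have p0: "p > 0" using p by (simp add: prime_gt_0_nat)
  have n0: "n > 0" using m p0 n by simp
  let ?f = "\<lambda>(b, e). p ^ b * e"
  have cop: "coprime (p ^ a) m" using m by simp
  have sub: "?f ` ({..a div 4} \<times> ?A) \<subseteq> ?B"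
  proof (rule subsetI, clarsimp)
    fix b e assume b: "b \<le> a div 4" and e: "e dvd m" "e * e \<le> m"
    have "p ^ b * e dvd n" unfolding n using b e by (intro mult_dvd_mono le_imp_power_dvd) auto
    moreover have "(p ^ b * e) ^ 4 * p ^ a \<le> n ^ 2"
    proof -
      have "(p ^ b * e) ^ 4 = p ^ (b * 4) * e ^ 4" by (simp only: power_mult_distrib power_mult)
      moreover have "e ^ 4 = (e * e) ^ 2" by (simp add: power2_eq_square power4_eq_xxxx)
      ultimately have "(p ^ b * e) ^ 4 * p ^ a = p ^ (4 * b + a) * (e * e) ^ 2"
        by (simp add: power_add mult.commute)
      \<comment> \<open>The fourth power turns \<open>b \<le> a div 4\<close> into
        \<open>4 * b \<le> a\<close>, and \<open>e * e \<le> m\<close> bounds the other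
        factor.\<close>
      also have "\<dots> \<le> p ^ (2 * a) * m ^ 2"
        using b e p0 by (intro mult_le_mono power_increasing power_mono) auto
      also have "\<dots> = n ^ 2" unfolding n power_mult_distrib power_mult[symmetric] by (simp add: mult.commute)
      finally show ?thesis .
    qed
    ultimately show "p ^ b * e dvd n \<and> (p ^ b * e) ^ 4 * p ^ a \<le> n\<^sup>2" by simp
  qed
  have inj: "inj_on ?f ({..a div 4} \<times> ?A)"
  proof (rule inj_onI, clarsimp)
    fix b e b' e' assume h: "b \<le> a div 4" "e dvd m" "b' \<le> a div 4" "e' dvd m" "p ^ b * e = p ^ b' * e'"
    have d1: "(p ^ b, e) \<in> {d. d dvd p ^ a} \<times> {d. d dvd m}"
      using h by (auto intro!: le_imp_power_dvd)
    have d2: "(p ^ b', e') \<in> {d. d dvd p ^ a} \<times> {d. d dvd m}"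
      using h by (auto intro!: le_imp_power_dvd)
    have "(p ^ b, e) = (p ^ b', e')"
      using inj_onD[OF inj_on_coprime_divisors[OF cop] _ d1 d2] h(5) by simp
    then show "b = b' \<and> e = e'" using prime_gt_1_nat[OF p] by simp
  qed
  have "(a div 4 + 1) * card ?A = card (?f ` ({..a div 4} \<times> ?A))"
    by (simp add: card_image[OF inj] card_cartesian_product)
  also have "\<dots> \<le> card ?B" using sub finite_divisors[OF n0] by (intro card_mono) auto
  finally have c: "(a div 4 + 1) * card ?A \<le> card ?B" .
  have "tau n = (a + 1) * tau m"
    unfolding n using tau_mult_coprime[OF _ m(1) cop] p0 by (simp add: tau_prime_power[OF p])
  \<comment> \<open>\<open>a + 1 \<le> 4 * (a div 4 + 1)\<close>: at least a quarter of the
    exponents of \<open>p\<close> and half of the divisors of the cofactor are kept, hence the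
    constant 8.\<close>
  also have "\<dots> \<le> (4 * (a div 4 + 1)) * (2 * card ?A)"
    using tau_le_twice_small[OF m(1)] by (intro mult_le_mono) auto
  also have "\<dots> = 8 * ((a div 4 + 1) * card ?A)" by (simp add: algebra_simps)
  also have "\<dots> \<le> 8 * card ?B" using c by (intro mult_le_mono2)
  finally show ?thesis .
qed

lemma prime_power_split:
  fixes n p :: nat
  assumes "n > 0" "prime p"
  obtains m where "m > 0" "coprime p m" "n = p ^ multiplicity p n * m"
proof -
  have "\<not> is_unit p" using assms not_prime_unit[of p] by blast
  moreover have "n \<noteq> 0" using assms by simp
  ultimately obtain m where "n = p ^ multiplicity p n * m" "\<not> p dvd m"
    using multiplicity_decompose'[of n p] by metis
  with assms show ?thesis using that[of m] by (metis gr_zeroI mult_0_right prime_imp_coprime)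
qed

text \<open>The witness is the number of distinct primes dividing \<open>n\<close>: each contributes
  a factor of at least 2 to \<open>tau n\<close> and of at most \<open>Q\<close> to
  \<open>n\<close>. The induction strips one prime power component at a time.\<close>

lemma le_power_tau:
  fixes Q :: real
  assumes "n > 0" "Q \<ge> 1" "\<And>p. prime p \<Longrightarrow> real (p ^ multiplicity p n) \<le> Q"
  shows "\<exists>k. 2 ^ k \<le> tau n \<and> real n \<le> Q ^ k"
  using assms
proof (induction n rule: less_induct)
  case (less n)
  show ?case
  proof (cases "n = 1")
    case True then show ?thesis using tau_pos[of 1] by (intro exI[of _ 0]) simp
  next
    case False
    obtain p where p: "prime p" "p dvd n" using prime_factor_nat[OF False] by auto
    let ?a = "multiplicity p n"
    obtain m where m: "m > 0" "coprime p m" "n = p ^ ?a * m" using prime_power_split[OF less.prems(1) p(1)] .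
    have a: "?a > 0" using p less.prems(1) prime_multiplicity_gt_zero_iff[of p n] by simp
    have "p ^ ?a > 1" using one_less_power[OF prime_gt_1_nat[OF p(1)] a] .
    then have mn: "m < n" using m(1) by (subst m(3)) simp
    have "real (q ^ multiplicity q m) \<le> Q" if q: "prime q" for q
    proof -
      have "q ^ multiplicity q m dvd n" using m(3) by (metis dvd_mult multiplicity_dvd)
      moreover have "n \<noteq> 0" "\<not> is_unit q" using less.prems(1) q not_prime_unit[of q] by auto
      ultimately have "multiplicity q m \<le> multiplicity q n" by (intro multiplicity_geI)
      then have "q ^ multiplicity q m \<le> q ^ multiplicity q n"
        using prime_gt_0_nat[OF q] by (intro power_increasing) auto
      then show ?thesis using less.prems(3)[OF q] by linarith
    qed
    from less.IH[OF mn m(1) less.prems(2) this] obtain k where k: "2 ^ k \<le> tau m" "real m \<le> Q ^ k" by auto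
    have "tau n = tau (p ^ ?a) * tau m"
      using tau_mult_coprime[of "p ^ ?a" m] m p(1) prime_gt_0_nat by simp
    also have "\<dots> \<ge> 2 * 2 ^ k" using a k by (subst tau_prime_power[OF p(1)]) (intro mult_le_mono, auto)
    finally have "2 ^ Suc k \<le> tau n" by simp
    moreover have "real n \<le> Q ^ Suc k"
    proof -
      have "real n = real (p ^ ?a) * real m" by (subst m(3)) simp
      also have "\<dots> \<le> Q * Q ^ k" using less.prems(2,3) p k by (intro mult_mono) auto
      finally show ?thesis by simp
    qed
    ultimately show ?thesis by blast
  qed
qed

text \<open>Few divisors mean few distinct primes, so a large \<open>n\<close> must have a prime
  power component above \<open>Q\<close>, and the bound for such a component applies. At least an
  eighth of the divisors then lie below \<open>sqrt n / Q powr (1 / 4)\<close>, which is a saving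
  over the square root.\<close>

lemma tau_le_small_divisors:
  fixes Q :: real
  assumes n: "n > 0" and Q: "Q \<ge> 1" and k: "tau n < 2 ^ k" "real n > Q ^ k"
  shows "tau n \<le> 8 * card {d. d dvd n \<and> real d ^ 4 * Q \<le> real n ^ 2}"
proof -
  have "\<exists>p. prime p \<and> real (p ^ multiplicity p n) > Q"
  proof (rule ccontr)
    assume "\<not> ?thesis"
    then have "\<And>p. prime p \<Longrightarrow> real (p ^ multiplicity p n) \<le> Q" by (meson leI)
    from le_power_tau[OF n Q this] obtain j where j: "2 ^ j \<le> tau n" "real n \<le> Q ^ j" by auto
    have "(2::nat) ^ j < 2 ^ k" using j k by linarith
    then have "j < k" by simp
    then have "Q ^ j \<le> Q ^ k" using Q by (intro power_increasing) auto
    then show False using j k by linarith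
  qed
  then obtain p where p: "prime p" "real (p ^ multiplicity p n) > Q" by auto
  obtain m where m: "m > 0" "coprime p m" "n = p ^ multiplicity p n * m" using prime_power_split[OF n p(1)] .
  have "tau n \<le> 8 * card {d. d dvd n \<and> d ^ 4 * p ^ multiplicity p n \<le> n ^ 2}"
    by (rule tau_le_eight_small[OF p(1) m])
  also have "\<dots> \<le> 8 * card {d. d dvd n \<and> real d ^ 4 * Q \<le> real n ^ 2}"
  proof (intro mult_le_mono2 card_mono)
    show "finite {d. d dvd n \<and> real d ^ 4 * Q \<le> real n ^ 2}" using finite_divisors[OF n] by simp
    show "{d. d dvd n \<and> d ^ 4 * p ^ multiplicity p n \<le> n ^ 2} \<subseteq> {d. d dvd n \<and> real d ^ 4 * Q \<le> real n ^ 2}"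
    proof clarsimp
      fix d assume d: "d ^ 4 * p ^ multiplicity p n \<le> n\<^sup>2"
      have "real d ^ 4 * Q \<le> real d ^ 4 * real (p ^ multiplicity p n)" using p by (intro mult_left_mono) auto
      also have "\<dots> = real (d ^ 4 * p ^ multiplicity p n)" by simp
      also have "\<dots> \<le> real (n\<^sup>2)" using d by (simp only: of_nat_le_iff)
      finally show "real d ^ 4 * Q \<le> (real n)\<^sup>2" by simp
    qed
  qed
  finally show ?thesis .
qed

text \<open>One factor \<open>tau n\<close> is opened as a sum over \<open>n = d * e\<close>.
  Submultiplicativity of \<open>tau\<close> bounds the result by the square of the sum for
  \<open>k\<close>, so the exponent of the harmonic sum doubles at each step.\<close>

lemma sum_tau_power_div:
  "(\<Sum>n = 1..N. real (tau n) ^ k / real n) \<le> (\<Sum>n = 1..N. 1 / real n) ^ (2 ^ k)"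
proof (induction k)
  case 0 then show ?case by simp
next
  case (Suc k)
  let ?f = "\<lambda>a. real (tau a) ^ k / real a"
  have "(\<Sum>n = 1..N. real (tau n) ^ Suc k / real n) = (\<Sum>n = 1..N. \<Sum>d\<in>{d. d dvd n}. real (tau n) ^ k / real n)"
    by (rule sum.cong) (simp_all add: tau_def)
  also have "\<dots> = (\<Sum>(n,d)\<in>(SIGMA n:{1..N}. {d. d dvd n}). real (tau n) ^ k / real n)"
    by (subst sum.Sigma) (auto simp: finite_divisors)
  also have "\<dots> \<le> (\<Sum>(n,d)\<in>(SIGMA n:{1..N}. {d. d dvd n}). ?f d * ?f (n div d))"
  proof (rule sum_mono, clarsimp)
    fix n d assume nd: "Suc 0 \<le> n" "n \<le> N" "d dvd n"
    then obtain e where e: "n = d * e" by auto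
    with nd have de: "d > 0" "e > 0" by (cases d; cases e; simp)+
    have "real (tau n) ^ k \<le> (real (tau d) * real (tau e)) ^ k"
      unfolding e using tau_mult_le[OF de] by (intro power_mono) (simp_all flip: of_nat_mult)
    then show "real (tau n) ^ k / real n \<le> real (tau d) ^ k * real (tau (n div d)) ^ k / (real d * real (n div d))"
      using e de by (simp add: divide_right_mono power_mult_distrib)
  qed
  also have "\<dots> = (\<Sum>(a,b)\<in>(\<lambda>(n,d). (d, n div d)) ` (SIGMA n:{1..N}. {d. d dvd n}). ?f a * ?f b)"
    by (subst sum.reindex) (auto simp: inj_on_def case_prod_beta elim!: dvdE)
  also have "\<dots> \<le> (\<Sum>(a,b)\<in>{1..N}\<times>{1..N}. ?f a * ?f b)"
  proof (rule sum_mono2)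
    show "(\<lambda>(n, d). (d, n div d)) ` (SIGMA n:{1..N}. {d. d dvd n}) \<subseteq> {1..N} \<times> {1..N}"
    proof (rule subsetI, clarsimp)
      fix n d assume nd: "Suc 0 \<le> n" "n \<le> N" "d dvd n"
      then have "d \<le> n" "n div d \<le> n" "d > 0" by (auto dest: dvd_imp_le intro: Nat.gr0I)
      moreover have "n div d > 0" using nd \<open>d > 0\<close> \<open>d \<le> n\<close> by (simp add: div_greater_zero_iff)
      ultimately show "Suc 0 \<le> d \<and> d \<le> N \<and> Suc 0 \<le> n div d \<and> n div d \<le> N" using nd \<open>d > 0\<close> \<open>d \<le> n\<close> \<open>n div d \<le> n\<close> by linarith
    qed
  qed auto
  also have "\<dots> = (\<Sum>a = 1..N. ?f a) * (\<Sum>b = 1..N. ?f b)"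
    by (simp add: sum_product sum.cartesian_product)
  also have "\<dots> \<le> (\<Sum>n = 1..N. 1 / real n) ^ (2 ^ k) * (\<Sum>n = 1..N. 1 / real n) ^ (2 ^ k)"
    using Suc.IH by (intro mult_mono) (auto intro!: sum_nonneg zero_le_power)
  finally show ?case by (simp add: mult_2 power_add[symmetric] del: One_nat_def)
qed

lemma sum_inverse_le_ln:
  assumes "N \<ge> 1" shows "(\<Sum>n = 1..N. 1 / real n) \<le> 1 + ln (real N)"
  using assms
proof (induction N rule: nat_induct_at_least)
  case base then show ?case by simp
next
  case (Suc N)
  have "1 / real (Suc N) \<le> ln (real (Suc N)) - ln (real N)"
  proof -
    have "- ln (real N / real (Suc N)) \<ge> 1 - real N / real (Suc N)"
      using ln_le_minus_one[of "real N / real (Suc N)"] Suc by simp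
    moreover have "ln (real N / real (Suc N)) = ln (real N) - ln (real (Suc N))"
      using Suc by (subst ln_div) auto
    moreover have "1 - real N / real (Suc N) = 1 / real (Suc N)" by (simp add: field_simps)
    ultimately show ?thesis by linarith
  qed
  then show ?case using Suc by simp
qed

section \<open>Multiplicative functions of several variables\<close>

lemma vec_set_eq_image: "{d :: 'a^'n. \<forall>i. d $ i \<in> A i} = vec_lambda ` (PiE UNIV A)"
proof
  show "{d. \<forall>i. d $ i \<in> A i} \<subseteq> vec_lambda ` (PiE UNIV A)"
  proof
    fix d :: "'a^'n" assume "d \<in> {d. \<forall>i. d $ i \<in> A i}"
    then have "vec_nth d \<in> PiE UNIV A" by auto
    then show "d \<in> vec_lambda ` (PiE UNIV A)" by (intro image_eqI[of _ _ "vec_nth d"]) simp_all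
  qed
qed auto

lemma inj_vec_lambda: "inj_on vec_lambda A"
  by (rule inj_onI) (simp add: vec_lambda_inject)

lemma finite_vec_set:
  assumes "\<And>i. finite (A i)" shows "finite {d :: 'a^'n. \<forall>i. d $ i \<in> A i}"
  unfolding vec_set_eq_image using assms by (intro finite_imageI finite_PiE) auto

lemma sum_vec_prod:
  fixes f :: "'n::finite \<Rightarrow> 'a \<Rightarrow> 'b::comm_semiring_1"
  assumes "\<And>i. finite (A i)"
  shows "(\<Sum>d\<in>{d :: 'a^'n. \<forall>i. d $ i \<in> A i}. \<Prod>i\<in>UNIV. f i (d $ i)) = (\<Prod>i\<in>UNIV. \<Sum>a\<in>A i. f i a)"
proof -
  have "(\<Prod>i\<in>UNIV. \<Sum>a\<in>A i. f i a) = (\<Sum>x\<in>PiE UNIV A. \<Prod>i\<in>UNIV. f i (x i))"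
    using assms by (intro prod_sum_PiE) auto
  also have "\<dots> = (\<Sum>d\<in>{d :: 'a^'n. \<forall>i. d $ i \<in> A i}. \<Prod>i\<in>UNIV. f i (d $ i))"
    unfolding vec_set_eq_image by (subst sum.reindex[OF inj_vec_lambda]) simp
  finally show ?thesis by simp
qed

lemma card_vec_set:
  assumes "\<And>i. finite (A i)"
  shows "card {d :: 'a^'n. \<forall>i. d $ i \<in> A i} = (\<Prod>i\<in>UNIV. card (A i))"
  using sum_vec_prod[OF assms, of "\<lambda>_ _. 1::nat"] by simp

section \<open>Tuples of positive integers and their Dirichlet convolution\<close>

definition vpos :: "nat^'n \<Rightarrow> bool" where
  "vpos d \<longleftrightarrow> (\<forall>i. d $ i > 0)"

definition vprod :: "nat^'n \<Rightarrow> nat" where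
  "vprod d = (\<Prod>i\<in>UNIV. d $ i)"

lemma vprod_mult: "vprod (d * e) = vprod d * vprod e"
  by (simp add: vprod_def prod.distrib)

lemma vpos_mult [simp]: "vpos (d * e) \<longleftrightarrow> vpos d \<and> vpos e"
  by (auto simp: vpos_def)

lemma vprod_pos: "vpos d \<Longrightarrow> vprod d > 0"
  by (simp add: vprod_def vpos_def prod_pos)

lemma dvd_vprod: "d $ i dvd vprod d"
  unfolding vprod_def by (rule dvd_prodI) auto

lemma le_vprod: "vpos d \<Longrightarrow> d $ i \<le> vprod d"
  using dvd_imp_le[OF dvd_vprod vprod_pos] .

definition ppow :: "nat \<Rightarrow> nat^'n \<Rightarrow> nat^'n" where
  "ppow p k = (\<chi> i. p ^ (k $ i))"

definition vdivs :: "nat^'n \<Rightarrow> (nat^'n) set" where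
  "vdivs e = {d. \<forall>i. d $ i \<in> {x. x dvd e $ i}}"

definition vquo :: "nat^'n \<Rightarrow> nat^'n \<Rightarrow> nat^'n" where
  "vquo e d = (\<chi> i. e $ i div d $ i)"

text \<open>Multiplicativity in several variables. Two tuples count as coprime when no prime divides
  a coordinate of each of them, which is coprimality of the two products of coordinates.\<close>

definition multv :: "(nat^'n \<Rightarrow> real) \<Rightarrow> bool" where
  "multv f \<longleftrightarrow> f 1 = 1 \<and> (\<forall>a b. vpos a \<longrightarrow> vpos b \<longrightarrow> coprime (vprod a) (vprod b) \<longrightarrow> f (a * b) = f a * f b)"

text \<open>Dirichlet convolution for coordinatewise multiplication: the sum runs over the
  factorisations \<open>e = d * vquo e d\<close>.\<close>

definition conv :: "(nat^'n \<Rightarrow> real) \<Rightarrow> (nat^'n \<Rightarrow> real) \<Rightarrow> nat^'n \<Rightarrow> real" where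
  "conv f g e = (\<Sum>d\<in>vdivs e. f d * g (vquo e d))"

lemma ppow_nth [simp]: "ppow p k $ i = p ^ (k $ i)"
  by (simp add: ppow_def)

lemma vquo_nth [simp]: "vquo e d $ i = e $ i div d $ i"
  by (simp add: vquo_def)

lemma ppow_zero [simp]: "ppow p 0 = 1"
  by (simp add: vec_eq_iff)

lemma vpos_ppow: "prime p \<Longrightarrow> vpos (ppow p k)"
  by (simp add: vpos_def prime_gt_0_nat)

lemma vpos_one [simp]: "vpos 1"
  by (simp add: vpos_def)

lemma vprod_one [simp]: "vprod 1 = 1"
  by (simp add: vprod_def)

lemma vprod_ppow: "vprod (ppow p k) = p ^ (\<Sum>i\<in>UNIV. k $ i)"
  by (simp add: vprod_def power_sum)

lemma multv_one: "multv f \<Longrightarrow> f 1 = 1"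
  by (simp add: multv_def)

lemma multv_mult: "multv f \<Longrightarrow> vpos a \<Longrightarrow> vpos b \<Longrightarrow> coprime (vprod a) (vprod b) \<Longrightarrow> f (a * b) = f a * f b"
  by (simp add: multv_def)

lemma finite_vdivs: "vpos e \<Longrightarrow> finite (vdivs e)"
  unfolding vdivs_def by (intro finite_vec_set) (simp add: vpos_def finite_divisors)

lemma vdivs_pos: "vpos e \<Longrightarrow> d \<in> vdivs e \<Longrightarrow> vpos d"
  using dvd_pos_nat unfolding vdivs_def vpos_def by blast

lemma vprod_dvd: "d \<in> vdivs e \<Longrightarrow> vprod d dvd vprod e"
  unfolding vprod_def by (intro prod_dvd_prod) (auto simp: vdivs_def)

lemma vquo_mult: "d \<in> vdivs e \<Longrightarrow> d * vquo e d = e"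
  by (simp add: vec_eq_iff vdivs_def)

lemma vquo_pos: "vpos e \<Longrightarrow> d \<in> vdivs e \<Longrightarrow> vpos (vquo e d)"
  using vquo_mult[of d e] vpos_mult[of d "vquo e d"] by simp

lemma vquo_dvd: "d \<in> vdivs e \<Longrightarrow> vquo e d \<in> vdivs e"
  by (simp add: vdivs_def) (metis dvd_div_mult_self dvd_triv_left)

lemma vquo_vquo: "vpos e \<Longrightarrow> d \<in> vdivs e \<Longrightarrow> vquo e (vquo e d) = d"
proof -
  assume e: "vpos e" and d: "d \<in> vdivs e"
  have "e $ i div (e $ i div d $ i) = d $ i" for i
  proof -
    have "d $ i dvd e $ i" using d by (simp add: vdivs_def)
    then obtain k where "e $ i = d $ i * k" ..
    moreover have "e $ i > 0" using e by (simp add: vpos_def)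
    ultimately show ?thesis by auto
  qed
  then show ?thesis by (simp add: vec_eq_iff)
qed

text \<open>A tuple dividing \<open>a * b\<close> splits uniquely into one dividing \<open>a\<close>
  and one dividing \<open>b\<close>, by coprimality in each coordinate, and both functions factor
  along this splitting.\<close>

lemma multv_conv:
  assumes f: "multv f" and g: "multv g"
  shows "multv (conv f g)"
  unfolding multv_def
proof (intro conjI allI impI)
  have "vdivs (1::nat^'a) = {1}" by (auto simp: vdivs_def vec_eq_iff)
  moreover have "vquo 1 1 = (1 :: nat^'a)" by (simp add: vec_eq_iff)
  ultimately show "conv f g 1 = 1" using f g by (simp add: conv_def multv_one)
  fix a b :: "nat^'a" assume a: "vpos a" and b: "vpos b" and cop: "coprime (vprod a) (vprod b)"
  have copi: "coprime (a $ i) (b $ i)" for i using cop coprime_divisors[OF dvd_vprod dvd_vprod] by blast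
  let ?m = "\<lambda>(x, y). x * y :: nat^'a"
  have inj: "inj_on ?m (vdivs a \<times> vdivs b)"
  proof (rule inj_onI)
    fix s t assume st: "s \<in> vdivs a \<times> vdivs b" "t \<in> vdivs a \<times> vdivs b" "?m s = ?m t"
    have "fst s $ i = fst t $ i \<and> snd s $ i = snd t $ i" for i
    proof -
      have "(fst s $ i, snd s $ i) = (fst t $ i, snd t $ i)"
        by (rule inj_onD[OF inj_on_coprime_divisors[OF copi[of i]]])
           (use st in \<open>auto simp: vdivs_def vec_eq_iff case_prod_beta\<close>)
      then show ?thesis by simp
    qed
    then show "s = t" by (simp add: prod_eq_iff vec_eq_iff)
  qed
  have im: "vdivs (a * b) = ?m ` (vdivs a \<times> vdivs b)"
  proof
    show "?m ` (vdivs a \<times> vdivs b) \<subseteq> vdivs (a * b)" by (clarsimp simp: vdivs_def mult_dvd_mono)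
    show "vdivs (a * b) \<subseteq> ?m ` (vdivs a \<times> vdivs b)"
    proof
      fix d assume "d \<in> vdivs (a * b)"
      then have "\<forall>i. \<exists>x y. d $ i = x * y \<and> x dvd a $ i \<and> y dvd b $ i"
        by (auto simp: vdivs_def intro: division_decomp)
      then obtain X Y where "\<And>i. d $ i = X i * Y i \<and> X i dvd a $ i \<and> Y i dvd b $ i" by metis
      then show "d \<in> ?m ` (vdivs a \<times> vdivs b)"
        by (intro image_eqI[of _ _ "(\<chi> i. X i, \<chi> i. Y i)"]) (auto simp: vdivs_def vec_eq_iff)
    qed
  qed
  have "conv f g (a * b) = (\<Sum>(x,y)\<in>vdivs a \<times> vdivs b. f (x * y) * g (vquo (a * b) (x * y)))"
    unfolding conv_def im by (subst sum.reindex[OF inj]) (simp add: case_prod_beta)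
  also have "\<dots> = (\<Sum>(x,y)\<in>vdivs a \<times> vdivs b. (f x * g (vquo a x)) * (f y * g (vquo b y)))"
  proof (rule sum.cong, simp, clarify)
    fix x y assume x: "x \<in> vdivs a" and y: "y \<in> vdivs b"
    have "f (x * y) = f x * f y"
      using vdivs_pos a b x y coprime_divisors[OF vprod_dvd vprod_dvd cop] by (intro multv_mult[OF f]) auto
    moreover have "vquo (a * b) (x * y) = vquo a x * vquo b y"
      using x y by (simp add: vec_eq_iff vdivs_def div_mult_div_if_dvd)
    moreover have "g (vquo a x * vquo b y) = g (vquo a x) * g (vquo b y)"
      using vquo_pos a b x y coprime_divisors[OF vprod_dvd[OF vquo_dvd] vprod_dvd[OF vquo_dvd] cop]
      by (intro multv_mult[OF g]) auto
    ultimately show "f (x * y) * g (vquo (a * b) (x * y)) = f x * g (vquo a x) * (f y * g (vquo b y))"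
      by (simp add: algebra_simps)
  qed
  also have "\<dots> = conv f g a * conv f g b"
    by (simp add: conv_def sum_product sum.cartesian_product)
  finally show "conv f g (a * b) = conv f g a * conv f g b" .
qed

lemma conv_commute: "vpos e \<Longrightarrow> conv f g e = conv g f e"
  unfolding conv_def
  by (rule sum.reindex_bij_witness[of _ "vquo e" "vquo e"]) (auto simp: vquo_vquo vquo_dvd)

text \<open>Both sides sum over chains of divisors \<open>c\<close>, \<open>d\<close>,
  \<open>e\<close>; the pair \<open>(d, c)\<close> on the left corresponds to
  \<open>(c, vquo d c)\<close> on the right.\<close>

lemma conv_assoc:
  assumes e: "vpos e" shows "conv (conv f g) j e = conv f (conv g j) e"
proof -
  have "conv (conv f g) j e = (\<Sum>d\<in>vdivs e. \<Sum>c\<in>vdivs d. f c * g (vquo d c) * j (vquo e d))"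
    by (simp add: conv_def sum_distrib_right)
  also have "\<dots> = (\<Sum>(d,c)\<in>(SIGMA d:vdivs e. vdivs d). f c * g (vquo d c) * j (vquo e d))"
    by (subst sum.Sigma) (auto intro: finite_vdivs vdivs_pos e)
  also have "\<dots> = (\<Sum>(c,b)\<in>(SIGMA c:vdivs e. vdivs (vquo e c)). f c * (g b * j (vquo (vquo e c) b)))"
  proof (rule sum.reindex_bij_witness[of _ "\<lambda>(c,b). (c * b, c)" "\<lambda>(d,c). (c, vquo d c)"], goal_cases)
    case (1 a)
    then show ?case using vquo_mult by (auto simp: case_prod_beta)
  next
    case (2 a)
    then obtain d c where a: "a = (d, c)" and d: "d \<in> vdivs e" and c: "c \<in> vdivs d" by auto
    have "c \<in> vdivs e" using d c by (auto simp: vdivs_def intro: dvd_trans)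
    moreover have "vquo d c \<in> vdivs (vquo e c)" using d c by (simp add: vdivs_def) (metis div_dvd_div dvd_trans)
    ultimately show ?case by (simp add: a)
  next
    case (3 a)
    then obtain c b where a: "a = (c, b)" and c: "c \<in> vdivs e" and b: "b \<in> vdivs (vquo e c)" by auto
    have "vpos c" using c e vdivs_pos by blast
    then show ?case by (simp add: a vec_eq_iff vpos_def)
  next
    case (4 a)
    then obtain c b where a: "a = (c, b)" and c: "c \<in> vdivs e" and b: "b \<in> vdivs (vquo e c)" by auto
    have "c $ i * b $ i dvd e $ i" for i
    proof -
      have "c $ i * b $ i dvd c $ i * (e $ i div c $ i)" using b by (intro mult_dvd_mono) (auto simp: vdivs_def)
      moreover have "c $ i * (e $ i div c $ i) = e $ i" using c by (simp add: vdivs_def)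
      ultimately show ?thesis by (simp only:)
    qed
    then have "c * b \<in> vdivs e" by (simp add: vdivs_def)
    moreover have "c \<in> vdivs (c * b)" by (simp add: vdivs_def)
    ultimately show ?case by (simp add: a)
  next
    case (5 a)
    then obtain d c where a: "a = (d, c)" and d: "d \<in> vdivs e" and c: "c \<in> vdivs d" by auto
    have "e $ i div d $ i = e $ i div c $ i div (d $ i div c $ i)" for i
    proof -
      have "d $ i = c $ i * (d $ i div c $ i)" using c by (simp add: vdivs_def)
      then show ?thesis by (metis div_mult2_eq)
    qed
    then have "vquo e d = vquo (vquo e c) (vquo d c)" by (simp add: vec_eq_iff)
    then show ?case by (simp add: a)
  qed
  also have "\<dots> = (\<Sum>c\<in>vdivs e. \<Sum>b\<in>vdivs (vquo e c). f c * (g b * j (vquo (vquo e c) b)))"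
    by (subst sum.Sigma) (auto intro: finite_vdivs vquo_pos e)
  also have "\<dots> = conv f (conv g j) e"
    by (simp add: conv_def sum_distrib_left)
  finally show ?thesis .
qed

section \<open>The Moebius function and the convolution inverse of the reciprocal\<close>

definition mu :: "nat \<Rightarrow> real" where
  "mu n = (if squarefree n then (-1) ^ card (prime_factors n) else 0)"

lemma mu_one [simp]: "mu (Suc 0) = 1"
  by (simp add: mu_def)

lemma mu_prime: "prime p \<Longrightarrow> mu p = -1"
  by (simp add: mu_def squarefree_prime prime_factorization_prime)

lemma mu_prime_power: "prime p \<Longrightarrow> a \<ge> 2 \<Longrightarrow> mu (p ^ a) = 0"
  using squarefree_power_iff[of p a] not_prime_unit[of p] by (auto simp: mu_def)

lemma mu_mult: "a > 0 \<Longrightarrow> b > 0 \<Longrightarrow> coprime a b \<Longrightarrow> mu (a * b) = mu a * mu b"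
proof -
  assume h: "a > 0" "b > 0" "coprime a b"
  have "prime_factors (a * b) = prime_factors a \<union> prime_factors b" using h by (intro prime_factors_product) auto
  moreover have "prime_factors a \<inter> prime_factors b = {}"
  proof (rule ccontr)
    assume "\<not> ?thesis"
    then obtain p where "prime p" "p dvd a" "p dvd b" by (auto simp: prime_factors_dvd)
    then show False using h(3) by (meson coprime_common_divisor not_prime_unit)
  qed
  ultimately have "card (prime_factors (a * b)) = card (prime_factors a) + card (prime_factors b)"
    by (simp add: card_Un_disjoint)
  moreover have "squarefree (a * b) \<longleftrightarrow> squarefree a \<and> squarefree b"
    using h(3) squarefree_multD squarefree_mult_coprime by blast
  ultimately show ?thesis by (simp add: mu_def power_add)
qed

lemma sum_mu_prime_power:
  assumes "prime p" "a > 0" shows "(\<Sum>d\<in>{d. d dvd p ^ a}. mu d) = 0"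
proof -
  have "{d. d dvd p ^ a} = (\<lambda>i. p ^ i) ` {..a}"
    using divides_primepow_nat[OF assms(1)] by auto
  moreover have "inj_on (\<lambda>i. p ^ i) {..a}"
    using prime_gt_1_nat[OF assms(1)] by (auto intro!: inj_onI)
  ultimately have "(\<Sum>d\<in>{d. d dvd p ^ a}. mu d) = (\<Sum>i\<le>a. mu (p ^ i))" by (simp add: sum.reindex)
  also have "\<dots> = (\<Sum>i\<in>{0,1}. mu (p ^ i))"
    using assms by (intro sum.mono_neutral_right) (auto intro!: mu_prime_power)
  also have "\<dots> = 0" using assms by (simp add: mu_prime)
  finally show ?thesis .
qed

text \<open>The full power of one prime in \<open>n\<close> is split off. The divisor sum factors,
  and the part at that prime vanishes because only the exponents 0 and 1 contribute, with opposite
  signs.\<close>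

lemma sum_mu: "n > 0 \<Longrightarrow> (\<Sum>d\<in>{d. d dvd n}. mu d) = (if n = 1 then 1 else 0)"
proof (cases "n = 1")
  case True
  then have "{d. d dvd n} = {1}" by auto
  then show ?thesis using True by simp
next
  case False
  assume n: "n > 0"
  obtain p where p: "prime p" "p dvd n" using prime_factor_nat[OF False] by auto
  obtain m where m: "m > 0" "coprime p m" "n = p ^ multiplicity p n * m" using prime_power_split[OF n p(1)] .
  let ?a = "multiplicity p n"
  have a: "?a > 0" using p n prime_multiplicity_gt_zero_iff[of p n] by simp
  have cop: "coprime (p ^ ?a) m" using m by simp
  have im: "{d. d dvd p ^ ?a * m} = (\<lambda>(x,y). x * y) ` ({d. d dvd p ^ ?a} \<times> {d. d dvd m})"
    using division_decomp by (force intro: mult_dvd_mono)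
  have "(\<Sum>d\<in>{d. d dvd n}. mu d) = (\<Sum>d\<in>{d. d dvd p ^ ?a * m}. mu d)" using m(3) by simp
  also have "\<dots> = (\<Sum>(x,y)\<in>{d. d dvd p ^ ?a} \<times> {d. d dvd m}. mu (x * y))"
    unfolding im by (subst sum.reindex[OF inj_on_coprime_divisors[OF cop]]) (simp add: case_prod_beta)
  also have "\<dots> = (\<Sum>(x,y)\<in>{d. d dvd p ^ ?a} \<times> {d. d dvd m}. mu x * mu y)"
  proof (rule sum.cong, simp, clarify)
    fix x y assume "x dvd p ^ ?a" "y dvd m"
    moreover have "x > 0" "y > 0" using calculation m(1) p(1) by (auto intro!: Nat.gr0I)
    ultimately show "mu (x * y) = mu x * mu y" using coprime_divisors[OF _ _ cop] by (intro mu_mult) auto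
  qed
  also have "\<dots> = (\<Sum>x\<in>{d. d dvd p ^ ?a}. mu x) * (\<Sum>y\<in>{d. d dvd m}. mu y)"
    by (simp add: sum_product sum.cartesian_product)
  finally show ?thesis using sum_mu_prime_power[OF p(1) a] False by simp
qed

text \<open>Coordinatewise Moebius function, weighted so that it inverts \<open>invv\<close> and not
  the constant function 1.\<close>

definition muv :: "nat^'n \<Rightarrow> real" where
  "muv d = (\<Prod>i\<in>UNIV. mu (d $ i) / real (d $ i))"

definition invv :: "nat^'n \<Rightarrow> real" where
  "invv d = 1 / real (vprod d)"

lemma invv_prod: "invv d = (\<Prod>i\<in>UNIV. 1 / real (d $ i))"
  by (simp add: invv_def vprod_def prod_dividef)

lemma multv_muv: "multv muv"
  unfolding multv_def
proof (intro conjI allI impI)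
  show "muv (1::nat^'a) = 1" by (simp add: muv_def)
  fix a b :: "nat^'a" assume ab: "vpos a" "vpos b" "coprime (vprod a) (vprod b)"
  have "mu (a $ i * b $ i) = mu (a $ i) * mu (b $ i)" for i
    using ab coprime_divisors[OF dvd_vprod dvd_vprod ab(3)] by (intro mu_mult) (auto simp: vpos_def)
  then show "muv (a * b) = muv a * muv b" by (simp add: muv_def flip: prod.distrib)
qed

text \<open>In each coordinate the two reciprocals combine to \<open>1 / e $ i\<close>, which leaves
  the divisor sum of \<open>mu\<close>.\<close>

lemma conv_muv_invv: "vpos e \<Longrightarrow> conv muv invv e = (if e = 1 then 1 else 0)"
proof -
  assume e: "vpos e"
  have "conv muv invv e = (\<Sum>d\<in>vdivs e. \<Prod>i\<in>UNIV. mu (d $ i) / real (e $ i))"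
    unfolding conv_def
  proof (rule sum.cong[OF refl])
    fix d assume d: "d \<in> vdivs e"
    have "mu (d $ i) / real (d $ i) * (1 / real (e $ i div d $ i)) = mu (d $ i) / real (e $ i)" for i
    proof -
      have "e $ i = d $ i * (e $ i div d $ i)" using d by (simp add: vdivs_def)
      then have "real (e $ i) = real (d $ i) * real (e $ i div d $ i)" by (metis of_nat_mult)
      then show ?thesis by simp
    qed
    then show "muv d * invv (vquo e d) = (\<Prod>i\<in>UNIV. mu (d $ i) / real (e $ i))"
      unfolding muv_def invv_prod prod.distrib[symmetric] vquo_nth by (intro prod.cong refl)
  qed
  also have "\<dots> = (\<Prod>i\<in>UNIV. \<Sum>x\<in>{x. x dvd e $ i}. mu x / real (e $ i))"
    unfolding vdivs_def using e by (intro sum_vec_prod) (auto simp: vpos_def finite_divisors)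
  also have "\<dots> = (\<Prod>i\<in>UNIV. if e $ i = 1 then 1 else 0)"
    using e by (intro prod.cong) (auto simp: vpos_def sum_mu simp flip: sum_divide_distrib)
  also have "\<dots> = (if e = 1 then 1 else 0)"
    by (auto simp: vec_eq_iff)
  finally show ?thesis .
qed

lemma conv_unit: "vpos e \<Longrightarrow> conv f (\<lambda>d. if d = 1 then 1 else 0) e = f e"
proof -
  assume e: "vpos e"
  have "conv f (\<lambda>d. if d = 1 then 1 else 0) e = (\<Sum>d\<in>{e}. f d * (if vquo e d = 1 then 1 else 0))"
    unfolding conv_def
  proof (rule sum.mono_neutral_right)
    show "{e} \<subseteq> vdivs e" by (simp add: vdivs_def)
    show "\<forall>d\<in>vdivs e - {e}. f d * (if vquo e d = 1 then 1 else 0) = 0"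
    proof
      fix d assume d: "d \<in> vdivs e - {e}"
      have "vquo e d \<noteq> 1"
      proof
        assume "vquo e d = 1"
        then have "d * 1 = e" using d vquo_mult[of d e] by simp
        then show False using d by simp
      qed
      then show "f d * (if vquo e d = 1 then 1 else 0) = 0" by simp
    qed
  qed (rule finite_vdivs[OF e])
  moreover have "vquo e e = 1" using e by (simp add: vec_eq_iff vpos_def)
  ultimately show ?thesis by simp
qed

text \<open>Any \<open>f\<close> is thus a convolution with \<open>invv\<close>. When
  \<open>f\<close> is close to \<open>invv\<close>, the other factor \<open>conv f muv\<close> is
  small, and sums of \<open>f\<close> reduce to sums of reciprocals.\<close>

lemma conv_inverse:
  assumes e: "vpos e" shows "conv (conv f muv) invv e = f e"
proof -
  have "conv (conv f muv) invv e = conv f (conv muv invv) e" by (rule conv_assoc[OF e])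
  also have "\<dots> = conv f (\<lambda>d. if d = 1 then 1 else 0) e"
    unfolding conv_def[of f] by (intro sum.cong refl) (simp add: conv_muv_invv vquo_pos[OF e])
  finally show ?thesis using conv_unit[OF e] by simp
qed

section \<open>Absolutely convergent Euler products in several variables\<close>

abbreviation abs_sum_on :: "('a \<Rightarrow> real) \<Rightarrow> 'a set \<Rightarrow> bool" (infix "abs'_sum'_on" 46) where
  "f abs_sum_on A \<equiv> (\<lambda>x. norm (f x)) summable_on A"

text \<open>Every finite set of exponent tuples lies in a cube with sides \<open>{..<N}\<close>,
  where the sum of a product is the product of one-dimensional sums.\<close>

lemma prod_vec_summable:
  fixes f :: "'n::finite \<Rightarrow> nat \<Rightarrow> real"
  assumes nn: "\<And>i k. f i k \<ge> 0" and bd: "\<And>i N. (\<Sum>k<N. f i k) \<le> C i"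
  shows "(\<lambda>k :: nat^'n. \<Prod>i\<in>UNIV. f i (k $ i)) summable_on UNIV"
    "infsum (\<lambda>k :: nat^'n. \<Prod>i\<in>UNIV. f i (k $ i)) UNIV \<le> (\<Prod>i\<in>UNIV. C i)"
proof -
  let ?F = "\<lambda>k :: nat^'n. \<Prod>i\<in>UNIV. f i (k $ i)"
  have fin: "sum ?F A \<le> (\<Prod>i\<in>UNIV. C i)" if A: "finite A" for A
  proof -
    define N where "N = Suc (Max (\<Union>k\<in>A. range (\<lambda>i. k $ i)))"
    have sub: "A \<subseteq> {k. \<forall>i. k $ i \<in> {..<N}}"
    proof clarsimp
      fix k i assume "k \<in> A"
      then have "k $ i \<le> Max (\<Union>k\<in>A. range (\<lambda>i. k $ i))" using A by (intro Max_ge) auto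
      then show "k $ i < N" by (simp add: N_def)
    qed
    have "sum ?F A \<le> sum ?F {k. \<forall>i. k $ i \<in> {..<N}}"
      by (rule sum_mono2[OF _ sub]) (auto intro!: finite_vec_set prod_nonneg nn simp del: lessThan_iff)
    also have "\<dots> = (\<Prod>i\<in>UNIV. \<Sum>k\<in>{..<N}. f i k)" by (rule sum_vec_prod) simp
    also have "\<dots> \<le> (\<Prod>i\<in>UNIV. C i)" by (intro prod_mono conjI bd sum_nonneg nn)
    finally show ?thesis .
  qed
  have nnF: "?F k \<ge> 0" for k by (intro prod_nonneg nn)
  show s: "?F summable_on UNIV"
    by (rule nonneg_bdd_above_summable_on) (auto intro!: nnF bdd_aboveI2[where M = "\<Prod>i\<in>UNIV. C i"] fin)
  show "infsum ?F UNIV \<le> (\<Prod>i\<in>UNIV. C i)"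
    by (rule infsum_le_finite_sums[OF s]) (use fin in auto)
qed

lemma has_sum_mult_Times:
  fixes f :: "'a \<Rightarrow> real" and g :: "'b \<Rightarrow> real"
  assumes f: "f abs_sum_on A" and g: "g abs_sum_on B"
  shows "(\<lambda>(x,y). f x * g y) abs_sum_on A \<times> B"
    "((\<lambda>(x,y). f x * g y) has_sum infsum f A * infsum g B) (A \<times> B)"
proof -
  have "(\<lambda>x. norm (f x) * infsum (\<lambda>y. norm (g y)) B) summable_on A"
    using f by (intro summable_on_cmult_left)
  moreover have "infsum (\<lambda>y. norm (g y)) B \<ge> 0" by (intro infsum_nonneg) auto
  ultimately show abs: "(\<lambda>(x,y). f x * g y) abs_sum_on A \<times> B"
    using g by (subst Infinite_Sum.abs_summable_on_Sigma_iff) (auto simp: abs_mult infsum_cmult_right' intro!: summable_on_cmult_right)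
  show "((\<lambda>(x,y). f x * g y) has_sum infsum f A * infsum g B) (A \<times> B)"
  proof (rule has_sum_SigmaI)
    show "((\<lambda>y. case (x, y) of (x, y) \<Rightarrow> f x * g y) has_sum f x * infsum g B) B" for x
      using has_sum_cmult_right[OF has_sum_infsum[OF abs_summable_summable[OF g]], of "f x"] by simp
    show "((\<lambda>x. f x * infsum g B) has_sum infsum f A * infsum g B) A"
      by (rule has_sum_cmult_left[OF has_sum_infsum[OF abs_summable_summable[OF f]]])
    show "(\<lambda>(x,y). f x * g y) summable_on A \<times> B" by (rule abs_summable_summable[OF abs])
  qed
qed

lemma vec_prime_split:
  fixes d :: "nat^'n"
  assumes d: "vpos d" and p: "prime p"
  obtains k e where "d = ppow p k * e" "vpos e" "\<not> p dvd vprod e" "coprime (vprod (ppow p k)) (vprod e)"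
proof -
  have "\<forall>i. \<exists>m. m > 0 \<and> coprime p m \<and> d $ i = p ^ multiplicity p (d $ i) * m"
    using prime_power_split[OF _ p] d unfolding vpos_def by metis
  then obtain m where m: "\<And>i. m i > 0" "\<And>i. coprime p (m i)" "\<And>i. d $ i = p ^ multiplicity p (d $ i) * m i" by metis
  define e :: "nat^'n" where "e = (\<chi> i. m i)"
  define k :: "nat^'n" where "k = (\<chi> i. multiplicity p (d $ i))"
  have cop: "coprime p (vprod e)" using m by (simp add: vprod_def e_def prod_coprime_right)
  show ?thesis
  proof (rule that[of k e])
    show "d = ppow p k * e" using m(3) by (simp add: vec_eq_iff k_def e_def)
    show "vpos e" using m(1) by (simp add: vpos_def e_def)
    show "\<not> p dvd vprod e" using cop p by (metis coprime_absorb_left not_prime_unit)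
    show "coprime (vprod (ppow p k)) (vprod e)" using cop by (simp add: vprod_ppow)
  qed
qed

definition smooth :: "nat set \<Rightarrow> (nat^'n) set" where
  "smooth P = {d. vpos d \<and> (\<forall>q. prime q \<longrightarrow> q dvd vprod d \<longrightarrow> q \<in> P)}"

lemma vprod_eq_1: "vprod d = 1 \<longleftrightarrow> d = 1"
  using dvd_vprod[of d] by (auto simp: vec_eq_iff vprod_def)

lemma smooth_empty: "smooth {} = {1}"
proof -
  have "d = 1" if "vpos d" "\<forall>q. prime q \<longrightarrow> \<not> q dvd vprod d" for d :: "nat^'n"
    using that prime_factor_nat vprod_eq_1 by blast
  then show ?thesis by (auto simp: smooth_def)
qed

text \<open>No coordinate of a tuple in \<open>smooth P\<close> is divisible by \<open>p\<close>, so
  the exponents of \<open>p\<close> in the product recover \<open>k\<close>.\<close>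

lemma smooth_insert:
  assumes p: "prime p" "p \<notin> P"
  shows "bij_betw (\<lambda>(k, d). ppow p k * d) (UNIV \<times> smooth P) (smooth (insert p P))"
proof (rule bij_betw_imageI)
  have ndvd: "\<not> p dvd d $ i" if "d \<in> smooth P" for d :: "nat^'n" and i
    using that p dvd_vprod[of d i] dvd_trans unfolding smooth_def by blast
  show "inj_on (\<lambda>(k, d). ppow p k * d) (UNIV \<times> smooth P :: ((nat^'n) \<times> (nat^'n)) set)"
  proof (rule inj_onI, clarsimp)
    fix k k' d d' :: "nat^'n" assume h: "d \<in> smooth P" "d' \<in> smooth P" "ppow p k * d = ppow p k' * d'"
    have "k $ i = k' $ i \<and> d $ i = d' $ i" for i
    proof -
      have eq: "p ^ k $ i * d $ i = p ^ k' $ i * d' $ i" using h(3) by (auto simp: vec_eq_iff)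
      have u: "\<not> is_unit p" "p \<noteq> 0" using p not_prime_unit[of p] by auto
      have "multiplicity p (p ^ k $ i * d $ i) = k $ i" "multiplicity p (p ^ k' $ i * d' $ i) = k' $ i"
        using ndvd[OF h(1), of i] ndvd[OF h(2), of i] u by (simp_all add: multiplicity_decomposeI)
      then have "k $ i = k' $ i" using eq by simp
      then show ?thesis using eq u by simp
    qed
    then show "k = k' \<and> d = d'" by (simp add: vec_eq_iff)
  qed
  show "(\<lambda>(k, d). ppow p k * d) ` (UNIV \<times> smooth P) = (smooth (insert p P) :: (nat^'n) set)"
  proof
    show "(\<lambda>(k, d). ppow p k * d) ` (UNIV \<times> smooth P) \<subseteq> (smooth (insert p P) :: (nat^'n) set)"
    proof clarsimp
      fix k d :: "nat^'n" assume d: "d \<in> smooth P"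
      have "q \<in> insert p P" if q: "prime q" "q dvd vprod (ppow p k * d)" for q
      proof -
        have "q dvd p ^ (\<Sum>i\<in>UNIV. k $ i) \<or> q dvd vprod d"
          using q prime_dvd_mult_iff unfolding vprod_mult vprod_ppow by blast
        then show ?thesis using q d p primes_dvd_imp_eq prime_dvd_power unfolding smooth_def by blast
      qed
      then show "ppow p k * d \<in> smooth (insert p P)" using d vpos_ppow[OF p(1)] by (auto simp: smooth_def)
    qed
    show "(smooth (insert p P) :: (nat^'n) set) \<subseteq> (\<lambda>(k, d). ppow p k * d) ` (UNIV \<times> smooth P)"
    proof
      fix d :: "nat^'n" assume d: "d \<in> smooth (insert p P)"
      then have "vpos d" by (simp add: smooth_def)
      from vec_prime_split[OF this p(1)] obtain k e where
        ke: "d = ppow p k * e" "vpos e" "\<not> p dvd vprod e" .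
      have "e \<in> smooth P" using d ke unfolding smooth_def by (auto simp: vprod_mult)
      then show "d \<in> (\<lambda>(k, d). ppow p k * d) ` (UNIV \<times> smooth P)"
        using ke(1) by (intro image_eqI[of _ _ "(k, e)"]) auto
    qed
  qed
qed

lemma smooth_coprime:
  assumes "prime p" "p \<notin> P" "d \<in> smooth P"
  shows "coprime (vprod (ppow p k)) (vprod d)"
proof -
  have "\<not> p dvd vprod d" using assms by (auto simp: smooth_def)
  then show ?thesis using assms(1) by (simp add: vprod_ppow prime_imp_coprime)
qed

text \<open>Induction on \<open>P\<close>: a tuple with prime factors in \<open>insert p P\<close>
  is uniquely a power part at \<open>p\<close> times a tuple in \<open>smooth P\<close>.
  Multiplicativity and absolute convergence turn the sum into a product.\<close>

lemma euler_product_smooth: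
  fixes f :: "nat^'n \<Rightarrow> real"
  assumes f: "multv f" and P: "finite P" "\<And>p. p \<in> P \<Longrightarrow> prime p"
    and s: "\<And>p. p \<in> P \<Longrightarrow> (\<lambda>k. f (ppow p k)) abs_sum_on UNIV"
  shows "f abs_sum_on smooth P \<and> infsum f (smooth P) = (\<Prod>p\<in>P. infsum (\<lambda>k. f (ppow p k)) UNIV)"
  using P s
proof (induction P rule: finite_induct)
  case empty
  then show ?case using f by (simp add: smooth_empty multv_one)
next
  case (insert p P)
  let ?b = "\<lambda>(k, d). ppow p k * d :: nat^'n"
  have p: "prime p" "p \<notin> P" using insert by auto
  have IH: "f abs_sum_on smooth P" "infsum f (smooth P) = (\<Prod>p\<in>P. infsum (\<lambda>k. f (ppow p k)) UNIV)"
    using insert by auto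
  have fb: "f (?b kd) = (\<lambda>(k, d). f (ppow p k) * f d) kd" if h: "kd \<in> UNIV \<times> smooth P" for kd
  proof -
    obtain k d where kd: "kd = (k, d)" "d \<in> smooth P" using h by auto
    then have "vpos d" by (simp add: smooth_def)
    then show ?thesis using kd multv_mult[OF f vpos_ppow[OF p(1)] _ smooth_coprime[OF p kd(2)]] by simp
  qed
  note T = has_sum_mult_Times[OF insert.prems(2)[of p] IH(1)]
  note bij = smooth_insert[OF p]
  have "(\<lambda>kd. norm (f (?b kd))) summable_on UNIV \<times> smooth P \<longleftrightarrow>
      (\<lambda>kd. norm ((\<lambda>(k, d). f (ppow p k) * f d) kd)) summable_on UNIV \<times> smooth P"
    by (rule summable_on_cong) (use fb in auto)
  then have "(\<lambda>kd. norm (f (?b kd))) summable_on UNIV \<times> smooth P" using T(1) by simp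
  then have 1: "f abs_sum_on smooth (insert p P)"
    by (subst (asm) summable_on_reindex_bij_betw[OF bij, of "\<lambda>d. norm (f d)"])
  have "infsum f (smooth (insert p P)) = infsum (\<lambda>kd. f (?b kd)) (UNIV \<times> smooth P)"
    by (rule infsum_reindex_bij_betw[OF bij, symmetric])
  also have "\<dots> = infsum (\<lambda>(k, d). f (ppow p k) * f d) (UNIV \<times> smooth P)"
    by (rule infsum_cong) (use fb in auto)
  also have "\<dots> = infsum (\<lambda>k. f (ppow p k)) UNIV * infsum f (smooth P)"
    using T(2) by (intro infsumI) simp
  finally show ?case using 1 IH insert.hyps by simp
qed

lemma smooth_exhaust:
  assumes F: "finite F" "\<And>d. d \<in> F \<Longrightarrow> vpos d"
  shows "\<exists>N. \<forall>n\<ge>N. F \<subseteq> smooth {p. prime p \<and> p \<le> n}"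
proof (intro exI allI impI subsetI)
  \<comment> \<open>The sum over \<open>F\<close> bounds the coordinate product of each member,
    hence every prime dividing one of them.\<close>
  fix n d assume n: "(\<Sum>d\<in>F. vprod d) \<le> n" and d: "d \<in> F"
  have "vprod d \<le> n" using member_le_sum[OF d, of vprod] F(1) n by simp
  then show "d \<in> smooth {p. prime p \<and> p \<le> n}"
    using F(2)[OF d] vprod_pos[of d] by (auto simp: smooth_def dest!: dvd_imp_le)
qed

text \<open>A finite set carrying all but a small part of the absolute sum lies in
  \<open>B n\<close> for large \<open>n\<close>; the sum over the complement of \<open>B n\<close>
  is then small.\<close>

lemma infsum_exhaust:
  fixes f :: "'a \<Rightarrow> real"
  assumes s: "f abs_sum_on A" and sub: "\<And>n. B n \<subseteq> A"
    and ex: "\<And>F. finite F \<Longrightarrow> F \<subseteq> A \<Longrightarrow> \<exists>N. \<forall>n\<ge>N. F \<subseteq> B (n::nat)"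
  shows "(\<lambda>n. infsum f (B n)) \<longlonglongrightarrow> infsum f A"
proof (rule LIMSEQ_I)
  fix e :: real assume e: "e > 0"
  let ?g = "\<lambda>x. norm (f x)"
  from infsum_finite_approximation[OF s, of "e/2"] e obtain F where
    F: "finite F" "F \<subseteq> A" "dist (sum ?g F) (infsum ?g A) \<le> e / 2" by auto
  obtain N where N: "\<And>n. n \<ge> N \<Longrightarrow> F \<subseteq> B n" using ex[OF F(1,2)] by blast
  have "norm (infsum f (B n) - infsum f A) < e" if n: "n \<ge> N" for n
  proof -
    have sB: "?g summable_on B n" "?g summable_on A - B n" using s sub summable_on_subset by blast+
    have "infsum f A - infsum f (B n) = infsum f (A - B n)"
      using infsum_Diff[OF abs_summable_summable[OF s] abs_summable_summable[OF sB(1)] sub] by simp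
    also have "norm \<dots> \<le> infsum ?g (A - B n)"
      using norm_infsum_bound[of f "A - B n"] sB(2) by simp
    also have "\<dots> = infsum ?g A - infsum ?g (B n)"
      by (rule infsum_Diff[OF s sB(1) sub])
    also have "infsum ?g (B n) \<ge> sum ?g F"
      using N[OF n] F(1) by (intro finite_sum_le_infsum[OF sB(1)]) auto
    then have "infsum ?g A - infsum ?g (B n) \<le> e / 2" using F(3) unfolding dist_real_def by linarith
    finally show ?thesis using e by (simp add: abs_minus_commute)
  qed
  then show "\<exists>N. \<forall>n\<ge>N. norm (infsum f (B n) - infsum f A) < e" by blast
qed

text \<open>A finite set of tuples involves only primes up to some bound. The Euler product over
  these is at most the product of the \<open>1 + b p\<close>, hence at most the exponential of the
  sum of \<open>b\<close>.\<close>

lemma euler_product_bound: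
  fixes f :: "nat^'n \<Rightarrow> real"
  assumes f: "multv f" and nn: "\<And>d. f d \<ge> 0"
    and s: "\<And>p. prime p \<Longrightarrow> (\<lambda>k. f (ppow p k)) summable_on UNIV"
    and b: "\<And>p. prime p \<Longrightarrow> infsum (\<lambda>k. f (ppow p k)) UNIV \<le> 1 + b p" and b0: "\<And>p. b p \<ge> 0"
    and sb: "summable b"
  shows "f summable_on {d. vpos d}"
proof (rule nonneg_bdd_above_summable_on)
  show "bdd_above (sum f ` {F. F \<subseteq> {d. vpos d} \<and> finite F})"
  proof (rule bdd_aboveI2[where M = "exp (suminf b)"], clarify)
    fix F :: "(nat^'n) set" assume F: "F \<subseteq> {d. vpos d}" "finite F"
    have "\<And>d. d \<in> F \<Longrightarrow> vpos d" using F by auto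
    from smooth_exhaust[OF F(2) this] obtain N where N: "F \<subseteq> smooth {p. prime p \<and> p \<le> N}" by auto
    let ?P = "{p. prime p \<and> p \<le> N}"
    have fa: "norm (f d) = f d" for d using nn by simp
    have "finite ?P" by (rule finite_subset[of _ "{..N}"]) auto
    from euler_product_smooth[OF f this, unfolded fa]
    have eu: "f summable_on smooth ?P" "infsum f (smooth ?P) = (\<Prod>p\<in>?P. infsum (\<lambda>k. f (ppow p k)) UNIV)"
      using s by blast+
    have "sum f F \<le> infsum f (smooth ?P)" using N F nn by (intro finite_sum_le_infsum[OF eu(1)]) auto
    also have "\<dots> \<le> (\<Prod>p\<in>?P. exp (b p))" unfolding eu(2)
    proof (intro prod_mono conjI infsum_nonneg nn)
      fix p assume "p \<in> ?P"
      then have "infsum (\<lambda>k. f (ppow p k)) UNIV \<le> 1 + b p" using b by auto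
      also have "\<dots> \<le> exp (b p)" by (rule exp_ge_add_one_self)
      finally show "infsum (\<lambda>k. f (ppow p k)) UNIV \<le> exp (b p)" .
    qed
    also have "\<dots> = exp (sum b ?P)" by (simp add: exp_sum)
    also have "\<dots> \<le> exp (suminf b)" using sum_le_suminf[OF sb, of ?P] b0 by simp
    finally show "sum f F \<le> exp (suminf b)" .
  qed
qed (rule nn)

section \<open>Local estimates at a prime\<close>

lemma sum_power_shift_le:
  fixes y :: real
  assumes y: "0 \<le> y" "y < 1"
  shows "(\<Sum>k<N. y ^ (k - w)) \<le> real w + 1 / (1 - y)"
proof (induction w arbitrary: N)
  case 0
  have "(\<Sum>k<N. y ^ k) = (1 - y ^ N) / (1 - y)" using sum_gp_strict[of y N] y by simp
  also have "\<dots> \<le> 1 / (1 - y)" using y by (intro divide_right_mono) auto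
  finally show ?case by simp
next
  case (Suc w)
  show ?case
  proof (cases N)
    case 0 then show ?thesis using y by simp
  next
    case (Suc M)
    \<comment> \<open>Subtraction is truncated: the term \<open>k = 0\<close> equals 1, and shifting
      the index lowers the offset by one. So the first \<open>w\<close> terms cost 1 each before the
      geometric decay starts.\<close>
    have "(\<Sum>k<N. y ^ (k - Suc w)) = 1 + (\<Sum>k<M. y ^ (k - w))"
      unfolding Suc by (subst sum.lessThan_Suc_shift) simp
    then show ?thesis using Suc.IH[of M] by simp
  qed
qed

text \<open>The bound is the geometric mean of the two given upper bounds for
  \<open>a\<close>.\<close>

lemma le_powr_half:
  fixes a P :: real
  assumes "0 \<le> a" "P > 0" "a * P powr s \<le> 1" "a * P powr t \<le> 1"
  shows "a \<le> P powr (- ((s + t) / 2))"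
proof (rule power2_le_imp_le)
  have "(a * P powr s) * (a * P powr t) \<le> 1 * 1" using assms by (intro mult_mono) auto
  then have "a\<^sup>2 * P powr (s + t) \<le> 1" by (simp add: power2_eq_square powr_add algebra_simps)
  then have "a\<^sup>2 \<le> 1 / P powr (s + t)" using assms(2) by (subst pos_le_divide_eq) auto
  also have "\<dots> = (P powr (- ((s + t) / 2)))\<^sup>2"
    unfolding power2_eq_square powr_add[symmetric] powr_minus_divide[symmetric] by simp
  finally show "a\<^sup>2 \<le> (P powr (- ((s + t) / 2)))\<^sup>2" .
qed simp

lemma prod_powr_power:
  "P > 0 \<Longrightarrow> (\<Prod>i\<in>UNIV. (P powr e) ^ (k $ i)) = P powr (e * real (\<Sum>i\<in>(UNIV :: 'n::finite set). k $ i))"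
  unfolding power_sum[symmetric] by (subst powr_realpow[symmetric]) (simp_all add: powr_powr)

text \<open>The exponent tuples at which \<open>muv (ppow p m)\<close> does not vanish, since
  \<open>mu\<close> kills higher powers of a prime.\<close>

definition bits :: "(nat^4) set" where
  "bits = {m. \<forall>i. m $ i \<in> {0,1}}"

lemma finite_bits: "finite bits"
  unfolding bits_def by (rule finite_vec_set) simp

lemma card_bits: "card bits = 16"
  unfolding bits_def by (subst card_vec_set) (simp_all add: numeral_eq_Suc)

lemma muv_ppow:
  assumes p: "prime p"
  shows "muv (ppow p m) = (if m \<in> bits then (\<Prod>i\<in>UNIV. (- 1 / real p) ^ (m $ i)) else 0)"
proof (cases "m \<in> bits")
  case True
  have "mu (p ^ m $ i) / real (p ^ m $ i) = (- 1 / real p) ^ (m $ i)" for i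
    using True mu_prime[OF p] by (auto simp: bits_def dest!: spec[of _ i])
  then show ?thesis using True by (simp add: muv_def)
next
  case False
  then obtain i where "m $ i \<ge> 2" by (auto simp: bits_def) (metis One_nat_def Suc_1 bot_nat_0.not_eq_extremum not_less_eq_eq le_SucE le_zero_eq nat_le_linear)
  then have "mu (p ^ m $ i) = 0" by (rule mu_prime_power[OF p])
  then have "muv (ppow p m) = 0" unfolding muv_def by (intro prod_zero) auto
  then show ?thesis using False by simp
qed

lemma vdivs_ppow:
  assumes p: "prime p" shows "vdivs (ppow p k) = ppow p ` {m. \<forall>i. m $ i \<le> k $ i}" "inj (ppow p)"
proof -
  show "inj (ppow p)" using prime_gt_1_nat[OF p] by (auto intro!: injI simp: vec_eq_iff)
  show "vdivs (ppow p k) = ppow p ` {m. \<forall>i. m $ i \<le> k $ i}"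
  proof
    show "ppow p ` {m. \<forall>i. m $ i \<le> k $ i} \<subseteq> vdivs (ppow p k)" by (clarsimp simp: vdivs_def le_imp_power_dvd)
    show "vdivs (ppow p k) \<subseteq> ppow p ` {m. \<forall>i. m $ i \<le> k $ i}"
    proof
      fix d assume "d \<in> vdivs (ppow p k)"
      then have "\<forall>i. \<exists>j\<le>k $ i. d $ i = p ^ j" using divides_primepow_nat[OF p] by (simp add: vdivs_def)
      then obtain j where "\<And>i. j i \<le> k $ i" "\<And>i. d $ i = p ^ j i" by metis
      then show "d \<in> ppow p ` {m. \<forall>i. m $ i \<le> k $ i}"
        by (intro image_eqI[of _ _ "\<chi> i. j i"]) (auto simp: vec_eq_iff)
    qed
  qed
qed

text \<open>The convolution is commuted so that the sum runs over the support of \<open>muv\<close>;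
  the condition on \<open>m\<close> is divisibility.\<close>

lemma conv_ppow_muv:
  fixes h :: "nat^4 \<Rightarrow> real"
  assumes p: "prime p"
  shows "conv h muv (ppow p k) =
    (\<Sum>m\<in>bits. if \<forall>i. m $ i \<le> k $ i then (\<Prod>i\<in>UNIV. (- 1 / real p) ^ (m $ i)) * h (ppow p (k - m)) else 0)"
proof -
  let ?A = "{m :: nat^4. \<forall>i. m $ i \<le> k $ i}"
  have finA: "finite ?A" using finite_vec_set[of "\<lambda>i. {..k $ i}"] by simp
  have "conv h muv (ppow p k) = (\<Sum>d\<in>vdivs (ppow p k). muv d * h (vquo (ppow p k) d))"
    using conv_commute[OF vpos_ppow[OF p]] by (simp add: conv_def)
  also have "\<dots> = (\<Sum>m\<in>?A. muv (ppow p m) * h (vquo (ppow p k) (ppow p m)))"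
    unfolding vdivs_ppow(1)[OF p] by (subst sum.reindex) (auto intro: inj_on_subset[OF vdivs_ppow(2)[OF p]])
  also have "\<dots> = (\<Sum>m\<in>?A. if m \<in> bits then (\<Prod>i\<in>UNIV. (- 1 / real p) ^ (m $ i)) * h (ppow p (k - m)) else 0)"
  proof (rule sum.cong[OF refl])
    fix m assume m: "m \<in> ?A"
    have "vquo (ppow p k) (ppow p m) = ppow p (k - m)"
      using m prime_gt_0_nat[OF p] by (simp add: vec_eq_iff power_diff)
    then show "muv (ppow p m) * h (vquo (ppow p k) (ppow p m)) =
        (if m \<in> bits then (\<Prod>i\<in>UNIV. (- 1 / real p) ^ (m $ i)) * h (ppow p (k - m)) else 0)"
      by (simp add: muv_ppow[OF p])
  qed
  also have "\<dots> = (\<Sum>m\<in>?A \<inter> bits. (\<Prod>i\<in>UNIV. (- 1 / real p) ^ (m $ i)) * h (ppow p (k - m)))"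
    by (rule sum.inter_restrict[OF finA, symmetric])
  also have "\<dots> = (\<Sum>m\<in>bits \<inter> ?A. (\<Prod>i\<in>UNIV. (- 1 / real p) ^ (m $ i)) * h (ppow p (k - m)))"
    by (simp only: Int_commute)
  also have "\<dots> = (\<Sum>m\<in>bits. if m \<in> ?A then (\<Prod>i\<in>UNIV. (- 1 / real p) ^ (m $ i)) * h (ppow p (k - m)) else 0)"
    by (rule sum.inter_restrict[OF finite_bits])
  finally show ?thesis by simp
qed

text \<open>Four geometric series of ratio at most \<open>2 powr (- 1 / 16)\<close>, times the 16
  terms of a convolution with \<open>muv\<close> at a prime power. It depends neither on the prime
  nor on the function.\<close>

definition K0 :: real where
  "K0 = 16 * (1 / (1 - 2 powr (- 1 / 16))) ^ 4"

text \<open>The prototype of \<open>h\<close> is the reciprocal index of a divisor sublattice. Then \<open>w p\<close> is the exponent of \<open>p\<close>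
  in a multiple of the determinants of all pairs of forms; it vanishes at the good primes.\<close>

locale arith =
  fixes h :: "nat^4 \<Rightarrow> real" and w :: "nat \<Rightarrow> nat"
  assumes mult: "multv h"
    and pos: "\<And>d. vpos d \<Longrightarrow> h d > 0"
    and low: "\<And>d. vpos d \<Longrightarrow> 1 \<le> h d * real (vprod d)"
    and up: "\<And>p k i j. prime p \<Longrightarrow> i \<noteq> j \<Longrightarrow> h (ppow p k) * real p ^ ((k $ i - w p) + (k $ j - w p)) \<le> 1"
    and fin: "finite {p. prime p \<and> w p > 0}"
begin

text \<open>The first factor in \<open>h = conv G invv\<close>. At good primes it vanishes on
  nontrivial powers in a single coordinate, which is the reason for its absolute
  summability.\<close>

definition G :: "nat^4 \<Rightarrow> real" where
  "G = conv h muv"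

text \<open>The Euler factor of the main term. It is also the local sum of \<open>G\<close>, the
  fourth power coming from \<open>muv\<close>.\<close>

definition c :: "nat \<Rightarrow> real" where
  "c p = (1 - 1 / real p) ^ 4 * infsum (\<lambda>k. h (ppow p k)) UNIV"

lemma multv_G: "multv G"
  unfolding G_def by (rule multv_conv[OF mult multv_muv])

lemma h_eq_conv: "vpos e \<Longrightarrow> conv G invv e = h e"
  unfolding G_def by (rule conv_inverse)

text \<open>The bounds for the pairs \<open>{1, 2}\<close> and \<open>{3, 4}\<close> are combined by
  a geometric mean, so that every coordinate decays with exponent \<open>1 / 2\<close>.\<close>

lemma pairs_imp_powr:
  assumes p: "prime p" and a: "0 \<le> a" and b: "\<And>i j. i \<noteq> j \<Longrightarrow> a * real p ^ ((k $ i - w p) + (k $ j - w p)) \<le> 1"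
  shows "a \<le> (\<Prod>i\<in>(UNIV :: 4 set). (real p powr (- 1 / 2)) ^ (k $ i - w p))"
proof -
  have P: "real p > 0" using p by (simp add: prime_gt_0_nat)
  have "a * real p powr real ((k $ 1 - w p) + (k $ 2 - w p)) \<le> 1"
    "a * real p powr real ((k $ 3 - w p) + (k $ 4 - w p)) \<le> 1"
    using b[of 1 2] b[of 3 4] P by (simp_all only: powr_realpow) simp_all
  from le_powr_half[OF a P this]
  have "a \<le> real p powr (- ((real ((k $ 1 - w p) + (k $ 2 - w p)) + real ((k $ 3 - w p) + (k $ 4 - w p))) / 2))" .
  also have "\<dots> = real p powr (\<Sum>i\<in>UNIV. (- 1 / 2) * real (k $ i - w p))"
    unfolding sum_4 by (simp add: algebra_simps add_divide_distrib)
  also have "\<dots> = (\<Prod>i\<in>UNIV. real p powr ((- 1 / 2) * real (k $ i - w p)))"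
    using P by (subst powr_sum) auto
  also have "\<dots> = (\<Prod>i\<in>(UNIV :: 4 set). (real p powr (- 1 / 2)) ^ (k $ i - w p))"
    using P by (simp add: powr_powr flip: powr_realpow)
  finally show ?thesis .
qed

lemma half_power_le:
  assumes p: "prime p" shows "real p powr (- 1 / 2) \<le> 3 / 4"
proof -
  have "real p \<ge> 2" using prime_ge_2_nat[OF p] by simp
  then have "(1 :: real) / real p \<le> 1 / 2" by (simp add: field_simps)
  also have "\<dots> \<le> (3 / 4)\<^sup>2" by (simp add: power2_eq_square)
  also have "1 / real p = (real p powr (- 1 / 2))\<^sup>2"
    using \<open>real p \<ge> 2\<close> by (simp add: power2_eq_square powr_minus_divide flip: powr_add)
  finally show ?thesis by (rule power2_le_imp_le) simp
qed

text \<open>Each coordinate has decay \<open>p powr (- 1 / 2)\<close> beyond the exponent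
  \<open>w p\<close>. This ratio is at most \<open>3 / 4\<close>, so one coordinate sums to at most
  \<open>w p + 4\<close>. The lower bound is the term at 0.\<close>

lemma h_local: 
  assumes p: "prime p"
  shows "(\<lambda>k. h (ppow p k)) summable_on UNIV" "infsum (\<lambda>k. h (ppow p k)) UNIV \<le> (real (w p) + 4) ^ 4"
    "infsum (\<lambda>k. h (ppow p k)) UNIV \<ge> 1"
proof -
  let ?q = "real p powr (- 1 / 2)"
  have bd: "(\<Sum>k<N. ?q ^ (k - w p)) \<le> real (w p) + 4" for N
  proof -
    have "(\<Sum>k<N. ?q ^ (k - w p)) \<le> real (w p) + 1 / (1 - ?q)"
      using half_power_le[OF p] by (intro sum_power_shift_le) auto
    also have "1 / (1 - ?q) \<le> 4" using half_power_le[OF p] by (simp add: field_simps)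
    finally show ?thesis by simp
  qed
  note S = prod_vec_summable[of "\<lambda>_ k. ?q ^ (k - w p)" "\<lambda>_::4. real (w p) + 4", OF _ bd]
  have le: "h (ppow p k) \<le> (\<Prod>i\<in>UNIV. ?q ^ (k $ i - w p))" for k
    using up[OF p] pos[OF vpos_ppow[OF p]] by (intro pairs_imp_powr[OF p]) (auto intro: less_imp_le)
  have nn: "h (ppow p k) \<ge> 0" for k using pos[OF vpos_ppow[OF p]] by (simp add: less_imp_le)
  show s: "(\<lambda>k. h (ppow p k)) summable_on UNIV"
    by (rule summable_on_comparison_test[OF S(1) le nn]) simp
  have "infsum (\<lambda>k. h (ppow p k)) UNIV \<le> infsum (\<lambda>k :: nat^4. \<Prod>i\<in>UNIV. ?q ^ (k $ i - w p)) UNIV"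
    by (rule infsum_mono[OF s S(1) le]) simp
  also have "\<dots> \<le> (real (w p) + 4) ^ 4" using S(2) by simp
  finally show "infsum (\<lambda>k. h (ppow p k)) UNIV \<le> (real (w p) + 4) ^ 4" .
  have "sum (\<lambda>k. h (ppow p k)) {0} \<le> infsum (\<lambda>k. h (ppow p k)) UNIV"
    by (rule finite_sum_le_infsum[OF s]) (auto simp: nn)
  then show "infsum (\<lambda>k. h (ppow p k)) UNIV \<ge> 1" using multv_one[OF mult] by simp
qed

lemma c_bounds:
  assumes p: "prime p" shows "0 < c p" "c p \<le> (real (w p) + 4) ^ 4"
proof -
  have "real p \<ge> 2" using prime_ge_2_nat[OF p] by simp
  then have 1: "0 < 1 - 1 / real p" "1 - 1 / real p \<le> 1" by (auto simp: field_simps)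
  then have 2: "0 < (1 - 1 / real p) ^ 4" "(1 - 1 / real p) ^ 4 \<le> 1" by (auto intro: power_le_one)
  show "0 < c p" unfolding c_def using 2 h_local(3)[OF p] by simp
  have "c p \<le> 1 * (real (w p) + 4) ^ 4"
    unfolding c_def using 2 h_local(2,3)[OF p] by (intro mult_mono) auto
  then show "c p \<le> (real (w p) + 4) ^ 4" by simp
qed

text \<open>In the term of \<open>m\<close>, passing from \<open>k\<close> to \<open>k - m\<close>
  weakens the bound \<open>up\<close> by at most \<open>p\<close> to the sum of the entries of
  \<open>m\<close>, and the factor from \<open>muv\<close> has exactly the inverse size. There are
  16 terms.\<close>

lemma G_pair:
  assumes p: "prime p" and ij: "i \<noteq> j"
  shows "\<bar>G (ppow p k)\<bar> / 16 * real p ^ ((k $ i - w p) + (k $ j - w p)) \<le> 1"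
proof -
  let ?E = "real p ^ ((k $ i - w p) + (k $ j - w p))"
  have P: "real p \<ge> 1" using prime_ge_1_nat[OF p] by simp
  have "\<bar>(if \<forall>i. m $ i \<le> k $ i then (\<Prod>i\<in>UNIV. (- 1 / real p) ^ (m $ i)) * h (ppow p (k - m)) else 0)\<bar> * ?E \<le> 1" for m :: "nat^4"
  proof (cases "\<forall>i. m $ i \<le> k $ i")
    case True
    have "?E \<le> real p ^ ((m $ i + m $ j) + (((k - m) $ i - w p) + ((k - m) $ j - w p)))"
      using P by (intro power_increasing) auto
    also have "\<dots> \<le> real p ^ ((\<Sum>i\<in>UNIV. m $ i) + (((k - m) $ i - w p) + ((k - m) $ j - w p)))"
    proof -
      have "(\<Sum>l\<in>{i,j}. m $ l) \<le> (\<Sum>l\<in>UNIV. m $ l)" by (rule sum_mono2) auto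
      then show ?thesis using P ij by (intro power_increasing) auto
    qed
    finally have E: "?E \<le> real p ^ (\<Sum>i\<in>UNIV. m $ i) * real p ^ (((k - m) $ i - w p) + ((k - m) $ j - w p))"
      by (simp add: power_add)
    have "\<bar>(\<Prod>i\<in>UNIV. (- 1 / real p) ^ (m $ i)) * h (ppow p (k - m))\<bar> * ?E
       = (1 / real p) ^ (\<Sum>i\<in>UNIV. m $ i) * h (ppow p (k - m)) * ?E"
      using pos[OF vpos_ppow[OF p], of "k - m"] by (simp add: abs_mult abs_prod power_abs power_sum)
    also have "\<dots> \<le> (1 / real p) ^ (\<Sum>i\<in>UNIV. m $ i) * h (ppow p (k - m)) *
        (real p ^ (\<Sum>i\<in>UNIV. m $ i) * real p ^ (((k - m) $ i - w p) + ((k - m) $ j - w p)))"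
      using pos[OF vpos_ppow[OF p], of "k - m"] by (intro mult_left_mono[OF E]) auto
    also have "\<dots> = h (ppow p (k - m)) * real p ^ (((k - m) $ i - w p) + ((k - m) $ j - w p))"
      using P by (simp add: power_one_over)
    also have "\<dots> \<le> 1" by (rule up[OF p ij])
    finally show ?thesis using True by simp
  qed auto
  then have "(\<Sum>m\<in>bits. \<bar>(if \<forall>i. m $ i \<le> k $ i then (\<Prod>i\<in>UNIV. (- 1 / real p) ^ (m $ i)) * h (ppow p (k - m)) else 0)\<bar> * ?E) \<le> (\<Sum>m\<in>bits. 1)"
    by (intro sum_mono)
  then have "(\<Sum>m\<in>bits. \<bar>(if \<forall>i. m $ i \<le> k $ i then (\<Prod>i\<in>UNIV. (- 1 / real p) ^ (m $ i)) * h (ppow p (k - m)) else 0)\<bar>) * ?E \<le> 16"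
    by (simp add: card_bits sum_distrib_right)
  moreover have "\<bar>G (ppow p k)\<bar> \<le> (\<Sum>m\<in>bits. \<bar>(if \<forall>i. m $ i \<le> k $ i then (\<Prod>i\<in>UNIV. (- 1 / real p) ^ (m $ i)) * h (ppow p (k - m)) else 0)\<bar>)"
    unfolding G_def conv_ppow_muv[OF p] by (rule sum_abs)
  ultimately have "\<bar>G (ppow p k)\<bar> * ?E \<le> 16"
    by (meson mult_right_mono order_trans zero_le_power of_nat_0_le_iff)
  then show ?thesis by simp
qed

text \<open>When \<open>p\<close> is a good prime, \<open>h\<close> agrees with \<open>1 / d\<close> at powers of \<open>p\<close> in a single coordinate, so the
  convolution inverse kills these terms.\<close>

lemma G_single:
  assumes p: "prime p" and w: "w p = 0" and k: "k \<noteq> 0" "\<And>j. j \<noteq> i \<Longrightarrow> k $ j = 0"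
  shows "G (ppow p k) = 0"
proof -
  have heq: "h d = invv d" if d: "d \<in> vdivs (ppow p k)" for d
  proof -
    obtain m where m: "d = ppow p m" "\<And>i. m $ i \<le> k $ i" using d unfolding vdivs_ppow(1)[OF p] by blast
    have m0: "m $ j = 0" if "j \<noteq> i" for j using m(2)[of j] k(2)[OF that] by simp
    obtain j where j: "i \<noteq> j"
    proof (cases "i = 1")
      case True then show ?thesis using that[of 2] by simp
    next
      case False then show ?thesis using that[of 1] by simp
    qed
    have s: "(\<Sum>l\<in>UNIV. m $ l) = m $ i"
      using m0 by (subst sum.mono_neutral_right[of UNIV "{i}"]) auto
    \<comment> \<open>The pair bound with exponent 0 at \<open>j\<close> and the general lower bound
      \<open>low\<close> meet, so \<open>h\<close> is exactly the reciprocal on these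
      divisors.\<close>
    have "h d * real p ^ (m $ i) \<le> 1" using up[OF p j, of m] m(1) w m0[of j] j by simp
    moreover have "1 \<le> h d * real p ^ (m $ i)" using low[OF vpos_ppow[OF p], of m] m(1) by (simp add: vprod_ppow s)
    ultimately have "h d * real p ^ (m $ i) = 1" by simp
    then show ?thesis using m(1) s prime_gt_0_nat[OF p] by (simp add: invv_def vprod_ppow field_simps)
  qed
  have "G (ppow p k) = conv invv muv (ppow p k)"
    unfolding G_def conv_def by (intro sum.cong refl) (simp add: heq)
  also have "\<dots> = conv muv invv (ppow p k)" by (rule conv_commute[OF vpos_ppow[OF p]])
  also have "\<dots> = 0"
  proof -
    have "ppow p k \<noteq> 1" using k(1) vdivs_ppow(2)[OF p] by (metis injD ppow_zero)
    then show ?thesis by (simp add: conv_muv_invv vpos_ppow[OF p])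
  qed
  finally show ?thesis .
qed

text \<open>The weight \<open>(\<Prod>i. d $ i) powr (1 / 16)\<close> absorbs the dependence on \<open>ln d\<close> of the error terms in sums of
  \<open>1 / m\<close>, so that they can be summed against \<open>G\<close>.\<close>

definition Gw :: "nat^4 \<Rightarrow> real" where
  "Gw d = \<bar>G d\<bar> * real (vprod d) powr (1 / 16)"

lemma multv_Gw: "multv Gw"
  using multv_G by (simp add: multv_def Gw_def vprod_mult abs_mult powr_mult)

lemma Gw_ppow:
  assumes p: "prime p"
  shows "Gw (ppow p k) = \<bar>G (ppow p k)\<bar> * (\<Prod>i\<in>UNIV. (real p powr (1 / 16)) ^ (k $ i))"
proof -
  have P: "real p > 0" using p by (simp add: prime_gt_0_nat)
  have "real (vprod (ppow p k)) powr (1 / 16) = (real p powr (1 / 16)) ^ (\<Sum>i\<in>UNIV. k $ i)"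
    using P by (simp add: vprod_ppow powr_powr mult.commute flip: powr_realpow)
  then show ?thesis by (simp add: Gw_def power_sum)
qed

text \<open>In each coordinate the decay \<open>p powr (- 1 / 2)\<close> of \<open>G\<close>
  outweighs the growth \<open>p powr (1 / 16)\<close> of the weight; the first \<open>w p\<close>
  exponents cost a factor that depends only on \<open>p\<close>.\<close>

lemma Gw_local:
  assumes p: "prime p" shows "(\<lambda>k. Gw (ppow p k)) summable_on UNIV"
proof -
  let ?q = "real p powr (- 1 / 2)" and ?x = "real p powr (1 / 16)"
  have P: "real p \<ge> 2" using prime_ge_2_nat[OF p] by simp
  have x1: "?x \<ge> 1" using P by (intro ge_one_powr_ge_zero) auto
  have qx: "?q * ?x < 1"
    using P by (simp flip: powr_add) (subst powr_less_one, auto)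
  have bd: "(\<Sum>k<N. ?q ^ (k - w p) * ?x ^ k) \<le> ?x ^ w p * (real (w p) + 1 / (1 - ?q * ?x))" for N
  proof -
    have "?q ^ (k - w p) * ?x ^ k \<le> ?x ^ w p * (?q * ?x) ^ (k - w p)" for k
    proof -
      have "?x ^ k \<le> ?x ^ (w p + (k - w p))" using x1 by (intro power_increasing) auto
      then have "?q ^ (k - w p) * ?x ^ k \<le> ?q ^ (k - w p) * ?x ^ (w p + (k - w p))" by (intro mult_left_mono) auto
      then show ?thesis by (simp add: power_add power_mult_distrib algebra_simps)
    qed
    then have "(\<Sum>k<N. ?q ^ (k - w p) * ?x ^ k) \<le> ?x ^ w p * (\<Sum>k<N. (?q * ?x) ^ (k - w p))"
      by (simp add: sum_distrib_left sum_mono)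
    also have "\<dots> \<le> ?x ^ w p * (real (w p) + 1 / (1 - ?q * ?x))"
      using qx by (intro mult_left_mono sum_power_shift_le) auto
    finally show ?thesis .
  qed
  have S: "(\<lambda>k :: nat^4. \<Prod>i\<in>UNIV. ?q ^ (k $ i - w p) * ?x ^ (k $ i)) summable_on UNIV"
    by (rule prod_vec_summable(1)[of "\<lambda>_ k. ?q ^ (k - w p) * ?x ^ k", OF _ bd]) simp
  have le: "Gw (ppow p k) \<le> 16 * (\<Prod>i\<in>UNIV. ?q ^ (k $ i - w p) * ?x ^ (k $ i))" for k
  proof -
    have "\<bar>G (ppow p k)\<bar> / 16 \<le> (\<Prod>i\<in>UNIV. ?q ^ (k $ i - w p))"
      using G_pair[OF p] by (intro pairs_imp_powr[OF p]) auto
    then have "\<bar>G (ppow p k)\<bar> * (\<Prod>i\<in>UNIV. ?x ^ (k $ i)) \<le> (16 * (\<Prod>i\<in>UNIV. ?q ^ (k $ i - w p))) * (\<Prod>i\<in>UNIV. ?x ^ (k $ i))"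
      by (intro mult_right_mono prod_nonneg) auto
    then show ?thesis by (simp add: Gw_ppow[OF p] prod.distrib)
  qed
  show ?thesis
    by (rule summable_on_comparison_test[OF summable_on_cmult_right[OF S, of 16] le]) (simp add: Gw_def)
qed

text \<open>Let \<open>n\<close> be the sum of the exponents. A nonvanishing term has two nonzero
  exponents, so \<open>\<bar>G (ppow p k)\<bar> / 16\<close> is at most \<open>p powr (- 2)\<close>
  and also at most \<open>p powr (- n / 2)\<close>. The geometric mean of the two, times the weight
  \<open>p powr (n / 16)\<close>, is \<open>p powr (- 1 - 3 / 16 * n)\<close>. As
  \<open>n \<ge> 2\<close>, the part \<open>n / 8\<close> of the exponent can be traded for
  \<open>1 / 4\<close>; what remains is summable over \<open>k\<close> and over
  \<open>p\<close>.\<close>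

lemma Gw_good_term:
  assumes p: "prime p" and w: "w p = 0" and k: "k \<noteq> 0"
  shows "Gw (ppow p k) \<le> 16 * real p powr (- 5 / 4) * (\<Prod>i\<in>UNIV. (real p powr (- 1 / 16)) ^ (k $ i))"
proof (cases "\<exists>i. \<forall>j. j \<noteq> i \<longrightarrow> k $ j = 0")
  case True
  then have "G (ppow p k) = 0" using G_single[OF p w k] by blast
  then show ?thesis by (simp add: Gw_def prod_nonneg)
next
  case False
  have P: "real p \<ge> 2" using prime_ge_2_nat[OF p] by simp
  obtain i where i: "k $ i \<noteq> 0" using k by (auto simp: vec_eq_iff)
  obtain j where j: "j \<noteq> i" "k $ j \<noteq> 0" using False by blast
  let ?n = "real (\<Sum>i\<in>UNIV. k $ i)"
  have n2: "?n \<ge> 2"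
  proof -
    have "(\<Sum>l\<in>{i,j}. k $ l) \<le> (\<Sum>l\<in>UNIV. k $ l)" by (rule sum_mono2) auto
    then have "2 \<le> (\<Sum>l\<in>UNIV. k $ l)" using i j by simp
    then show ?thesis by (metis of_nat_le_iff of_nat_numeral)
  qed
  let ?a = "\<bar>G (ppow p k)\<bar> / 16"
  have "?a * real p ^ 2 \<le> ?a * real p ^ (k $ i + k $ j)"
    using i j P by (intro mult_left_mono power_increasing) auto
  also have "\<dots> \<le> 1" using G_pair[OF p j(1)[symmetric], of k] w by simp
  finally have a2: "?a * real p powr 2 \<le> 1" using P by simp
  have "?a \<le> (\<Prod>i\<in>UNIV. (real p powr (- 1 / 2)) ^ (k $ i))"
    using pairs_imp_powr[OF p, of ?a k] G_pair[OF p] w by simp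
  also have "\<dots> = real p powr (- (?n / 2))"
    using P by (subst prod_powr_power) simp_all
  finally have "?a * real p powr (?n / 2) \<le> real p powr (- (?n / 2)) * real p powr (?n / 2)"
    by (intro mult_right_mono) auto
  also have "\<dots> = 1" using P by (simp flip: powr_add)
  finally have an: "?a * real p powr (?n / 2) \<le> 1" .
  have "?a \<le> real p powr (- ((2 + ?n / 2) / 2))"
    by (rule le_powr_half[OF _ _ a2 an]) (use P in auto)
  then have "Gw (ppow p k) \<le> 16 * real p powr (- ((2 + ?n / 2) / 2)) * (\<Prod>i\<in>UNIV. (real p powr (1 / 16)) ^ (k $ i))"
    unfolding Gw_ppow[OF p] by (intro mult_right_mono prod_nonneg) auto
  also have "(\<Prod>i\<in>UNIV. (real p powr (1 / 16)) ^ (k $ i)) = real p powr (?n / 16)"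
    using P by (subst prod_powr_power) simp_all
  also have "16 * real p powr (- ((2 + ?n / 2) / 2)) * real p powr (?n / 16) = 16 * real p powr (- 1 - 3 / 16 * ?n)"
    by (simp add: field_simps flip: powr_add)
  also have "\<dots> \<le> 16 * real p powr (- 5 / 4 + - (?n / 16))"
    using n2 P by (intro mult_left_mono powr_mono) auto
  also have "\<dots> = 16 * real p powr (- 5 / 4) * real p powr (- (?n / 16))" by (subst powr_add) simp
  also have "real p powr (- (?n / 16)) = (\<Prod>i\<in>UNIV. (real p powr (- 1 / 16)) ^ (k $ i))"
    using P by (subst prod_powr_power) simp_all
  finally show ?thesis .
qed

lemma Gw_good:
  assumes p: "prime p" and w: "w p = 0"
  shows "infsum (\<lambda>k. if k = 0 then 0 else Gw (ppow p k)) UNIV \<le> K0 * real p powr (- 5 / 4)"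
    "(\<lambda>k. if k = 0 then 0 else Gw (ppow p k)) summable_on UNIV"
proof -
  let ?y = "real p powr (- 1 / 16)"
  have P: "real p \<ge> 2" using prime_ge_2_nat[OF p] by simp
  have y: "?y \<le> 2 powr (- 1 / 16)" using P by (intro powr_mono2') auto
  have t1: "(2::real) powr (- 1 / 16) < 1" by (subst powr_less_one) auto
  have bd: "(\<Sum>k<N. ?y ^ k) \<le> 1 / (1 - 2 powr (- 1 / 16))" for N
  proof -
    have "(\<Sum>k<N. ?y ^ k) \<le> 1 / (1 - ?y)" using sum_power_shift_le[of ?y 0 N] y t1 by simp
    also have "\<dots> \<le> 1 / (1 - 2 powr (- 1 / 16))" using y t1 by (intro divide_left_mono) auto
    finally show ?thesis .
  qed
  note S = prod_vec_summable[of "\<lambda>_ k. ?y ^ k" "\<lambda>_::4. 1 / (1 - 2 powr (- 1 / 16))", OF _ bd]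
  let ?B = "\<lambda>k :: nat^4. 16 * real p powr (- 5 / 4) * (\<Prod>i\<in>UNIV. ?y ^ (k $ i))"
  have SB: "?B summable_on UNIV" by (intro summable_on_cmult_right S(1)) simp
  have le: "(if k = 0 then 0 else Gw (ppow p k)) \<le> ?B k" for k
    using Gw_good_term[OF p w, of k] by (auto intro!: mult_nonneg_nonneg prod_nonneg)
  show s: "(\<lambda>k. if k = 0 then 0 else Gw (ppow p k)) summable_on UNIV"
    by (rule summable_on_comparison_test[OF SB le]) (auto simp: Gw_def)
  have "infsum (\<lambda>k. if k = 0 then 0 else Gw (ppow p k)) UNIV \<le> infsum ?B UNIV"
    by (rule infsum_mono[OF s SB le])
  also have "\<dots> = 16 * real p powr (- 5 / 4) * infsum (\<lambda>k :: nat^4. \<Prod>i\<in>UNIV. ?y ^ (k $ i)) UNIV"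
    by (rule infsum_cmult_right') 
  also have "\<dots> \<le> 16 * real p powr (- 5 / 4) * (\<Prod>i\<in>(UNIV::4 set). 1 / (1 - 2 powr (- 1 / 16)))"
    using S(2) by (intro mult_left_mono) auto
  finally show "infsum (\<lambda>k. if k = 0 then 0 else Gw (ppow p k)) UNIV \<le> K0 * real p powr (- 5 / 4)"
    by (simp add: K0_def mult_ac)
qed

end

lemma K0_pos: "K0 > 0"
proof -
  have "(2::real) powr (- 1 / 16) < 1" by (subst powr_less_one) auto
  then show ?thesis by (simp add: K0_def)
qed

lemma has_sum_finite_sum:
  fixes f :: "'i \<Rightarrow> 'a \<Rightarrow> real"
  assumes "finite I" "\<And>i. i \<in> I \<Longrightarrow> (f i has_sum s i) A"
  shows "((\<lambda>x. \<Sum>i\<in>I. f i x) has_sum (\<Sum>i\<in>I. s i)) A"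
  using assms by (induction I rule: finite_induct) (auto intro!: has_sum_add)

lemma infsum_remove_zero:
  fixes f :: "nat^4 \<Rightarrow> real"
  assumes "f summable_on UNIV"
  shows "(\<lambda>k. if k = 0 then 0 else f k) summable_on UNIV"
    "infsum f UNIV = f 0 + infsum (\<lambda>k. if k = 0 then 0 else f k) UNIV"
proof -
  have 1: "((\<lambda>k. if k = 0 then - f 0 else 0) has_sum - f 0) UNIV"
    by (rule has_sum_finite_neutralI[of "{0}"]) auto
  have 2: "((\<lambda>k. f k + (if k = 0 then - f 0 else 0)) has_sum (infsum f UNIV + - f 0)) UNIV"
    by (rule has_sum_add[OF has_sum_infsum[OF assms] 1])
  have e: "(\<lambda>k. f k + (if k = 0 then - f 0 else 0)) = (\<lambda>k. if k = 0 then 0 else f k)" by auto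
  show "(\<lambda>k. if k = 0 then 0 else f k) summable_on UNIV" using 2 unfolding e by (rule has_sum_imp_summable)
  show "infsum f UNIV = f 0 + infsum (\<lambda>k. if k = 0 then 0 else f k) UNIV"
    using infsumI[OF 2] unfolding e by simp
qed

lemma polynomial_le_exponential:
  fixes \<epsilon> :: real
  assumes "\<epsilon> > 0"
  shows "\<exists>A\<ge>1. \<forall>w::nat. (real w + 4) ^ 4 \<le> A * 2 powr (\<epsilon> * real w)"
proof -
  \<comment> \<open>Chosen so that the fourth power of \<open>exp (t * w)\<close> is
    \<open>2 powr (\<epsilon> * w)\<close>.\<close>
  define t where "t = \<epsilon> * ln 2 / 4"
  have t: "t > 0" using assms by (simp add: t_def)
  have "(real w + 4) ^ 4 \<le> (4 + 1 / t) ^ 4 * 2 powr (\<epsilon> * real w)" for w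
  proof -
    have "real w + 4 \<le> (4 + 1 / t) * (1 + t * real w)"
    proof -
      have "(4 + 1 / t) * (1 + t * real w) = 4 + real w + (1 / t + 4 * t * real w)" using t by (simp add: field_simps)
      moreover have "1 / t + 4 * t * real w \<ge> 0" using t by simp
      ultimately show ?thesis by linarith
    qed
    also have "\<dots> \<le> (4 + 1 / t) * exp (t * real w)" using t by (intro mult_left_mono exp_ge_add_one_self) auto
    finally have "(real w + 4) ^ 4 \<le> ((4 + 1 / t) * exp (t * real w)) ^ 4" by (intro power_mono) auto
    also have "\<dots> = (4 + 1 / t) ^ 4 * exp (4 * (t * real w))"
      by (simp add: power_mult_distrib exp_of_nat_mult[of 4 "t * real w", simplified])
    also have "exp (4 * (t * real w)) = 2 powr (\<epsilon> * real w)" by (simp add: powr_def t_def)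
    finally show ?thesis .
  qed
  moreover have "(4 + 1 / t) ^ 4 \<ge> 1" using t by (intro one_le_power) simp
  ultimately show ?thesis by blast
qed

text \<open>As for the divisor function: a prime above \<open>625 powr (1 / \<epsilon>)\<close> pays
  for its own factor because \<open>(w + 4) ^ 4 \<le> 625 ^ w\<close> for \<open>w \<ge> 1\<close>,
  and each of the finitely many smaller primes costs at most the constant \<open>A\<close>.\<close>

lemma prod_multiplicity_bound:
  fixes \<epsilon> :: real
  assumes e: "\<epsilon> > 0"
  shows "\<exists>K>0. \<forall>n>0. (\<Prod>p\<in>prime_factors n. (real (multiplicity p n) + 4) ^ 4) \<le> K * real n powr \<epsilon>"
proof -
  obtain A where A: "A \<ge> 1" "\<And>w::nat. (real w + 4) ^ 4 \<le> A * 2 powr (\<epsilon> * real w)"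
    using polynomial_le_exponential[OF e] by blast
  define P where "P = nat \<lceil>(625::real) powr (1 / \<epsilon>)\<rceil>"
  have bd: "(real w + 4) ^ 4 \<le> (if p \<le> P then A else 1) * real p powr (\<epsilon> * real w)" if p: "prime p" and w: "w \<ge> 1" for p w
  proof (cases "p \<le> P")
    case True
    have "2 powr (\<epsilon> * real w) \<le> real p powr (\<epsilon> * real w)"
      using prime_ge_2_nat[OF p] e by (intro powr_mono2) auto
    then have "A * 2 powr (\<epsilon> * real w) \<le> A * real p powr (\<epsilon> * real w)" using A(1) by (intro mult_left_mono) auto
    then show ?thesis using A(2)[of w] True by simp
  next
    case False
    then have "625 powr (1 / \<epsilon>) \<le> real p" unfolding P_def by linarith
    then have "(625 powr (1 / \<epsilon>)) powr (\<epsilon> * real w) \<le> real p powr (\<epsilon> * real w)"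
      using e by (intro powr_mono2) auto
    moreover have "(625 powr (1 / \<epsilon>)) powr (\<epsilon> * real w) = (625::real) ^ w"
      using e by (simp add: powr_powr powr_realpow)
    moreover have "(real w + 4) ^ 4 \<le> 625 ^ w"
    proof -
      have "w + 4 \<le> 5 ^ w" using w by (induction w rule: nat_induct_at_least) auto
      then have "real w + 4 \<le> 5 ^ w" by (metis of_nat_add of_nat_le_iff of_nat_numeral of_nat_power)
      then have "(real w + 4) ^ 4 \<le> (5 ^ w) ^ 4" by (intro power_mono) auto
      also have "\<dots> = (5 ^ 4) ^ w" by (simp only: power_mult[symmetric] mult.commute)
      finally show ?thesis by simp
    qed
    ultimately show ?thesis using False by simp
  qed
  have "(\<Prod>p\<in>prime_factors n. (real (multiplicity p n) + 4) ^ 4) \<le> A ^ (P + 1) * real n powr \<epsilon>" if n: "n > 0" for n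
  proof -
    have fin: "finite (prime_factors n)" by simp
    have "(\<Prod>p\<in>prime_factors n. (real (multiplicity p n) + 4) ^ 4)
        \<le> (\<Prod>p\<in>prime_factors n. (if p \<le> P then A else 1) * real p powr (\<epsilon> * real (multiplicity p n)))"
    proof (intro prod_mono conjI bd)
      fix p assume "p \<in> prime_factors n"
      then show "multiplicity p n \<ge> 1" "prime p"
        by (auto simp: prime_factors_multiplicity)
    qed auto
    also have "\<dots> = (\<Prod>p\<in>prime_factors n. if p \<le> P then A else 1) * (\<Prod>p\<in>prime_factors n. real p powr (\<epsilon> * real (multiplicity p n)))"
      by (rule prod.distrib)
    also have "(\<Prod>p\<in>prime_factors n. real p powr (\<epsilon> * real (multiplicity p n))) = real n powr \<epsilon>"
    proof -
      have "real n = (\<Prod>p\<in>prime_factors n. real p ^ multiplicity p n)"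
        using prime_factorization_nat[OF n] by (metis (no_types, lifting) of_nat_power of_nat_prod prod.cong)
      then have "real n powr \<epsilon> = (\<Prod>p\<in>prime_factors n. (real p ^ multiplicity p n) powr \<epsilon>)"
        by (simp add: prod_powr_distrib)
      also have "\<dots> = (\<Prod>p\<in>prime_factors n. real p powr (\<epsilon> * real (multiplicity p n)))"
      proof (rule prod.cong[OF refl])
        fix p assume "p \<in> prime_factors n"
        then have "p > 0" by (metis in_prime_factors_imp_prime prime_gt_0_nat)
        then show "(real p ^ multiplicity p n) powr \<epsilon> = real p powr (\<epsilon> * real (multiplicity p n))"
          by (simp add: powr_powr mult.commute flip: powr_realpow)
      qed
      finally show ?thesis by simp
    qed
    also have "(\<Prod>p\<in>prime_factors n. if p \<le> P then A else 1) = A ^ card {p \<in> prime_factors n. p \<le> P}"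
      by (simp add: prod.If_cases Int_def)
    also have "A ^ card {p \<in> prime_factors n. p \<le> P} \<le> A ^ (P + 1)"
    proof (rule power_increasing[OF _ A(1)])
      have "card {p \<in> prime_factors n. p \<le> P} \<le> card {..P}" by (intro card_mono) auto
      then show "card {p \<in> prime_factors n. p \<le> P} \<le> P + 1" by simp
    qed
    finally show ?thesis by (simp add: mult_right_mono)
  qed
  then show ?thesis using A(1) by (intro exI[of _ "A ^ (P + 1)"]) (auto intro: zero_less_power)
qed

lemma summable_54: "summable (\<lambda>p. K0 * real p powr (- 5 / 4))"
  using summable_real_powr_iff[of "- 5 / 4"] by (intro summable_mult) simp

section \<open>Summation over all primes and the Euler product\<close>

context arith begin

lemma abs_G_le_Gw: "vpos d \<Longrightarrow> \<bar>G d\<bar> \<le> Gw d"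
proof -
  assume "vpos d"
  then have "1 \<le> real (vprod d)" using vprod_pos[of d] by linarith
  then have "1 \<le> real (vprod d) powr (1 / 16)" by (intro ge_one_powr_ge_zero) auto
  from mult_left_mono[OF this, of "\<bar>G d\<bar>"] show ?thesis by (simp add: Gw_def)
qed

lemma Gw_summable: "Gw summable_on {d. vpos d}"
proof -
  let ?I = "\<lambda>p. infsum (\<lambda>k. Gw (ppow p k)) UNIV"
  \<comment> \<open>The finitely many bad primes enter with their full local sum, the others with
    the summable bound for the terms away from \<open>k = 0\<close>.\<close>
  define b where "b = (\<lambda>p. (if prime p \<and> w p > 0 then ?I p else 0) + K0 * real p powr (- 5 / 4))"
  have nn: "Gw d \<ge> 0" for d by (simp add: Gw_def)
  have I0: "?I p \<ge> 0" for p by (intro infsum_nonneg nn)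
  show ?thesis
  proof (rule euler_product_bound[OF multv_Gw nn Gw_local])
    show "b p \<ge> 0" for p using I0[of p] K0_pos by (simp add: b_def)
    show "summable b" unfolding b_def
    proof (rule summable_add[OF _ summable_54])
      show "summable (\<lambda>p. if prime p \<and> w p > 0 then ?I p else 0)"
        by (rule summable_finite[OF fin]) auto
    qed
    show "?I p \<le> 1 + b p" if p: "prime p" for p
    proof (cases "w p > 0")
      case True then show ?thesis using p K0_pos by (simp add: b_def)
    next
      case False
      have "Gw (ppow p 0) = 1" using multv_one[OF multv_Gw] by simp
      then show ?thesis using infsum_remove_zero(2)[OF Gw_local[OF p]] Gw_good(1)[OF p] False by (simp add: b_def)
    qed
  qed
qed

lemma G_summable: "G abs_sum_on {d. vpos d}"
  by (rule summable_on_comparison_test[OF Gw_summable]) (auto simp: abs_G_le_Gw)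

lemma G_local: "prime p \<Longrightarrow> (\<lambda>k. G (ppow p k)) abs_sum_on UNIV"
  by (rule summable_on_comparison_test[OF Gw_local]) (auto simp: abs_G_le_Gw vpos_ppow)

text \<open>Each \<open>m\<close> in \<open>bits\<close> contributes a shifted copy of the local
  series of \<open>h\<close>, and the coefficients add up to a product of four factors
  \<open>1 - 1 / p\<close>.\<close>

lemma G_local_sum:
  assumes p: "prime p" shows "infsum (\<lambda>k. G (ppow p k)) UNIV = c p"
proof -
  let ?a = "\<lambda>m :: nat^4. \<Prod>i\<in>UNIV. (- 1 / real p) ^ (m $ i)" and ?H = "infsum (\<lambda>k. h (ppow p k)) UNIV"
  have each: "((\<lambda>k. if \<forall>i. m $ i \<le> k $ i then ?a m * h (ppow p (k - m)) else 0) has_sum (?a m * ?H)) UNIV" for m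
  proof -
    have bij: "bij_betw (\<lambda>k. k + m) UNIV {k. \<forall>i. m $ i \<le> k $ i}"
      by (rule bij_betwI[where g = "\<lambda>k. k - m"]) (auto simp: vec_eq_iff)
    have "((\<lambda>k. ?a m * h (ppow p k)) has_sum (?a m * ?H)) UNIV"
      by (rule has_sum_cmult_right[OF has_sum_infsum[OF h_local(1)[OF p]]])
    then have "((\<lambda>k. ?a m * h (ppow p (k + m - m))) has_sum (?a m * ?H)) UNIV" by simp
    then have "((\<lambda>k. ?a m * h (ppow p (k - m))) has_sum (?a m * ?H)) {k. \<forall>i. m $ i \<le> k $ i}"
      using has_sum_reindex_bij_betw[OF bij, of "\<lambda>k. ?a m * h (ppow p (k - m))"] by simp
    then show ?thesis
      by (subst has_sum_cong_neutral[of "{k. \<forall>i. m $ i \<le> k $ i}" UNIV]) auto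
  qed
  have "((\<lambda>k. G (ppow p k)) has_sum (\<Sum>m\<in>bits. ?a m * ?H)) UNIV"
    unfolding G_def conv_ppow_muv[OF p] by (rule has_sum_finite_sum[OF finite_bits each])
  then have "infsum (\<lambda>k. G (ppow p k)) UNIV = (\<Sum>m\<in>bits. ?a m * ?H)" by (rule infsumI)
  also have "\<dots> = (\<Sum>m\<in>bits. ?a m) * ?H" by (rule sum_distrib_right[symmetric])
  also have "(\<Sum>m\<in>bits. ?a m) = (\<Prod>i\<in>(UNIV::4 set). \<Sum>b\<in>{0,1}. (- 1 / real p) ^ b)"
    unfolding bits_def by (rule sum_vec_prod) simp
  also have "\<dots> = (1 - 1 / real p) ^ 4" by simp
  finally show ?thesis by (simp add: c_def)
qed

text \<open>The term of \<open>G\<close> at \<open>k = 0\<close> is 1, and the remaining ones are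
  dominated by those of \<open>Gw\<close>.\<close>

lemma c_good:
  assumes p: "prime p" and w: "w p = 0" shows "\<bar>c p - 1\<bar> \<le> K0 * real p powr (- 5 / 4)"
proof -
  let ?g = "\<lambda>k. G (ppow p k)"
  have s: "?g summable_on UNIV" using G_local[OF p] by (rule abs_summable_summable)
  have "?g 0 = 1" using multv_one[OF multv_G] by simp
  then have "c p - 1 = infsum (\<lambda>k. if k = 0 then 0 else ?g k) UNIV"
    using infsum_remove_zero(2)[OF s] G_local_sum[OF p] by simp
  also have "\<bar>\<dots>\<bar> \<le> infsum (\<lambda>k. norm (if k = 0 then 0 else ?g k)) UNIV"
  proof -
    have "(\<lambda>k. norm (if k = 0 then 0 else ?g k)) summable_on UNIV"
      using infsum_remove_zero(1)[OF s] by (subst (asm) summable_on_iff_abs_summable_on_real)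
    from norm_infsum_bound[OF this] show ?thesis by simp
  qed
  also have "\<dots> \<le> infsum (\<lambda>k. if k = 0 then 0 else Gw (ppow p k)) UNIV"
  proof (rule infsum_mono)
    show "(\<lambda>k. norm (if k = 0 then 0 else ?g k)) summable_on UNIV"
      using infsum_remove_zero(1)[OF s] by (subst (asm) summable_on_iff_abs_summable_on_real)
  qed (use Gw_good(2)[OF p w] abs_G_le_Gw vpos_ppow[OF p] in auto)
  also have "\<dots> \<le> K0 * real p powr (- 5 / 4)" by (rule Gw_good(1)[OF p w])
  finally show ?thesis .
qed

lemma convergent_c: "convergent_prod (at_primes c)"
proof -
  have "summable (\<lambda>p. norm (at_primes c p - 1))"
  proof (rule summable_comparison_test_ev)
    show "summable (\<lambda>p. K0 * real p powr (- 5 / 4))" by (rule summable_54)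
    obtain N where N: "\<And>p. p \<in> {p. prime p \<and> w p > 0} \<Longrightarrow> p < N" using fin unfolding finite_nat_set_iff_bounded by blast
    show "\<forall>\<^sub>F p in sequentially. norm (norm (at_primes c p - 1)) \<le> K0 * real p powr (- 5 / 4)"
    proof (rule eventually_sequentiallyI[of N])
      fix p assume p: "N \<le> p"
      show "norm (norm (at_primes c p - 1)) \<le> K0 * real p powr (- 5 / 4)"
      proof (cases "prime p")
        case True
        then have "w p = 0" using N[of p] p by auto
        then show ?thesis using c_good True by (simp add: at_primes_def)
      next
        case False then show ?thesis using K0_pos by (simp add: at_primes_def)
      qed
    qed
  qed
  then have "abs_convergent_prod (at_primes c)" by (rule summable_imp_abs_convergent_prod)
  then show ?thesis by (rule abs_convergent_prod_imp_convergent_prod)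
qed

lemma prod_at_primes: "(\<Prod>n\<le>N. at_primes f n) = (\<Prod>p | prime p \<and> p \<le> N. f p)"
proof -
  have "(\<Prod>p | prime p \<and> p \<le> N. f p) = (\<Prod>p | prime p \<and> p \<le> N. at_primes f p)"
    by (rule prod.cong) (auto simp: at_primes_def)
  also have "\<dots> = (\<Prod>n\<le>N. at_primes f n)"
    by (rule prod.mono_neutral_left) (auto simp: at_primes_def)
  finally show ?thesis by simp
qed

text \<open>The partial product over the primes up to \<open>n\<close> is the sum of
  \<open>G\<close> over the tuples with prime factors among these, and such tuples exhaust all
  tuples.\<close>

lemma G_sum: "(G has_sum prodinf (at_primes c)) {d. vpos d}"
proof -
  let ?S = "\<lambda>n. smooth {p. prime p \<and> p \<le> n} :: (nat^4) set"
  have fin: "finite {p. prime p \<and> p \<le> n}" for n :: nat by (rule finite_subset[of _ "{..n}"]) auto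
  have "(\<lambda>n. infsum G (?S n)) \<longlonglongrightarrow> infsum G {d. vpos d}"
  proof (rule infsum_exhaust[OF G_summable])
    show "?S n \<subseteq> {d. vpos d}" for n by (auto simp: smooth_def)
    show "\<exists>N. \<forall>n\<ge>N. F \<subseteq> ?S n" if "finite F" "F \<subseteq> {d. vpos d}" for F
      using smooth_exhaust[OF that(1)] that(2) by blast
  qed
  moreover have "infsum G (?S n) = (\<Prod>k\<le>n. at_primes c k)" for n
    using euler_product_smooth[OF multv_G fin, of n] G_local G_local_sum by (simp add: prod_at_primes)
  ultimately have "(\<lambda>n. \<Prod>k\<le>n. at_primes c k) \<longlonglongrightarrow> infsum G {d. vpos d}" by simp
  then have "prodinf (at_primes c) = infsum G {d. vpos d}"
    using LIMSEQ_unique convergent_prod_LIMSEQ[OF convergent_c] by blast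
  then show ?thesis using has_sum_infsum[OF abs_summable_summable[OF G_summable]] by simp
qed

text \<open>The primes dividing \<open>n\<close> contribute at most \<open>B\<close>. All others
  together contribute an exponential that is independent of \<open>h\<close>; this gives a bound
  uniform in the lattice and the forms.\<close>

lemma prodinf_c_bound:
  assumes n: "n > 0" and w: "\<And>p. prime p \<Longrightarrow> w p = multiplicity p n"
    and K: "(\<Prod>p\<in>prime_factors n. (real (multiplicity p n) + 4) ^ 4) \<le> B"
  shows "prodinf (at_primes c) \<le> B * exp (suminf (\<lambda>p. K0 * real p powr (- 5 / 4)))"
proof (rule prodinf_le_const[OF convergent_c])
  fix N :: nat assume N: "N \<ge> Suc 0"
  then obtain M where M: "N = Suc M" by (cases N) auto
  let ?P = "{p. prime p \<and> p \<le> M}"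
  let ?u = "\<lambda>p. if p \<in> prime_factors n then (real (multiplicity p n) + 4) ^ 4 else 1"
  let ?e = "\<lambda>p. K0 * real p powr (- 5 / 4)"
  have fin: "finite ?P" by (rule finite_subset[of _ "{..M}"]) auto
  have "prod (at_primes c) {..<N} = (\<Prod>p\<in>?P. c p)" unfolding M lessThan_Suc_atMost by (rule prod_at_primes)
  also have "\<dots> \<le> (\<Prod>p\<in>?P. ?u p * exp (?e p))"
  proof (intro prod_mono conjI)
    fix p assume "p \<in> ?P"
    then have p: "prime p" by simp
    show "0 \<le> c p" using c_bounds(1)[OF p] by simp
    have e1: "1 \<le> exp (?e p)" using K0_pos by simp
    show "c p \<le> ?u p * exp (?e p)"
    proof (cases "p \<in> prime_factors n")
      case True
      have "c p \<le> (real (multiplicity p n) + 4) ^ 4" using c_bounds(2)[OF p] w[OF p] by simp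
      also have "\<dots> \<le> (real (multiplicity p n) + 4) ^ 4 * exp (?e p)" using e1 by (simp add: mult_le_cancel_left1)
      finally show ?thesis using True by simp
    next
      case False
      then have "w p = 0" using w[OF p] p by (auto simp: prime_factors_multiplicity)
      from c_good[OF p this] have "c p \<le> 1 + ?e p" by linarith
      also have "\<dots> \<le> exp (?e p)" by (rule exp_ge_add_one_self)
      finally show ?thesis using False by simp
    qed
  qed
  also have "\<dots> = (\<Prod>p\<in>?P. ?u p) * exp (\<Sum>p\<in>?P. ?e p)" using fin by (simp add: prod.distrib exp_sum)
  also have "\<dots> \<le> B * exp (suminf ?e)"
  proof (intro mult_mono)
    have "(\<Prod>p\<in>?P. ?u p) \<le> (\<Prod>p\<in>?P \<union> prime_factors n. ?u p)"
    proof (rule prod_mono2)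
      show "1 \<le> ?u b" if "b \<in> ?P \<union> prime_factors n - ?P" for b by (auto intro: one_le_power)
    qed (use fin in auto)
    also have "\<dots> = (\<Prod>p\<in>prime_factors n. ?u p)"
      by (rule prod.mono_neutral_right) (use fin in auto)
    also have "\<dots> \<le> B" using K by simp
    finally show "(\<Prod>p\<in>?P. ?u p) \<le> B" .
    then show "0 \<le> B" by (rule order_trans[rotated]) (auto intro!: prod_nonneg)
    show "exp (\<Sum>p\<in>?P. ?e p) \<le> exp (suminf ?e)"
      using sum_le_suminf[OF summable_54 fin] K0_pos by simp
  qed simp
  finally show "prod (at_primes c) {..<N} \<le> B * exp (suminf ?e)" .
qed

end

section \<open>Sums over logarithmic cells\<close>

lemma half_open_box:
  fixes a b :: "real^'n"
  assumes "\<And>i. a $ i \<le> b $ i"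
  shows "{w. \<forall>i. a $ i \<le> w $ i \<and> w $ i < b $ i} \<in> lmeasurable"
    "measure lebesgue {w. \<forall>i. a $ i \<le> w $ i \<and> w $ i < b $ i} = (\<Prod>i\<in>UNIV. b $ i - a $ i)"
proof -
  let ?Q = "{w. \<forall>i. a $ i \<le> w $ i \<and> w $ i < b $ i}"
  have Qc: "?Q \<subseteq> cbox a b" "box a b \<subseteq> ?Q"
    by (auto simp: mem_box_cart) (meson less_imp_le)+
  have "negligible (cbox a b - box a b)" by (simp add: negligible_frontier_interval)
  then have neg: "negligible (cbox a b - ?Q)" by (rule negligible_subset) (use Qc in auto)
  have Qe: "?Q = cbox a b - (cbox a b - ?Q)" using Qc by auto
  show "?Q \<in> lmeasurable"
    by (subst Qe) (intro fmeasurable.Diff lmeasurable_cbox negligible_imp_measurable[OF neg])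
  have "measure lebesgue ?Q = measure lebesgue (cbox a b)"
    by (subst Qe) (rule measure_Diff_null_set, use neg in \<open>auto simp: negligible_iff_null_sets\<close>)
  also have "\<dots> = measure lborel (cbox a b)" by (rule measure_completion) simp
  also have "\<dots> = (\<Prod>i\<in>UNIV. b $ i - a $ i)"
    using assms by (subst content_cbox_cart) (auto simp: interval_eq_empty_cart not_le not_less)
  finally show "measure lebesgue ?Q = (\<Prod>i\<in>UNIV. b $ i - a $ i)" .
qed

section \<open>Slabs around hyperplanes\<close>

definition l1norm :: "real^4 \<Rightarrow> real" where
  "l1norm a = (\<Sum>i\<in>UNIV. \<bar>a $ i\<bar>)"

text \<open>If every coordinate of \<open>w\<close> moves by at most \<open>\<delta>\<close>, then
  \<open>a \<bullet> w\<close> moves by at most \<open>\<delta> * l1norm a\<close>. The slab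
  contains all points from which the hyperplane can be reached in this way.\<close>

definition slab :: "real^4 \<Rightarrow> real \<Rightarrow> real \<Rightarrow> (real^4) set" where
  "slab a b \<delta> = {w. \<bar>a \<bullet> w - b\<bar> \<le> \<delta> * l1norm a}"

lemma inner_diff_le:
  fixes a v w :: "real^4"
  assumes "\<And>i. \<bar>v $ i - w $ i\<bar> \<le> \<delta>"
  shows "\<bar>a \<bullet> v - a \<bullet> w\<bar> \<le> \<delta> * l1norm a"
proof -
  have "\<bar>a \<bullet> v - a \<bullet> w\<bar> = \<bar>\<Sum>i\<in>UNIV. a $ i * (v $ i - w $ i)\<bar>"
    by (simp add: inner_vec_def sum_subtractf right_diff_distrib)
  also have "\<dots> \<le> (\<Sum>i\<in>UNIV. \<bar>a $ i * (v $ i - w $ i)\<bar>)" by (rule sum_abs)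
  also have "\<dots> \<le> (\<Sum>i\<in>UNIV. \<delta> * \<bar>a $ i\<bar>)"
    unfolding abs_mult by (intro sum_mono, subst mult.commute, intro mult_right_mono assms abs_ge_zero)
  finally show ?thesis by (simp add: l1norm_def sum_distrib_left)
qed

lemma closed_slab: "closed (slab a b \<delta>)"
  unfolding slab_def by (intro closed_Collect_le continuous_intros)

text \<open>The volume of the box \<open>cbox (-1) 11\<close> that receives the translates of a
  slab, doubled to allow for rounding \<open>1 / \<delta>\<close> down to an integer.\<close>

definition slabC :: real where "slabC = 2 * 12 ^ 4"

text \<open>About \<open>1 / \<delta>\<close> disjoint translates of the slab fit into a bounded box.\<close>

lemma slab_measure:
  assumes a: "a \<noteq> 0" and \<delta>: "0 < \<delta>" "\<delta> \<le> 1"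
  shows "measure lebesgue (slab a b \<delta> \<inter> cbox (-1) 2) \<le> slabC * \<delta>"
proof -
  let ?S = "slab a b \<delta> \<inter> cbox (-1) 2"
  \<comment> \<open>A coordinate of largest modulus: in its direction the slab has extent at most
    \<open>8 * \<delta>\<close>, because
    \<open>l1norm a \<le> 4 * \<bar>a $ i\<bar>\<close>.\<close>
  obtain i where i: "\<And>j. \<bar>a $ j\<bar> \<le> \<bar>a $ i\<bar>"
  proof -
    let ?R = "range (\<lambda>j. \<bar>a $ j\<bar>)"
    have "Max ?R \<in> ?R" by (intro Max_in) auto
    then obtain i where "Max ?R = \<bar>a $ i\<bar>" by blast
    then have "\<bar>a $ j\<bar> \<le> \<bar>a $ i\<bar>" for j using Max_ge[of ?R "\<bar>a $ j\<bar>"] by simp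
    then show ?thesis using that by blast
  qed
  have ai: "\<bar>a $ i\<bar> > 0"
  proof (rule ccontr)
    assume "\<not> ?thesis"
    then have "a $ j = 0" for j using i[of j] by auto
    then show False using a by (simp add: vec_eq_iff)
  qed
  have l1: "l1norm a \<le> 4 * \<bar>a $ i\<bar>"
  proof -
    have "l1norm a \<le> (\<Sum>j\<in>(UNIV::4 set). \<bar>a $ i\<bar>)" unfolding l1norm_def by (intro sum_mono i)
    then show ?thesis by simp
  qed
  define J where "J = nat \<lfloor>1 / \<delta>\<rfloor>"
  have J: "real J \<le> 1 / \<delta>" "1 / \<delta> < real J + 1" using \<delta> unfolding J_def by (simp_all add: of_nat_nat)
  have "1 / \<delta> \<ge> 1" using \<delta> by simp
  then have J1: "J \<ge> 1" unfolding J_def by (simp add: le_nat_floor)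
  \<comment> \<open>The step \<open>9 * \<delta>\<close> exceeds the extent
    \<open>8 * \<delta>\<close>, so the translates are disjoint. As there are at most
    \<open>1 / \<delta>\<close> of them, the shifts stay within 9 and the translates within
    \<open>cbox (-1) 11\<close>.\<close>
  define t where "t = (\<lambda>j::nat. (9 * \<delta> * real j) *\<^sub>R (axis i 1 :: real^4))"
  have at: "a \<bullet> t j = 9 * \<delta> * real j * a $ i" for j by (simp add: t_def inner_axis)
  have Sm: "?S \<in> lmeasurable"
    by (subst Int_commute) (intro lmeasurable_compact compact_Int_closed compact_cbox closed_slab)
  let ?T = "\<lambda>j. (+) (t j) ` ?S"
  have "real J * measure lebesgue ?S = (\<Sum>j<J. measure lebesgue (?T j))" by (simp add: measure_translation)
  also have "\<dots> = measure lebesgue (\<Union>j<J. ?T j)"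
  proof (rule measure_UNION'[symmetric])
    show "pairwise (\<lambda>j j'. disjnt (?T j) (?T j')) {..<J}"
    proof (rule pairwiseI, rule ccontr)
      fix j j' assume h: "j \<noteq> j'" "\<not> disjnt (?T j) (?T j')"
      then obtain y y' where y: "y \<in> slab a b \<delta>" "y' \<in> slab a b \<delta>" "t j + y = t j' + y'"
        by (auto simp: disjnt_def)
      then have "a \<bullet> t j + a \<bullet> y = a \<bullet> t j' + a \<bullet> y'" by (metis inner_add_right)
      then have "9 * \<delta> * (real j - real j') * a $ i = (a \<bullet> y' - b) - (a \<bullet> y - b)"
        unfolding at by (simp add: algebra_simps)
      also have "\<bar>\<dots>\<bar> \<le> \<delta> * l1norm a + \<delta> * l1norm a"
        using y(1,2) unfolding slab_def mem_Collect_eq by linarith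
      also have "\<dots> \<le> 8 * \<delta> * \<bar>a $ i\<bar>" using mult_left_mono[OF l1, of \<delta>] \<delta> by simp
      finally have "9 * \<delta> * \<bar>real j - real j'\<bar> * \<bar>a $ i\<bar> \<le> 8 * \<delta> * \<bar>a $ i\<bar>"
        using \<delta> by (simp add: abs_mult)
      then have "9 * \<bar>real j - real j'\<bar> \<le> 8" using \<delta> ai by simp
      moreover have "9 * 1 \<le> 9 * \<bar>real j - real j'\<bar>" using h(1) by (intro mult_left_mono) auto
      ultimately have "9 * 1 \<le> (8::real)" by (rule order_trans[rotated])
      then show False by simp
    qed
  qed (use Sm measurable_translation in auto)
  also have "\<dots> \<le> measure lebesgue (cbox (-1) 11 :: (real^4) set)"
  proof (rule measure_mono_fmeasurable)
    show "(\<Union>j<J. ?T j) \<subseteq> cbox (-1) 11"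
    proof clarsimp
      fix j y assume j: "j < J" and y: "y \<in> cbox (- 1) (2 :: real^4)"
      have b: "0 \<le> 9 * \<delta> * real j" "9 * \<delta> * real j \<le> 9"
      proof -
        have "real j \<le> 1 / \<delta>" using j J by linarith
        then show "9 * \<delta> * real j \<le> 9" using \<delta> by (simp add: field_simps)
      qed (use \<delta> in simp)
      show "t j + y \<in> cbox (- 1) 11"
        unfolding mem_box_cart
      proof
        fix l
        have "-1 \<le> y $ l" "y $ l \<le> 2" using y by (auto simp: mem_box_cart)
        moreover have "0 \<le> t j $ l" "t j $ l \<le> 9" using b by (auto simp: t_def axis_def)
        ultimately show "(- 1 :: real^4) $ l \<le> (t j + y) $ l \<and> (t j + y) $ l \<le> (11 :: real^4) $ l" by auto
      qed
    qed
  qed (use Sm measurable_translation in \<open>auto intro!: sets.finite_UN\<close>)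
  also have "\<dots> = measure lborel (cbox (-1) 11 :: (real^4) set)" by (rule measure_completion) simp
  also have "\<dots> = 12 ^ 4" by (subst content_cbox_cart) (auto simp: interval_eq_empty_cart not_less)
  finally have le: "real J * measure lebesgue ?S \<le> 12 ^ 4" .
  have "1 / \<delta> \<le> 2 * real J" using J J1 by linarith
  then have "1 \<le> 2 * real J * \<delta>" using \<delta> by (simp add: field_simps)
  then have "measure lebesgue ?S \<le> 2 * real J * \<delta> * measure lebesgue ?S" by (simp add: mult_le_cancel_right1)
  also have "\<dots> = 2 * \<delta> * (real J * measure lebesgue ?S)" by simp
  also have "\<dots> \<le> 2 * \<delta> * 12 ^ 4" using le \<delta> by (intro mult_left_mono) auto
  finally show ?thesis by (simp add: slabC_def)
qed

text \<open>The form of \<open>cut_out\<close> used below: the set of hyperplanes is a parameter, so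
  that its cardinality can be followed through reflections, and compactness is included.\<close>

definition cut_by :: "((real^4) \<times> real) set \<Rightarrow> (real^4) set \<Rightarrow> bool" where
  "cut_by H E \<longleftrightarrow> E \<subseteq> cbox 0 1 \<and> compact E \<and> finite H \<and> (\<forall>(a, b)\<in>H. a \<noteq> 0) \<and>
     (\<forall>v\<in>cbox 0 1. \<forall>w\<in>cbox 0 1. (\<forall>(a, b)\<in>H. sgn (a \<bullet> v - b) = sgn (a \<bullet> w - b)) \<longrightarrow> (v \<in> E \<longleftrightarrow> w \<in> E))"

text \<open>Membership changes only if the sign of some \<open>a \<bullet> v - b\<close> changes,
  and then \<open>\<bar>a \<bullet> w - b\<bar>\<close> is at most the difference of the two
  values.\<close>

lemma cut_by_near:
  assumes E: "cut_by H E" and vw: "v \<in> cbox 0 1" "w \<in> cbox 0 1" "(v \<in> E) \<noteq> (w \<in> E)"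
    and near: "\<And>i. \<bar>v $ i - w $ i\<bar> \<le> \<delta>"
  shows "\<exists>(a, b)\<in>H. w \<in> slab a b \<delta>"
proof -
  obtain a b where ab: "(a, b) \<in> H" "sgn (a \<bullet> v - b) \<noteq> sgn (a \<bullet> w - b)"
    using E vw unfolding cut_by_def by blast
  then have "\<bar>a \<bullet> w - b\<bar> \<le> \<bar>a \<bullet> v - a \<bullet> w\<bar>" by (auto simp: sgn_if split: if_splits)
  also have "\<dots> \<le> \<delta> * l1norm a" by (rule inner_diff_le[OF near])
  finally show ?thesis using ab(1) by (intro bexI[of _ "(a, b)"]) (auto simp: slab_def)
qed

lemma cut_by_slab:
  assumes a: "a \<noteq> 0"
  shows "cut_by {(a, b + \<delta> * l1norm a), (a, b - \<delta> * l1norm a)} (slab a b \<delta> \<inter> cbox 0 1)"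
proof -
  have cpt: "compact (slab a b \<delta> \<inter> cbox 0 1)"
    by (subst Int_commute) (intro compact_Int_closed compact_cbox closed_slab)
  have mem: "w \<in> slab a b \<delta> \<longleftrightarrow> sgn (a \<bullet> w - (b + \<delta> * l1norm a)) \<le> 0 \<and> sgn (a \<bullet> w - (b - \<delta> * l1norm a)) \<ge> 0" for w
    unfolding slab_def by (auto simp: abs_le_iff)
  show ?thesis unfolding cut_by_def
  proof (intro conjI ballI impI)
    fix v w :: "real^4" assume vw: "v \<in> cbox 0 1" "w \<in> cbox 0 1"
      and s: "\<forall>(a', b')\<in>{(a, b + \<delta> * l1norm a), (a, b - \<delta> * l1norm a)}. sgn (a' \<bullet> v - b') = sgn (a' \<bullet> w - b')"
    have "v \<in> slab a b \<delta> \<longleftrightarrow> w \<in> slab a b \<delta>" unfolding mem using s by simp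
    then show "v \<in> slab a b \<delta> \<inter> cbox 0 1 \<longleftrightarrow> w \<in> slab a b \<delta> \<inter> cbox 0 1" using vw by blast
  qed (use a cpt in auto)
qed

section \<open>Logarithmic coordinates and sums of reciprocals\<close>

definition phi :: "real \<Rightarrow> nat^4 \<Rightarrow> real^4" where
  "phi l d = (\<chi> i. ln (real (d $ i)) / l)"

lemma phi_nth [simp]: "phi l d $ i = ln (real (d $ i)) / l"
  by (simp add: phi_def)

definition vbox :: "nat \<Rightarrow> (nat^4) set" where
  "vbox N = {d. \<forall>i. d $ i \<in> {1..N}}"

lemma finite_vbox: "finite (vbox N)"
  unfolding vbox_def by (rule finite_vec_set) simp

lemma vbox_pos: "d \<in> vbox N \<Longrightarrow> vpos d"
  by (auto simp: vbox_def vpos_def Suc_le_eq)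

lemma phi_cube_vbox:
  assumes l: "l > 0" and d: "vpos d" "phi l d \<in> cbox 0 1"
  shows "d \<in> vbox (nat \<lfloor>exp l\<rfloor>)"
  unfolding vbox_def
proof (intro CollectI allI)
  fix i
  have "ln (real (d $ i)) / l \<le> 1" using d(2) by (auto simp: mem_box_cart)
  then have "ln (real (d $ i)) \<le> l" using l by (simp add: divide_le_eq)
  moreover have di: "real (d $ i) > 0" using d(1) by (simp add: vpos_def)
  ultimately have "real (d $ i) \<le> exp l" by (metis exp_ln exp_le_cancel_iff)
  then show "d $ i \<in> {1..nat \<lfloor>exp l\<rfloor>}" using di by (simp add: le_nat_floor)
qed

lemma finite_phi_cube:
  assumes "l > 0" "E \<subseteq> cbox 0 1" shows "finite {d. vpos d \<and> phi l d \<in> E}"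
  by (rule finite_subset[OF _ finite_vbox[of "nat \<lfloor>exp l\<rfloor>"]]) (use assms phi_cube_vbox in blast)

text \<open>The half-open box between the logarithmic coordinates of \<open>m\<close> and of
  \<open>m + 1\<close>. Its volume times \<open>l ^ 4\<close> is close to \<open>invv m\<close>, so
  that sums of reciprocals become volumes.\<close>

definition lcell :: "real \<Rightarrow> nat^4 \<Rightarrow> (real^4) set" where
  "lcell l m = {w. \<forall>i. phi l m $ i \<le> w $ i \<and> w $ i < phi l (m + 1) $ i}"

lemma lcell_measure:
  assumes l: "l > 0" and m: "vpos m"
  shows "lcell l m \<in> lmeasurable"
    "measure lebesgue (lcell l m) = (\<Prod>i\<in>UNIV. (ln (real (m $ i) + 1) - ln (real (m $ i)))) / l ^ 4"
proof -
  have le: "phi l m $ i \<le> phi l (m + 1) $ i" for i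
    using l m by (simp add: vpos_def divide_right_mono)
  show "lcell l m \<in> lmeasurable" unfolding lcell_def by (rule half_open_box(1)[OF le])
  have "measure lebesgue (lcell l m) = (\<Prod>i\<in>UNIV. phi l (m + 1) $ i - phi l m $ i)"
    unfolding lcell_def by (rule half_open_box(2)[OF le])
  also have "\<dots> = (\<Prod>i\<in>UNIV. (ln (real (m $ i) + 1) - ln (real (m $ i))) / l)"
    by (simp add: diff_divide_distrib add.commute)
  also have "\<dots> = (\<Prod>i\<in>UNIV. (ln (real (m $ i) + 1) - ln (real (m $ i)))) / l ^ 4"
    by (simp add: prod_dividef)
  finally show "measure lebesgue (lcell l m) = \<dots>" .
qed

lemma lcell_disjoint:
  assumes l: "l > 0" and m: "vpos m" "vpos m'" and w: "w \<in> lcell l m" "w \<in> lcell l m'"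
  shows "m = m'"
proof -
  have "m $ i \<le> m' $ i" if h: "vpos m" "vpos m'" "w \<in> lcell l m" "w \<in> lcell l m'" for m m' i
  proof -
    have "ln (real (m $ i)) / l < ln (real (m' $ i) + 1) / l"
      using h(3,4) unfolding lcell_def by (auto simp: add.commute dest!: spec[of _ i])
    then have "ln (real (m $ i)) < ln (real (m' $ i) + 1)" using l by (simp add: divide_less_cancel)
    then have "real (m $ i) < real (m' $ i) + 1" using h(1) by (subst (asm) ln_less_cancel_iff) (auto simp: vpos_def)
    then show ?thesis by linarith
  qed
  then show ?thesis using assms by (simp add: vec_eq_iff order.antisym)
qed

lemma lcell_cover:
  assumes l: "l > 0" and w: "w \<in> cbox 0 1"
  shows "\<exists>m\<in>vbox (nat \<lfloor>exp l\<rfloor>). w \<in> lcell l m"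
proof -
  define m :: "nat^4" where "m = (\<chi> i. nat \<lfloor>exp (l * w $ i)\<rfloor>)"
  have w01: "0 \<le> w $ i" "w $ i \<le> 1" for i using w by (auto simp: mem_box_cart)
  have e1: "exp (l * w $ i) \<ge> 1" for i using l w01[of i] by simp
  have mi: "real (m $ i) \<le> exp (l * w $ i)" "exp (l * w $ i) < real (m $ i) + 1" "m $ i \<ge> 1" for i
  proof -
    have "\<lfloor>exp (l * w $ i)\<rfloor> \<ge> 1" using e1[of i] by simp
    then have "real (m $ i) = of_int \<lfloor>exp (l * w $ i)\<rfloor>" "m $ i \<ge> 1"
      unfolding m_def vec_lambda_beta by linarith+
    then show "real (m $ i) \<le> exp (l * w $ i)" "exp (l * w $ i) < real (m $ i) + 1" "m $ i \<ge> 1" by linarith+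
  qed
  have "m $ i \<le> nat \<lfloor>exp l\<rfloor>" for i
  proof -
    have "l * w $ i \<le> l * 1" using l w01[of i] by (intro mult_left_mono) auto
    then have "exp (l * w $ i) \<le> exp l" by simp
    then show ?thesis unfolding m_def by (simp add: nat_mono floor_mono)
  qed
  then have "m \<in> vbox (nat \<lfloor>exp l\<rfloor>)" using mi(3) by (simp add: vbox_def)
  moreover have "w \<in> lcell l m"
    unfolding lcell_def
  proof (intro CollectI allI conjI)
    fix i
    have "ln (real (m $ i)) \<le> ln (exp (l * w $ i))" using mi(1,3)[of i] by (subst ln_le_cancel_iff) auto
    then show "phi l m $ i \<le> w $ i" using l by (simp add: divide_le_eq mult.commute)
    have "ln (exp (l * w $ i)) < ln (real (m $ i) + 1)" using mi(2,3)[of i] by (subst ln_less_cancel_iff) auto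
    then show "w $ i < phi l (m + 1) $ i" using l by (simp add: less_divide_eq mult.commute add.commute)
  qed
  ultimately show ?thesis by blast
qed

lemma sum_invv_vbox: "(\<Sum>m\<in>vbox N. invv m) = (\<Sum>n = 1..N. 1 / real n) ^ 4"
  unfolding invv_prod vbox_def by (subst sum_vec_prod) simp_all

text \<open>The inner sum that remains for a fixed \<open>k\<close> once
  \<open>h = conv G invv\<close> is opened at \<open>e = k * m\<close>.\<close>

definition recip :: "real \<Rightarrow> nat^4 \<Rightarrow> (real^4) set \<Rightarrow> real" where
  "recip l k E = (\<Sum>m | vpos m \<and> phi l (k * m) \<in> E. invv m)"

lemma recip_subset_vbox:
  assumes l: "l > 0" and k: "vpos k" and E: "E \<subseteq> cbox 0 1"
  shows "{m. vpos m \<and> phi l (k * m) \<in> E} \<subseteq> vbox (nat \<lfloor>exp l\<rfloor>)"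
proof
  fix m assume m: "m \<in> {m. vpos m \<and> phi l (k * m) \<in> E}"
  then have "k * m \<in> vbox (nat \<lfloor>exp l\<rfloor>)" using l k E by (intro phi_cube_vbox) auto
  then have "k $ i * m $ i \<le> nat \<lfloor>exp l\<rfloor>" for i by (simp add: vbox_def)
  moreover have "m $ i \<le> k $ i * m $ i" for i using k by (simp add: vpos_def Suc_leI)
  ultimately have "m $ i \<le> nat \<lfloor>exp l\<rfloor>" for i by (rule order_trans[rotated])
  moreover have "m $ i \<ge> 1" for i using m by (simp add: vpos_def Suc_leI)
  ultimately show "m \<in> vbox (nat \<lfloor>exp l\<rfloor>)" by (simp add: vbox_def)
qed

lemma floor_exp_bounds:
  assumes "l \<ge> 1" 
  shows "nat \<lfloor>exp l\<rfloor> \<ge> 1" "ln (real (nat \<lfloor>exp l\<rfloor>)) \<le> l" "(\<Sum>n = 1..nat \<lfloor>exp l\<rfloor>. 1 / real n) \<le> 1 + l"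
proof -
  have "exp l \<ge> 1" using assms by simp
  then show N: "nat \<lfloor>exp l\<rfloor> \<ge> 1" by (simp add: le_nat_floor)
  have "real (nat \<lfloor>exp l\<rfloor>) \<le> exp l" by (simp add: of_nat_floor)
  then have "ln (real (nat \<lfloor>exp l\<rfloor>)) \<le> ln (exp l)" using N assms by (subst ln_le_cancel_iff) auto
  then show "ln (real (nat \<lfloor>exp l\<rfloor>)) \<le> l" by simp
  then show "(\<Sum>n = 1..nat \<lfloor>exp l\<rfloor>. 1 / real n) \<le> 1 + l" using sum_inverse_le_ln[OF N] by linarith
qed

lemma recip_nonneg: "0 \<le> recip l k E"
  unfolding recip_def by (intro sum_nonneg) (simp add: invv_def)

lemma recip_trivial:
  assumes l: "l \<ge> 1" and k: "vpos k" and E: "E \<subseteq> cbox 0 1"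
  shows "recip l k E \<le> (1 + l) ^ 4"
proof -
  have "recip l k E \<le> (\<Sum>m\<in>vbox (nat \<lfloor>exp l\<rfloor>). invv m)"
    unfolding recip_def using recip_subset_vbox[OF _ k E] l
    by (intro sum_mono2 finite_vbox) (auto simp: invv_def)
  also have "\<dots> \<le> (1 + l) ^ 4"
    unfolding sum_invv_vbox using floor_exp_bounds[OF l] by (intro power_mono sum_nonneg) auto
  finally show ?thesis .
qed

text \<open>A cell volume times \<open>l ^ 4\<close> is at most \<open>invv m\<close>. So the excess
  over \<open>A\<close> is at most the excess over the whole box, where both sums are fourth powers,
  of a harmonic sum and of a logarithm. The constant is \<open>15 = 4 + 6 + 4 + 1\<close>.\<close>

lemma cell_sum_diff:
  assumes l: "l \<ge> 1" and A: "A \<subseteq> vbox (nat \<lfloor>exp l\<rfloor>)"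
  shows "\<bar>(\<Sum>m\<in>A. invv m) - l ^ 4 * measure lebesgue (\<Union>m\<in>A. lcell l m)\<bar> \<le> 15 * l ^ 3"
proof -
  let ?N = "nat \<lfloor>exp l\<rfloor>"
  let ?d = "\<lambda>m :: nat^4. \<Prod>i\<in>UNIV. (ln (real (m $ i) + 1) - ln (real (m $ i)))"
  have finA: "finite A" using A finite_vbox finite_subset by blast
  have l0: "l > 0" using l by simp
  have "measure lebesgue (\<Union>m\<in>A. lcell l m) = (\<Sum>m\<in>A. measure lebesgue (lcell l m))"
  proof (rule measure_UNION')
    show "pairwise (\<lambda>m m'. disjnt (lcell l m) (lcell l m')) A"
    proof (rule pairwiseI, rule ccontr)
      fix m m' assume h: "m \<in> A" "m' \<in> A" "m \<noteq> m'" "\<not> disjnt (lcell l m) (lcell l m')"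
      then obtain w where "w \<in> lcell l m" "w \<in> lcell l m'" by (auto simp: disjnt_def)
      then show False using lcell_disjoint[OF l0 vbox_pos vbox_pos] A h by blast
    qed
  qed (use finA A vbox_pos lcell_measure(1)[OF l0] in auto)
  also have "\<dots> = (\<Sum>m\<in>A. ?d m / l ^ 4)"
    using A vbox_pos lcell_measure(2)[OF l0] by (intro sum.cong) auto
  finally have mA: "l ^ 4 * measure lebesgue (\<Union>m\<in>A. lcell l m) = (\<Sum>m\<in>A. ?d m)"
    using l by (simp flip: sum_divide_distrib)
  have d1: "0 \<le> ln (real n + 1) - ln (real n)" "ln (real n + 1) - ln (real n) \<le> 1 / real n" if "n \<ge> 1" for n
  proof -
    show "0 \<le> ln (real n + 1) - ln (real n)" using that by simp
    have "ln (real n + 1) - ln (real n) = ln (1 + 1 / real n)"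
      using that by (subst ln_divide_pos[symmetric]) (auto simp: field_simps)
    also have "\<dots> \<le> 1 / real n" by (rule ln_add_one_self_le_self) simp
    finally show "ln (real n + 1) - ln (real n) \<le> 1 / real n" .
  qed
  have dm: "0 \<le> ?d m" "?d m \<le> invv m" if "m \<in> vbox ?N" for m
  proof -
    have m1: "m $ i \<ge> 1" for i using that by (simp add: vbox_def)
    show "0 \<le> ?d m" by (intro prod_nonneg ballI d1(1) m1)
    show "?d m \<le> invv m" unfolding invv_prod by (intro prod_mono conjI d1 m1)
  qed
  have "(\<Sum>m\<in>A. invv m) - l ^ 4 * measure lebesgue (\<Union>m\<in>A. lcell l m) = (\<Sum>m\<in>A. invv m - ?d m)"
    by (simp add: mA sum_subtractf)
  moreover have "0 \<le> (\<Sum>m\<in>A. invv m - ?d m)" using dm A by (intro sum_nonneg) auto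
  moreover have "(\<Sum>m\<in>A. invv m - ?d m) \<le> (\<Sum>m\<in>vbox ?N. invv m - ?d m)"
    using dm by (intro sum_mono2 finite_vbox A) auto
  moreover have "(\<Sum>m\<in>vbox ?N. ?d m) = ln (real ?N + 1) ^ 4"
  proof -
    have "(\<Sum>m\<in>vbox ?N. ?d m) = (\<Prod>i\<in>(UNIV::4 set). \<Sum>n\<in>{1..?N}. (ln (real n + 1) - ln (real n)))"
      unfolding vbox_def by (rule sum_vec_prod) simp
    also have "(\<Sum>n = 1..N. (ln (real n + 1) - ln (real n))) = ln (real N + 1)" for N
      by (induction N) (auto simp: add.commute)
    finally show ?thesis by simp
  qed
  moreover have "(\<Sum>n = 1..?N. 1 / real n) ^ 4 - ln (real ?N + 1) ^ 4 \<le> 15 * l ^ 3"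
  proof -
    let ?x = "ln (real ?N)"
    have "real 1 \<le> real ?N" by (rule of_nat_mono[OF floor_exp_bounds(1)[OF l]])
    then have x: "0 \<le> ?x" "?x \<le> l" using floor_exp_bounds(2)[OF l] by simp_all
    have "(\<Sum>n = 1..?N. 1 / real n) ^ 4 \<le> (1 + ?x) ^ 4"
      by (intro power_mono sum_nonneg sum_inverse_le_ln floor_exp_bounds(1)[OF l]) auto
    moreover have "?x ^ 4 \<le> ln (real ?N + 1) ^ 4" using x floor_exp_bounds(1)[OF l] by (intro power_mono) auto
    moreover have "(1 + ?x) ^ 4 - ?x ^ 4 \<le> 15 * l ^ 3"
    proof -
      have "(1 + ?x) ^ 4 - ?x ^ 4 = 4 * ?x ^ 3 + 6 * ?x ^ 2 + 4 * ?x + 1"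
        by (simp add: power4_eq_xxxx power3_eq_cube power2_eq_square algebra_simps)
      also have "\<dots> \<le> 4 * l ^ 3 + 6 * l ^ 2 + 4 * l + 1"
        using x by (intro add_mono mult_left_mono power_mono) auto
      also have "\<dots> \<le> 4 * l ^ 3 + 6 * l ^ 3 + 4 * l ^ 3 + l ^ 3"
        using l power_increasing[of 2 3 l] power_increasing[of 1 3 l] one_le_power[of l 3] by auto
      finally show ?thesis by simp
    qed
    ultimately show ?thesis by linarith
  qed
  ultimately show ?thesis by (simp add: sum_subtractf sum_invv_vbox)
qed

text \<open>The 304 covers both 15, from the comparison with cells, and
  \<open>289 = 17 * 17\<close>, from the trivial bound. The summand 4 stands for the upper faces of
  the cube, and 17 comes from \<open>ln 2 + ln x \<le> 17 * x powr (1 / 16)\<close>.\<close>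

definition KH :: "nat \<Rightarrow> real" where
  "KH n = 304 + 17 * (real n + 4) * slabC"

lemma slabC_pos: "slabC > 0"
  by (simp add: slabC_def)

lemma cube_subset: "cbox 0 1 \<subseteq> cbox (-1) (2 :: real^4)"
proof
  fix x :: "real^4" assume "x \<in> cbox 0 1"
  then have "0 \<le> x $ i" "x $ i \<le> 1" for i by (auto simp: mem_box_cart)
  then have "- 1 \<le> x $ i" "x $ i \<le> 2" for i using order_trans[of "-1" 0 "x $ i"] order_trans[of "x $ i" 1 2] by auto
  then show "x \<in> cbox (-1) 2" by (simp add: mem_box_cart)
qed

lemma slab_axis: "w \<in> slab (axis i 1) b \<delta> \<longleftrightarrow> \<bar>w $ i - b\<bar> \<le> \<delta>"
proof -
  have "l1norm (axis i 1) = (\<Sum>j\<in>UNIV. if j = i then 1 else 0)"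
    unfolding l1norm_def by (intro sum.cong) (auto simp: axis_def)
  then have "l1norm (axis i 1) = 1" by simp
  then show ?thesis by (simp add: slab_def inner_axis')
qed

text \<open>A cell has width at most \<open>ln 2 / l\<close> in each direction, and multiplication
  by \<open>k\<close> shifts the coordinate \<open>i\<close> by
  \<open>ln (k $ i) / l\<close>.\<close>

lemma phi_near_lcell:
  assumes l: "l > 0" and k: "vpos k" and m: "vpos m" and w: "w \<in> lcell l m"
  shows "\<bar>phi l (k * m) $ i - w $ i\<bar> \<le> (ln 2 + ln (real (vprod k))) / l" "0 \<le> w $ i"
proof -
  have ki: "real (k $ i) \<ge> 1" "real (m $ i) \<ge> 1" using k m by (simp_all add: vpos_def Suc_leI)
  have kv: "ln (real (k $ i)) \<le> ln (real (vprod k))"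
    using le_vprod[OF k, of i] ki by (subst ln_le_cancel_iff) auto
  have l2: "0 \<le> ln (2::real)" by simp
  have w1: "ln (real (m $ i)) / l \<le> w $ i" "w $ i \<le> ln (real (m $ i) + 1) / l"
    using w unfolding lcell_def by (auto simp: add.commute intro: less_imp_le)
  have "ln (real (m $ i) + 1) \<le> ln (2 * real (m $ i))" using ki by (subst ln_le_cancel_iff) auto
  also have "\<dots> = ln 2 + ln (real (m $ i))" using ki by (subst ln_mult) auto
  finally have w2: "w $ i \<le> (ln 2 + ln (real (m $ i))) / l"
    using w1(2) l by (meson divide_right_mono less_imp_le order_trans)
  have ph: "phi l (k * m) $ i = (ln (real (k $ i)) + ln (real (m $ i))) / l"
    using ki by (simp add: ln_mult)
  have lk: "0 \<le> ln (real (k $ i))" "0 \<le> ln (real (m $ i))" using ki by auto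
  have "phi l (k * m) $ i - w $ i \<le> ln (real (k $ i)) / l"
    using w1(1) unfolding ph add_divide_distrib by linarith
  also have "\<dots> \<le> (ln 2 + ln (real (vprod k))) / l" using kv l l2 by (intro divide_right_mono) linarith+
  finally have a: "phi l (k * m) $ i - w $ i \<le> (ln 2 + ln (real (vprod k))) / l" .
  have "w $ i - phi l (k * m) $ i \<le> (ln 2 - ln (real (k $ i))) / l"
    using w2 unfolding ph add_divide_distrib diff_divide_distrib by linarith
  also have "\<dots> \<le> (ln 2 + ln (real (vprod k))) / l" using kv lk l by (intro divide_right_mono) linarith+
  finally show "\<bar>phi l (k * m) $ i - w $ i\<bar> \<le> (ln 2 + ln (real (vprod k))) / l" using a by linarith
  show "0 \<le> w $ i" using w1(1) lk l by (meson divide_nonneg_pos order_trans)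
qed

text \<open>The cells of the \<open>m\<close> that are counted agree with \<open>E\<close> up to
  points close to a cutting hyperplane or to an upper face of the cube; the volume of the
  corresponding slabs bounds the difference in both directions.\<close>

lemma recip_asymp_small:
  assumes H: "cut_by H E" and l: "l \<ge> 1" and k: "vpos k"
    and \<delta>: "\<delta> = (ln 2 + ln (real (vprod k))) / l" "\<delta> \<le> 1"
  shows "\<bar>recip l k E - l ^ 4 * measure lebesgue E\<bar> \<le> 15 * l ^ 3 + l ^ 4 * ((real (card H) + 4) * slabC * \<delta>)"
proof -
  have l0: "l > 0" using l by simp
  have E: "E \<subseteq> cbox 0 1" "compact E" "finite H" "\<And>a b. (a, b) \<in> H \<Longrightarrow> a \<noteq> 0" using H by (auto simp: cut_by_def)
  have v1: "real (vprod k) \<ge> 1" using vprod_pos[OF k] by linarith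
  then have \<delta>0: "\<delta> > 0" using l unfolding \<delta>(1) by (intro divide_pos_pos add_pos_nonneg) auto
  define A where "A = {m. vpos m \<and> phi l (k * m) \<in> E}"
  define U where "U = (\<Union>m\<in>A. lcell l m)"
  \<comment> \<open>The upper faces are included because a cell, or the shifted point
    \<open>phi l (k * m)\<close>, may stick out of the cube there; all coordinates are
    nonnegative.\<close>
  define H' where "H' = H \<union> range (\<lambda>i. (axis i 1, 1))"
  define T where "T = (\<Union>(a, b)\<in>H'. slab a b \<delta> \<inter> cbox (-1) 2)"
  have A: "A \<subseteq> vbox (nat \<lfloor>exp l\<rfloor>)" unfolding A_def by (rule recip_subset_vbox[OF l0 k E(1)])
  have finA: "finite A" using A finite_vbox finite_subset by blast
  have Um: "U \<in> lmeasurable" unfolding U_def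
    using finA lcell_measure(1)[OF l0] by (intro fmeasurable.finite_UN) (auto simp: A_def)
  have Em: "E \<in> lmeasurable" by (rule lmeasurable_compact[OF E(2)])
  have finH': "finite H'" using E(3) by (simp add: H'_def)
  have Sm: "slab a b \<delta> \<inter> cbox (-1) 2 \<in> lmeasurable" for a b
    by (subst Int_commute) (intro lmeasurable_compact compact_Int_closed compact_cbox closed_slab)
  have Tm: "T \<in> lmeasurable" unfolding T_def using finH' Sm by (intro fmeasurable.finite_UN) auto
  have inT: "w \<in> T" if "(a, b) \<in> H'" "w \<in> slab a b \<delta>" "w \<in> cbox (-1) 2" for a b w
    using that unfolding T_def by blast
  have axT: "w \<in> T" if "\<bar>w $ i - 1\<bar> \<le> \<delta>" "w \<in> cbox (-1) 2" for w i
    by (rule inT[of "axis i 1" 1]) (use that in \<open>auto simp: H'_def slab_axis\<close>)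
  have nearT: "w \<in> T" if vw: "v \<in> cbox 0 1" "w \<in> cbox 0 1" "(v \<in> E) \<noteq> (w \<in> E)" "\<And>i. \<bar>v $ i - w $ i\<bar> \<le> \<delta>" for v w
  proof -
    obtain a b where "(a, b) \<in> H" "w \<in> slab a b \<delta>" using cut_by_near[OF H vw] by blast
    moreover have "w \<in> cbox (-1) 2" using vw(2) cube_subset by blast
    ultimately show ?thesis using inT by (auto simp: H'_def)
  qed
  have near: "\<bar>phi l (k * m) $ i - w $ i\<bar> \<le> \<delta>" "0 \<le> w $ i" if "vpos m" "w \<in> lcell l m" for m w i
    using phi_near_lcell[OF l0 k that] unfolding \<delta>(1) by auto
  have "U \<subseteq> E \<union> T"
  proof
    fix w assume "w \<in> U"
    then obtain m where m: "vpos m" "phi l (k * m) \<in> E" "w \<in> lcell l m" by (auto simp: U_def A_def)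
    have pc: "phi l (k * m) \<in> cbox 0 1" using m(2) E(1) by blast
    have le: "phi l (k * m) $ i \<le> 1" for i using pc by (simp add: mem_box_cart del: phi_nth)
    show "w \<in> E \<union> T"
    proof (cases "w \<in> cbox 0 1")
      case True
      then show ?thesis using nearT[OF pc True] near(1)[OF m(1,3)] m(2) by blast
    next
      case False
      then obtain i where i: "w $ i > 1" using near(2)[OF m(1,3)] by (auto simp: mem_box_cart not_le)
      have "w $ j \<le> 2" for j using near(1)[OF m(1,3), of j] le[of j] \<delta>(2) by linarith
      then have "w \<in> cbox (-1) 2" using near(2)[OF m(1,3)] by (auto simp: mem_box_cart intro: order_trans[of _ 0])
      moreover have "\<bar>w $ i - 1\<bar> \<le> \<delta>" using near(1)[OF m(1,3), of i] le[of i] i by linarith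
      ultimately show ?thesis using axT by blast
    qed
  qed
  then have 1: "measure lebesgue U \<le> measure lebesgue E + measure lebesgue T"
    using measure_mono_fmeasurable[of U "E \<union> T" lebesgue] measure_Un_le[of E lebesgue T] Um Em Tm
    by (meson fmeasurable.Un fmeasurableD order_trans)
  have "E \<subseteq> U \<union> T"
  proof
    fix w assume w: "w \<in> E"
    then have wc: "w \<in> cbox 0 1" using E(1) by blast
    then obtain m where m: "m \<in> vbox (nat \<lfloor>exp l\<rfloor>)" "w \<in> lcell l m" using lcell_cover[OF l0] by blast
    have mp: "vpos m" using vbox_pos[OF m(1)] .
    show "w \<in> U \<union> T"
    proof (cases "phi l (k * m) \<in> E")
      case True then show ?thesis using m mp by (auto simp: U_def A_def)
    next
      case False
      show ?thesis
      proof (cases "phi l (k * m) \<in> cbox 0 1")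
        case True
        then show ?thesis using nearT[OF True wc] near(1)[OF mp m(2)] False w by blast
      next
        case nc: False
        have "real (k $ i) * real (m $ i) \<ge> 1" for i
        proof -
          have "1 * 1 \<le> real (k $ i) * real (m $ i)" using k mp by (intro mult_mono) (auto simp: vpos_def Suc_leI)
          then show ?thesis by simp
        qed
        then have "phi l (k * m) $ i \<ge> 0" for i using l by simp
        then obtain i where i: "phi l (k * m) $ i > 1" using nc by (auto simp: mem_box_cart not_le simp del: phi_nth)
        have w1: "0 \<le> w $ j" "w $ j \<le> 1" for j using wc by (auto simp: mem_box_cart)
        have "\<bar>w $ i - 1\<bar> \<le> \<delta>" using near(1)[OF mp m(2), of i] i w1(2)[of i] by linarith
        moreover have "w \<in> cbox (-1) 2" using wc cube_subset by blast
        ultimately show ?thesis using axT by blast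
      qed
    qed
  qed
  then have 2: "measure lebesgue E \<le> measure lebesgue U + measure lebesgue T"
    using measure_mono_fmeasurable[of E "U \<union> T" lebesgue] measure_Un_le[of U lebesgue T] Um Em Tm
    by (meson fmeasurable.Un fmeasurableD order_trans)
  have T: "measure lebesgue T \<le> (real (card H) + 4) * slabC * \<delta>"
  proof -
    have "measure lebesgue T \<le> (\<Sum>x\<in>H'. measure lebesgue (case x of (a, b) \<Rightarrow> slab a b \<delta> \<inter> cbox (-1) 2))"
      unfolding T_def using finH' Sm by (intro measure_UNION_le) auto
    also have "\<dots> \<le> (\<Sum>x\<in>H'. slabC * \<delta>)"
    proof (rule sum_mono, clarify)
      fix a b assume "(a, b) \<in> H'"
      then have "a \<noteq> 0" using E(4) by (auto simp: H'_def axis_eq_0_iff)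
      then show "measure lebesgue (slab a b \<delta> \<inter> cbox (-1) 2) \<le> slabC * \<delta>" by (rule slab_measure[OF _ \<delta>0 \<delta>(2)])
    qed
    also have "\<dots> = real (card H') * (slabC * \<delta>)" by simp
    also have "\<dots> \<le> (real (card H) + 4) * (slabC * \<delta>)"
    proof (rule mult_right_mono)
      have "card (range (\<lambda>i::4. (axis i 1 :: real^4, 1::real))) \<le> card (UNIV :: 4 set)" by (rule card_image_le) simp
      then have "card H' \<le> card H + 4" unfolding H'_def using card_Un_le[of H "range (\<lambda>i::4. (axis i 1 :: real^4, 1::real))"] by simp
      then show "real (card H') \<le> real (card H) + 4" by linarith
      show "0 \<le> slabC * \<delta>" using \<delta>0 slabC_pos by simp
    qed
    finally show ?thesis by simp
  qed
  have "\<bar>measure lebesgue U - measure lebesgue E\<bar> \<le> (real (card H) + 4) * slabC * \<delta>" using 1 2 T by linarith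
  then have "l ^ 4 * \<bar>measure lebesgue U - measure lebesgue E\<bar> \<le> l ^ 4 * ((real (card H) + 4) * slabC * \<delta>)"
    using l by (intro mult_left_mono) auto
  moreover have "l ^ 4 * \<bar>measure lebesgue U - measure lebesgue E\<bar> = \<bar>l ^ 4 * measure lebesgue U - l ^ 4 * measure lebesgue E\<bar>"
    using l by (simp add: abs_mult flip: right_diff_distrib)
  moreover have "\<bar>recip l k E - l ^ 4 * measure lebesgue U\<bar> \<le> 15 * l ^ 3"
    using cell_sum_diff[OF l A] unfolding recip_def A_def U_def .
  ultimately show ?thesis by linarith
qed

lemma ln_le_powr16: "(x::real) \<ge> 1 \<Longrightarrow> ln x \<le> 16 * x powr (1 / 16)"
proof -
  assume x: "x \<ge> 1"
  have "ln (x powr (1 / 16)) \<le> x powr (1 / 16)" using ln_le_minus_one[of "x powr (1/16)"] x by simp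
  then show ?thesis using x by (simp add: ln_powr)
qed

lemma cut_by_measure_le: "cut_by H E \<Longrightarrow> measure lebesgue E \<le> 1"
proof -
  assume H: "cut_by H E"
  then have "measure lebesgue E \<le> measure lebesgue (cbox 0 1 :: (real^4) set)"
    by (intro measure_mono_fmeasurable) (auto simp: cut_by_def intro: fmeasurableD lmeasurable_compact)
  also have "\<dots> = measure lborel (cbox 0 1 :: (real^4) set)" by (rule measure_completion) simp
  also have "\<dots> = 1" by (subst content_cbox_cart) (auto simp: interval_eq_empty_cart not_less)
  finally show ?thesis .
qed

text \<open>For \<open>\<delta> > 1\<close> the tuple \<open>k\<close> is so large that
  \<open>l\<close> itself is at most 17 times \<open>vprod k powr (1 / 16)\<close>, and the trivial
  bound of order \<open>l ^ 4\<close> already has the required size.\<close>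

lemma recip_asymp:
  assumes H: "cut_by H E" and l: "l \<ge> 1" and k: "vpos k"
  shows "\<bar>recip l k E - l ^ 4 * measure lebesgue E\<bar> \<le> KH (card H) * l ^ 3 * real (vprod k) powr (1 / 16)"
proof -
  define \<delta> where "\<delta> = (ln 2 + ln (real (vprod k))) / l"
  let ?P = "real (vprod k) powr (1 / 16)"
  have v1: "real (vprod k) \<ge> 1" using vprod_pos[OF k] by linarith
  have P1: "?P \<ge> 1" using v1 by (intro ge_one_powr_ge_zero) auto
  have "ln (2::real) \<le> 1" using ln_le_minus_one[of "2::real"] by simp
  then have num: "ln 2 + ln (real (vprod k)) \<le> 17 * ?P" using ln_le_powr16[OF v1] P1 by linarith
  have l3: "l ^ 3 \<ge> 0" using l by simp
  have l4: "l ^ 4 = l ^ 3 * l" by (simp add: power4_eq_xxxx power3_eq_cube)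
  show ?thesis
  proof (cases "\<delta> \<le> 1")
    case True
    have "\<bar>recip l k E - l ^ 4 * measure lebesgue E\<bar> \<le> 15 * l ^ 3 + l ^ 4 * ((real (card H) + 4) * slabC * \<delta>)"
      by (rule recip_asymp_small[OF H l k \<delta>_def True])
    also have "l ^ 4 * ((real (card H) + 4) * slabC * \<delta>) = l ^ 3 * ((real (card H) + 4) * slabC) * (ln 2 + ln (real (vprod k)))"
      using l unfolding l4 \<delta>_def by simp
    also have "\<dots> \<le> l ^ 3 * ((real (card H) + 4) * slabC) * (17 * ?P)"
      using slabC_pos l3 by (intro mult_left_mono num) auto
    also have "15 * l ^ 3 \<le> 304 * l ^ 3 * ?P"
    proof -
      have "15 * l ^ 3 * 1 \<le> 304 * l ^ 3 * ?P" using l3 P1 by (intro mult_mono) auto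
      then show ?thesis by simp
    qed
    finally show ?thesis by (simp add: KH_def algebra_simps)
  next
    case False
    then have "l \<le> ln 2 + ln (real (vprod k))" using l by (simp add: \<delta>_def field_simps)
    then have lP: "l \<le> 17 * ?P" using num by linarith
    have "E \<subseteq> cbox 0 1" using H by (simp add: cut_by_def)
    then have "recip l k E \<le> (1 + l) ^ 4" by (rule recip_trivial[OF l k])
    also have "\<dots> \<le> (2 * l) ^ 4" using l by (intro power_mono) auto
    finally have "recip l k E \<le> 16 * l ^ 4" by (simp add: power_mult_distrib)
    moreover have "l ^ 4 * measure lebesgue E \<le> l ^ 4 * 1"
      using cut_by_measure_le[OF H] l by (intro mult_left_mono) auto
    moreover have "0 \<le> l ^ 4 * measure lebesgue E" using l by simp
    ultimately have "\<bar>recip l k E - l ^ 4 * measure lebesgue E\<bar> \<le> 17 * l ^ 4" using recip_nonneg[of l k E] by linarith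
    also have "\<dots> \<le> 17 * (l ^ 3 * (17 * ?P))" unfolding l4 using l3 lP by (intro mult_left_mono) auto
    also have "\<dots> \<le> 304 * (l ^ 3 * ?P)" using l3 by (simp add: mult_right_mono)
    also have "\<dots> \<le> KH (card H) * (l ^ 3 * ?P)"
      using slabC_pos l3 by (intro mult_right_mono) (auto simp: KH_def)
    finally show ?thesis by simp
  qed
qed

section \<open>Sums of the multiplicative function over cut-out sets\<close>

context arith begin

definition euler_const :: real where "euler_const = prodinf (at_primes c)"

definition KG :: real where "KG = infsum Gw {d. vpos d}"

lemma KG_nonneg: "KG \<ge> 0"
  unfolding KG_def by (intro infsum_nonneg) (simp add: Gw_def)

lemma abs_euler_const_le: "\<bar>euler_const\<bar> \<le> KG"
proof -
  have "euler_const = infsum G {d. vpos d}" using infsumI[OF G_sum] by (simp add: euler_const_def)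
  also have "\<bar>\<dots>\<bar> \<le> infsum (\<lambda>d. norm (G d)) {d. vpos d}" using norm_infsum_bound[OF G_summable] by simp
  also have "\<dots> \<le> KG" unfolding KG_def
    by (rule infsum_mono[OF G_summable Gw_summable]) (simp add: abs_G_le_Gw)
  finally show ?thesis .
qed

text \<open>The convolution \<open>h = conv G invv\<close> is inserted and the terms are collected
  by the factor \<open>k\<close> of \<open>e = k * m\<close>. A \<open>k\<close> outside the box has
  an empty inner sum, so the series has finitely many nonzero terms.\<close>

lemma h_sum_eq:
  assumes l: "l > 0" and E: "E \<subseteq> cbox 0 1"
  shows "((\<lambda>k. G k * recip l k E) has_sum (\<Sum>e | vpos e \<and> phi l e \<in> E. h e)) {k. vpos k}"
proof (rule has_sum_finite_neutralI)
  let ?N = "nat \<lfloor>exp l\<rfloor>"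
  show "finite (vbox ?N)" by (rule finite_vbox)
  show "vbox ?N \<subseteq> {k. vpos k}" using vbox_pos by blast
  let ?M = "\<lambda>k. {m. vpos m \<and> phi l (k * m) \<in> E}"
  show "G k * recip l k E = 0" if k: "k \<in> {k. vpos k} - vbox ?N" for k
  proof -
    have "?M k = {}"
    proof (rule ccontr)
      assume "?M k \<noteq> {}"
      then obtain m where m: "vpos m" "phi l (k * m) \<in> E" by auto
      then have "k * m \<in> vbox ?N" using l k E by (intro phi_cube_vbox) auto
      then have "k $ i * m $ i \<le> ?N" for i by (simp add: vbox_def)
      moreover have "k $ i \<le> k $ i * m $ i" for i using m(1) by (simp add: vpos_def Suc_leI)
      ultimately have "k $ i \<le> ?N" for i by (rule order_trans[rotated])
      moreover have "k $ i \<ge> 1" for i using k by (simp add: vpos_def Suc_leI)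
      ultimately show False using k by (simp add: vbox_def)
    qed
    then have "recip l k E = 0" unfolding recip_def by (simp only: sum.empty)
    then show ?thesis by simp
  qed
  have finM: "finite (?M k)" if "k \<in> vbox ?N" for k
    by (rule finite_subset[OF recip_subset_vbox[OF l vbox_pos[OF that] E] finite_vbox])
  have finE: "finite {e. vpos e \<and> phi l e \<in> E}" by (rule finite_phi_cube[OF l E])
  have "(\<Sum>e | vpos e \<and> phi l e \<in> E. h e) = (\<Sum>e | vpos e \<and> phi l e \<in> E. \<Sum>k\<in>vdivs e. G k * invv (vquo e k))"
    by (intro sum.cong refl) (simp add: h_eq_conv[symmetric] conv_def)
  also have "\<dots> = (\<Sum>(e,k)\<in>(SIGMA e:{e. vpos e \<and> phi l e \<in> E}. vdivs e). G k * invv (vquo e k))"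
    using finE finite_vdivs by (subst sum.Sigma) auto
  also have "\<dots> = (\<Sum>(k,m)\<in>(SIGMA k:vbox ?N. ?M k). G k * invv m)"
  proof (rule sum.reindex_bij_witness[of _ "\<lambda>(k,m). (k * m, k)" "\<lambda>(e,k). (k, vquo e k)"], goal_cases)
    case (1 a)
    then show ?case using vquo_mult by (auto simp: case_prod_beta)
  next
    case (2 a)
    then obtain e k where a: "a = (e, k)" and e: "vpos e" "phi l e \<in> E" and k: "k \<in> vdivs e" by auto
    have ev: "e \<in> vbox ?N" using l e E by (intro phi_cube_vbox) auto
    have kp: "vpos k" by (rule vdivs_pos[OF e(1) k])
    have "k $ i \<le> ?N" for i
    proof -
      have "k $ i \<le> e $ i" using k e(1) by (auto simp: vdivs_def vpos_def intro: dvd_imp_le)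
      also have "\<dots> \<le> ?N" using ev by (simp add: vbox_def)
      finally show ?thesis .
    qed
    then have "k \<in> vbox ?N" using kp by (simp add: vbox_def vpos_def Suc_leI)
    then show ?case using a e k vquo_pos[OF e(1) k] vquo_mult[OF k] by simp
  next
    case (3 a)
    then obtain k m where a: "a = (k, m)" and k: "k \<in> vbox ?N" and m: "m \<in> ?M k" by auto
    have "vpos k" by (rule vbox_pos[OF k])
    then show ?case by (simp add: a vec_eq_iff vpos_def)
  next
    case (4 a)
    then obtain k m where a: "a = (k, m)" and k: "k \<in> vbox ?N" and m: "m \<in> ?M k" by auto
    then show ?case using vbox_pos[OF k] by (simp add: vdivs_def)
  next
    case (5 a)
    then show ?case by auto
  qed
  also have "\<dots> = (\<Sum>k\<in>vbox ?N. G k * recip l k E)"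
    using finM by (subst sum.Sigma[symmetric]) (auto simp: finite_vbox recip_def sum_distrib_left)
  finally show "(\<Sum>e | vpos e \<and> phi l e \<in> E. h e) = (\<Sum>k\<in>vbox ?N. G k * recip l k E)" .
qed

text \<open>The asymptotics of \<open>recip\<close> at \<open>k\<close> have an error proportional
  to \<open>vprod k powr (1 / 16)\<close>; times \<open>\<bar>G k\<bar>\<close> this is
  \<open>Gw k\<close>, which is summable.\<close>

lemma h_sum_asymp:
  assumes H: "cut_by H E" and l: "l \<ge> 1"
  shows "\<bar>(\<Sum>e | vpos e \<and> phi l e \<in> E. h e) - euler_const * l ^ 4 * measure lebesgue E\<bar> \<le> KG * KH (card H) * l ^ 3"
proof -
  let ?S = "\<Sum>e | vpos e \<and> phi l e \<in> E. h e"
  have E: "E \<subseteq> cbox 0 1" using H by (simp add: cut_by_def)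
  have l0: "l > 0" using l by simp
  let ?f = "\<lambda>k. G k * recip l k E + G k * (- (l ^ 4 * measure lebesgue E))"
  have 1: "(?f has_sum (?S + euler_const * (- (l ^ 4 * measure lebesgue E)))) {k. vpos k}"
    using G_sum unfolding euler_const_def[symmetric] by (intro has_sum_add h_sum_eq[OF l0 E] has_sum_cmult_left)
  have le: "norm (?f k) \<le> KH (card H) * l ^ 3 * Gw k" if k: "k \<in> {k. vpos k}" for k
  proof -
    have "norm (?f k) = \<bar>G k\<bar> * \<bar>recip l k E - l ^ 4 * measure lebesgue E\<bar>"
      by (simp add: abs_mult[symmetric] algebra_simps)
    also have "\<dots> \<le> \<bar>G k\<bar> * (KH (card H) * l ^ 3 * real (vprod k) powr (1 / 16))"
      using k by (intro mult_left_mono recip_asymp[OF H l]) auto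
    finally show ?thesis by (simp add: Gw_def algebra_simps)
  qed
  have s: "(\<lambda>k. KH (card H) * l ^ 3 * Gw k) summable_on {k. vpos k}"
    by (intro summable_on_cmult_right Gw_summable)
  have fs: "(\<lambda>k. norm (?f k)) summable_on {k. vpos k}"
    by (rule summable_on_comparison_test[OF s le]) auto
  have "\<bar>infsum ?f {k. vpos k}\<bar> \<le> infsum (\<lambda>k. norm (?f k)) {k. vpos k}"
    using norm_infsum_bound[OF fs] by simp
  also have "\<dots> \<le> infsum (\<lambda>k. KH (card H) * l ^ 3 * Gw k) {k. vpos k}"
    by (rule infsum_mono[OF fs s le])
  also have "\<dots> = KH (card H) * l ^ 3 * KG" unfolding KG_def by (rule infsum_cmult_right')
  finally show ?thesis using infsumI[OF 1] by (simp add: algebra_simps)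
qed

text \<open>A slab is cut by two hyperplanes and has volume at most \<open>slabC * \<delta>\<close>.
  All contributions near a hyperplane are bounded in this way.\<close>

lemma h_sum_slab:
  assumes a: "a \<noteq> 0" and l: "l \<ge> 1" and \<delta>: "0 < \<delta>" "\<delta> \<le> 1"
  shows "(\<Sum>e | vpos e \<and> phi l e \<in> slab a b \<delta> \<inter> cbox 0 1. h e) \<le> KG * (KH 2 * l ^ 3 + slabC * \<delta> * l ^ 4)"
proof -
  let ?E = "slab a b \<delta> \<inter> cbox 0 1" and ?H = "{(a, b + \<delta> * l1norm a), (a, b - \<delta> * l1norm a)}"
  have H: "cut_by ?H ?E" by (rule cut_by_slab[OF a])
  have "card ?H \<le> 2" by (simp add: card_insert_if)
  then have KH: "KH (card ?H) \<le> KH 2" using slabC_pos by (simp add: KH_def)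
  have "measure lebesgue ?E \<le> measure lebesgue (slab a b \<delta> \<inter> cbox (-1) 2)"
  proof (rule measure_mono_fmeasurable)
    show "?E \<subseteq> slab a b \<delta> \<inter> cbox (-1) 2"
      using cube_subset by blast
    show "?E \<in> sets lebesgue" using H by (auto simp: cut_by_def intro: fmeasurableD lmeasurable_compact)
    show "slab a b \<delta> \<inter> cbox (-1) 2 \<in> lmeasurable"
      by (subst Int_commute) (intro lmeasurable_compact compact_Int_closed compact_cbox closed_slab)
  qed
  also have "\<dots> \<le> slabC * \<delta>" by (rule slab_measure[OF a \<delta>])
  finally have m: "measure lebesgue ?E \<le> slabC * \<delta>" .
  have "(\<Sum>e | vpos e \<and> phi l e \<in> ?E. h e) \<le> euler_const * l ^ 4 * measure lebesgue ?E + KG * KH (card ?H) * l ^ 3"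
    using h_sum_asymp[OF H l] by linarith
  also have "euler_const * l ^ 4 * measure lebesgue ?E \<le> KG * l ^ 4 * (slabC * \<delta>)"
    using abs_euler_const_le m l KG_nonneg by (intro mult_mono) auto
  also have "KG * KH (card ?H) * l ^ 3 \<le> KG * KH 2 * l ^ 3"
    using KH KG_nonneg l by (intro mult_right_mono mult_left_mono) auto
  finally show ?thesis by (simp add: algebra_simps)
qed

end

section \<open>Lattice points in plane regions\<close>

lemma set_length_cover:
  assumes "set_length A \<le> ennreal l" "l \<ge> 0" "\<delta> > 0" "e > 0"
  obtains U :: "nat \<Rightarrow> (real^2) set" where "A \<subseteq> (\<Union>n. U n)" "\<And>n. bounded (U n)" "\<And>n. diameter (U n) \<le> \<delta>"
    "(\<Sum>n. ennreal (diameter (U n))) < ennreal (l + e)"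
proof -
  let ?S = "{U. A \<subseteq> (\<Union>n::nat. U n) \<and> (\<forall>n. bounded (U n) \<and> diameter (U n) \<le> \<delta>)}"
  have "(INF U\<in>?S. (\<Sum>n. ennreal (diameter (U n)))) \<le> set_length A"
    unfolding set_length_def using assms(3) by (intro SUP_upper2[of \<delta>]) auto
  also have "\<dots> < ennreal (l + e)"
    using assms by (intro le_less_trans[OF assms(1)]) (simp add: ennreal_less_iff)
  finally obtain U where "U \<in> ?S" "(\<Sum>n. ennreal (diameter (U n))) < ennreal (l + e)"
    unfolding INF_less_iff by blast
  then show ?thesis using that[of U] by blast
qed

text \<open>The distance from a point of a connected set maps the part of the set near that point onto an
  interval, and it does not increase diameters.\<close>

lemma connected_near_point_cover:
  fixes K :: "(real^2) set"
  assumes K: "connected K" and x: "x \<in> K" and y: "y \<in> K" "dist x y \<ge> t" and t: "t \<ge> 0"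
    and cov: "K \<subseteq> (\<Union>n::nat. U n)" and bd: "\<And>n. bounded (U n)"
    and I: "\<And>n z. z \<in> U n \<Longrightarrow> z \<in> K \<Longrightarrow> dist x z \<le> t \<Longrightarrow> n \<in> I"
  shows "ennreal t \<le> (\<Sum>n. if n \<in> I then ennreal (diameter (U n)) else 0)"
proof -
  define a where "a = (\<lambda>n. Inf (dist x ` U n))"
  \<comment> \<open>The distances from \<open>x\<close> to points of \<open>U n\<close> lie in an
    interval of length \<open>diameter (U n)\<close> that starts at their infimum
    \<open>a n\<close>.\<close>
  define J where "J = (\<lambda>n. if n \<in> I then {a n .. a n + diameter (U n)} else {})"
  have "{0..t} \<subseteq> (\<Union>n. J n)"
  proof
    fix r assume r: "r \<in> {0..t}"
    have "connected (dist x ` K)" by (intro connected_continuous_image continuous_intros K)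
    moreover have "0 \<in> dist x ` K" using x by (force simp: image_iff)
    moreover have "dist x y \<in> dist x ` K" using y by auto
    ultimately have "{0..dist x y} \<subseteq> dist x ` K" by (rule connected_contains_Icc)
    then obtain z where z: "z \<in> K" "dist x z = r" using r y by fastforce
    obtain n where n: "z \<in> U n" using cov z by auto
    have nI: "n \<in> I" using I[OF n z(1)] z r by auto
    have bb: "bdd_below (dist x ` U n)" by (rule bdd_belowI[of _ 0]) auto
    have "a n \<le> r" unfolding a_def using n z bb by (auto intro!: cInf_lower)
    moreover have "r - diameter (U n) \<le> a n"
      unfolding a_def
    proof (rule cInf_greatest)
      show "dist x ` U n \<noteq> {}" using n by auto
      fix w assume "w \<in> dist x ` U n"
      then obtain v where v: "v \<in> U n" "w = dist x v" by auto
      have "dist v z \<le> diameter (U n)" by (rule diameter_bounded_bound[OF bd v(1) n])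
      then show "r - diameter (U n) \<le> w" using z v dist_triangle[of x z v] by simp
    qed
    ultimately show "r \<in> (\<Union>n. J n)" using nI by (auto simp: J_def intro!: exI[of _ n])
  qed
  then have "emeasure lborel {0..t} \<le> emeasure lborel (\<Union>n. J n)"
    by (intro emeasure_mono) (auto simp: J_def)
  also have "\<dots> \<le> (\<Sum>n. emeasure lborel (J n))"
    by (intro emeasure_subadditive_countably) (auto simp: J_def)
  also have "\<dots> = (\<Sum>n. if n \<in> I then ennreal (diameter (U n)) else 0)"
    by (intro suminf_cong) (auto simp: J_def diameter_ge_0[OF bd])
  finally show ?thesis using t by simp
qed

definition separated :: "real \<Rightarrow> 'a::metric_space set \<Rightarrow> bool" where
  "separated s P \<longleftrightarrow> finite P \<and> (\<forall>x\<in>P. \<forall>y\<in>P. x \<noteq> y \<longrightarrow> dist x y \<ge> s)"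

text \<open>A covering set of diameter at most \<open>s / 4\<close> that comes within
  \<open>s / 4\<close> of two points of \<open>P\<close> would put these at distance at most
  \<open>3 * s / 4\<close>. So different points use disjoint families of covering sets, each of
  total diameter at least \<open>s / 4\<close>. The summand 1 covers sets with fewer than two
  points.\<close>

lemma separated_card_bound:
  fixes K :: "(real^2) set"
  assumes K: "connected K" "K \<subseteq> A" and len: "set_length A \<le> ennreal l" "l \<ge> 0" and s: "s > 0"
    and P: "separated s P" "P \<subseteq> K"
  shows "real (card P) \<le> 1 + 4 * l / s"
proof (cases "card P \<ge> 2")
  case False
  then have "real (card P) \<le> 1" by simp
  moreover have "0 \<le> 4 * l / s" using len s by simp
  ultimately show ?thesis by linarith
next
  case True
  have fin: "finite P" using P by (simp add: separated_def)
  have "real (card P) * (s / 4) \<le> l + e" if e: "e > 0" for e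
  proof -
    obtain U where U: "A \<subseteq> (\<Union>n. U n)" "\<And>n. bounded (U n)" "\<And>n. diameter (U n) \<le> s / 4"
      "(\<Sum>n. ennreal (diameter (U n))) < ennreal (l + e)"
      using set_length_cover[OF len, of "s/4" e] s e by auto
    define I where "I = (\<lambda>x. {n. \<exists>z\<in>U n. dist x z \<le> s / 4})"
    have disj: "x = y" if h: "x \<in> P" "y \<in> P" "n \<in> I x" "n \<in> I y" for x y n
    proof (rule ccontr)
      assume "x \<noteq> y"
      then have d: "dist x y \<ge> s" using P that by (auto simp: separated_def)
      obtain z w where zw: "z \<in> U n" "dist x z \<le> s / 4" "w \<in> U n" "dist y w \<le> s / 4"
        using h unfolding I_def by blast
      have "dist z w \<le> s / 4" using diameter_bounded_bound[OF U(2) zw(1,3)] U(3)[of n] by linarith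
      then have "dist x y \<le> s / 4 + s / 4 + s / 4"
        using zw dist_triangle[of x y z] dist_triangle[of z y w] by (simp add: dist_commute)
      then show False using d s by linarith
    qed
    have each: "ennreal (s / 4) \<le> (\<Sum>n. if n \<in> I x then ennreal (diameter (U n)) else 0)" if x: "x \<in> P" for x
    proof -
      obtain y where y: "y \<in> P" "y \<noteq> x"
      proof (rule ccontr)
        assume "\<not> thesis"
        then have "P \<subseteq> {x}" using that by blast
        then have "card P \<le> 1" using card_mono[of "{x}" P] by simp
        then show False using True by simp
      qed
      have "dist x y \<ge> s" using P x y by (auto simp: separated_def)
      then show ?thesis
        using x y P K U s by (intro connected_near_point_cover[OF K(1), of x y]) (auto simp: I_def)
    qed
    have "ennreal (real (card P) * (s / 4)) = (\<Sum>x\<in>P. ennreal (s / 4))"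
      using s by (simp add: ennreal_of_nat_eq_real_of_nat flip: ennreal_mult)
    also have "\<dots> \<le> (\<Sum>x\<in>P. \<Sum>n. if n \<in> I x then ennreal (diameter (U n)) else 0)"
      by (intro sum_mono each)
    also have "\<dots> = (\<Sum>n. \<Sum>x\<in>P. if n \<in> I x then ennreal (diameter (U n)) else 0)"
      by (rule suminf_sum[symmetric]) auto
    also have "\<dots> \<le> (\<Sum>n. ennreal (diameter (U n)))"
    proof (intro suminf_le summableI)
      fix n
      show "(\<Sum>x\<in>P. if n \<in> I x then ennreal (diameter (U n)) else 0) \<le> ennreal (diameter (U n))"
      proof (cases "\<exists>x\<in>P. n \<in> I x")
        case True
        then obtain x where x: "x \<in> P" "n \<in> I x" by auto
        have "(\<Sum>x'\<in>P. if n \<in> I x' then ennreal (diameter (U n)) else 0)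
            = (\<Sum>x'\<in>P. if x' = x then ennreal (diameter (U n)) else 0)"
          using x disj by (intro sum.cong) auto
        then show ?thesis using fin x by simp
      next
        case False
        then have "(\<Sum>x\<in>P. if n \<in> I x then ennreal (diameter (U n)) else 0) = 0"
          by (intro sum.neutral) auto
        then show ?thesis by simp
      qed
    qed
    also have "\<dots> \<le> ennreal (l + e)" using U(4) by simp
    finally show ?thesis using len e by (subst (asm) ennreal_le_iff) auto
  qed
  then have "real (card P) * (s / 4) \<le> l" by (rule field_le_epsilon)
  then have "real (card P) \<le> 4 * l / s" using s by (simp add: field_simps)
  then show ?thesis by simp
qed

text \<open>The bound for separated sets gives one of maximal cardinality; by maximality the balls
  around its points cover \<open>K\<close>.\<close>

lemma connected_covered_by_balls:
  fixes K :: "(real^2) set"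
  assumes K: "connected K" "K \<subseteq> A" and len: "set_length A \<le> ennreal l" "l \<ge> 0" and s: "s > 0"
  obtains P where "finite P" "K \<subseteq> (\<Union>x\<in>P. cball x s)" "real (card P) \<le> 1 + 4 * l / s"
proof -
  let ?Q = "\<lambda>P. separated s P \<and> P \<subseteq> K"
  have bound: "card P < nat \<lfloor>1 + 4 * l / s\<rfloor> + 1" if "?Q P" for P
  proof -
    have "real (card P) \<le> 1 + 4 * l / s" using separated_card_bound[OF K len s] that by simp
    from floor_mono[OF this] show ?thesis by simp
  qed
  have "\<exists>P. ?Q P \<and> (\<forall>P'. ?Q P' \<longrightarrow> card P' \<le> card P)"
    using bound by (intro ex_has_greatest_nat[of ?Q "{}" card]) (simp add: separated_def, blast)
  then obtain P where P: "?Q P" "\<And>P'. ?Q P' \<Longrightarrow> card P' \<le> card P" by blast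
  have fin: "finite P" using P by (simp add: separated_def)
  have "K \<subseteq> (\<Union>x\<in>P. cball x s)"
  proof (rule subsetI, rule ccontr)
    fix z assume z: "z \<in> K" "z \<notin> (\<Union>x\<in>P. cball x s)"
    then have far: "dist x z > s" if "x \<in> P" for x using that by auto
    then have "z \<notin> P" using s by force
    have "?Q (insert z P)" using P z(1) far by (auto simp: separated_def dist_commute less_imp_le)
    then have "card (insert z P) \<le> card P" by (rule P(2))
    then show False using fin \<open>z \<notin> P\<close> by simp
  qed
  then show ?thesis using that fin separated_card_bound[OF K len s] P(1) by blast
qed

section \<open>Plane lattices and reduced bases\<close>

definition cross :: "real^2 \<Rightarrow> real^2 \<Rightarrow> real" where
  "cross u v = u $ 1 * v $ 2 - u $ 2 * v $ 1"

lemma cross_simps [simp]: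
  "cross (x + y) v = cross x v + cross y v" "cross u (x + y) = cross u x + cross u y"
  "cross (x - y) v = cross x v - cross y v" "cross u (x - y) = cross u x - cross u y"
  "cross (c *\<^sub>R x) v = c * cross x v" "cross u (c *\<^sub>R y) = c * cross u y"
  "cross u u = 0" "cross 0 v = 0" "cross u 0 = 0" "cross (- x) v = - cross x v" "cross u (- x) = - cross u x"
  by (simp_all add: cross_def algebra_simps)

text \<open>Cramer's rule for the coordinates with respect to \<open>u\<close> and
  \<open>v\<close>.\<close>

lemma cross_expand:
  assumes "cross u v \<noteq> 0"
  shows "x = (cross x v / cross u v) *\<^sub>R u + (cross u x / cross u v) *\<^sub>R v"
proof -
  have "cross u v *\<^sub>R x = cross x v *\<^sub>R u + cross u x *\<^sub>R v"
    by (simp add: vec_eq_iff forall_2 cross_def algebra_simps)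
  then have "x = (1 / cross u v) *\<^sub>R (cross x v *\<^sub>R u + cross u x *\<^sub>R v)"
    using assms by (metis divide_inverse mult_1 real_vector.scale_scale right_inverse scaleR_one mult.commute)
  then show ?thesis by (simp add: algebra_simps)
qed

lemma cross_parallel:
  assumes "cross u x = 0" "u \<noteq> 0"
  shows "x = ((u \<bullet> x) / (u \<bullet> u)) *\<^sub>R u"
proof -
  have "(u \<bullet> u) *\<^sub>R x = (u \<bullet> x) *\<^sub>R u"
    using assms(1) by (simp add: vec_eq_iff forall_2 cross_def inner_vec_def sum_2 algebra_simps)
  moreover have "u \<bullet> u \<noteq> 0" using assms by simp
  ultimately show ?thesis by (metis divide_inverse mult.commute real_vector.scale_scale left_inverse scaleR_one)
qed

lemma norm_sq_2: "(norm (x::real^2))\<^sup>2 = (x $ 1)\<^sup>2 + (x $ 2)\<^sup>2"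
  unfolding power2_norm_eq_inner by (simp add: inner_vec_def sum_2 power2_eq_square)

lemma cross_sq: "(cross u v)\<^sup>2 = (norm u)\<^sup>2 * (norm v)\<^sup>2 - (u \<bullet> v)\<^sup>2"
  unfolding norm_sq_2 by (simp add: cross_def inner_vec_def sum_2 power2_eq_square algebra_simps)

lemma abs_cross_le: "\<bar>cross u v\<bar> \<le> norm u * norm v"
proof (rule power2_le_imp_le)
  show "\<bar>cross u v\<bar>\<^sup>2 \<le> (norm u * norm v)\<^sup>2"
    using cross_sq[of u v] by (simp add: power_mult_distrib)
qed simp

lemma add_scaled_inner: "(norm (a *\<^sub>R u + b *\<^sub>R v))\<^sup>2 = a\<^sup>2 * (norm u)\<^sup>2 + 2 * a * b * (u \<bullet> v) + b\<^sup>2 * (norm v)\<^sup>2"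
  unfolding power2_norm_eq_inner by (simp add: inner_simps inner_commute power2_eq_square algebra_simps)

text \<open>A subgroup of rank two of the integral points. Divisor sublattices arise in this form,
  without a basis.\<close>

locale plane_lattice =
  fixes S :: "(real^2) set"
  assumes zero: "0 \<in> S" and add: "\<And>x y. x \<in> S \<Longrightarrow> y \<in> S \<Longrightarrow> x + y \<in> S"
    and neg: "\<And>x. x \<in> S \<Longrightarrow> - x \<in> S"
    and int: "S \<subseteq> integral_points"
    and rank: "\<exists>u\<in>S. \<exists>v\<in>S. cross u v \<noteq> 0"
begin

lemma diff: "x \<in> S \<Longrightarrow> y \<in> S \<Longrightarrow> x - y \<in> S"
  using add[of x "- y"] neg[of y] by simp

lemma scale_nat: "x \<in> S \<Longrightarrow> of_nat n *\<^sub>R x \<in> S"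
  by (induction n) (auto simp: zero algebra_simps intro: add)

lemma scale_int: "x \<in> S \<Longrightarrow> of_int k *\<^sub>R x \<in> S"
  by (cases k rule: int_cases2) (use scale_nat neg in \<open>force+\<close>)

lemma norm_sq_int: "x \<in> S \<Longrightarrow> \<exists>n::nat. (norm x)\<^sup>2 = real n"
proof -
  assume "x \<in> S"
  then have "x $ 1 \<in> \<int>" "x $ 2 \<in> \<int>" using int by (auto simp: integral_points_def)
  then have "(norm x)\<^sup>2 \<in> \<int>" by (simp add: norm_sq_2)
  then obtain k where "(norm x)\<^sup>2 = of_int k" by (auto elim: Ints_cases)
  moreover from this have "k \<ge> 0" by (metis of_int_0_le_iff zero_le_power2)
  ultimately show ?thesis by (metis nat_0_le of_int_of_nat_eq)
qed

text \<open>Squared norms are natural numbers, so a minimum is attained.\<close>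

lemma shortest_in:
  assumes "x0 \<in> S" "Q x0"
  obtains x where "x \<in> S" "Q x" "\<And>y. y \<in> S \<Longrightarrow> Q y \<Longrightarrow> norm x \<le> norm y"
proof -
  let ?m = "\<lambda>x::real^2. nat \<lfloor>(norm x)\<^sup>2\<rfloor>"
  from ex_has_least_nat[of "\<lambda>x. x \<in> S \<and> Q x" x0 ?m] assms
  obtain x where x: "x \<in> S" "Q x" "\<And>y. y \<in> S \<Longrightarrow> Q y \<Longrightarrow> ?m x \<le> ?m y" by blast
  have "norm x \<le> norm y" if h: "y \<in> S" "Q y" for y
  proof -
    obtain a b where ab: "(norm x)\<^sup>2 = real a" "(norm y)\<^sup>2 = real b" using norm_sq_int[OF x(1)] norm_sq_int[OF h(1)] by blast
    then have "(norm x)\<^sup>2 \<le> (norm y)\<^sup>2" using x(3)[OF h] by simp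
    then show ?thesis by (rule power2_le_imp_le) simp
  qed
  then show ?thesis using that x by blast
qed

text \<open>Lagrange reduction: \<open>u\<close> is a shortest nonzero vector and \<open>v\<close> a
  shortest vector not parallel to it. Comparing \<open>v\<close> with \<open>v + u\<close> and
  \<open>v - u\<close> bounds \<open>2 * \<bar>u \<bullet> v\<bar>\<close> by the square of
  \<open>norm u\<close>, and Lagrange's identity then keeps the determinant close to the product of
  the lengths.\<close>

lemma reduced_basis:
  obtains u v where "u \<in> S" "v \<in> S" "cross u v \<noteq> 0" "norm u \<le> norm v"
    "\<And>x. x \<in> S \<Longrightarrow> \<exists>m n::int. x = of_int m *\<^sub>R u + of_int n *\<^sub>R v"
    "3 * ((norm u)\<^sup>2 * (norm v)\<^sup>2) \<le> 4 * (cross u v)\<^sup>2"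
proof -
  obtain a b where ab: "a \<in> S" "b \<in> S" "cross a b \<noteq> 0" using rank by auto
  have "a \<noteq> 0" using ab by auto
  from shortest_in[of a "\<lambda>x. x \<noteq> 0", OF ab(1) this] obtain u where
    u: "u \<in> S" "u \<noteq> 0" "\<And>y. y \<in> S \<Longrightarrow> y \<noteq> 0 \<Longrightarrow> norm u \<le> norm y" by blast
  have "\<exists>x\<in>S. cross u x \<noteq> 0"
  proof (rule ccontr)
    assume "\<not> ?thesis"
    then have "cross u a = 0" "cross u b = 0" using ab by auto
    from this[THEN cross_parallel[OF _ u(2)]] obtain s t where "a = s *\<^sub>R u" "b = t *\<^sub>R u" by blast
    then show False using ab(3) by simp
  qed
  then obtain x0 where "x0 \<in> S" "cross u x0 \<noteq> 0" by auto
  from shortest_in[of x0 "\<lambda>x. cross u x \<noteq> 0", OF this] obtain v where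
    v: "v \<in> S" "cross u v \<noteq> 0" "\<And>y. y \<in> S \<Longrightarrow> cross u y \<noteq> 0 \<Longrightarrow> norm v \<le> norm y" by blast
  have "v \<noteq> 0" using v(2) by auto
  then have uv: "norm u \<le> norm v" using u v by auto
  have "(norm v)\<^sup>2 \<le> (norm (1 *\<^sub>R u + 1 *\<^sub>R v))\<^sup>2"
    using v(3)[OF add[OF u(1) v(1)]] v(2) by (intro power_mono) simp_all
  then have i1: "- (2 * (u \<bullet> v)) \<le> (norm u)\<^sup>2" unfolding add_scaled_inner by simp
  have "(norm v)\<^sup>2 \<le> (norm ((-1) *\<^sub>R u + 1 *\<^sub>R v))\<^sup>2"
    using v(3)[OF diff[OF v(1) u(1)]] v(2) by (intro power_mono) simp_all
  then have i2: "2 * (u \<bullet> v) \<le> (norm u)\<^sup>2" unfolding add_scaled_inner by simp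
  have iabs: "2 * \<bar>u \<bullet> v\<bar> \<le> (norm u)\<^sup>2" using i1 i2 by linarith
  have uv2: "(norm u)\<^sup>2 \<le> (norm v)\<^sup>2" using uv by (intro power_mono) auto
  have area: "3 * ((norm u)\<^sup>2 * (norm v)\<^sup>2) \<le> 4 * (cross u v)\<^sup>2"
  proof -
    have "(2 * \<bar>u \<bullet> v\<bar>)\<^sup>2 \<le> ((norm u)\<^sup>2)\<^sup>2" using iabs by (intro power_mono) auto
    also have "\<dots> \<le> (norm u)\<^sup>2 * (norm v)\<^sup>2" using uv2 by (subst power2_eq_square) (intro mult_left_mono, auto)
    finally show ?thesis unfolding cross_sq by (simp add: power_mult_distrib)
  qed
  have gen: "\<exists>m n::int. x = of_int m *\<^sub>R u + of_int n *\<^sub>R v" if x: "x \<in> S" for x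
  proof -
    define s t where "s = cross x v / cross u v" and "t = cross u x / cross u v"
    have xe: "x = s *\<^sub>R u + t *\<^sub>R v" using cross_expand[OF v(2)] by (simp add: s_def t_def)
    define y where "y = x - of_int (round s) *\<^sub>R u - of_int (round t) *\<^sub>R v"
    define s' t' where "s' = s - of_int (round s)" and "t' = t - of_int (round t)"
    have ye: "y = s' *\<^sub>R u + t' *\<^sub>R v" by (subst y_def, subst xe) (simp add: s'_def t'_def algebra_simps)
    have yS: "y \<in> S" unfolding y_def by (intro diff x scale_int u v)
    have st: "\<bar>s'\<bar> \<le> 1/2" "\<bar>t'\<bar> \<le> 1/2"
      using of_int_round_abs_le[of s] of_int_round_abs_le[of t] by (auto simp: s'_def t'_def abs_minus_commute)
    have sq: "s'\<^sup>2 \<le> 1/4" "t'\<^sup>2 \<le> 1/4"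
      using power_mono[OF st(1), of 2] power_mono[OF st(2), of 2] by (simp_all add: power_divide)
    have "\<bar>s' * t'\<bar> \<le> 1/2 * (1/2)" unfolding abs_mult using st by (intro mult_mono) auto
    then have "\<bar>s' * t' * (u \<bullet> v)\<bar> \<le> 1/4 * \<bar>u \<bullet> v\<bar>"
      unfolding abs_mult[of "s' * t'"] by (intro mult_right_mono) auto
    then have "2 * s' * t' * (u \<bullet> v) \<le> 1/4 * (norm u)\<^sup>2" using iabs by linarith
    moreover have "s'\<^sup>2 * (norm u)\<^sup>2 \<le> 1/4 * (norm u)\<^sup>2" "t'\<^sup>2 * (norm v)\<^sup>2 \<le> 1/4 * (norm v)\<^sup>2"
      using sq by (intro mult_right_mono; simp)+
    \<comment> \<open>The three terms are at most a quarter of the squared lengths of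
      \<open>u\<close>, \<open>u\<close> and \<open>v\<close>. So the remainder is shorter than
      \<open>v\<close>, hence parallel to \<open>u\<close>; its coefficient is at most
      \<open>1 / 2\<close>, hence it is shorter than \<open>u\<close> and vanishes.\<close>
    ultimately have "(norm y)\<^sup>2 \<le> 3/4 * (norm v)\<^sup>2" unfolding ye add_scaled_inner using uv2 by linarith
    also have "\<dots> < (norm v)\<^sup>2" using \<open>v \<noteq> 0\<close> by simp
    finally have "norm y < norm v" by (simp add: power2_less_imp_less)
    then have "cross u y = 0" using v(3)[OF yS] by force
    then have t0: "t' = 0" unfolding ye using v(2) by simp
    then have "norm y = \<bar>s'\<bar> * norm u" by (simp add: ye)
    also have "\<dots> \<le> 1/2 * norm u" using st by (intro mult_right_mono) auto
    also have "\<dots> < norm u" using u by simp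
    finally have "y = 0" using u(3)[OF yS] by force
    then show ?thesis by (intro exI[of _ "round s"] exI[of _ "round t"]) (simp add: y_def algebra_simps)
  qed
  show ?thesis using that u(1) v(1,2) uv gen area by blast
qed

end

section \<open>Fundamental domains and the determinant\<close>

lemma integral_points_countable: "countable integral_points"
proof -
  have "integral_points \<subseteq> (\<lambda>(a,b). \<chi> i. if i = 1 then of_int a else of_int b) ` (UNIV :: (int \<times> int) set)"
  proof
    fix x assume "x \<in> integral_points"
    then obtain a b where "x $ 1 = of_int a" "x $ 2 = of_int b"
      unfolding integral_points_def by (metis Ints_cases mem_Collect_eq)
    then have "x = (\<lambda>(a,b). \<chi> i. if i = 1 then of_int a else of_int b) (a, b)"
      by (simp add: vec_eq_iff forall_2)
    then show "x \<in> (\<lambda>(a,b). \<chi> i. if i = 1 then of_int a else of_int b) ` (UNIV :: (int \<times> int) set)" by blast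
  qed
  then show ?thesis by (rule countable_subset) auto
qed

text \<open>\<open>F\<close> is cut into its pieces in the translates of \<open>G\<close>; moved
  back by the lattice vector, they become the pieces of \<open>G\<close> in the translates of
  \<open>F\<close>.\<close>

lemma fundamental_domain_emeasure_eq:
  assumes S: "countable S" "\<And>x. x \<in> S \<Longrightarrow> - x \<in> S"
    and F: "fundamental_domain S F" and G: "fundamental_domain S G"
  shows "emeasure lebesgue F = emeasure lebesgue G"
proof -
  have tr: "emeasure lebesgue F = (\<integral>\<^sup>+ l. emeasure lebesgue (F \<inter> (+) l ` G) \<partial>count_space S)"
    if F: "fundamental_domain S F" and G: "fundamental_domain S G" for F G
  proof -
    have m: "F \<in> sets lebesgue" "G \<in> sets lebesgue" using F G by (auto simp: fundamental_domain_def)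
    have "F = (\<Union>l\<in>S. F \<inter> (+) l ` G)"
    proof -
      have "\<exists>l\<in>S. y \<in> (+) l ` G" for y
      proof -
        obtain l where "l \<in> S" "y - l \<in> G" using G unfolding fundamental_domain_def by blast
        then show ?thesis by (intro bexI[of _ l] image_eqI[of _ _ "y - l"]) auto
      qed
      then show ?thesis by auto
    qed
    then have "emeasure lebesgue F = emeasure lebesgue (\<Union>l\<in>S. F \<inter> (+) l ` G)" by simp
    also have "\<dots> = (\<integral>\<^sup>+ l. emeasure lebesgue (F \<inter> (+) l ` G) \<partial>count_space S)"
    proof (rule emeasure_UN_countable)
      show "disjoint_family_on (\<lambda>l. F \<inter> (+) l ` G) S"
        unfolding disjoint_family_on_def
      proof (intro ballI impI, rule ccontr)
        fix l l' assume h: "l \<in> S" "l' \<in> S" "l \<noteq> l'" "F \<inter> (+) l ` G \<inter> (F \<inter> (+) l' ` G) \<noteq> {}"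
        then obtain y where "y \<in> (+) l ` G" "y \<in> (+) l' ` G" by blast
        then have "y - l \<in> G" "y - l' \<in> G" by (metis add_diff_cancel_left' imageE)+
        then show False using G h unfolding fundamental_domain_def by metis
      qed
    qed (use m S in \<open>auto intro!: sets.Int lebesgue_sets_translation\<close>)
    finally show ?thesis .
  qed
  have "emeasure lebesgue F = (\<integral>\<^sup>+ l. emeasure lebesgue (F \<inter> (+) l ` G) \<partial>count_space S)" by (rule tr[OF F G])
  also have "\<dots> = (\<integral>\<^sup>+ l. emeasure lebesgue (G \<inter> (+) (- l) ` F) \<partial>count_space S)"
  proof (rule nn_integral_cong)
    fix l :: "real^2"
    have "F \<inter> (+) l ` G = (+) l ` (G \<inter> (+) (- l) ` F)"
      by (force simp: image_iff)
    moreover have "emeasure lebesgue ((+) l ` A) = emeasure lebesgue A" for A :: "(real^2) set"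
    proof -
      have "(+) l = (\<lambda>x. x + l)" by (auto simp: add.commute)
      then show ?thesis using emeasure_lebesgue_affine[of 1 l A] by simp
    qed
    ultimately show "emeasure lebesgue (F \<inter> (+) l ` G) = emeasure lebesgue (G \<inter> (+) (- l) ` F)" by simp
  qed
  also have "\<dots> = (\<integral>\<^sup>+ l. emeasure lebesgue (G \<inter> (+) l ` F) \<partial>count_space S)"
    by (rule nn_integral_bij_count_space[of uminus S S "\<lambda>l. emeasure lebesgue (G \<inter> (+) l ` F)"])
       (use S(2) in \<open>force simp: bij_betw_def inj_on_def image_iff\<close>)
  also have "\<dots> = emeasure lebesgue G" by (rule tr[OF G F, symmetric])
  finally show ?thesis .
qed

lemma lattice_det_eq:
  assumes "countable S" "\<And>x. x \<in> S \<Longrightarrow> - x \<in> S" "fundamental_domain S F"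
  shows "lattice_det S = measure lebesgue F"
  unfolding lattice_det_def
proof (rule the_equality)
  show "\<forall>G. fundamental_domain S G \<longrightarrow> measure lebesgue G = measure lebesgue F"
    using fundamental_domain_emeasure_eq[OF assms(1,2) _ assms(3)] by (simp add: measure_def)
  show "D = measure lebesgue F" if "\<forall>G. fundamental_domain S G \<longrightarrow> measure lebesgue G = D" for D
    using that assms(3) by blast
qed

definition cell :: "real^2 \<Rightarrow> real^2 \<Rightarrow> (real^2) set" where
  "cell u v = {s *\<^sub>R u + t *\<^sub>R v | s t. 0 \<le> s \<and> s < 1 \<and> 0 \<le> t \<and> t < 1}"

lemma mem_cell_iff:
  assumes "cross u v \<noteq> 0"
  shows "x \<in> cell u v \<longleftrightarrow> 0 \<le> cross x v / cross u v \<and> cross x v / cross u v < 1 \<and>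
     0 \<le> cross u x / cross u v \<and> cross u x / cross u v < 1"
proof
  assume "x \<in> cell u v"
  then obtain s t where "x = s *\<^sub>R u + t *\<^sub>R v" "0 \<le> s" "s < 1" "0 \<le> t" "t < 1" by (auto simp: cell_def)
  then show "0 \<le> cross x v / cross u v \<and> cross x v / cross u v < 1 \<and>
     0 \<le> cross u x / cross u v \<and> cross u x / cross u v < 1" using assms by simp
next
  assume "0 \<le> cross x v / cross u v \<and> cross x v / cross u v < 1 \<and>
     0 \<le> cross u x / cross u v \<and> cross u x / cross u v < 1"
  then show "x \<in> cell u v" unfolding cell_def using cross_expand[OF assms, of x] by blast
qed

lemma cell_measure:
  shows "cell u v \<in> lmeasurable" "measure lebesgue (cell u v) = \<bar>cross u v\<bar>" "bounded (cell u v)"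
proof -
  let ?Q = "{w :: real^2. \<forall>i. 0 \<le> w $ i \<and> w $ i < 1}"
  let ?f = "\<lambda>w :: real^2. w $ 1 *\<^sub>R u + w $ 2 *\<^sub>R v"
  have Qc: "?Q \<subseteq> cbox 0 1" "box 0 1 \<subseteq> ?Q"
    by (auto simp: mem_box_cart) (meson less_imp_le)+
  have "negligible (cbox (0::real^2) 1 - box 0 1)" by (simp add: negligible_frontier_interval)
  then have neg: "negligible (cbox (0::real^2) 1 - ?Q)" by (rule negligible_subset) (use Qc in auto)
  have Qe: "?Q = cbox 0 1 - (cbox 0 1 - ?Q)" using Qc by auto
  have Qm: "?Q \<in> lmeasurable"
    by (subst Qe) (intro fmeasurable.Diff lmeasurable_cbox negligible_imp_measurable[OF neg])
  have Q1: "measure lebesgue ?Q = 1"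
  proof -
    have "measure lebesgue ?Q = measure lebesgue (cbox (0::real^2) 1)"
      by (subst Qe) (rule measure_Diff_null_set, use neg in \<open>auto simp: negligible_iff_null_sets\<close>)
    also have "\<dots> = measure lborel (cbox (0::real^2) 1)" by (rule measure_completion) simp
    also have "\<dots> = 1" by (subst content_cbox_cart) (auto simp: interval_eq_empty_cart not_le)
    finally show ?thesis .
  qed
  have bQ: "bounded ?Q" using Qc(1) bounded_cbox bounded_subset by blast
  have lin: "linear ?f" by (rule linearI) (auto simp: algebra_simps)
  have im: "cell u v = ?f ` ?Q"
  proof
    show "?f ` ?Q \<subseteq> cell u v" by (auto simp: cell_def)
    show "cell u v \<subseteq> ?f ` ?Q"
    proof
      fix x assume "x \<in> cell u v"
      then obtain s t where x: "x = s *\<^sub>R u + t *\<^sub>R v" "0 \<le> s" "s < 1" "0 \<le> t" "t < 1" by (auto simp: cell_def)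
      define w :: "real^2" where "w = (\<chi> i. if i = 1 then s else t)"
      have "w \<in> ?Q" "x = ?f w" using x by (auto simp: w_def)
      then show "x \<in> ?f ` ?Q" by blast
    qed
  qed
  show "bounded (cell u v)" unfolding im by (rule bounded_linear_image[OF bQ]) (use lin linear_conv_bounded_linear in blast)
  show "cell u v \<in> lmeasurable" unfolding im by (rule measurable_linear_image[OF lin Qm])
  have "measure lebesgue (cell u v) = \<bar>det (matrix ?f)\<bar> * measure lebesgue ?Q"
    unfolding im by (rule measure_lebesgue_linear_transformation[OF bQ _ lin]) (use Qm in auto)
  also have "det (matrix ?f) = cross u v"
    by (simp add: det_2 matrix_def cross_def axis_def)
  finally show "measure lebesgue (cell u v) = \<bar>cross u v\<bar>" using Q1 by simp
qed

section \<open>Counting lattice points by cells of a reduced basis\<close>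

lemma card_int_near: "card {k::int. \<bar>of_int k - (\<alpha>::real)\<bar> < 3} \<le> 6" "finite {k::int. \<bar>of_int k - (\<alpha>::real)\<bar> < 3}"
proof -
  have sub: "{k::int. \<bar>of_int k - \<alpha>\<bar> < 3} \<subseteq> {\<lfloor>\<alpha>\<rfloor> - 2..\<lfloor>\<alpha>\<rfloor> + 3}"
  proof
    fix k :: int assume "k \<in> {k. \<bar>of_int k - \<alpha>\<bar> < 3}"
    then have "of_int k < \<alpha> + 3" "\<alpha> - 3 < of_int k" by (auto simp: abs_less_iff)
    moreover have "of_int \<lfloor>\<alpha>\<rfloor> \<le> \<alpha>" "\<alpha> < of_int \<lfloor>\<alpha>\<rfloor> + 1" by linarith+
    ultimately have "of_int k < (of_int (\<lfloor>\<alpha>\<rfloor> + 4) :: real)" "(of_int (\<lfloor>\<alpha>\<rfloor> - 3) :: real) < of_int k"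
      unfolding of_int_add of_int_diff of_int_numeral by linarith+
    then have "k < \<lfloor>\<alpha>\<rfloor> + 4" "\<lfloor>\<alpha>\<rfloor> - 3 < k" by (simp_all only: of_int_less_iff)
    then show "k \<in> {\<lfloor>\<alpha>\<rfloor> - 2..\<lfloor>\<alpha>\<rfloor> + 3}" by auto
  qed
  show "finite {k::int. \<bar>of_int k - \<alpha>\<bar> < 3}" by (rule finite_subset[OF sub]) simp
  show "card {k::int. \<bar>of_int k - \<alpha>\<bar> < 3} \<le> 6" using card_mono[OF _ sub] by simp
qed

context plane_lattice begin

lemma countable: "countable S"
  by (rule countable_subset[OF int integral_points_countable])

lemma fundamental_domain_cell:
  assumes uv: "u \<in> S" "v \<in> S" "cross u v \<noteq> 0"
    and gen: "\<And>x. x \<in> S \<Longrightarrow> \<exists>m n::int. x = of_int m *\<^sub>R u + of_int n *\<^sub>R v"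
  shows "fundamental_domain S (cell u v)"
  unfolding fundamental_domain_def
proof (intro conjI allI)
  show "cell u v \<in> sets lebesgue" using cell_measure(1) by auto
  fix y
  define a b where "a = cross y v / cross u v" and "b = cross u y / cross u v"
  let ?l = "of_int \<lfloor>a\<rfloor> *\<^sub>R u + of_int \<lfloor>b\<rfloor> *\<^sub>R v"
  have iff: "y - (of_int m *\<^sub>R u + of_int n *\<^sub>R v) \<in> cell u v \<longleftrightarrow> m = \<lfloor>a\<rfloor> \<and> n = \<lfloor>b\<rfloor>" for m n :: int
    unfolding mem_cell_iff[OF uv(3)] using uv(3)
    by (simp add: diff_divide_distrib flip: a_def b_def) (auto simp: eq_commute[of _ "\<lfloor>_\<rfloor>"] floor_eq_iff)
  show "\<exists>!l. l \<in> S \<and> y - l \<in> cell u v"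
  proof (rule ex1I[of _ ?l])
    show "?l \<in> S \<and> y - ?l \<in> cell u v" using uv by (simp add: iff add scale_int)
    show "l = ?l" if l: "l \<in> S \<and> y - l \<in> cell u v" for l
    proof -
      obtain m n where mn: "l = of_int m *\<^sub>R u + of_int n *\<^sub>R v" using gen l by blast
      then show ?thesis using l by (simp add: iff)
    qed
  qed
qed

lemma lattice_det_basis:
  assumes uv: "u \<in> S" "v \<in> S" "cross u v \<noteq> 0"
    and gen: "\<And>x. x \<in> S \<Longrightarrow> \<exists>m n::int. x = of_int m *\<^sub>R u + of_int n *\<^sub>R v"
  shows "lattice_det S = \<bar>cross u v\<bar>"
  using lattice_det_eq[OF countable neg fundamental_domain_cell[OF assms]] by (simp add: cell_measure)

lemma finite_bounded: "bounded K \<Longrightarrow> finite (S \<inter> K)"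
proof -
  assume "bounded K"
  then obtain B where B: "\<And>x. x \<in> K \<Longrightarrow> norm x \<le> B" unfolding bounded_iff by auto
  have "S \<inter> K \<subseteq> (\<lambda>(a,b). \<chi> i. if i = 1 then of_int a else of_int b) ` ({-\<lceil>B\<rceil>..\<lceil>B\<rceil>} \<times> {-\<lceil>B\<rceil>..\<lceil>B\<rceil>})"
  proof
    fix x assume x: "x \<in> S \<inter> K"
    then have "x $ 1 \<in> \<int>" "x $ 2 \<in> \<int>" using int by (auto simp: integral_points_def)
    then obtain a b where ab: "x $ 1 = of_int a" "x $ 2 = of_int b" by (auto elim!: Ints_cases)
    have "\<bar>x $ 1\<bar> \<le> B" "\<bar>x $ 2\<bar> \<le> B" using B[of x] component_le_norm_cart[of x] x by (meson IntD2 order_trans)+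
    then have "\<bar>real_of_int a\<bar> \<le> B" "\<bar>real_of_int b\<bar> \<le> B" using ab by auto
    then have "a \<in> {-\<lceil>B\<rceil>..\<lceil>B\<rceil>}" "b \<in> {-\<lceil>B\<rceil>..\<lceil>B\<rceil>}" by (auto simp: abs_le_iff; linarith)+
    moreover have "x = (\<lambda>(a,b). \<chi> i. if i = 1 then of_int a else of_int b) (a, b)"
      using ab by (simp add: vec_eq_iff forall_2)
    ultimately show "x \<in> (\<lambda>(a,b). \<chi> i. if i = 1 then of_int a else of_int b) ` ({-\<lceil>B\<rceil>..\<lceil>B\<rceil>} \<times> {-\<lceil>B\<rceil>..\<lceil>B\<rceil>})"
      by blast
  qed
  then show ?thesis by (rule finite_subset) auto
qed

text \<open>For a reduced basis both coordinates of a vector of length at most \<open>norm u\<close> are bounded by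
  \<open>2 / sqrt 3\<close>, so a ball of that radius meets boundedly many cells.\<close>

lemma cells_meeting_ball:
  assumes uv: "u \<in> S" "v \<in> S" "cross u v \<noteq> 0" "norm u \<le> norm v"
    and gen: "\<And>x. x \<in> S \<Longrightarrow> \<exists>m n::int. x = of_int m *\<^sub>R u + of_int n *\<^sub>R v"
    and area: "3 * ((norm u)\<^sup>2 * (norm v)\<^sup>2) \<le> 4 * (cross u v)\<^sup>2"
  shows "finite {l \<in> S. (+) l ` cell u v \<inter> cball x (norm u) \<noteq> {}}"
    "card {l \<in> S. (+) l ` cell u v \<inter> cball x (norm u) \<noteq> {}} \<le> 36"
proof -
  define a b where "a = cross x v / cross u v" and "b = cross u x / cross u v"
  let ?A = "{k::int. \<bar>of_int k - a\<bar> < 3}" and ?B = "{k::int. \<bar>of_int k - b\<bar> < 3}"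
  let ?L = "{l \<in> S. (+) l ` cell u v \<inter> cball x (norm u) \<noteq> {}}"
  let ?g = "\<lambda>(m,n). of_int m *\<^sub>R u + of_int n *\<^sub>R v"
  have "(norm u * norm v)\<^sup>2 \<le> (2 * \<bar>cross u v\<bar>)\<^sup>2"
    using area by (simp add: power_mult_distrib) (smt (verit) mult_nonneg_nonneg zero_le_power2)
  then have ar: "norm u * norm v \<le> 2 * \<bar>cross u v\<bar>" by (rule power2_le_imp_le) simp
  have small: "\<bar>cross z v / cross u v\<bar> \<le> 2" "\<bar>cross u z / cross u v\<bar> \<le> 2" if z: "norm z \<le> norm u" for z
  proof -
    have "\<bar>cross z v\<bar> \<le> norm u * norm v"
      using abs_cross_le[of z v] mult_right_mono[OF z norm_ge_zero[of v]] by linarith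
    then show "\<bar>cross z v / cross u v\<bar> \<le> 2" using ar uv(3) by (simp add: divide_le_eq)
    have "\<bar>cross u z\<bar> \<le> norm u * norm v"
      using abs_cross_le[of u z] mult_left_mono[OF order_trans[OF z uv(4)] norm_ge_zero[of u]] by linarith
    then show "\<bar>cross u z / cross u v\<bar> \<le> 2" using ar uv(3) by (simp add: divide_le_eq)
  qed
  have sub: "?L \<subseteq> ?g ` (?A \<times> ?B)"
  proof
    fix l assume "l \<in> ?L"
    then obtain w where l: "l \<in> S" "w \<in> cell u v" "dist x (l + w) \<le> norm u" by auto
    obtain m n where mn: "l = of_int m *\<^sub>R u + of_int n *\<^sub>R v" using gen l(1) by blast
    define z where "z = l + w - x"
    have z: "norm z \<le> norm u" using l(3) by (simp add: z_def dist_norm norm_minus_commute)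
    have w: "w = z + x - l" by (simp add: z_def)
    have "0 \<le> cross w v / cross u v" "cross w v / cross u v < 1"
      "0 \<le> cross u w / cross u v" "cross u w / cross u v < 1" using l(2) mem_cell_iff[OF uv(3)] by auto
    moreover have "cross w v / cross u v = cross z v / cross u v + a - of_int m"
      "cross u w / cross u v = cross u z / cross u v + b - of_int n"
      unfolding w mn a_def b_def using uv(3) by (simp_all add: add_divide_distrib diff_divide_distrib)
    \<comment> \<open>A coordinate of \<open>w\<close> lies in \<open>[0, 1)\<close> and one of
      \<open>z\<close> in \<open>[-2, 2]\<close>, so \<open>m\<close> and \<open>n\<close> differ by
      less than 3 from the coordinates of the centre.\<close>
    ultimately have "m \<in> ?A" "n \<in> ?B" using small[OF z] unfolding mem_Collect_eq by linarith+
    then show "l \<in> ?g ` (?A \<times> ?B)" using mn by (intro image_eqI[of _ _ "(m, n)"]) auto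
  qed
  have fin: "finite (?g ` (?A \<times> ?B))" using card_int_near(2) by blast
  show "finite ?L" by (rule finite_subset[OF sub fin])
  have "card ?L \<le> card (?g ` (?A \<times> ?B))" by (rule card_mono[OF fin sub])
  also have "\<dots> \<le> card (?A \<times> ?B)" by (rule card_image_le) (use card_int_near(2) in blast)
  also have "\<dots> \<le> 6 * 6" unfolding card_cartesian_product by (intro mult_le_mono card_int_near(1))
  finally show "card ?L \<le> 36" by simp
qed

text \<open>A cell that misses the frontier of \<open>K\<close> is connected, hence lies inside or outside \<open>K\<close>; the
  error is at most the number of cells that meet the frontier.\<close>

lemma lattice_point_count_cells:
  assumes K: "compact K" and F: "fundamental_domain S F" "F \<in> lmeasurable" "connected F" "bounded F" "0 \<in> F"
    and B: "finite B" "{l \<in> S. (+) l ` F \<inter> frontier K \<noteq> {}} \<subseteq> B"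
  shows "\<bar>real (card (S \<inter> K)) * measure lebesgue F - measure lebesgue K\<bar> \<le> real (card B) * measure lebesgue F"
proof -
  define I where "I = {l \<in> S. (+) l ` F \<inter> K \<noteq> {}}"
  have bK: "bounded K" using K compact_imp_bounded by blast
  have bI: "bounded {x - y | x y. x \<in> K \<and> y \<in> F}" using bounded_minus[OF bK F(4)] by (rule bounded_subset) force
  have "I \<subseteq> S \<inter> {x - y | x y. x \<in> K \<and> y \<in> F}"
  proof
    fix l assume "l \<in> I"
    then obtain y where "y \<in> F" "l + y \<in> K" "l \<in> S" by (auto simp: I_def)
    then show "l \<in> S \<inter> {x - y | x y. x \<in> K \<and> y \<in> F}"
      by (intro IntI CollectI exI[of _ "l + y"] exI[of _ y]) auto
  qed
  then have finI: "finite I" by (rule finite_subset) (rule finite_bounded[OF bI])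
  have finK: "finite (S \<inter> K)" by (rule finite_bounded[OF bK])
  let ?c = "\<lambda>l. K \<inter> (+) l ` F"
  have Km: "K \<in> lmeasurable" using K by (rule lmeasurable_compact)
  have cm: "?c l \<in> lmeasurable" for l using Km F(2) by (intro fmeasurable.Int measurable_translation)
  have SKI: "S \<inter> K \<subseteq> I" using F(5) by (force simp: I_def image_iff)
  have "K = (\<Union>l\<in>I. ?c l)"
  proof -
    have "\<exists>l\<in>I. y \<in> (+) l ` F" if "y \<in> K" for y
    proof -
      obtain l where "l \<in> S" "y - l \<in> F" using F(1) unfolding fundamental_domain_def by blast
      moreover from this have "y \<in> (+) l ` F" by (intro image_eqI[of _ _ "y - l"]) auto
      ultimately show ?thesis using that unfolding I_def by blast
    qed
    then show ?thesis by auto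
  qed
  then have "measure lebesgue K = measure lebesgue (\<Union>l\<in>I. ?c l)" by simp
  also have "\<dots> = (\<Sum>l\<in>I. measure lebesgue (?c l))"
  proof (rule measure_UNION')
    show "finite I" by (rule finI)
    show "pairwise (\<lambda>l l'. disjnt (?c l) (?c l')) I"
    proof (rule pairwiseI, rule ccontr)
      fix l l' assume h: "l \<in> I" "l' \<in> I" "l \<noteq> l'" "\<not> disjnt (?c l) (?c l')"
      then obtain y where "y \<in> (+) l ` F" "y \<in> (+) l' ` F" by (auto simp: disjnt_def)
      then have "y - l \<in> F" "y - l' \<in> F" by (metis add_diff_cancel_left' imageE)+
      then show False using F(1) h unfolding fundamental_domain_def I_def by blast
    qed
  qed (use cm in auto)
  finally have mK: "measure lebesgue K = (\<Sum>l\<in>I. measure lebesgue (?c l))" .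
  let ?mF = "measure lebesgue F"
  have cF: "measure lebesgue (?c l) \<le> ?mF" for l
  proof -
    have "measure lebesgue (?c l) \<le> measure lebesgue ((+) l ` F)"
      by (rule measure_mono_fmeasurable) (use cm F(2) measurable_translation in auto)
    then show ?thesis by (simp add: measure_translation)
  qed
  have dev: "\<bar>(if l \<in> K then ?mF else 0) - measure lebesgue (?c l)\<bar> \<le> (if l \<in> B then ?mF else 0)"
    if l: "l \<in> I" for l
  proof (cases "l \<in> B")
    case True
    then show ?thesis using cF[of l] measure_nonneg[of lebesgue "?c l"] by auto
  next
    case False
    then have miss: "(+) l ` F \<inter> frontier K = {}" using B(2) l by (auto simp: I_def)
    have con: "connected ((+) l ` F)" by (intro connected_continuous_image continuous_intros F(3))
    have meet: "(+) l ` F \<inter> K \<noteq> {}" using l by (auto simp: I_def)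
    have "(+) l ` F - K = {}" using connected_Int_frontier[OF con meet] miss by blast
    then have sub: "(+) l ` F \<subseteq> K" by blast
    then have "l \<in> K" using F(5) by (force simp: image_iff)
    moreover have "?c l = (+) l ` F" using sub by blast
    ultimately show ?thesis using False by (simp add: measure_translation)
  qed
  have "real (card (S \<inter> K)) * ?mF = (\<Sum>l\<in>S \<inter> K. ?mF)" by simp
  also have "\<dots> = (\<Sum>l\<in>I. if l \<in> K then ?mF else 0)"
  proof -
    have "S \<inter> K = {l \<in> I. l \<in> K}" using SKI by (auto simp: I_def)
    then show ?thesis by (simp only: sum.inter_filter[OF finI])
  qed
  finally have "real (card (S \<inter> K)) * ?mF - measure lebesgue K
      = (\<Sum>l\<in>I. (if l \<in> K then ?mF else 0) - measure lebesgue (?c l))"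
    by (simp add: mK sum_subtractf)
  also have "\<bar>\<dots>\<bar> \<le> (\<Sum>l\<in>I. if l \<in> B then ?mF else 0)"
    by (rule order_trans[OF sum_abs sum_mono[OF dev]])
  also have "\<dots> = (\<Sum>l\<in>{l\<in>I. l \<in> B}. ?mF)" by (simp only: sum.inter_filter[OF finI])
  also have "\<dots> = real (card {l\<in>I. l \<in> B}) * ?mF" by simp
  also have "\<dots> \<le> real (card B) * ?mF"
    using B(1) by (intro mult_right_mono of_nat_mono card_mono) auto
  finally show ?thesis .
qed

text \<open>Each connected piece of the frontier is covered by at most
  \<open>1 + 4 * l / norm u\<close> balls of radius \<open>norm u\<close>, and each ball meets at
  most 36 cells. Using the shorter basis vector as radius makes the length term inversely
  proportional to it.\<close>

lemma lattice_point_count: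
  assumes uv: "u \<in> S" "v \<in> S" "cross u v \<noteq> 0" "norm u \<le> norm v"
    and gen: "\<And>x. x \<in> S \<Longrightarrow> \<exists>m n::int. x = of_int m *\<^sub>R u + of_int n *\<^sub>R v"
    and area: "3 * ((norm u)\<^sup>2 * (norm v)\<^sup>2) \<le> 4 * (cross u v)\<^sup>2"
    and K: "compact K" and fr: "frontier K = \<Union>\<C>" "finite \<C>" "card \<C> \<le> m" "\<And>C. C \<in> \<C> \<Longrightarrow> connected C"
    and len: "set_length (frontier K) \<le> ennreal l" "l \<ge> 0"
  shows "\<bar>real (card (S \<inter> K)) - measure lebesgue K / lattice_det S\<bar> \<le> 36 * real m * (1 + 4 * l / norm u)"
proof -
  let ?F = "cell u v"
  have u0: "norm u > 0" using uv(3) by (auto simp: zero_less_norm_iff)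
  have "\<exists>P. finite P \<and> C \<subseteq> (\<Union>x\<in>P. cball x (norm u)) \<and> real (card P) \<le> 1 + 4 * l / norm u" if "C \<in> \<C>" for C
    using connected_covered_by_balls[OF fr(4)[OF that] _ len u0] that fr(1) by (metis Union_upper)
  then obtain P where P: "\<And>C. C \<in> \<C> \<Longrightarrow> finite (P C)" "\<And>C. C \<in> \<C> \<Longrightarrow> C \<subseteq> (\<Union>x\<in>P C. cball x (norm u))"
    "\<And>C. C \<in> \<C> \<Longrightarrow> real (card (P C)) \<le> 1 + 4 * l / norm u" by metis
  let ?L = "\<lambda>x. {l \<in> S. (+) l ` ?F \<inter> cball x (norm u) \<noteq> {}}"
  define B where "B = (\<Union>C\<in>\<C>. \<Union>x\<in>P C. ?L x)"
  note ball = cells_meeting_ball[OF uv gen area]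
  have finB: "finite B" unfolding B_def using fr(2) P(1) ball(1) by blast
  have sub: "{l \<in> S. (+) l ` ?F \<inter> frontier K \<noteq> {}} \<subseteq> B"
  proof
    fix l assume "l \<in> {l \<in> S. (+) l ` ?F \<inter> frontier K \<noteq> {}}"
    then obtain y C where y: "l \<in> S" "y \<in> (+) l ` ?F" "y \<in> C" "C \<in> \<C>" using fr(1) by auto
    then obtain x where "x \<in> P C" "y \<in> cball x (norm u)" using P(2) by blast
    then show "l \<in> B" unfolding B_def using y by blast
  qed
  have cB: "real (card B) \<le> 36 * real m * (1 + 4 * l / norm u)"
  proof -
    have "card B \<le> (\<Sum>C\<in>\<C>. card (\<Union>x\<in>P C. ?L x))" unfolding B_def by (rule card_UN_le[OF fr(2)])
    also have "\<dots> \<le> (\<Sum>C\<in>\<C>. \<Sum>x\<in>P C. card (?L x))" by (intro sum_mono card_UN_le P(1))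
    also have "\<dots> \<le> (\<Sum>C\<in>\<C>. \<Sum>x\<in>P C. 36)" by (intro sum_mono ball(2))
    finally have "real (card B) \<le> real (\<Sum>C\<in>\<C>. \<Sum>x\<in>P C. 36)" by (simp only: of_nat_le_iff)
    also have "\<dots> = (\<Sum>C\<in>\<C>. 36 * real (card (P C)))" by (simp add: mult.commute)
    also have "\<dots> \<le> (\<Sum>C\<in>\<C>. 36 * (1 + 4 * l / norm u))" using P(3) by (intro sum_mono mult_left_mono) auto
    also have "\<dots> = real (card \<C>) * (36 * (1 + 4 * l / norm u))" by simp
    also have "\<dots> \<le> real m * (36 * (1 + 4 * l / norm u))" using fr(3) len(2) u0 by (intro mult_right_mono) auto
    finally show ?thesis by (simp add: algebra_simps)
  qed
  have cF: "connected ?F"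
  proof -
    have "convex ?F" unfolding cell_def
    proof (rule convexI, clarsimp)
      fix s t s' t' a b :: real
      assume h: "0 \<le> a" "0 \<le> b" "a + b = 1" "0 \<le> s" "s < 1" "0 \<le> t" "t < 1" "0 \<le> s'" "s' < 1" "0 \<le> t'" "t' < 1"
      have lt: "a * x + b * y < 1" if "x < 1" "y < 1" for x y
      proof -
        have "a * x + b * y \<le> a * max x y + b * max x y" using h by (intro add_mono mult_left_mono) auto
        also have "\<dots> = max x y" using h(3) by (metis distrib_right mult_1)
        finally show ?thesis using that by auto
      qed
      show "\<exists>x y. a *\<^sub>R (s *\<^sub>R u + t *\<^sub>R v) + b *\<^sub>R (s' *\<^sub>R u + t' *\<^sub>R v) = x *\<^sub>R u + y *\<^sub>R v \<and>
          0 \<le> x \<and> x < 1 \<and> 0 \<le> y \<and> y < 1"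
        using h lt[of s s'] lt[of t t']
        by (rule_tac x = "a * s + b * s'" in exI, rule_tac x = "a * t + b * t'" in exI) (auto simp: algebra_simps)
    qed
    then show ?thesis by (rule convex_connected)
  qed
  have "0 \<in> ?F" unfolding cell_def by (intro CollectI exI[of _ 0]) auto
  from lattice_point_count_cells[OF K fundamental_domain_cell[OF uv(1-3) gen] cell_measure(1) cF cell_measure(3) this finB sub]
  have "\<bar>real (card (S \<inter> K)) * \<bar>cross u v\<bar> - measure lebesgue K\<bar> \<le> real (card B) * \<bar>cross u v\<bar>"
    by (simp add: cell_measure(2))
  moreover have "real (card (S \<inter> K)) * \<bar>cross u v\<bar> - measure lebesgue K
      = (real (card (S \<inter> K)) - measure lebesgue K / \<bar>cross u v\<bar>) * \<bar>cross u v\<bar>"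
    using uv(3) by (simp add: left_diff_distrib)
  ultimately have "\<bar>real (card (S \<inter> K)) - measure lebesgue K / \<bar>cross u v\<bar>\<bar> * \<bar>cross u v\<bar> \<le> real (card B) * \<bar>cross u v\<bar>"
    by (simp only: abs_mult abs_abs)
  then have "\<bar>real (card (S \<inter> K)) - measure lebesgue K / \<bar>cross u v\<bar>\<bar> \<le> real (card B)" using uv(3) by simp
  then show ?thesis using cB lattice_det_basis[OF uv(1-3) gen] by simp
qed

end

section \<open>Divisor sublattices\<close>

lemma lform_add: "lform a (x + y) = lform a x + lform a y"
  by (simp add: lform_def sum.distrib algebra_simps)

lemma lform_scaleR: "lform a (c *\<^sub>R x) = c * lform a x"
  by (simp add: lform_def sum_distrib_left algebra_simps)

lemma lform_2: "lform a x = of_rat (a $ 1) * x $ 1 + of_rat (a $ 2) * x $ 2"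
  by (simp add: lform_def sum_2)

lemma lform_zero [simp]: "lform a 0 = 0"
  by (simp add: lform_2)

definition rdet :: "rat^2 \<Rightarrow> rat^2 \<Rightarrow> rat" where
  "rdet a b = a $ 1 * b $ 2 - a $ 2 * b $ 1"

lemma lform_cross:
  "lform a x * lform b y - lform a y * lform b x = of_rat (rdet a b) * cross x y"
  by (simp add: lform_2 cross_def rdet_def of_rat_diff of_rat_mult algebra_simps)

lemma form_denom:
  "form_denom a > 0" "of_nat (form_denom a) * a $ j \<in> \<int>"
proof -
  let ?P = "\<lambda>c. c > 0 \<and> (\<forall>j. of_nat c * (a :: rat^2) $ j \<in> \<int>)"
  obtain p1 q1 where 1: "quotient_of (a $ 1) = (p1, q1)" by (cases "quotient_of (a $ 1)")
  obtain p2 q2 where 2: "quotient_of (a $ 2) = (p2, q2)" by (cases "quotient_of (a $ 2)")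
  have q: "q1 > 0" "q2 > 0" using quotient_of_denom_pos 1 2 by blast+
  have a: "a $ 1 = of_int p1 / of_int q1" "a $ 2 = of_int p2 / of_int q2"
    using quotient_of_div 1 2 by blast+
  have "of_nat (nat (q1 * q2)) = (of_int (q1 * q2) :: rat)" using q by simp
  moreover have "of_int (q1 * q2) * a $ 1 = of_int (p1 * q2)" "of_int (q1 * q2) * a $ 2 = of_int (p2 * q1)"
    using q a by simp_all
  ultimately have "?P (nat (q1 * q2))" using q by (simp add: forall_2 del: of_int_mult)
  then have "?P (form_denom a)" unfolding form_denom_def by (rule LeastI)
  then show "form_denom a > 0" "of_nat (form_denom a) * a $ j \<in> \<int>" by auto
qed

lemma integral_form: "of_int (integral_form a $ j) = of_nat (form_denom a) * a $ j"
  using form_denom(2)[of a j] by (auto simp: integral_form_def elim: Ints_cases)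

lemma form_resultant_rdet:
  "of_int (form_resultant (integral_form a) (integral_form b)) = of_nat (form_denom a * form_denom b) * rdet a b"
  by (simp add: form_resultant_def integral_form rdet_def algebra_simps)

text \<open>The factor \<open>E\<close> accounts for at most \<open>w\<close> of the
  \<open>a\<close> powers of \<open>p\<close>.\<close>

lemma prime_power_dvd_cancel:
  fixes p :: nat and m E :: int
  assumes p: "prime p" and E: "E \<noteq> 0" "multiplicity (int p) E \<le> w" and d: "int (p ^ a) dvd m * E"
  shows "int (p ^ (a - w)) dvd m"
proof (cases "m = 0")
  case False
  have ip: "prime (int p)" using p by simp
  have "a \<le> multiplicity (int p) (m * E)"
    using d False E(1) ip by (intro multiplicity_geI) (auto simp: not_prime_unit)
  also have "\<dots> = multiplicity (int p) m + multiplicity (int p) E"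
    using ip False E(1) by (intro prime_elem_multiplicity_mult_distrib) auto
  finally have "a - w \<le> multiplicity (int p) m" using E(2) by linarith
  then have "int p ^ (a - w) dvd m" by (rule multiplicity_dvd')
  then show ?thesis by simp
qed simp

locale adm =
  fixes \<Lambda> :: "(real^2) set" and L :: "rat^2^4"
  assumes adm: "admissible \<Lambda> L"
begin

definition Lf :: "4 \<Rightarrow> real^2 \<Rightarrow> int" where
  "Lf i x = \<lfloor>lform (L $ i) x\<rfloor>"

lemma Lf: "x \<in> \<Lambda> \<Longrightarrow> of_int (Lf i x) = lform (L $ i) x"
  using adm by (auto simp: admissible_def Lf_def elim!: Ints_cases)

lemma basis:
  obtains u v where "u \<in> \<Lambda>" "v \<in> \<Lambda>" "cross u v \<noteq> 0"
    "\<Lambda> = {of_int m *\<^sub>R u + of_int n *\<^sub>R v | (m::int) (n::int). True}"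
proof -
  obtain u v where uv: "u \<noteq> v" "independent {u, v}" and \<Lambda>: "\<Lambda> = {of_int m *\<^sub>R u + of_int n *\<^sub>R v | (m::int) (n::int). True}"
    using adm by (auto simp: admissible_def is_lattice_def)
  have "u \<in> \<Lambda>" unfolding \<Lambda> by (intro CollectI exI[of _ 1] exI[of _ 0]) simp
  moreover have "v \<in> \<Lambda>" unfolding \<Lambda> by (intro CollectI exI[of _ 0] exI[of _ 1]) simp
  moreover have "cross u v \<noteq> 0"
  proof
    assume c: "cross u v = 0"
    have u0: "u \<noteq> 0" using uv(2) dependent_zero by blast
    from cross_parallel[OF c u0] have "v \<in> span {u}" by (metis span_base span_scale insertI1)
    then have "dependent {u, v}" using uv(1) unfolding dependent_def
      by (intro bexI[of _ v]) (auto simp: insert_Diff_if)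
    then show False using uv(2) by simp
  qed
  ultimately show ?thesis using that \<Lambda> by blast
qed

sublocale plane_lattice \<Lambda>
proof -
  obtain u v where uv: "u \<in> \<Lambda>" "v \<in> \<Lambda>" "cross u v \<noteq> 0"
    and \<Lambda>: "\<Lambda> = {of_int m *\<^sub>R u + of_int n *\<^sub>R v | (m::int) (n::int). True}" by (rule basis)
  show "plane_lattice \<Lambda>"
  proof
    show "0 \<in> \<Lambda>" unfolding \<Lambda> by (intro CollectI exI[of _ 0]) simp
    show "x + y \<in> \<Lambda>" if xy: "x \<in> \<Lambda>" "y \<in> \<Lambda>" for x y
    proof -
      obtain m n m' n' where "x = of_int m *\<^sub>R u + of_int n *\<^sub>R v" "y = of_int m' *\<^sub>R u + of_int n' *\<^sub>R v"
        using xy unfolding \<Lambda> by auto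
      then have "x + y = of_int (m + m') *\<^sub>R u + of_int (n + n') *\<^sub>R v" by (simp add: algebra_simps)
      then show ?thesis unfolding \<Lambda> by blast
    qed
    show "- x \<in> \<Lambda>" if x: "x \<in> \<Lambda>" for x
    proof -
      obtain m n where "x = of_int m *\<^sub>R u + of_int n *\<^sub>R v" using x unfolding \<Lambda> by auto
      then have "- x = of_int (- m) *\<^sub>R u + of_int (- n) *\<^sub>R v" by simp
      then show ?thesis unfolding \<Lambda> by blast
    qed
    show "\<Lambda> \<subseteq> integral_points" using adm by (simp add: admissible_def)
    show "\<exists>u\<in>\<Lambda>. \<exists>v\<in>\<Lambda>. cross u v \<noteq> 0" using uv by blast
  qed
qed

lemma Lf_add: "x \<in> \<Lambda> \<Longrightarrow> y \<in> \<Lambda> \<Longrightarrow> Lf i (x + y) = Lf i x + Lf i y"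
  using Lf[of x i] Lf[of y i] Lf[of "x + y" i] add[of x y] by (simp add: lform_add flip: of_int_add)

lemma Lf_scale: "x \<in> \<Lambda> \<Longrightarrow> Lf i (of_int k *\<^sub>R x) = k * Lf i x"
proof -
  assume x: "x \<in> \<Lambda>"
  have "(of_int (Lf i (of_int k *\<^sub>R x)) :: real) = of_int (k * Lf i x)"
    using Lf[OF scale_int[OF x, of k], of i] Lf[OF x, of i] by (simp add: lform_scaleR)
  then show ?thesis by (simp only: of_int_eq_iff)
qed

lemma Lf_neg: "x \<in> \<Lambda> \<Longrightarrow> Lf i (- x) = - Lf i x"
  using Lf_scale[of x i "-1"] by simp

lemma Lf_diff: "x \<in> \<Lambda> \<Longrightarrow> y \<in> \<Lambda> \<Longrightarrow> Lf i (x - y) = Lf i x - Lf i y"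
  using Lf_add[of x "- y" i] Lf_neg[of y i] neg[of y] by simp

lemma Lf_zero [simp]: "Lf i 0 = 0"
  by (simp add: Lf_def)

abbreviation subl :: "nat^4 \<Rightarrow> (real^2) set" where
  "subl d \<equiv> divisor_sublattice \<Lambda> L d"

lemma mem_subl: "x \<in> subl d \<longleftrightarrow> x \<in> \<Lambda> \<and> (\<forall>i. int (d $ i) dvd Lf i x)"
  by (simp add: divisor_sublattice_def Lf_def)

lemma plane_lattice_subl:
  assumes d: "vpos d" shows "plane_lattice (subl d)"
proof
  show "0 \<in> subl d" by (simp add: mem_subl zero)
  show "x + y \<in> subl d" if "x \<in> subl d" "y \<in> subl d" for x y
    using that by (auto simp: mem_subl add Lf_add)
  show "- x \<in> subl d" if "x \<in> subl d" for x
    using that by (auto simp: mem_subl neg Lf_neg)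
  show "subl d \<subseteq> integral_points" using int by (auto simp: mem_subl)
  obtain u v where uv: "u \<in> \<Lambda>" "v \<in> \<Lambda>" "cross u v \<noteq> 0" by (rule basis)
  let ?D = "of_int (int (vprod d)) :: real"
  have "?D *\<^sub>R x \<in> subl d" if "x \<in> \<Lambda>" for x
    unfolding mem_subl using that dvd_vprod[of d] by (auto simp: Lf_scale scale_int simp del: of_int_of_nat_eq)
  moreover have "cross (?D *\<^sub>R u) (?D *\<^sub>R v) \<noteq> 0" using uv vprod_pos[OF d] by simp
  ultimately show "\<exists>u\<in>subl d. \<exists>v\<in>subl d. cross u v \<noteq> 0" using uv by blast
qed

section \<open>The index of a divisor sublattice\<close>

definition res :: "nat^4 \<Rightarrow> real^2 \<Rightarrow> int^4" where
  "res d x = (\<chi> i. Lf i x mod int (d $ i))"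

text \<open>The index of \<open>subl d\<close> in \<open>\<Lambda>\<close>: two points have the same
  residue vector exactly when they lie in the same coset.\<close>

definition idx :: "nat^4 \<Rightarrow> nat" where
  "idx d = card (res d ` \<Lambda>)"

lemma res_eq_iff: "x \<in> \<Lambda> \<Longrightarrow> y \<in> \<Lambda> \<Longrightarrow> res d x = res d y \<longleftrightarrow> x - y \<in> subl d"
  by (auto simp: res_def vec_eq_iff mem_subl diff Lf_diff mod_eq_dvd_iff)

lemma res_range:
  assumes "vpos d"
  shows "res d ` \<Lambda> \<subseteq> {v. \<forall>i. v $ i \<in> {0..<int (d $ i)}}"
  using assms by (auto simp: res_def vpos_def)

lemma finite_res: "vpos d \<Longrightarrow> finite (res d ` \<Lambda>)"
  by (rule finite_subset[OF res_range], assumption, rule finite_vec_set) simp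

lemma idx_le: "vpos d \<Longrightarrow> idx d \<le> vprod d"
proof -
  assume d: "vpos d"
  have "idx d \<le> card {v :: int^4. \<forall>i. v $ i \<in> {0..<int (d $ i)}}"
    unfolding idx_def by (intro card_mono res_range d finite_vec_set) auto
  also have "\<dots> = vprod d" by (subst card_vec_set) (auto simp: vprod_def)
  finally show ?thesis .
qed

lemma idx_pos: "vpos d \<Longrightarrow> idx d > 0"
  unfolding idx_def using finite_res[of d] zero by (auto simp: card_gt_0_iff)

lemma idx_one: "idx 1 = 1"
proof -
  have "res 1 ` \<Lambda> = {0}" using zero by (force simp: res_def vec_eq_iff)
  then show ?thesis by (simp add: idx_def)
qed

text \<open>The translates of a cell by representatives of the \<open>idx d\<close> cosets are
  disjoint, and their union is a fundamental domain of the sublattice.\<close>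

lemma lattice_det_subl:
  assumes d: "vpos d" shows "lattice_det (subl d) = real (idx d) * lattice_det \<Lambda>"
proof -
  obtain u v where uv: "u \<in> \<Lambda>" "v \<in> \<Lambda>" "cross u v \<noteq> 0"
    and \<Lambda>: "\<Lambda> = {of_int m *\<^sub>R u + of_int n *\<^sub>R v | (m::int) (n::int). True}" by (rule basis)
  have gen: "\<exists>m n::int. x = of_int m *\<^sub>R u + of_int n *\<^sub>R v" if "x \<in> \<Lambda>" for x
    using that unfolding \<Lambda> by auto
  let ?F = "cell u v"
  have fd: "fundamental_domain \<Lambda> ?F" by (rule fundamental_domain_cell[OF uv gen])
  have "\<forall>c\<in>res d ` \<Lambda>. \<exists>x\<in>\<Lambda>. res d x = c" by auto
  then obtain r where r: "\<And>c. c \<in> res d ` \<Lambda> \<Longrightarrow> r c \<in> \<Lambda> \<and> res d (r c) = c" by metis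
  let ?I = "res d ` \<Lambda>"
  define G where "G = (\<Union>c\<in>?I. (+) (r c) ` ?F)"
  have Fm: "?F \<in> lmeasurable" by (rule cell_measure)
  have mem: "y - l \<in> G \<longleftrightarrow> (\<exists>c\<in>?I. y - (l + r c) \<in> ?F)" for y l
  proof -
    have "y - l \<in> (+) (r c) ` ?F \<longleftrightarrow> y - (l + r c) \<in> ?F" for c
    proof
      assume "y - l \<in> (+) (r c) ` ?F"
      then obtain z where "z \<in> ?F" "y - l = r c + z" by auto
      then have "z = y - (l + r c)" by (simp add: algebra_simps)
      then show "y - (l + r c) \<in> ?F" using \<open>z \<in> ?F\<close> by simp
    next
      assume "y - (l + r c) \<in> ?F"
      then show "y - l \<in> (+) (r c) ` ?F" by (intro image_eqI[of _ _ "y - (l + r c)"]) (auto simp: algebra_simps)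
    qed
    then show ?thesis by (auto simp: G_def)
  qed
  have "fundamental_domain (subl d) G"
    unfolding fundamental_domain_def
  proof (intro conjI allI)
    show "G \<in> sets lebesgue" unfolding G_def
      using finite_res[OF d] Fm measurable_translation by (intro sets.finite_UN) auto
    fix y
    obtain l where l: "l \<in> \<Lambda>" "y - l \<in> ?F" "\<And>l'. l' \<in> \<Lambda> \<Longrightarrow> y - l' \<in> ?F \<Longrightarrow> l' = l"
      using fd unfolding fundamental_domain_def by metis
    have c: "res d l \<in> ?I" using l(1) by (rule imageI)
    show "\<exists>!m. m \<in> subl d \<and> y - m \<in> G"
    proof (rule ex1I[of _ "l - r (res d l)"])
      have "l - r (res d l) \<in> subl d" using res_eq_iff[of l "r (res d l)" d] r[OF c] l(1) by simp
      moreover have "y - (l - r (res d l)) \<in> G" unfolding mem using l(2) by (intro bexI[OF _ c]) simp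
      ultimately show "l - r (res d l) \<in> subl d \<and> y - (l - r (res d l)) \<in> G" by simp
    next
      fix m assume m: "m \<in> subl d \<and> y - m \<in> G"
      then obtain c where c: "c \<in> ?I" "y - (m + r c) \<in> ?F" unfolding mem by auto
      have m\<Lambda>: "m \<in> \<Lambda>" using m by (simp add: mem_subl)
      have "m + r c = l" using l(3) c r[OF c(1)] m\<Lambda> add by blast
      moreover have "res d (m + r c) = res d (r c)" using res_eq_iff[of "m + r c" "r c" d] m m\<Lambda> r[OF c(1)] add by auto
      ultimately have "res d l = c" using r[OF c(1)] by simp
      then show "m = l - r (res d l)" using \<open>m + r c = l\<close> by (simp add: eq_diff_eq)
    qed
  qed
  moreover have "countable (subl d)" "\<And>x. x \<in> subl d \<Longrightarrow> - x \<in> subl d"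
    using plane_lattice.countable[OF plane_lattice_subl[OF d]] plane_lattice.neg[OF plane_lattice_subl[OF d]] by auto
  ultimately have "lattice_det (subl d) = measure lebesgue G" by (intro lattice_det_eq)
  also have "\<dots> = (\<Sum>c\<in>?I. measure lebesgue ((+) (r c) ` ?F))" unfolding G_def
  proof (rule measure_UNION')
    show "pairwise (\<lambda>c c'. disjnt ((+) (r c) ` ?F) ((+) (r c') ` ?F)) ?I"
    proof (rule pairwiseI, rule ccontr)
      fix c c' assume h: "c \<in> ?I" "c' \<in> ?I" "c \<noteq> c'" "\<not> disjnt ((+) (r c) ` ?F) ((+) (r c') ` ?F)"
      then obtain y where "y \<in> (+) (r c) ` ?F" "y \<in> (+) (r c') ` ?F" by (auto simp: disjnt_def)
      then have "y - r c \<in> ?F" "y - r c' \<in> ?F" by (metis add_diff_cancel_left' imageE)+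
      then have "r c = r c'" using fd h r unfolding fundamental_domain_def by blast
      then show False using h r by metis
    qed
  qed (use finite_res[OF d] Fm measurable_translation in auto)
  also have "\<dots> = real (idx d) * measure lebesgue ?F" by (simp add: measure_translation idx_def)
  also have "measure lebesgue ?F = lattice_det \<Lambda>"
    using lattice_det_basis[OF uv gen] by (simp add: cell_measure)
  finally show ?thesis .
qed

lemma lattice_det_pos: "lattice_det \<Lambda> > 0"
proof -
  obtain u v where uv: "u \<in> \<Lambda>" "v \<in> \<Lambda>" "cross u v \<noteq> 0"
    and \<Lambda>: "\<Lambda> = {of_int m *\<^sub>R u + of_int n *\<^sub>R v | (m::int) (n::int). True}" by (rule basis)
  have "\<exists>m n::int. x = of_int m *\<^sub>R u + of_int n *\<^sub>R v" if "x \<in> \<Lambda>" for x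
    using that unfolding \<Lambda> by auto
  from lattice_det_basis[OF uv this] show ?thesis using uv by simp
qed

lemma rho_eq_idx: "vpos d \<Longrightarrow> rho \<Lambda> L d = real (idx d)"
  using lattice_det_subl[of d] lattice_det_pos by (simp add: rho_def)

text \<open>The Chinese remainder theorem: the residue vectors attained modulo \<open>d * e\<close>
  correspond to pairs of those attained modulo \<open>d\<close> and modulo \<open>e\<close>.\<close>

lemma idx_mult:
  assumes d: "vpos d" and e: "vpos e" and cop: "coprime (vprod d) (vprod e)"
  shows "idx (d * e) = idx d * idx e"
proof -
  let ?f = "\<lambda>z :: int^4. (\<chi> i. z $ i mod int (d $ i), \<chi> i. z $ i mod int (e $ i)) :: (int^4) \<times> (int^4)"
  have f: "?f (res (d * e) x) = (res d x, res e x)" for x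
    by (simp add: res_def vec_eq_iff mod_mod_cancel)
  have "bij_betw ?f (res (d * e) ` \<Lambda>) (res d ` \<Lambda> \<times> res e ` \<Lambda>)"
    unfolding bij_betw_def
  proof
    show "inj_on ?f (res (d * e) ` \<Lambda>)"
    proof (rule inj_onI)
      fix a b assume "a \<in> res (d * e) ` \<Lambda>" "b \<in> res (d * e) ` \<Lambda>" and eq: "?f a = ?f b"
      then obtain x y where x: "x \<in> \<Lambda>" "a = res (d * e) x" and y: "y \<in> \<Lambda>" "b = res (d * e) y" by blast
      have "res d x = res d y" "res e x = res e y" using eq f x y by auto
      then have s: "x - y \<in> subl d" "x - y \<in> subl e" using res_eq_iff x y by blast+
      have "int (d $ i * e $ i) dvd Lf i (x - y)" for i
      proof -
        have "coprime (int (d $ i)) (int (e $ i))"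
          using cop coprime_divisors[OF dvd_vprod dvd_vprod] by auto
        then show ?thesis using s by (simp add: mem_subl divides_mult)
      qed
      then have "x - y \<in> subl (d * e)" using s by (simp add: mem_subl)
      then show "a = b" using res_eq_iff x y by blast
    qed
    show "?f ` res (d * e) ` \<Lambda> = res d ` \<Lambda> \<times> res e ` \<Lambda>"
    proof
      show "?f ` res (d * e) ` \<Lambda> \<subseteq> res d ` \<Lambda> \<times> res e ` \<Lambda>" using f by auto
      show "res d ` \<Lambda> \<times> res e ` \<Lambda> \<subseteq> ?f ` res (d * e) ` \<Lambda>"
      proof
        fix ab assume "ab \<in> res d ` \<Lambda> \<times> res e ` \<Lambda>"
        then obtain x y where xy: "x \<in> \<Lambda>" "y \<in> \<Lambda>" "ab = (res d x, res e y)" by auto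
        have "coprime (int (vprod d)) (int (vprod e))" using cop by simp
        then obtain s t where st: "s * int (vprod d) + t * int (vprod e) = 1"
          using bezout_int[of "int (vprod d)" "int (vprod e)"] by auto
        \<comment> \<open>By Bezout the coefficients of \<open>x\<close> and \<open>y\<close> are 1
          and 0 modulo \<open>vprod d\<close>, and 0 and 1 modulo \<open>vprod e\<close>.\<close>
        define z where "z = of_int (t * int (vprod e)) *\<^sub>R x + of_int (s * int (vprod d)) *\<^sub>R y"
        have z: "z \<in> \<Lambda>" unfolding z_def by (intro add scale_int xy)
        have Lz: "Lf i z = t * int (vprod e) * Lf i x + s * int (vprod d) * Lf i y" for i
          unfolding z_def using xy by (simp only: Lf_add scale_int Lf_scale)
        have "int (d $ i) dvd Lf i (z - x)" for i
        proof -
          have *: "t * int (vprod e) = 1 - s * int (vprod d)" using st by simp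
          have "Lf i (z - x) = int (vprod d) * (s * (Lf i y - Lf i x))"
            unfolding Lf_diff[OF z xy(1)] Lz[of i] * by (simp add: algebra_simps)
          then show ?thesis using dvd_vprod[of d i] by (simp add: dvd_mult2)
        qed
        moreover have "int (e $ i) dvd Lf i (z - y)" for i
        proof -
          have *: "s * int (vprod d) = 1 - t * int (vprod e)" using st by simp
          have "Lf i (z - y) = int (vprod e) * (t * (Lf i x - Lf i y))"
            unfolding Lf_diff[OF z xy(2)] Lz[of i] * by (simp add: algebra_simps)
          then show ?thesis using dvd_vprod[of e i] by (simp add: dvd_mult2)
        qed
        ultimately have "res d z = res d x" "res e z = res e y"
          using res_eq_iff z xy by (simp_all add: mem_subl diff)
        then have "ab = ?f (res (d * e) z)" using f xy by simp
        then show "ab \<in> ?f ` res (d * e) ` \<Lambda>" using z by blast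
      qed
    qed
  qed
  then have "idx (d * e) = card (res d ` \<Lambda> \<times> res e ` \<Lambda>)"
    unfolding idx_def by (rule bij_betw_same_card)
  then show ?thesis by (simp add: card_cartesian_product idx_def)
qed

section \<open>Resultants and the bad primes\<close>

lemma rdet_nonzero:
  assumes "i \<noteq> j" shows "rdet (L $ i) (L $ j) \<noteq> 0"
proof
  assume z: "rdet (L $ i) (L $ j) = 0"
  have np: "\<And>i j t. i \<noteq> j \<Longrightarrow> L $ i \<noteq> t *s L $ j"
    using adm by (auto simp: admissible_def pairwise_nonproportional_def)
  have "L $ j \<noteq> 0" using np[of j i 0] assms by auto
  then consider "L $ j $ 1 \<noteq> 0" | "L $ j $ 2 \<noteq> 0" by (auto simp: vec_eq_iff forall_2)
  then show False
  proof cases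
    case 1
    then have "L $ i = (L $ i $ 1 / L $ j $ 1) *s L $ j"
      using z by (auto simp: vec_eq_iff forall_2 rdet_def field_simps)
    then show False using np assms by blast
  next
    case 2
    then have "L $ i = (L $ i $ 2 / L $ j $ 2) *s L $ j"
      using z by (auto simp: vec_eq_iff forall_2 rdet_def field_simps)
    then show False using np assms by blast
  qed
qed

lemma form_Delta_pos: "form_Delta L > 0"
proof -
  let ?r = "\<lambda>i j. form_resultant (integral_form (L $ i)) (integral_form (L $ j))"
  have set: "{(i, j). i \<noteq> j} = {(1,2),(2,1),(1,3),(3,1),(1,4),(4,1),(2,3),(3,2),(2,4),(4,2),(3,4),(4,3)::4\<times>4}"
    by (simp add: set_eq_iff forall_4)
  have sw: "?r j i = - ?r i j" for i j by (simp add: form_resultant_def)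
  have nz: "?r i j \<noteq> 0" if "i \<noteq> j" for i j
  proof -
    have "(of_int (?r i j) :: rat) \<noteq> 0"
      unfolding form_resultant_rdet using rdet_nonzero[OF that] form_denom(1) by simp
    then show ?thesis by simp
  qed
  have "form_Delta L = (?r 1 2 * ?r 1 3 * ?r 1 4 * ?r 2 3 * ?r 2 4 * ?r 3 4)\<^sup>2"
    unfolding form_Delta_def set
    by (simp add: sw[of 2 1] sw[of 3 1] sw[of 4 1] sw[of 3 2] sw[of 4 2] sw[of 4 3] power2_eq_square)
  then show ?thesis using nz by simp
qed

text \<open>\<Delta> times the lattice determinant, as a natural number; the determinant is an
  integer because the lattice is integral. Outside the divisors of this number every prime is
  good.\<close>

definition bad :: nat where
  "bad = nat (form_Delta L * \<lfloor>lattice_det \<Lambda>\<rfloor>)"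

lemma cross_int: "x \<in> \<Lambda> \<Longrightarrow> y \<in> \<Lambda> \<Longrightarrow> cross x y \<in> \<int>"
  unfolding cross_def by (intro Ints_diff Ints_mult) (use int in \<open>auto simp: integral_points_def\<close>)

text \<open>\<open>E\<close> is the determinant of the pair of forms on a basis of
  \<open>\<Lambda>\<close>. Times the two denominators it is, up to sign, the resultant times the
  lattice determinant, so it divides \<open>bad\<close>. The points \<open>x1\<close> and
  \<open>x2\<close> come from the adjugate matrix, which the pair of forms maps to \<open>E\<close>
  times the unit vectors.\<close>

lemma form_det_bad:
  assumes ij: "i \<noteq> j"
  obtains E x1 x2 where "E \<noteq> 0" "E dvd int bad" "x1 \<in> \<Lambda>" "x2 \<in> \<Lambda>" "real bad = of_int (form_Delta L) * lattice_det \<Lambda>"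
    "Lf i x1 = E" "Lf j x1 = 0" "Lf i x2 = 0" "Lf j x2 = E"
proof -
  obtain u v where uv: "u \<in> \<Lambda>" "v \<in> \<Lambda>" "cross u v \<noteq> 0"
    and \<Lambda>: "\<Lambda> = {of_int m *\<^sub>R u + of_int n *\<^sub>R v | (m::int) (n::int). True}" by (rule basis)
  have "\<exists>m n::int. x = of_int m *\<^sub>R u + of_int n *\<^sub>R v" if "x \<in> \<Lambda>" for x
    using that unfolding \<Lambda> by auto
  from lattice_det_basis[OF uv this] have det: "lattice_det \<Lambda> = \<bar>cross u v\<bar>" .
  obtain N where N: "cross u v = of_int N" using cross_int[OF uv(1,2)] by (auto elim: Ints_cases)
  have ld: "lattice_det \<Lambda> = of_int \<bar>N\<bar>" using N det by simp
  then have fl: "\<lfloor>lattice_det \<Lambda>\<rfloor> = \<bar>N\<bar>" by (simp only: floor_of_int)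
  have ib: "int bad = form_Delta L * \<bar>N\<bar>" unfolding bad_def fl using form_Delta_pos by simp
  have "real bad = of_int (int bad)" by simp
  then have rb: "real bad = of_int (form_Delta L) * lattice_det \<Lambda>" unfolding ib ld by simp
  define E where "E = Lf i u * Lf j v - Lf i v * Lf j u"
  define c where "c = form_denom (L $ i) * form_denom (L $ j)"
  define R where "R = form_resultant (integral_form (L $ i)) (integral_form (L $ j))"
  have "of_int E = (of_rat (rdet (L $ i) (L $ j)) :: real) * of_int N"
    using lform_cross[of "L $ i" u "L $ j" v] by (simp add: E_def Lf uv N)
  then have "of_int (E * int c) = (of_rat (of_nat c * rdet (L $ i) (L $ j)) :: real) * of_int N"
    by (simp add: of_rat_mult)
  also have "of_nat c * rdet (L $ i) (L $ j) = of_int R"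
    unfolding c_def R_def form_resultant_rdet ..
  finally have "of_int (E * int c) = (of_int (R * N) :: real)" by simp
  then have EcRN: "E * int c = R * N" by (simp only: of_int_eq_iff)
  have "R \<noteq> 0"
  proof -
    have "(of_int R :: rat) \<noteq> 0"
      unfolding R_def form_resultant_rdet using rdet_nonzero[OF ij] form_denom(1) by simp
    then show ?thesis by simp
  qed
  then have E0: "E \<noteq> 0" using EcRN N uv(3) by auto
  have "R dvd form_Delta L"
  proof -
    let ?r = "\<lambda>(i, j). form_resultant (integral_form (L $ i)) (integral_form (L $ j))"
    have "?r (i, j) dvd prod ?r {(i, j). i \<noteq> j}" using ij by (intro dvd_prodI) auto
    then show ?thesis by (simp add: R_def form_Delta_def)
  qed
  then have "R * N dvd int bad" unfolding ib by (intro mult_dvd_mono) auto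
  then have Eb: "E dvd int bad" using EcRN by (metis dvd_trans dvd_triv_left)
  define x1 where "x1 = of_int (Lf j v) *\<^sub>R u + of_int (- Lf j u) *\<^sub>R v"
  define x2 where "x2 = of_int (- Lf i v) *\<^sub>R u + of_int (Lf i u) *\<^sub>R v"
  have x: "x1 \<in> \<Lambda>" "x2 \<in> \<Lambda>" unfolding x1_def x2_def by (intro add scale_int uv)+
  have L1: "Lf k x1 = Lf j v * Lf k u + (- Lf j u) * Lf k v" for k
    unfolding x1_def using uv by (simp only: Lf_add scale_int Lf_scale)
  have L2: "Lf k x2 = (- Lf i v) * Lf k u + Lf i u * Lf k v" for k
    unfolding x2_def using uv by (simp only: Lf_add scale_int Lf_scale)
  show ?thesis
    by (rule that[OF E0 Eb x rb]) (simp_all add: L1 L2 E_def algebra_simps)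
qed

lemma bad_eq: "real bad = of_int (form_Delta L) * lattice_det \<Lambda>"
  by (rule form_det_bad[of 1 2]) auto

lemma bad_pos: "bad > 0"
  using bad_eq form_Delta_pos lattice_det_pos by (metis mult_pos_pos of_int_0_less_iff of_nat_0_less_iff)

text \<open>A combination of \<open>x1\<close> and \<open>x2\<close> with coefficients
  \<open>s\<close> and \<open>t\<close> has the values \<open>s * E\<close> and
  \<open>t * E\<close>, and \<open>E\<close> contains \<open>p\<close> at most
  \<open>multiplicity p bad\<close> times. So different residues of \<open>s\<close> and
  \<open>t\<close> modulo the remaining powers of \<open>p\<close> give different cosets.\<close>

lemma idx_prime_power_ge:
  assumes p: "prime p" and ij: "i \<noteq> j"
  shows "p ^ ((k $ i - multiplicity p bad) + (k $ j - multiplicity p bad)) \<le> idx (\<chi> i. p ^ (k $ i))"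
proof -
  let ?w = "multiplicity p bad" and ?d = "\<chi> i. p ^ (k $ i) :: nat^4"
  obtain E x1 x2 where E: "E \<noteq> 0" "E dvd int bad" and x: "x1 \<in> \<Lambda>" "x2 \<in> \<Lambda>"
    and L: "Lf i x1 = E" "Lf j x1 = 0" "Lf i x2 = 0" "Lf j x2 = E" by (rule form_det_bad[OF ij])
  have d: "vpos ?d" using p by (simp add: vpos_def prime_gt_0_nat)
  have mE: "multiplicity (int p) E \<le> ?w"
  proof -
    have "multiplicity (int p) E \<le> multiplicity (int p) (int bad)"
      using E bad_pos by (intro dvd_imp_multiplicity_le) auto
    moreover have "multiplicity (int p) (int bad) \<le> ?w"
    proof (rule multiplicity_geI)
      have "int (p ^ multiplicity (int p) (int bad)) dvd int bad" by (simp add: multiplicity_dvd)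
      then show "p ^ multiplicity (int p) (int bad) dvd bad" by (simp only: int_dvd_int_iff)
    qed (use bad_pos p not_prime_unit[of p] in auto)
    ultimately show ?thesis by simp
  qed
  let ?A = "{0..<int (p ^ (k $ i - ?w))} \<times> {0..<int (p ^ (k $ j - ?w))}"
  let ?z = "\<lambda>(s, t). of_int s *\<^sub>R x1 + of_int t *\<^sub>R x2"
  have z\<Lambda>: "?z st \<in> \<Lambda>" for st by (cases st) (auto intro!: add scale_int x)
  have Lz: "Lf i (?z (s, t)) = s * E" "Lf j (?z (s, t)) = t * E" for s t
    using x L by (simp_all add: Lf_add scale_int Lf_scale)
  have small: "s = s'" if h: "s \<in> {0..<int (p ^ m)}" "s' \<in> {0..<int (p ^ m)}" "int (p ^ m) dvd s - s'" for s s' m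
    using h by (metis atLeastLessThan_iff mod_eq_dvd_iff mod_pos_pos_trivial)
  have "inj_on (\<lambda>st. res ?d (?z st)) ?A"
  proof (rule inj_onI)
    fix a b assume a: "a \<in> ?A" and b: "b \<in> ?A" and eq: "res ?d (?z a) = res ?d (?z b)"
    obtain s t s' t' where ab: "a = (s, t)" "b = (s', t')" by fastforce
    have sub: "?z a - ?z b \<in> subl ?d" using eq res_eq_iff z\<Lambda> by blast
    have "int (p ^ (k $ i)) dvd (s - s') * E" "int (p ^ (k $ j)) dvd (t - t') * E"
    proof -
      have "int (?d $ i) dvd Lf i (?z a - ?z b)" "int (?d $ j) dvd Lf j (?z a - ?z b)"
        using sub unfolding mem_subl by blast+
      then show "int (p ^ (k $ i)) dvd (s - s') * E" "int (p ^ (k $ j)) dvd (t - t') * E"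
        unfolding ab Lf_diff[OF z\<Lambda> z\<Lambda>] Lz by (simp_all add: algebra_simps)
    qed
    from this[THEN prime_power_dvd_cancel[OF p E(1) mE]]
    have "s = s'" "t = t'" using a b small unfolding ab by blast+
    then show "a = b" by (simp add: ab)
  qed
  then have "card ?A = card ((\<lambda>st. res ?d (?z st)) ` ?A)" by (simp add: card_image)
  also have "\<dots> \<le> idx ?d" unfolding idx_def
    by (intro card_mono finite_res d) (use z\<Lambda> in blast)
  finally show ?thesis by (simp add: card_cartesian_product power_add nat_power_eq)
qed

end

section \<open>Lattice points in divisor sublattices on average\<close>

text \<open>The product is at most the fourth power of its largest factor; as the factors are at
  least 1, this also holds for fewer than four of them.\<close>

lemma prod4_le_sum_pow4:
  fixes a :: "4 \<Rightarrow> real"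
  assumes nn: "\<And>i. i \<in> S \<Longrightarrow> a i \<ge> 1" and S: "S \<noteq> {}"
  shows "(\<Prod>i\<in>S. a i) \<le> (\<Sum>i\<in>S. a i ^ 4)"
proof -
  have fin: "finite S" by simp
  have "Max (a ` S) \<in> a ` S" using S fin by (intro Max_in) auto
  then obtain j where j: "j \<in> S" "Max (a ` S) = a j" by auto
  have le: "a i \<le> a j" if "i \<in> S" for i using that fin j(2) by (metis Max_ge finite_imageI imageI)
  have "(\<Prod>i\<in>S. a i) \<le> (\<Prod>i\<in>S. a j)" using nn le by (intro prod_mono) (auto intro: order_trans[OF zero_le_one])
  also have "\<dots> = a j ^ card S" by simp
  also have "\<dots> \<le> a j ^ 4"
    using nn[OF j(1)] card_mono[of "UNIV :: 4 set" S] by (intro power_increasing) auto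
  also have "\<dots> \<le> (\<Sum>i\<in>S. a i ^ 4)"
    by (rule member_le_sum[OF j(1)]) (use nn in \<open>auto intro: order_trans[OF zero_le_one]\<close>)
  finally show ?thesis .
qed

lemma lform_bound:
  "\<bar>lform a x\<bar> \<le> (\<bar>of_rat (a $ 1)\<bar> + \<bar>of_rat (a $ 2)\<bar>) * norm x"
proof -
  have "\<bar>lform a x\<bar> \<le> \<bar>of_rat (a $ 1)\<bar> * \<bar>x $ 1\<bar> + \<bar>of_rat (a $ 2)\<bar> * \<bar>x $ 2\<bar>"
    unfolding lform_2 by (rule order_trans[OF abs_triangle_ineq]) (simp add: abs_mult)
  also have "\<dots> \<le> \<bar>of_rat (a $ 1)\<bar> * norm x + \<bar>of_rat (a $ 2)\<bar> * norm x"
    by (intro add_mono mult_left_mono component_le_norm_cart) auto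
  finally show ?thesis by (simp add: algebra_simps)
qed

definition tauf :: "int \<Rightarrow> real" where
  "tauf n = real (tau (nat \<bar>n\<bar>))"

lemma tauf_ge1: "n \<noteq> 0 \<Longrightarrow> tauf n \<ge> 1"
  using tau_pos[of "nat \<bar>n\<bar>"] by (simp add: tauf_def)

definition dbox :: "(4 \<Rightarrow> real) \<Rightarrow> (nat^4) set" where
  "dbox D = {d. \<forall>i. d $ i \<in> {n. 0 < n \<and> real n \<le> D i}}"

lemma finite_dbox_coord: "finite {n. 0 < n \<and> real n \<le> (x::real)}"
  by (rule finite_subset[of _ "{..nat \<lfloor>x\<rfloor>}"]) (auto intro: le_nat_floor)

lemma finite_dbox: "finite (dbox D)"
  unfolding dbox_def by (intro finite_vec_set finite_dbox_coord)

lemma dbox_pos: "d \<in> dbox D \<Longrightarrow> vpos d"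
  by (simp add: dbox_def vpos_def)

lemma card_dbox_coord: "x \<ge> 0 \<Longrightarrow> real (card {n. 0 < n \<and> real n \<le> x}) \<le> x"
proof -
  assume x: "x \<ge> 0"
  have "card {n. 0 < n \<and> real n \<le> x} \<le> card {1..nat \<lfloor>x\<rfloor>}"
    by (rule card_mono) (auto intro: le_nat_floor)
  also have "real (card {1..nat \<lfloor>x\<rfloor>}) \<le> x" using x by (simp add: of_nat_floor)
  finally show ?thesis by (simp add: of_nat_mono order_trans)
qed

lemma card_dbox: "(\<And>i. D i \<ge> 0) \<Longrightarrow> real (card (dbox D)) \<le> (\<Prod>i\<in>UNIV. D i)"
  unfolding dbox_def by (subst card_vec_set) (auto intro!: finite_dbox_coord prod_mono card_dbox_coord)

lemma vprod_dbox: "d \<in> dbox D \<Longrightarrow> real (vprod d) \<le> (\<Prod>i\<in>UNIV. D i)"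
  unfolding vprod_def dbox_def of_nat_prod by (intro prod_mono) auto

context adm begin

definition cL :: real where
  "cL = 1 + (\<Sum>i\<in>UNIV. \<bar>of_rat (L $ i $ 1)\<bar> + \<bar>of_rat (L $ i $ 2)\<bar>)"

lemma cL_ge1: "cL \<ge> 1"
  unfolding cL_def by (simp add: sum_nonneg)

lemma Lf_bound: "x \<in> \<Lambda> \<Longrightarrow> \<bar>of_int (Lf i x)\<bar> \<le> cL * norm x"
proof -
  assume x: "x \<in> \<Lambda>"
  have "\<bar>of_rat (L $ i $ 1)\<bar> + \<bar>of_rat (L $ i $ 2)\<bar> \<le> (\<Sum>i\<in>UNIV. \<bar>of_rat (L $ i $ 1)\<bar> + \<bar>of_rat (L $ i $ 2)\<bar> :: real)"
    by (rule member_le_sum) auto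
  then have "\<bar>of_rat (L $ i $ 1)\<bar> + \<bar>of_rat (L $ i $ 2)\<bar> \<le> cL" by (simp add: cL_def)
  then have "(\<bar>of_rat (L $ i $ 1)\<bar> + \<bar>of_rat (L $ i $ 2)\<bar>) * norm x \<le> cL * norm x" by (intro mult_right_mono) auto
  then show ?thesis using lform_bound[of "L $ i" x] Lf[OF x, of i] by simp
qed

lemma Lf_two_zero:
  assumes x: "x \<in> \<Lambda>" and ij: "i \<noteq> j" and z: "Lf i x = 0" "Lf j x = 0"
  shows "x = 0"
proof -
  have l: "lform (L $ i) x = 0" "lform (L $ j) x = 0" using Lf[OF x, of i] Lf[OF x, of j] z by auto
  have "cross x y = 0" for y
    using lform_cross[of "L $ i" x "L $ j" y] rdet_nonzero[OF ij] l by simp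
  from this[of "\<chi> i. if i = 1 then 0 else 1"] this[of "\<chi> i. if i = 1 then 1 else 0"]
  show ?thesis by (simp add: cross_def vec_eq_iff forall_2)
qed

definition ball\<Lambda> :: "real \<Rightarrow> (real^2) set" where
  "ball\<Lambda> M = {x \<in> \<Lambda>. x \<noteq> 0 \<and> norm x \<le> M}"

lemma finite_ball\<Lambda>: "finite (ball\<Lambda> M)"
proof -
  have "ball\<Lambda> M \<subseteq> \<Lambda> \<inter> cball 0 M" by (auto simp: ball\<Lambda>_def)
  then show ?thesis by (rule finite_subset) (rule finite_bounded, simp)
qed

text \<open>On a fibre of the form one integral coordinate determines the other, and it has at most
  \<open>2 * M + 1\<close> values.\<close>

lemma fiber_card:
  assumes M: "M \<ge> 1"
  shows "real (card {x \<in> ball\<Lambda> M. Lf i x = n}) \<le> 3 * M"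
proof -
  have "L $ i \<noteq> 0"
  proof
    assume z: "L $ i = 0"
    obtain j where "j \<noteq> i"
    proof (cases "i = 1")
      case True then show ?thesis using that[of 2] by simp
    next
      case False then show ?thesis using that[of 1] by simp
    qed
    from rdet_nonzero[OF this[symmetric]] show False using z by (simp add: rdet_def)
  qed
  then obtain k k' :: 2 where k: "L $ i $ k \<noteq> 0" "UNIV = {k, k'}" "k \<noteq> k'"
  proof -
    have "L $ i $ 1 \<noteq> 0 \<or> L $ i $ 2 \<noteq> 0" using \<open>L $ i \<noteq> 0\<close> by (auto simp: vec_eq_iff forall_2)
    then show ?thesis
    proof
      assume "L $ i $ 1 \<noteq> 0"
      then show ?thesis using that[of 1 2] UNIV_2 by simp
    next
      assume "L $ i $ 2 \<noteq> 0"
      then show ?thesis using that[of 2 1] UNIV_2 by (simp add: insert_commute)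
    qed
  qed
  let ?A = "{x \<in> ball\<Lambda> M. Lf i x = n}"
  have lf: "lform (L $ i) x = of_rat (L $ i $ k) * x $ k + of_rat (L $ i $ k') * x $ k'" for x
    unfolding lform_def k(2) using k(3) by simp
  have int: "x $ l \<in> \<int>" if "x \<in> ?A" for x l using that int by (auto simp: ball\<Lambda>_def integral_points_def)
  have "inj_on (\<lambda>x. \<lfloor>x $ k'\<rfloor>) ?A"
  proof (rule inj_onI)
    fix x y assume x: "x \<in> ?A" and y: "y \<in> ?A" and e: "\<lfloor>x $ k'\<rfloor> = \<lfloor>y $ k'\<rfloor>"
    obtain z z' where z: "x $ k' = of_int z" "y $ k' = of_int z'"
      using int[OF x, of k'] int[OF y, of k'] by (meson Ints_cases)
    then have "x $ k' = y $ k'" using e by simp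
    moreover have "lform (L $ i) x = lform (L $ i) y" using x y Lf[of x i] Lf[of y i] by (auto simp: ball\<Lambda>_def)
    ultimately have "x $ k = y $ k" using k(1) unfolding lf by simp
    have "x $ l = y $ l" for l
    proof -
      have "l = k \<or> l = k'" using k(2) by blast
      then show ?thesis using \<open>x $ k = y $ k\<close> \<open>x $ k' = y $ k'\<close> by blast
    qed
    then show "x = y" by (simp add: vec_eq_iff)
  qed
  moreover have "(\<lambda>x. \<lfloor>x $ k'\<rfloor>) ` ?A \<subseteq> {-\<lfloor>M\<rfloor>..\<lfloor>M\<rfloor>}"
  proof clarsimp
    fix x assume x: "x \<in> ball\<Lambda> M" "n = Lf i x"
    have a: "\<bar>x $ k'\<bar> \<le> M" using component_le_norm_cart[of x k'] x by (auto simp: ball\<Lambda>_def)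
    obtain z where z: "x $ k' = of_int z" using int[of x k'] x by (auto elim: Ints_cases)
    have "\<bar>z\<bar> \<le> \<lfloor>M\<rfloor>" using a unfolding z by (simp add: le_floor_iff)
    then show "- \<lfloor>M\<rfloor> \<le> \<lfloor>x $ k'\<rfloor> \<and> \<lfloor>x $ k'\<rfloor> \<le> \<lfloor>M\<rfloor>" unfolding z by auto
  qed
  ultimately have "card ?A \<le> card {-\<lfloor>M\<rfloor>..\<lfloor>M\<rfloor>}" by (rule card_inj_on_le) simp
  also have "\<dots> = nat (2 * \<lfloor>M\<rfloor> + 1)" by simp
  also have "real (nat (2 * \<lfloor>M\<rfloor> + 1)) = 2 * of_int \<lfloor>M\<rfloor> + 1" using M by simp
  also have "\<dots> \<le> 3 * M" using M of_int_floor_le[of M] by linarith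
  finally show ?thesis by simp
qed

text \<open>As \<open>\<bar>Lf j x\<bar> \<le> cL * norm x\<close>, the weight
  \<open>1 / norm x\<close> is at most \<open>cL / n\<close> for
  \<open>n = \<bar>Lf j x\<bar>\<close>. Grouping by \<open>n\<close>, where the values
  \<open>n\<close> and \<open>- n\<close> give the factor 2, leaves a moment of \<open>tau\<close>
  with weight \<open>1 / n\<close>.\<close>

lemma sum_tauf_generic:
  assumes M: "M \<ge> 1" and W: "W \<subseteq> ball\<Lambda> M" "\<And>x. x \<in> W \<Longrightarrow> Lf j x \<noteq> 0"
    and fib: "\<And>n. n \<noteq> 0 \<Longrightarrow> real (card {x \<in> W. Lf j x = n}) \<le> B"
  shows "(\<Sum>x\<in>W. tauf (Lf j x) ^ k / norm x) \<le> 2 * cL * B * (1 + ln (cL * M)) ^ (2 ^ k)"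
proof -
  have finW: "finite W" using W(1) finite_ball\<Lambda> finite_subset by blast
  define N where "N = nat \<lfloor>cL * M\<rfloor>"
  have cM: "cL * M \<ge> 1" using cL_ge1 M mult_mono[of 1 cL 1 M] by simp
  have N1: "N \<ge> 1" unfolding N_def using cM by (simp add: le_nat_floor)
  have NM: "real N \<le> cL * M" unfolding N_def using cM by (simp add: of_nat_floor)
  let ?g = "\<lambda>x. nat \<bar>Lf j x\<bar>"
  have g: "?g x \<in> {1..N}" if "x \<in> W" for x
  proof -
    have x: "x \<in> \<Lambda>" "norm x \<le> M" using that W(1) by (auto simp: ball\<Lambda>_def)
    have "\<bar>of_int (Lf j x)\<bar> \<le> cL * M"
      using Lf_bound[OF x(1), of j] mult_left_mono[OF x(2), of cL] cL_ge1 by linarith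
    then have "real (?g x) \<le> cL * M" by simp
    then have "?g x \<le> N" unfolding N_def by (rule le_nat_floor)
    moreover have "?g x \<ge> 1" using W(2)[OF that] by simp
    ultimately show ?thesis by simp
  qed
  have B0: "B \<ge> 0" using order_trans[OF of_nat_0_le_iff fib[of 1]] by simp
  have trm: "tauf (Lf j x) ^ k / norm x \<le> cL * (real (tau (?g x)) ^ k / real (?g x))" if x: "x \<in> W" for x
  proof -
    have x': "x \<in> \<Lambda>" "x \<noteq> 0" using x W(1) by (auto simp: ball\<Lambda>_def)
    have g0: "real (?g x) > 0" using W(2)[OF x] by simp
    have "real (?g x) \<le> cL * norm x" using Lf_bound[OF x'(1), of j] by simp
    then have "1 / norm x \<le> cL / real (?g x)" using g0 x'(2) by (simp add: field_simps)
    then have "real (tau (?g x)) ^ k * (1 / norm x) \<le> real (tau (?g x)) ^ k * (cL / real (?g x))"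
      by (intro mult_left_mono) auto
    then show ?thesis by (simp add: tauf_def mult.commute)
  qed
  have fibn: "real (card {x \<in> W. ?g x = n}) \<le> 2 * B" if "n \<in> {1..N}" for n
  proof -
    have "{x \<in> W. ?g x = n} \<subseteq> {x \<in> W. Lf j x = int n} \<union> {x \<in> W. Lf j x = - int n}" by auto
    then have "card {x \<in> W. ?g x = n} \<le> card ({x \<in> W. Lf j x = int n} \<union> {x \<in> W. Lf j x = - int n})"
      using finW by (intro card_mono) auto
    also have "\<dots> \<le> card {x \<in> W. Lf j x = int n} + card {x \<in> W. Lf j x = - int n}" by (rule card_Un_le)
    finally show ?thesis using fib[of "int n"] fib[of "- int n"] that by simp
  qed
  have "(\<Sum>x\<in>W. tauf (Lf j x) ^ k / norm x) \<le> (\<Sum>x\<in>W. cL * (real (tau (?g x)) ^ k / real (?g x)))"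
    by (intro sum_mono trm)
  also have "\<dots> = (\<Sum>n\<in>{1..N}. \<Sum>x\<in>{x\<in>W. ?g x = n}. cL * (real (tau (?g x)) ^ k / real (?g x)))"
    by (rule sum.group[symmetric]) (use finW g in auto)
  also have "\<dots> = (\<Sum>n\<in>{1..N}. real (card {x\<in>W. ?g x = n}) * (cL * (real (tau n) ^ k / real n)))"
    by (intro sum.cong refl) simp
  also have "\<dots> \<le> (\<Sum>n\<in>{1..N}. 2 * B * (cL * (real (tau n) ^ k / real n)))"
    using cL_ge1 by (intro sum_mono mult_right_mono fibn) auto
  also have "\<dots> = 2 * cL * B * (\<Sum>n = 1..N. real (tau n) ^ k / real n)"
    by (simp add: sum_distrib_left algebra_simps)
  also have "\<dots> \<le> 2 * cL * B * (\<Sum>n = 1..N. 1 / real n) ^ (2 ^ k)"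
    using cL_ge1 B0 by (intro mult_left_mono sum_tau_power_div) auto
  also have "\<dots> \<le> 2 * cL * B * (1 + ln (cL * M)) ^ (2 ^ k)"
  proof (intro mult_left_mono power_mono)
    have "(\<Sum>n = 1..N. 1 / real n) \<le> 1 + ln (real N)" by (rule sum_inverse_le_ln[OF N1])
    also have "ln (real N) \<le> ln (cL * M)" using N1 NM cM by (subst ln_le_cancel_iff) auto
    finally show "(\<Sum>n = 1..N. 1 / real n) \<le> 1 + ln (cL * M)" by simp
  qed (use cL_ge1 B0 in \<open>auto intro: sum_nonneg\<close>)
  finally show ?thesis .
qed

lemma sum_tauf:
  assumes M: "M \<ge> 1"
  shows "(\<Sum>x\<in>{x \<in> ball\<Lambda> M. Lf j x \<noteq> 0}. tauf (Lf j x) ^ k / norm x) \<le> 6 * cL * M * (1 + ln (cL * M)) ^ (2 ^ k)"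
proof -
  let ?W = "{x \<in> ball\<Lambda> M. Lf j x \<noteq> 0}"
  have "real (card {x \<in> ?W. Lf j x = n}) \<le> 3 * M" if "n \<noteq> 0" for n
  proof -
    have "{x \<in> ?W. Lf j x = n} = {x \<in> ball\<Lambda> M. Lf j x = n}" using that by auto
    then show ?thesis using fiber_card[OF M, of j n] by simp
  qed
  then have "(\<Sum>x\<in>?W. tauf (Lf j x) ^ k / norm x) \<le> 2 * cL * (3 * M) * (1 + ln (cL * M)) ^ (2 ^ k)"
    by (intro sum_tauf_generic[OF M]) auto
  then show ?thesis by simp
qed

text \<open>On the line where form \<open>i\<close> vanishes, form \<open>j\<close> is injective.
  The fibres then have at most one point, which saves the factor \<open>M\<close>; this makes up for
  the trivial count of the divisors of 0.\<close>

lemma sum_tauf_line: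
  assumes M: "M \<ge> 1" and ij: "i \<noteq> j"
  shows "(\<Sum>x\<in>{x \<in> ball\<Lambda> M. Lf i x = 0}. tauf (Lf j x) ^ k / norm x) \<le> 2 * cL * (1 + ln (cL * M)) ^ (2 ^ k)"
proof -
  let ?W = "{x \<in> ball\<Lambda> M. Lf i x = 0}"
  have "real (card {x \<in> ?W. Lf j x = n}) \<le> 1" if "n \<noteq> 0" for n
  proof -
    have "x = y" if "x \<in> {x \<in> ?W. Lf j x = n}" "y \<in> {x \<in> ?W. Lf j x = n}" for x y
    proof -
      have xy: "x \<in> \<Lambda>" "y \<in> \<Lambda>" "Lf i x = 0" "Lf i y = 0" "Lf j x = Lf j y" using that by (auto simp: ball\<Lambda>_def)
      then have "Lf i (x - y) = 0" "Lf j (x - y) = 0" by (simp_all add: Lf_diff)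
      then have "x - y = 0" by (rule Lf_two_zero[OF diff[OF xy(1,2)] ij])
      then show ?thesis by simp
    qed
    then have "card {x \<in> ?W. Lf j x = n} \<le> 1" by (simp add: card_le_Suc0_iff_eq finite_ball\<Lambda>)
    then show ?thesis by simp
  qed
  moreover have "Lf j x \<noteq> 0" if "x \<in> ?W" for x
    using that Lf_two_zero[of x i j] ij by (auto simp: ball\<Lambda>_def)
  ultimately show ?thesis using sum_tauf_generic[OF M, of ?W j 1 k] by simp
qed

definition fcount :: "(4 \<Rightarrow> real) \<Rightarrow> real^2 \<Rightarrow> real" where
  "fcount D x = real (card {d \<in> dbox D. x \<in> subl d})"

lemma fcount_prod:
  assumes x: "x \<in> \<Lambda>" and c: "\<And>i. real (card {n. 0 < n \<and> real n \<le> D i \<and> int n dvd Lf i x}) \<le> c i"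
  shows "fcount D x \<le> (\<Prod>i\<in>UNIV. c i)"
proof -
  let ?A = "\<lambda>i. {n. 0 < n \<and> real n \<le> D i \<and> int n dvd Lf i x}"
  have finA: "finite (?A i)" for i by (rule finite_subset[OF _ finite_dbox_coord[of "D i"]]) auto
  have "{d \<in> dbox D. x \<in> subl d} = {d. \<forall>i. d $ i \<in> ?A i}" using x by (auto simp: dbox_def mem_subl)
  then have "fcount D x = (\<Prod>i\<in>UNIV. real (card (?A i)))"
    unfolding fcount_def by (simp only: card_vec_set[OF finA] of_nat_prod)
  also have "\<dots> \<le> (\<Prod>i\<in>UNIV. c i)" by (intro prod_mono) (use c in auto)
  finally show ?thesis .
qed

lemma card_le_tauf:
  assumes "z \<noteq> 0" shows "real (card {n. 0 < n \<and> real n \<le> y \<and> int n dvd z}) \<le> tauf z"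
proof -
  have "{n. 0 < n \<and> real n \<le> y \<and> int n dvd z} \<subseteq> {n. n dvd nat \<bar>z\<bar>}"
    using nat_abs_dvd_iff by (auto simp: int_dvd_int_iff[symmetric] simp del: int_dvd_int_iff)
  then have "card {n. 0 < n \<and> real n \<le> y \<and> int n dvd z} \<le> tau (nat \<bar>z\<bar>)"
    unfolding tau_def using assms by (intro card_mono finite_divisors) auto
  then show ?thesis by (simp add: tauf_def)
qed

lemma fcount_nonzero:
  assumes x: "x \<in> \<Lambda>" and nz: "\<And>i. Lf i x \<noteq> 0"
  shows "fcount D x \<le> (\<Sum>i\<in>UNIV. tauf (Lf i x) ^ 4)"
proof -
  have "fcount D x \<le> (\<Prod>i\<in>UNIV. tauf (Lf i x))"
    by (intro fcount_prod x card_le_tauf nz)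
  also have "\<dots> \<le> (\<Sum>i\<in>UNIV. tauf (Lf i x) ^ 4)"
    by (rule prod4_le_sum_pow4) (auto simp: tauf_ge1 nz)
  finally show ?thesis .
qed

text \<open>Everything divides a vanishing value, so the coordinate \<open>i\<close> is only bounded
  by the side \<open>Mx\<close> of the box. The other three values are nonzero, because two forms
  vanish together only at 0.\<close>

lemma fcount_zero:
  assumes x: "x \<in> \<Lambda>" "x \<noteq> 0" and z: "Lf i x = 0" and D: "\<And>i. 0 \<le> D i" "\<And>i. D i \<le> Mx"
  shows "fcount D x \<le> Mx * (\<Sum>j\<in>- {i}. tauf (Lf j x) ^ 4)"
proof -
  have nz: "Lf j x \<noteq> 0" if "j \<noteq> i" for j using Lf_two_zero[OF x(1), of i j] x(2) z that by auto
  have "fcount D x \<le> (\<Prod>j\<in>UNIV. if j = i then Mx else tauf (Lf j x))"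
  proof (rule fcount_prod[OF x(1)])
    fix j
    show "real (card {n. 0 < n \<and> real n \<le> D j \<and> int n dvd Lf j x}) \<le> (if j = i then Mx else tauf (Lf j x))"
    proof (cases "j = i")
      case True
      have "card {n. 0 < n \<and> real n \<le> D j \<and> int n dvd Lf j x} \<le> card {n. 0 < n \<and> real n \<le> D j}"
        by (intro card_mono finite_dbox_coord) auto
      also have "real \<dots> \<le> Mx" using card_dbox_coord[OF D(1)[of j]] D(2)[of j] by linarith
      finally show ?thesis using True by (simp add: of_nat_mono)
    next
      case False then show ?thesis using card_le_tauf[OF nz[OF False]] by simp
    qed
  qed
  also have "\<dots> = Mx * (\<Prod>j\<in>- {i}. tauf (Lf j x))"
    by (subst prod.remove[of UNIV i]) (auto simp: Compl_eq_Diff_UNIV intro!: prod.cong)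
  also have "\<dots> \<le> Mx * (\<Sum>j\<in>- {i}. tauf (Lf j x) ^ 4)"
  proof (rule mult_left_mono)
    have "- {i} \<noteq> {}"
    proof (cases "i = 1")
      case True then have "2 \<in> - {i}" by simp then show ?thesis by blast
    next
      case False then have "1 \<in> - {i}" by simp then show ?thesis by blast
    qed
    then show "(\<Prod>j\<in>- {i}. tauf (Lf j x)) \<le> (\<Sum>j\<in>- {i}. tauf (Lf j x) ^ 4)"
      by (intro prod4_le_sum_pow4) (auto simp: tauf_ge1 nz)
    show "0 \<le> Mx" using D[of i] by linarith
  qed
  finally show ?thesis .
qed

lemma sum_fcount_zero:
  assumes M: "M \<ge> 1" and D: "\<And>i. 0 \<le> D i" "\<And>i. D i \<le> Mx"
  shows "(\<Sum>x\<in>{x \<in> ball\<Lambda> M. \<exists>i. Lf i x = 0}. fcount D x / norm x) \<le> 24 * cL * Mx * (1 + ln (cL * M)) ^ 16"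
proof -
  have Mx: "Mx \<ge> 0" using D[of 1] by linarith
  let ?Z = "\<lambda>i. {x \<in> ball\<Lambda> M. Lf i x = 0}"
  have fin: "finite (?Z i)" for i using finite_ball\<Lambda> by simp
  have un: "{x \<in> ball\<Lambda> M. \<exists>i. Lf i x = 0} = (\<Union>i\<in>UNIV. ?Z i)" by auto
  have f0: "fcount D x / norm x \<ge> 0" for x by (simp add: fcount_def)
  have "(\<Sum>x\<in>{x \<in> ball\<Lambda> M. \<exists>i. Lf i x = 0}. fcount D x / norm x) = (\<Sum>i\<in>UNIV. \<Sum>x\<in>?Z i. fcount D x / norm x)"
    unfolding un
  proof (rule sum.UNION_disjoint)
    show "\<forall>i\<in>UNIV. \<forall>j\<in>UNIV. i \<noteq> j \<longrightarrow> ?Z i \<inter> ?Z j = {}"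
      using Lf_two_zero by (auto simp: ball\<Lambda>_def)
  qed (use fin in auto)
  also have "\<dots> \<le> (\<Sum>i\<in>UNIV. \<Sum>x\<in>?Z i. \<Sum>j\<in>- {i}. Mx * (tauf (Lf j x) ^ 4 / norm x))"
  proof (intro sum_mono)
    fix i x assume x: "x \<in> ?Z i"
    have "fcount D x \<le> Mx * (\<Sum>j\<in>- {i}. tauf (Lf j x) ^ 4)"
      using x by (intro fcount_zero D) (auto simp: ball\<Lambda>_def)
    then have "fcount D x / norm x \<le> Mx * (\<Sum>j\<in>- {i}. tauf (Lf j x) ^ 4) / norm x" by (intro divide_right_mono) auto
    then show "fcount D x / norm x \<le> (\<Sum>j\<in>- {i}. Mx * (tauf (Lf j x) ^ 4 / norm x))"
      by (simp add: sum_distrib_left sum_divide_distrib)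
  qed
  also have "\<dots> = (\<Sum>i\<in>UNIV. \<Sum>j\<in>- {i}. \<Sum>x\<in>?Z i. Mx * (tauf (Lf j x) ^ 4 / norm x))"
    by (intro sum.cong refl) (rule sum.swap)
  also have "\<dots> \<le> (\<Sum>i\<in>(UNIV::4 set). \<Sum>j\<in>- {i}. Mx * (2 * cL * (1 + ln (cL * M)) ^ 16))"
  proof (intro sum_mono)
    fix i j :: 4 assume "j \<in> - {i}"
    then have "Mx * (\<Sum>x\<in>?Z i. tauf (Lf j x) ^ 4 / norm x) \<le> Mx * (2 * cL * (1 + ln (cL * M)) ^ 16)"
      using sum_tauf_line[OF M, of i j 4] Mx by (intro mult_left_mono) auto
    then show "(\<Sum>x\<in>?Z i. Mx * (tauf (Lf j x) ^ 4 / norm x)) \<le> Mx * (2 * cL * (1 + ln (cL * M)) ^ 16)"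
      by (simp add: sum_distrib_left)
  qed
  also have "\<dots> = (\<Sum>i\<in>(UNIV::4 set). real (card (- {i})) * (Mx * (2 * cL * (1 + ln (cL * M)) ^ 16)))" by simp
  \<comment> \<open>Four lines, three remaining forms on each, and the factor 2 of the estimate on a
    line.\<close>
  also have "\<dots> = 24 * cL * Mx * (1 + ln (cL * M)) ^ 16" by (simp add: Compl_eq_Diff_UNIV card_Diff_subset)
  finally show ?thesis .
qed

lemma sum_fcount:
  assumes M: "M \<ge> 1" and D: "\<And>i. 0 \<le> D i" "\<And>i. D i \<le> Mx"
  shows "(\<Sum>x\<in>ball\<Lambda> M. fcount D x / norm x) \<le> 24 * cL * (M + Mx) * (1 + ln (cL * M)) ^ 16"
proof -
  let ?H = "(1 + ln (cL * M)) ^ 16"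
  let ?N = "{x \<in> ball\<Lambda> M. \<forall>i. Lf i x \<noteq> 0}"
  have "ball\<Lambda> M = ?N \<union> {x \<in> ball\<Lambda> M. \<exists>i. Lf i x = 0}" by auto
  then have "(\<Sum>x\<in>ball\<Lambda> M. fcount D x / norm x)
      = (\<Sum>x\<in>?N. fcount D x / norm x) + (\<Sum>x\<in>{x \<in> ball\<Lambda> M. \<exists>i. Lf i x = 0}. fcount D x / norm x)"
    using finite_ball\<Lambda>[of M] by (subst sum.union_disjoint[symmetric]) auto
  moreover have "(\<Sum>x\<in>?N. fcount D x / norm x) \<le> 24 * cL * M * ?H"
  proof -
    have "(\<Sum>x\<in>?N. fcount D x / norm x) \<le> (\<Sum>x\<in>?N. \<Sum>i\<in>UNIV. tauf (Lf i x) ^ 4 / norm x)"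
      unfolding sum_divide_distrib[symmetric]
      by (intro sum_mono divide_right_mono fcount_nonzero) (auto simp: ball\<Lambda>_def)
    also have "\<dots> = (\<Sum>i\<in>UNIV. \<Sum>x\<in>?N. tauf (Lf i x) ^ 4 / norm x)" by (rule sum.swap)
    also have "\<dots> \<le> (\<Sum>i\<in>UNIV. \<Sum>x\<in>{x \<in> ball\<Lambda> M. Lf i x \<noteq> 0}. tauf (Lf i x) ^ 4 / norm x)"
      by (intro sum_mono sum_mono2) (auto simp: finite_ball\<Lambda> tauf_def)
    also have "\<dots> \<le> (\<Sum>i\<in>(UNIV::4 set). 6 * cL * M * ?H)"
      using sum_tauf[OF M, of _ 4] by (intro sum_mono) auto
    finally show ?thesis by simp
  qed
  moreover have "24 * cL * (M + Mx) * ?H = 24 * cL * M * ?H + 24 * cL * Mx * ?H" by (simp add: algebra_simps)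
  ultimately show ?thesis using sum_fcount_zero[of M D Mx, OF M D] by linarith
qed

end

text \<open>What the count needs to know about a dilated region: its frontier enters the error terms
  only through the number of connected pieces and a bound for the length.\<close>

definition nice :: "nat \<Rightarrow> real \<Rightarrow> (real^2) set \<Rightarrow> bool" where
  "nice m l K \<longleftrightarrow> compact K \<and> (\<exists>\<C>. frontier K = \<Union>\<C> \<and> finite \<C> \<and> card \<C> \<le> m \<and> (\<forall>C\<in>\<C>. connected C)) \<and>
     set_length (frontier K) \<le> ennreal l \<and> l \<ge> 0"

section \<open>Level of distribution of the divisor sublattices\<close>

context adm begin

definition inv_idx :: "nat^4 \<Rightarrow> real" where
  "inv_idx d = 1 / real (idx d)"

definition Acount :: "(real^2) set \<Rightarrow> nat^4 \<Rightarrow> real" where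
  "Acount K d = real (card {x \<in> subl d \<inter> K. \<forall>i. Lf i x \<noteq> 0})"

text \<open>The shorter vector of a reduced basis has square at most twice the determinant of the
  sublattice, which is \<open>idx d * lattice_det \<Lambda>\<close> with
  \<open>idx d \<le> vprod d\<close>.\<close>

lemma level_of_distribution_single:
  assumes d: "vpos d" and K: "nice m l K"
  shows "\<exists>u\<in>subl d. u \<noteq> 0 \<and> (norm u)\<^sup>2 \<le> 2 * real (vprod d) * lattice_det \<Lambda> \<and>
    \<bar>real (card (subl d \<inter> K)) - measure lebesgue K / lattice_det \<Lambda> * inv_idx d\<bar> \<le> 36 * real m * (1 + 4 * l / norm u)"
proof -
  interpret S: plane_lattice "subl d" by (rule plane_lattice_subl[OF d])
  obtain u v where uv: "u \<in> subl d" "v \<in> subl d" "cross u v \<noteq> 0" "norm u \<le> norm v"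
    and gen: "\<And>x. x \<in> subl d \<Longrightarrow> \<exists>m n::int. x = of_int m *\<^sub>R u + of_int n *\<^sub>R v"
    and area: "3 * ((norm u)\<^sup>2 * (norm v)\<^sup>2) \<le> 4 * (cross u v)\<^sup>2" by (rule S.reduced_basis) blast
  obtain \<C> where \<C>: "frontier K = \<Union>\<C>" "finite \<C>" "card \<C> \<le> m" "\<And>C. C \<in> \<C> \<Longrightarrow> connected C"
    and Kc: "compact K" "set_length (frontier K) \<le> ennreal l" "l \<ge> 0" using K unfolding nice_def by blast
  have det: "lattice_det (subl d) = \<bar>cross u v\<bar>" by (rule S.lattice_det_basis[OF uv(1-3) gen])
  have cnt: "\<bar>real (card (subl d \<inter> K)) - measure lebesgue K / lattice_det (subl d)\<bar> \<le> 36 * real m * (1 + 4 * l / norm u)"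
    by (rule S.lattice_point_count[OF uv gen area Kc(1) \<C> Kc(2,3)])
  have "((norm u)\<^sup>2)\<^sup>2 \<le> (2 * \<bar>cross u v\<bar>)\<^sup>2"
  proof -
    have "(norm u)\<^sup>2 * (norm u)\<^sup>2 \<le> (norm u)\<^sup>2 * (norm v)\<^sup>2" using uv(4) by (intro mult_left_mono power_mono) auto
    moreover have "0 \<le> (norm u)\<^sup>2 * (norm v)\<^sup>2" by simp
    ultimately have "(norm u)\<^sup>2 * (norm u)\<^sup>2 \<le> 4 * (cross u v)\<^sup>2" using area by linarith
    then show ?thesis unfolding power_mult_distrib power2_abs by (simp add: power2_eq_square)
  qed
  then have "(norm u)\<^sup>2 \<le> 2 * \<bar>cross u v\<bar>" by (rule power2_le_imp_le) simp
  also have "\<dots> = 2 * (real (idx d) * lattice_det \<Lambda>)" using det lattice_det_subl[OF d] by simp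
  also have "\<dots> \<le> 2 * (real (vprod d) * lattice_det \<Lambda>)"
    using idx_le[OF d] lattice_det_pos by (intro mult_left_mono mult_right_mono) auto
  finally have "(norm u)\<^sup>2 \<le> 2 * real (vprod d) * lattice_det \<Lambda>" by simp
  moreover have "measure lebesgue K / lattice_det (subl d) = measure lebesgue K / lattice_det \<Lambda> * inv_idx d"
    unfolding lattice_det_subl[OF d] inv_idx_def by simp
  moreover have "u \<noteq> 0" using uv(3) by auto
  ultimately show ?thesis using cnt uv(1) by (intro bexI[of _ u]) auto
qed

text \<open>The error at \<open>d\<close> is governed by a shortest vector \<open>u\<close> of the sublattice. Exchanging the sums, every \<open>u\<close> is counted
  once for each \<open>d\<close> with \<open>d $ i dvd Lf i u\<close>, which is bounded by divisor functions of the values \<open>Lf i u\<close>.\<close>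

lemma level_of_distribution:
  assumes K: "nice m l K" "K \<subseteq> cball 0 M'" "M' \<ge> 1" and D: "\<And>i. D i \<ge> 0" "\<And>i. D i \<le> Mx"
    and M: "M = 1 + sqrt (2 * (\<Prod>i\<in>UNIV. D i) * lattice_det \<Lambda>)"
  shows "(\<Sum>d\<in>dbox D. \<bar>Acount K d - measure lebesgue K / lattice_det \<Lambda> * inv_idx d\<bar>)
    \<le> (36 * real m + 1) * (\<Prod>i\<in>UNIV. D i) + 144 * real m * l * (24 * cL * (M + Mx) * (1 + ln (cL * M)) ^ 16)
       + M' * (24 * cL * Mx * (1 + ln (cL * M')) ^ 16)"
proof -
  let ?\<Pi> = "\<Prod>i\<in>UNIV. D i" and ?mn = "\<lambda>d. measure lebesgue K / lattice_det \<Lambda> * inv_idx d"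
  have \<Pi>0: "?\<Pi> \<ge> 0" by (intro prod_nonneg ballI D(1))
  have M1: "M \<ge> 1" unfolding M using \<Pi>0 lattice_det_pos by simp
  have l0: "l \<ge> 0" and bK: "bounded K" using K(1) compact_imp_bounded by (auto simp: nice_def)
  have "\<forall>d\<in>dbox D. \<exists>u. u \<in> subl d \<and> u \<noteq> 0 \<and> (norm u)\<^sup>2 \<le> 2 * real (vprod d) * lattice_det \<Lambda> \<and>
    \<bar>real (card (subl d \<inter> K)) - ?mn d\<bar> \<le> 36 * real m * (1 + 4 * l / norm u)"
    using level_of_distribution_single[OF dbox_pos K(1)] by blast
  then obtain u where u: "\<And>d. d \<in> dbox D \<Longrightarrow> u d \<in> subl d" "\<And>d. d \<in> dbox D \<Longrightarrow> u d \<noteq> 0"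
    "\<And>d. d \<in> dbox D \<Longrightarrow> (norm (u d))\<^sup>2 \<le> 2 * real (vprod d) * lattice_det \<Lambda>"
    "\<And>d. d \<in> dbox D \<Longrightarrow> \<bar>real (card (subl d \<inter> K)) - ?mn d\<bar> \<le> 36 * real m * (1 + 4 * l / norm (u d))"
    by metis
  let ?Z = "{x \<in> ball\<Lambda> M'. \<exists>i. Lf i x = 0}"
  have sub\<Lambda>: "subl d \<subseteq> \<Lambda>" for d by (auto simp: mem_subl)
  have finK: "finite (subl d \<inter> K)" for d
    by (rule finite_subset[OF _ finite_bounded[OF bK]]) (use sub\<Lambda> in blast)
  \<comment> \<open>\<open>Acount\<close> leaves out the points at which a form vanishes. Besides
    the origin, which accounts for the summand 1, they lie in \<open>?Z\<close> and are estimated on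
    average over \<open>d\<close>.\<close>
  have each: "\<bar>Acount K d - ?mn d\<bar> \<le> 36 * real m * (1 + 4 * l / norm (u d)) + (1 + real (card {x \<in> ?Z. x \<in> subl d}))"
    if d: "d \<in> dbox D" for d
  proof -
    let ?B = "{x \<in> subl d \<inter> K. \<exists>i. Lf i x = 0}"
    let ?A = "{x \<in> subl d \<inter> K. \<forall>i. Lf i x \<noteq> 0}"
    have un: "subl d \<inter> K = ?A \<union> ?B" by auto
    have "card (subl d \<inter> K) = card (?A \<union> ?B)" by (rule arg_cong[OF un])
    also have "\<dots> = card ?A + card ?B"
      by (rule card_Un_disjoint) (auto intro: finite_subset[OF _ finK[of d]])
    finally have "card (subl d \<inter> K) = card ?A + card ?B" .
    then have "real (card (subl d \<inter> K)) = Acount K d + real (card ?B)" by (simp add: Acount_def)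
    moreover have "real (card ?B) \<le> 1 + real (card {x \<in> ?Z. x \<in> subl d})"
    proof -
      have "?B \<subseteq> insert 0 {x \<in> ?Z. x \<in> subl d}"
      proof
        fix x assume x: "x \<in> ?B"
        then have "x \<in> \<Lambda>" "norm x \<le> M'" using K(2) sub\<Lambda>[of d] by auto
        then show "x \<in> insert 0 {x \<in> ?Z. x \<in> subl d}" using x by (auto simp: ball\<Lambda>_def)
      qed
      then have "card ?B \<le> card (insert 0 {x \<in> ?Z. x \<in> subl d})" using finite_ball\<Lambda> by (intro card_mono) auto
      also have "\<dots> \<le> Suc (card {x \<in> ?Z. x \<in> subl d})" using finite_ball\<Lambda> by (simp add: card_insert_if)
      finally show ?thesis by simp
    qed
    ultimately show ?thesis using u(4)[OF d] by linarith
  qed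
  have cardD: "real (card (dbox D)) \<le> ?\<Pi>" by (rule card_dbox[OF D(1)])
  have "(\<Sum>d\<in>dbox D. \<bar>Acount K d - ?mn d\<bar>)
    \<le> (\<Sum>d\<in>dbox D. 36 * real m * (1 + 4 * l / norm (u d)) + (1 + real (card {x \<in> ?Z. x \<in> subl d})))"
    by (intro sum_mono each)
  also have "\<dots> = (\<Sum>d\<in>dbox D. (36 * real m + 1) + 144 * real m * l * (1 / norm (u d)) + real (card {x \<in> ?Z. x \<in> subl d}))"
    by (intro sum.cong refl) (simp add: algebra_simps)
  also have "\<dots> = (36 * real m + 1) * real (card (dbox D)) + 144 * real m * l * (\<Sum>d\<in>dbox D. 1 / norm (u d))
      + (\<Sum>d\<in>dbox D. real (card {x \<in> ?Z. x \<in> subl d}))"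
    unfolding sum.distrib sum_distrib_left[symmetric] by (simp add: algebra_simps)
  also have "\<dots> \<le> (36 * real m + 1) * ?\<Pi> + 144 * real m * l * (24 * cL * (M + Mx) * (1 + ln (cL * M)) ^ 16)
       + M' * (24 * cL * Mx * (1 + ln (cL * M')) ^ 16)"
  proof (intro add_mono mult_left_mono cardD)
    \<comment> \<open>The chosen vector is replaced by all vectors of the sublattice in the ball,
      after which the two sums can be interchanged.\<close>
    have "(\<Sum>d\<in>dbox D. 1 / norm (u d)) \<le> (\<Sum>d\<in>dbox D. \<Sum>x\<in>ball\<Lambda> M. if x \<in> subl d then 1 / norm x else 0)"
    proof (rule sum_mono)
      fix d assume d: "d \<in> dbox D"
      have "(norm (u d))\<^sup>2 \<le> 2 * ?\<Pi> * lattice_det \<Lambda>"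
        using u(3)[OF d] vprod_dbox[OF d] lattice_det_pos by (meson less_imp_le mult_left_mono mult_right_mono order_trans zero_le_numeral)
      then have "norm (u d) \<le> M" unfolding M using real_le_rsqrt by fastforce
      then have mem: "u d \<in> ball\<Lambda> M" using u(1,2)[OF d] sub\<Lambda> by (auto simp: ball\<Lambda>_def)
      have "1 / norm (u d) = (if u d \<in> subl d then 1 / norm (u d) else 0)" using u(1)[OF d] by simp
      also have "\<dots> \<le> (\<Sum>x\<in>ball\<Lambda> M. if x \<in> subl d then 1 / norm x else 0)"
        by (rule member_le_sum[OF mem]) (auto simp: finite_ball\<Lambda>)
      finally show "1 / norm (u d) \<le> (\<Sum>x\<in>ball\<Lambda> M. if x \<in> subl d then 1 / norm x else 0)" .
    qed
    also have "\<dots> = (\<Sum>x\<in>ball\<Lambda> M. \<Sum>d\<in>dbox D. if x \<in> subl d then 1 / norm x else 0)" by (rule sum.swap)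
    also have "\<dots> = (\<Sum>x\<in>ball\<Lambda> M. fcount D x / norm x)"
    proof (rule sum.cong[OF refl])
      fix x
      have "(\<Sum>d\<in>dbox D. if x \<in> subl d then 1 / norm x else 0) = (\<Sum>d\<in>{d \<in> dbox D. x \<in> subl d}. 1 / norm x)"
        by (rule sum.inter_filter[OF finite_dbox, symmetric])
      then show "(\<Sum>d\<in>dbox D. if x \<in> subl d then 1 / norm x else 0) = fcount D x / norm x" by (simp add: fcount_def)
    qed
    also have "\<dots> \<le> 24 * cL * (M + Mx) * (1 + ln (cL * M)) ^ 16" by (rule sum_fcount[OF M1 D])
    finally show "(\<Sum>d\<in>dbox D. 1 / norm (u d)) \<le> 24 * cL * (M + Mx) * (1 + ln (cL * M)) ^ 16" .
    have "(\<Sum>d\<in>dbox D. real (card {x \<in> ?Z. x \<in> subl d})) = (\<Sum>d\<in>dbox D. \<Sum>x\<in>?Z. if x \<in> subl d then 1 else 0)"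
      using finite_ball\<Lambda> by (intro sum.cong refl) (simp add: sum.inter_filter[symmetric])
    also have "\<dots> = (\<Sum>x\<in>?Z. \<Sum>d\<in>dbox D. if x \<in> subl d then 1 else 0)" by (rule sum.swap)
    also have "\<dots> = (\<Sum>x\<in>?Z. fcount D x)"
      using finite_dbox by (intro sum.cong refl) (simp add: fcount_def sum.inter_filter[symmetric])
    \<comment> \<open>The available estimate carries the weight \<open>1 / norm x\<close>, which
      costs the factor \<open>M'\<close>.\<close>
    also have "\<dots> \<le> (\<Sum>x\<in>?Z. M' * (fcount D x / norm x))"
    proof (rule sum_mono)
      fix x assume "x \<in> ?Z"
      then have x: "norm x \<le> M'" "norm x > 0" by (auto simp: ball\<Lambda>_def)
      have "fcount D x * norm x \<le> fcount D x * M'" using x by (intro mult_left_mono) (auto simp: fcount_def)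
      then show "fcount D x \<le> M' * (fcount D x / norm x)" using x(2) by (simp add: field_simps)
    qed
    also have "\<dots> = M' * (\<Sum>x\<in>?Z. fcount D x / norm x)" by (simp add: sum_distrib_left)
    also have "\<dots> \<le> M' * (24 * cL * Mx * (1 + ln (cL * M')) ^ 16)"
      using K(3) by (intro mult_left_mono sum_fcount_zero[OF K(3) D]) auto
    finally show "(\<Sum>d\<in>dbox D. real (card {x \<in> ?Z. x \<in> subl d})) \<le> M' * (24 * cL * Mx * (1 + ln (cL * M')) ^ 16)" .
  qed (use l0 in auto)
  finally show ?thesis .
qed

end

text \<open>The lower bound is \<open>idx d \<le> vprod d\<close>, the upper bound the count of
  cosets at prime powers; the bad primes divide \<open>bad\<close>.\<close>

sublocale adm \<subseteq> arith inv_idx "\<lambda>p. multiplicity p bad"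
proof
  show "multv inv_idx"
    unfolding multv_def by (auto simp: inv_idx_def idx_one idx_mult)
  show "inv_idx d > 0" if "vpos d" for d using idx_pos[OF that] by (simp add: inv_idx_def)
  show "1 \<le> inv_idx d * real (vprod d)" if "vpos d" for d
    using idx_le[OF that] idx_pos[OF that] by (simp add: inv_idx_def)
  show "inv_idx (ppow p k) * real p ^ ((k $ i - multiplicity p bad) + (k $ j - multiplicity p bad)) \<le> 1"
    if p: "prime p" and ij: "i \<noteq> j" for p k i j
  proof -
    have "real (p ^ ((k $ i - multiplicity p bad) + (k $ j - multiplicity p bad))) \<le> real (idx (ppow p k))"
      using idx_prime_power_ge[OF p ij, of k] unfolding ppow_def by (rule of_nat_mono)
    then show ?thesis using idx_pos[OF vpos_ppow[OF p]] by (simp add: inv_idx_def)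
  qed
  show "finite {p. prime p \<and> multiplicity p bad > 0}"
  proof (rule finite_subset)
    show "{p. prime p \<and> multiplicity p bad > 0} \<subseteq> prime_factors bad" by (auto simp: prime_factors_multiplicity)
  qed simp
qed

section \<open>Switching divisors\<close>

text \<open>If \<open>d $ i\<close> exceeds the square root of \<open>n $ i\<close> for the indices \<open>i\<close> in \<open>\<sigma>\<close>, it is replaced by the complementary divisor; in
  logarithmic coordinates this is almost the reflection \<open>w \<mapsto> 1 - w\<close>.\<close>

definition vfold :: "4 set \<Rightarrow> real^4 \<Rightarrow> real^4" where
  "vfold \<sigma> w = (\<chi> i. if i \<in> \<sigma> then 1 - w $ i else w $ i)"

definition gfold :: "nat^4 \<Rightarrow> 4 set \<Rightarrow> nat^4 \<Rightarrow> nat^4" where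
  "gfold n \<sigma> e = (\<chi> i. if i \<in> \<sigma> then n $ i div e $ i else e $ i)"

lemma vfold_nth: "vfold \<sigma> w $ i = (if i \<in> \<sigma> then 1 - w $ i else w $ i)"
  by (simp add: vfold_def)

lemma gfold_nth: "gfold n \<sigma> e $ i = (if i \<in> \<sigma> then n $ i div e $ i else e $ i)"
  by (simp add: gfold_def)

text \<open>The entries of \<open>e\<close> lie strictly below the square root of those of
  \<open>n\<close> and the complementary divisors strictly above it, so the result reveals which
  coordinates were switched.\<close>

lemma gfold_inj:
  assumes n: "vpos n" and D: "\<And>i. D * D < real (n $ i)"
    and e: "e \<in> vdivs n \<inter> dbox (\<lambda>_. D)" "e' \<in> vdivs n \<inter> dbox (\<lambda>_. D)"
    and eq: "gfold n \<sigma> e = gfold n \<sigma>' e'"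
  shows "\<sigma> = \<sigma>' \<and> e = e'"
proof -
  have small: "e $ i * e $ i < n $ i" "n $ i < (n $ i div e $ i) * (n $ i div e $ i)" "e $ i * (n $ i div e $ i) = n $ i"
    if "e \<in> vdivs n \<inter> dbox (\<lambda>_. D)" for e i
  proof -
    have dv: "e $ i dvd n $ i" "e $ i > 0" "real (e $ i) \<le> D" using that by (auto simp: vdivs_def dbox_def)
    have "real (e $ i) * real (e $ i) \<le> D * D" using dv by (intro mult_mono) auto
    then have "real (e $ i * e $ i) < real (n $ i)" using D[of i] by simp
    then show s: "e $ i * e $ i < n $ i" by (simp only: of_nat_less_iff)
    obtain q where q: "n $ i = e $ i * q" using dv(1) ..
    then have "e $ i < q" using s by simp
    moreover have "n $ i div e $ i = q" using q dv(2) by simp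
    ultimately show "n $ i < (n $ i div e $ i) * (n $ i div e $ i)" "e $ i * (n $ i div e $ i) = n $ i"
      using q dv(2) by auto
  qed
  have "(i \<in> \<sigma> \<longleftrightarrow> i \<in> \<sigma>') \<and> e $ i = e' $ i" for i
  proof -
    have g: "gfold n \<sigma> e $ i = gfold n \<sigma>' e' $ i" using eq by simp
    have s: "i \<in> \<sigma> \<longleftrightarrow> n $ i < gfold n \<sigma> e $ i * gfold n \<sigma> e $ i"
      using small[OF e(1), of i] by (auto simp: gfold_nth)
    have s': "i \<in> \<sigma>' \<longleftrightarrow> n $ i < gfold n \<sigma>' e' $ i * gfold n \<sigma>' e' $ i"
      using small[OF e(2), of i] by (auto simp: gfold_nth)
    have iff: "i \<in> \<sigma> \<longleftrightarrow> i \<in> \<sigma>'" using s s' g by simp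
    show ?thesis
    proof (cases "i \<in> \<sigma>")
      case True
      then have q: "n $ i div e $ i = n $ i div e' $ i" using g iff by (simp add: gfold_nth)
      have "e $ i * (n $ i div e $ i) = e' $ i * (n $ i div e $ i)" using small(3)[OF e(1), of i] small(3)[OF e(2), of i] q by simp
      moreover have "n $ i div e $ i > 0" using small(2)[OF e(1), of i] by (auto intro: Nat.gr0I)
      ultimately show ?thesis using iff by simp
    next
      case False
      then show ?thesis using g iff by (simp add: gfold_nth)
    qed
  qed
  then show ?thesis by (auto simp: vec_eq_iff)
qed

lemma gfold_vdivs: "e \<in> vdivs n \<Longrightarrow> gfold n \<sigma> e \<in> vdivs n"
  unfolding vdivs_def by (simp add: gfold_nth) (metis dvd_div_mult_self dvd_triv_left)

text \<open>Switching exactly the coordinates larger than \<open>D\<close> leads into the box,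
  unless some entry and its complementary divisor both exceed \<open>D\<close>.\<close>

lemma not_folded:
  assumes n: "vpos n" and d: "d \<in> vdivs n"
    and nf: "\<And>\<sigma> e. e \<in> vdivs n \<inter> dbox (\<lambda>_. D) \<Longrightarrow> d \<noteq> gfold n \<sigma> e"
  shows "\<exists>j. D < real (d $ j) \<and> D < real (n $ j div d $ j)"
proof (rule ccontr)
  assume neg: "\<not> ?thesis"
  define \<sigma> where "\<sigma> = {i. D < real (d $ i)}"
  define e where "e = gfold n \<sigma> d"
  have pos: "d $ i > 0" "d $ i dvd n $ i" "n $ i > 0" for i
    using d n vdivs_pos[OF n d] by (auto simp: vdivs_def vpos_def)
  have "e \<in> vdivs n" unfolding e_def by (rule gfold_vdivs[OF d])
  moreover have "e \<in> dbox (\<lambda>_. D)"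
    unfolding dbox_def
  proof (intro CollectI allI conjI)
    fix i
    show "0 < e $ i" using vdivs_pos[OF n \<open>e \<in> vdivs n\<close>] by (simp add: vpos_def)
    have "\<not> (D < real (d $ i) \<and> D < real (n $ i div d $ i))" using neg by blast
    then show "real (e $ i) \<le> D" by (cases "D < real (d $ i)") (simp_all add: e_def gfold_nth \<sigma>_def not_less)
  qed
  moreover have "d = gfold n \<sigma> e"
  proof -
    have "n $ i div (n $ i div d $ i) = d $ i" for i
    proof -
      obtain q where "n $ i = d $ i * q" using pos(2) ..
      then show ?thesis using pos(1,3)[of i] by auto
    qed
    then show ?thesis by (simp add: vec_eq_iff e_def gfold_nth)
  qed
  ultimately show False using nf by blast
qed

text \<open>The product of \<open>d\<close> and \<open>N div d\<close> is at most \<open>Y\<close>,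
  so one of them is at most \<open>sqrt Y\<close>.\<close>

lemma card_mid_divisors:
  assumes N: "N > 0" "real N \<le> Y"
  shows "card {d. d dvd N \<and> D < real d \<and> D < real (N div d)} \<le> 2 * card {d. d dvd N \<and> D < real d \<and> real d \<le> sqrt Y}"
proof -
  let ?A = "{d. d dvd N \<and> D < real d \<and> D < real (N div d)}" and ?B = "{d. d dvd N \<and> D < real d \<and> real d \<le> sqrt Y}"
  have finB: "finite ?B" using finite_divisors[OF N(1)] by simp
  have Y0: "Y \<ge> 0" using N by linarith
  have "?A \<subseteq> ?B \<union> (\<lambda>d. N div d) ` ?B"
  proof
    fix d assume d: "d \<in> ?A"
    obtain q where q: "N = d * q" using d by auto
    have dq: "d > 0" "q > 0" using q N(1) by auto
    show "d \<in> ?B \<union> (\<lambda>d. N div d) ` ?B"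
    proof (cases "real d \<le> sqrt Y")
      case True then show ?thesis using d by blast
    next
      case False
      have "real q \<le> sqrt Y"
      proof (rule ccontr)
        assume "\<not> real q \<le> sqrt Y"
        then have "sqrt Y * sqrt Y < real d * real q" using False Y0 dq by (intro mult_strict_mono) auto
        then show False using N(2) Y0 q by simp
      qed
      then have "q \<in> ?B" using d q dq by auto
      moreover have "d = N div q" using q dq by simp
      ultimately show ?thesis by blast
    qed
  qed
  then have "card ?A \<le> card (?B \<union> (\<lambda>d. N div d) ` ?B)" using finB by (intro card_mono) auto
  also have "\<dots> \<le> card ?B + card ((\<lambda>d. N div d) ` ?B)" by (rule card_Un_le)
  also have "\<dots> \<le> card ?B + card ?B" using card_image_le[OF finB] by simp
  finally show ?thesis by simp
qed

text \<open>The set to which tuples with a middle divisor in the coordinate \<open>j\<close> are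
  reduced: this coordinate lies just below the square root, the others do not exceed the
  cut.\<close>

definition midset :: "real \<Rightarrow> real \<Rightarrow> 4 \<Rightarrow> (nat^4) set" where
  "midset D Y j = {e. \<forall>i. e $ i \<in> (if i = j then {d. D < real d \<and> real d \<le> sqrt Y} else {d. 0 < d \<and> real d \<le> D})}"

text \<open>\<open>1024 = 2 * 8 ^ 3\<close>: in the coordinate \<open>j\<close> one passes to the
  smaller of two complementary divisors, in the other three from all divisors to those up to
  \<open>D\<close>.\<close>

lemma card_mid_vec:
  assumes n: "vpos n" "\<And>i. real (n $ i) \<le> Y"
    and small: "\<And>i. tau (n $ i) \<le> 8 * card {d. d dvd n $ i \<and> real d \<le> D}"
  shows "card {d \<in> vdivs n. D < real (d $ j) \<and> D < real (n $ j div d $ j)} \<le> 1024 * card (vdivs n \<inter> midset D Y j)"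
proof -
  have n0: "n $ i > 0" for i using n(1) by (simp add: vpos_def)
  let ?A = "\<lambda>i. if i = j then {d. d dvd n $ i \<and> D < real d \<and> D < real (n $ i div d)} else {d. d dvd n $ i}"
  let ?B = "\<lambda>i. if i = j then {d. d dvd n $ i \<and> D < real d \<and> real d \<le> sqrt Y} else {d. d dvd n $ i \<and> real d \<le> D}"
  have finA: "finite (?A i)" and finB: "finite (?B i)" for i using finite_divisors[OF n0[of i]] by auto
  have A: "{d \<in> vdivs n. D < real (d $ j) \<and> D < real (n $ j div d $ j)} = {d. \<forall>i. d $ i \<in> ?A i}"
    by (auto simp: vdivs_def)
  have B: "vdivs n \<inter> midset D Y j = {d. \<forall>i. d $ i \<in> ?B i}"
  proof -
    have "d $ i > 0" if "d $ i dvd n $ i" for d :: "nat^4" and i using that n0[of i] by (auto intro: Nat.gr0I)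
    then show ?thesis by (auto simp: vdivs_def midset_def split: if_splits)
  qed
  have "card {d. \<forall>i. d $ i \<in> ?A i} = (\<Prod>i\<in>UNIV. card (?A i))" by (rule card_vec_set[OF finA])
  also have "\<dots> \<le> (\<Prod>i\<in>UNIV. (if i = j then 2 else 8) * card (?B i))"
    using card_mid_divisors[OF n0[of j] n(2)[of j]] small by (intro prod_mono) (auto simp: tau_def)
  also have "\<dots> = (\<Prod>i\<in>UNIV. if i = j then 2 else 8) * (\<Prod>i\<in>UNIV. card (?B i))" by (rule prod.distrib)
  also have "(\<Prod>i\<in>(UNIV :: 4 set). if i = j then 2 else (8::nat)) = 2 * 8 ^ card (UNIV - {j})"
    by (subst prod.remove[of UNIV j]) auto
  also have "(\<Prod>i\<in>UNIV. card (?B i)) = card {d. \<forall>i. d $ i \<in> ?B i}" by (rule card_vec_set[OF finB, symmetric])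
  finally show ?thesis unfolding A B by (simp add: card_Diff_subset)
qed

text \<open>Tuples obtained by switching are compared with the reflection \<open>vfold\<close>,
  which uses \<open>l\<close> in place of \<open>ln (n $ i)\<close>. As \<open>n $ i\<close> lies
  between \<open>Y / B\<close> and \<open>Y\<close>, the two points differ by at most
  \<open>\<delta>\<close>, and membership in \<open>V\<close> can change only in slabs around its
  hyperplanes. The remaining tuples have a middle divisor in some coordinate.\<close>

lemma card_divisors_folded:
  fixes n :: "nat^4"
  assumes V: "cut_by H V" and l: "l > 0" "Y = exp l" and n: "vpos n" "\<And>i. real (n $ i) \<le> Y" "\<And>i. Y \<le> B * real (n $ i)"
    and B: "B \<ge> 1" and D: "D * D * B < Y" "D \<le> Y" and \<delta>: "\<delta> = ln B / l"
    and small: "\<And>i. tau (n $ i) \<le> 8 * card {d. d dvd n $ i \<and> real d \<le> D}"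
  shows "\<bar>real (card {d \<in> vdivs n. phi l d \<in> V}) - (\<Sum>\<sigma>\<in>UNIV. real (card {e \<in> vdivs n \<inter> dbox (\<lambda>_. D). vfold \<sigma> (phi l e) \<in> V}))\<bar>
    \<le> (\<Sum>j\<in>UNIV. 1024 * real (card (vdivs n \<inter> midset D Y j)))
       + (\<Sum>\<sigma>\<in>UNIV. \<Sum>(a,b)\<in>H. real (card {e \<in> vdivs n \<inter> dbox (\<lambda>_. D). vfold \<sigma> (phi l e) \<in> slab a b \<delta>}))"
proof -
  let ?E = "vdivs n \<inter> dbox (\<lambda>_. D)"
  have finv: "finite (vdivs n)" by (rule finite_vdivs[OF n(1)])
  have finE: "finite ?E" using finv by simp
  have n0: "real (n $ i) > 0" for i using n(1) by (simp add: vpos_def)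
  have Y0: "Y > 0" using l by simp
  have DD: "D * D < real (n $ i)" for i
  proof -
    have "D * D * B < B * real (n $ i)" using D(1) n(3)[of i] by linarith
    then show ?thesis using B by (simp add: mult.commute)
  qed
  have lnn: "ln (real (n $ i)) \<le> l" "l \<le> ln (real (n $ i)) + ln B" for i
  proof -
    have "ln (real (n $ i)) \<le> ln Y" using n0 n(2)[of i] Y0 by (subst ln_le_cancel_iff) auto
    then show "ln (real (n $ i)) \<le> l" using l by simp
    have "ln Y \<le> ln (B * real (n $ i))" using n0[of i] n(3)[of i] Y0 B by (subst ln_le_cancel_iff) auto
    also have "\<dots> = ln B + ln (real (n $ i))" using n0[of i] B by (subst ln_mult) auto
    finally show "l \<le> ln (real (n $ i)) + ln B" using l by simp
  qed
  let ?g = "\<lambda>(\<sigma>, e). gfold n \<sigma> e"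
  let ?F1 = "?g ` (UNIV \<times> ?E)"
  have inj: "inj_on ?g (UNIV \<times> ?E)"
    by (rule inj_onI) (use gfold_inj[OF n(1) DD] in fastforce)
  have F1: "?F1 \<subseteq> vdivs n" using gfold_vdivs by auto
  let ?V = "\<lambda>d. phi l d \<in> V"
  define N1 where "N1 = card {d \<in> ?F1. ?V d}"
  define N2 where "N2 = card {d \<in> vdivs n - ?F1. ?V d}"
  have split: "card {d \<in> vdivs n. ?V d} = N1 + N2"
  proof -
    have "{d \<in> vdivs n. ?V d} = {d \<in> ?F1. ?V d} \<union> {d \<in> vdivs n - ?F1. ?V d}" using F1 by blast
    then show ?thesis unfolding N1_def N2_def
      by (simp only:) (rule card_Un_disjoint, use finv F1 in \<open>auto intro: finite_subset\<close>)
  qed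
  have N1: "real N1 = (\<Sum>\<sigma>\<in>UNIV. \<Sum>e\<in>?E. of_bool (?V (gfold n \<sigma> e)))"
  proof -
    have "real N1 = (\<Sum>d\<in>?F1. of_bool (?V d))"
      unfolding N1_def using finE by (simp add: of_bool_def sum.If_cases Int_def)
    also have "\<dots> = (\<Sum>(\<sigma>,e)\<in>UNIV \<times> ?E. of_bool (?V (gfold n \<sigma> e)))"
      by (subst sum.reindex[OF inj]) (simp add: case_prod_beta)
    finally show ?thesis by (simp add: sum.cartesian_product)
  qed
  have M: "(\<Sum>\<sigma>\<in>UNIV. real (card {e \<in> ?E. vfold \<sigma> (phi l e) \<in> V})) = (\<Sum>\<sigma>\<in>UNIV. \<Sum>e\<in>?E. of_bool (vfold \<sigma> (phi l e) \<in> V))"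
    using finE by (simp add: of_bool_def sum.If_cases Int_def)
  have near: "of_bool (?V (gfold n \<sigma> e)) - of_bool (vfold \<sigma> (phi l e) \<in> V) \<le> (\<Sum>(a,b)\<in>H. of_bool (vfold \<sigma> (phi l e) \<in> slab a b \<delta>) :: real)"
     "of_bool (vfold \<sigma> (phi l e) \<in> V) - of_bool (?V (gfold n \<sigma> e)) \<le> (\<Sum>(a,b)\<in>H. of_bool (vfold \<sigma> (phi l e) \<in> slab a b \<delta>) :: real)"
    if e: "e \<in> ?E" for \<sigma> e
  proof -
    have ei: "e $ i dvd n $ i" "e $ i > 0" "real (e $ i) \<le> D" for i using e by (auto simp: vdivs_def dbox_def)
    have le: "0 \<le> ln (real (e $ i))" "ln (real (e $ i)) \<le> ln (real (n $ i))" for i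
      using ei[of i] n0[of i] by (auto simp: Suc_le_eq ln_le_cancel_iff dest: dvd_imp_le)
    have lq: "ln (real (n $ i div e $ i)) = ln (real (n $ i)) - ln (real (e $ i))" for i
      using ei[of i] n0[of i] by (simp add: real_of_nat_div ln_div)
    have v: "phi l (gfold n \<sigma> e) \<in> cbox 0 1"
      unfolding mem_box_cart
    proof
      fix i
      show "(0 :: real^4) $ i \<le> phi l (gfold n \<sigma> e) $ i \<and> phi l (gfold n \<sigma> e) $ i \<le> (1 :: real^4) $ i"
        using le[of i] lq[of i] lnn(1)[of i] l by (auto simp: gfold_nth divide_le_eq)
    qed
    have w: "vfold \<sigma> (phi l e) \<in> cbox 0 1"
      unfolding mem_box_cart
    proof
      fix i
      have "ln (real (e $ i)) / l \<le> 1" "0 \<le> ln (real (e $ i)) / l" using le[of i] lnn(1)[of i] l by (auto simp: divide_le_eq)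
      then show "(0 :: real^4) $ i \<le> vfold \<sigma> (phi l e) $ i \<and> vfold \<sigma> (phi l e) $ i \<le> (1 :: real^4) $ i"
        by (auto simp: vfold_nth)
    qed
    have diff: "\<bar>phi l (gfold n \<sigma> e) $ i - vfold \<sigma> (phi l e) $ i\<bar> \<le> \<delta>" for i
    proof (cases "i \<in> \<sigma>")
      case True
      have "phi l (gfold n \<sigma> e) $ i - vfold \<sigma> (phi l e) $ i = (ln (real (n $ i)) - l) / l"
        using True lq[of i] l by (simp add: gfold_nth vfold_nth diff_divide_distrib)
      also have "\<bar>\<dots>\<bar> = \<bar>ln (real (n $ i)) - l\<bar> / l" using l by simp
      also have "\<dots> \<le> ln B / l" using lnn[of i] l B by (intro divide_right_mono) (auto simp: abs_le_iff)
      finally show ?thesis by (simp add: \<delta>)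
    next
      case False then show ?thesis using B l by (simp add: gfold_nth vfold_nth \<delta>)
    qed
    have finH: "finite H" using V by (simp add: cut_by_def)
    have ge: "1 \<le> (\<Sum>(a,b)\<in>H. of_bool (vfold \<sigma> (phi l e) \<in> slab a b \<delta>) :: real)"
      if ne: "(?V (gfold n \<sigma> e)) \<noteq> (vfold \<sigma> (phi l e) \<in> V)"
    proof -
      obtain a b where ab: "(a, b) \<in> H" "vfold \<sigma> (phi l e) \<in> slab a b \<delta>"
        using cut_by_near[OF V v w ne diff] by blast
      have "(case (a, b) of (a, b) \<Rightarrow> of_bool (vfold \<sigma> (phi l e) \<in> slab a b \<delta>)) \<le> (\<Sum>(a,b)\<in>H. of_bool (vfold \<sigma> (phi l e) \<in> slab a b \<delta>) :: real)"
        by (rule member_le_sum[OF ab(1)]) (use finH in auto)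
      then show ?thesis using ab(2) by simp
    qed
    have nn: "0 \<le> (\<Sum>(a,b)\<in>H. of_bool (vfold \<sigma> (phi l e) \<in> slab a b \<delta>) :: real)" by (intro sum_nonneg) auto
    show "of_bool (?V (gfold n \<sigma> e)) - of_bool (vfold \<sigma> (phi l e) \<in> V) \<le> (\<Sum>(a,b)\<in>H. of_bool (vfold \<sigma> (phi l e) \<in> slab a b \<delta>) :: real)"
      "of_bool (vfold \<sigma> (phi l e) \<in> V) - of_bool (?V (gfold n \<sigma> e)) \<le> (\<Sum>(a,b)\<in>H. of_bool (vfold \<sigma> (phi l e) \<in> slab a b \<delta>) :: real)"
      using ge nn by (cases "?V (gfold n \<sigma> e)"; cases "vfold \<sigma> (phi l e) \<in> V"; simp)+
  qed
  have "\<bar>real N1 - (\<Sum>\<sigma>\<in>UNIV. real (card {e \<in> ?E. vfold \<sigma> (phi l e) \<in> V}))\<bar>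
      \<le> (\<Sum>\<sigma>\<in>UNIV. \<Sum>e\<in>?E. \<bar>of_bool (?V (gfold n \<sigma> e)) - of_bool (vfold \<sigma> (phi l e) \<in> V)\<bar>)"
    unfolding N1 M sum_subtractf[symmetric] by (rule order_trans[OF sum_abs sum_mono[OF sum_abs]])
  also have "\<dots> \<le> (\<Sum>\<sigma>\<in>UNIV. \<Sum>e\<in>?E. \<Sum>(a,b)\<in>H. of_bool (vfold \<sigma> (phi l e) \<in> slab a b \<delta>))"
    using near by (intro sum_mono) (simp add: abs_le_iff)
  also have "\<dots> = (\<Sum>\<sigma>\<in>UNIV. \<Sum>(a,b)\<in>H. \<Sum>e\<in>?E. of_bool (vfold \<sigma> (phi l e) \<in> slab a b \<delta>))"
    by (intro sum.cong refl) (subst sum.swap, simp add: case_prod_beta)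
  also have "\<dots> = (\<Sum>\<sigma>\<in>UNIV. \<Sum>(a,b)\<in>H. real (card {e \<in> ?E. vfold \<sigma> (phi l e) \<in> slab a b \<delta>}))"
    using finE by (intro sum.cong refl) (simp add: of_bool_def sum.If_cases Int_def case_prod_beta)
  finally have 1: "\<bar>real N1 - (\<Sum>\<sigma>\<in>UNIV. real (card {e \<in> ?E. vfold \<sigma> (phi l e) \<in> V}))\<bar>
    \<le> (\<Sum>\<sigma>\<in>UNIV. \<Sum>(a,b)\<in>H. real (card {e \<in> ?E. vfold \<sigma> (phi l e) \<in> slab a b \<delta>}))" .
  have 2: "real N2 \<le> (\<Sum>j\<in>UNIV. 1024 * real (card (vdivs n \<inter> midset D Y j)))"
  proof -
    let ?R = "\<lambda>j. {d \<in> vdivs n. D < real (d $ j) \<and> D < real (n $ j div d $ j)}"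
    have "{d \<in> vdivs n - ?F1. ?V d} \<subseteq> (\<Union>j\<in>UNIV. ?R j)"
    proof
      fix d assume d: "d \<in> {d \<in> vdivs n - ?F1. ?V d}"
      have "d \<noteq> gfold n \<sigma> e" if "e \<in> ?E" for \<sigma> e
        using d that by (metis (no_types, lifting) DiffD2 SigmaI UNIV_I case_prod_conv image_eqI mem_Collect_eq)
      from not_folded[OF n(1) _ this] d show "d \<in> (\<Union>j\<in>UNIV. ?R j)" by blast
    qed
    then have "N2 \<le> card (\<Union>j\<in>UNIV. ?R j)" unfolding N2_def using finv by (intro card_mono) auto
    also have "\<dots> \<le> (\<Sum>j\<in>UNIV. card (?R j))" by (rule card_UN_le) simp
    also have "\<dots> \<le> (\<Sum>j\<in>UNIV. 1024 * card (vdivs n \<inter> midset D Y j))"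
      by (intro sum_mono card_mid_vec n small)
    finally have "real N2 \<le> real (\<Sum>j\<in>UNIV. 1024 * card (vdivs n \<inter> midset D Y j))" by (rule of_nat_mono)
    then show ?thesis by simp
  qed
  have "real (card {d \<in> vdivs n. ?V d}) = real N1 + real N2" using split by simp
  then show ?thesis using 1 2 by linarith
qed

section \<open>Reflected hyperplanes and the folded exponent set\<close>

definition afold :: "4 set \<Rightarrow> real^4 \<Rightarrow> real^4" where
  "afold \<sigma> a = (\<chi> i. if i \<in> \<sigma> then - a $ i else a $ i)"

definition bfold :: "4 set \<Rightarrow> real^4 \<Rightarrow> real \<Rightarrow> real" where
  "bfold \<sigma> a b = b - (\<Sum>i\<in>\<sigma>. a $ i)"

text \<open>A reflection carries hyperplanes to hyperplanes; \<open>afold\<close> and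
  \<open>bfold\<close> give the coefficients of the one pulled back.\<close>

lemma inner_vfold: "a \<bullet> vfold \<sigma> w - b = afold \<sigma> a \<bullet> w - bfold \<sigma> a b"
proof -
  have "a \<bullet> vfold \<sigma> w = (\<Sum>i\<in>UNIV. (if i \<in> \<sigma> then a $ i else 0) + afold \<sigma> a $ i * w $ i)"
    unfolding inner_vec_def by (intro sum.cong refl) (auto simp: vfold_nth afold_def algebra_simps)
  also have "\<dots> = (\<Sum>i\<in>\<sigma>. a $ i) + afold \<sigma> a \<bullet> w"
    by (simp add: sum.distrib inner_vec_def sum.If_cases)
  finally show ?thesis by (simp add: bfold_def)
qed

lemma l1norm_afold: "l1norm (afold \<sigma> a) = l1norm a"
  unfolding l1norm_def by (intro sum.cong) (auto simp: afold_def)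

lemma vfold_slab: "vfold \<sigma> w \<in> slab a b \<delta> \<longleftrightarrow> w \<in> slab (afold \<sigma> a) (bfold \<sigma> a b) \<delta>"
  by (simp add: slab_def inner_vfold l1norm_afold)

lemma afold_nonzero: "a \<noteq> 0 \<Longrightarrow> afold \<sigma> a \<noteq> 0"
  by (auto simp: vec_eq_iff afold_def)

lemma vfold_vfold: "vfold \<sigma> (vfold \<sigma> w) = w"
  by (simp add: vec_eq_iff vfold_nth)

lemma vfold_cube: "vfold \<sigma> w \<in> cbox 0 1 \<longleftrightarrow> w \<in> cbox 0 1"
  by (auto simp: mem_box_cart vfold_nth split: if_splits)

lemma vfold_affine: "vfold \<sigma> = (\<lambda>w. (\<chi> i. if i \<in> \<sigma> then 1 else 0) + (\<chi> i. (if i \<in> \<sigma> then - 1 else 1) * w $ i))"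
  by (auto simp: fun_eq_iff vec_eq_iff vfold_nth)

lemma continuous_vfold: "continuous_on S (vfold \<sigma>)"
  unfolding vfold_def
proof (intro continuous_on_vec_lambda)
  show "continuous_on S (\<lambda>w :: real^4. if i \<in> \<sigma> then 1 - w $ i else w $ i)" for i
    by (cases "i \<in> \<sigma>") (auto intro!: continuous_intros)
qed

lemma measure_vfold:
  assumes "S \<in> lmeasurable"
  shows "vfold \<sigma> ` S \<in> lmeasurable" "measure lebesgue (vfold \<sigma> ` S) = measure lebesgue S"
proof -
  let ?s = "\<lambda>w :: real^4. \<chi> i. (if i \<in> \<sigma> then - 1 else 1) * w $ i" and ?t = "(\<chi> i. if i \<in> \<sigma> then 1 else 0) :: real^4"
  have im: "vfold \<sigma> ` S = (+) ?t ` ?s ` S" unfolding vfold_affine image_image ..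
  have m: "?s ` S \<in> lmeasurable" by (rule measurable_stretch[OF assms])
  show "vfold \<sigma> ` S \<in> lmeasurable" unfolding im by (rule measurable_translation[OF m])
  have "measure lebesgue (?s ` S) = \<bar>\<Prod>i\<in>UNIV. (if i \<in> \<sigma> then - 1 else 1)\<bar> * measure lebesgue S"
    by (rule measure_stretch[OF assms])
  also have "\<bar>\<Prod>i\<in>(UNIV :: 4 set). (if i \<in> \<sigma> then - 1 else (1::real))\<bar> = 1"
    unfolding abs_prod by (intro prod.neutral) auto
  finally show "measure lebesgue (vfold \<sigma> ` S) = measure lebesgue S" unfolding im measure_translation by simp
qed

text \<open>The part of the small cube whose reflection lies in \<open>V\<close>; here
  \<open>\<theta>\<close> will be the logarithmic size of the cut \<open>D\<close>, slightly below
  \<open>1 / 2\<close>.\<close>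

definition Wfold :: "(real^4) set \<Rightarrow> real \<Rightarrow> 4 set \<Rightarrow> (real^4) set" where
  "Wfold V \<theta> \<sigma> = {w \<in> cbox 0 (\<chi> i. \<theta>). vfold \<sigma> w \<in> V}"

text \<open>The reflected hyperplanes together with the four faces that bound the small cube from
  above.\<close>

definition Hfold :: "((real^4) \<times> real) set \<Rightarrow> real \<Rightarrow> 4 set \<Rightarrow> ((real^4) \<times> real) set" where
  "Hfold H \<theta> \<sigma> = (\<lambda>(a, b). (afold \<sigma> a, bfold \<sigma> a b)) ` H \<union> range (\<lambda>i. (axis i 1, \<theta>))"

lemma Wfold_cut:
  assumes V: "cut_by H V" and \<theta>: "\<theta> \<le> 1"
  shows "cut_by (Hfold H \<theta> \<sigma>) (Wfold V \<theta> \<sigma>)" "card (Hfold H \<theta> \<sigma>) \<le> card H + 4"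
proof -
  have V': "V \<subseteq> cbox 0 1" "compact V" "finite H" "\<And>a b. (a, b) \<in> H \<Longrightarrow> a \<noteq> 0" using V by (auto simp: cut_by_def)
  have "compact (cbox 0 (\<chi> i. \<theta>) \<inter> vfold \<sigma> -` V)"
    by (intro compact_Int_closed compact_cbox closed_vimage compact_imp_closed V'(2) continuous_vfold)
  moreover have "cbox 0 (\<chi> i. \<theta>) \<inter> vfold \<sigma> -` V = Wfold V \<theta> \<sigma>" by (auto simp: Wfold_def)
  ultimately have c: "compact (Wfold V \<theta> \<sigma>)" by simp
  have sub: "Wfold V \<theta> \<sigma> \<subseteq> cbox 0 1"
    unfolding Wfold_def
  proof clarify
    fix w :: "real^4" assume w: "w \<in> cbox 0 (\<chi> i. \<theta>)"
    have "0 \<le> w $ i" "w $ i \<le> 1" for i using w order_trans[OF _ \<theta>, of "w $ i"] by (auto simp: mem_box_cart)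
    then show "w \<in> cbox 0 1" by (simp add: mem_box_cart)
  qed
  show "cut_by (Hfold H \<theta> \<sigma>) (Wfold V \<theta> \<sigma>)"
    unfolding cut_by_def
  proof (intro conjI c sub ballI impI)
    show "finite (Hfold H \<theta> \<sigma>)" using V'(3) by (simp add: Hfold_def)
    fix ab assume "ab \<in> Hfold H \<theta> \<sigma>"
    then show "case ab of (a, b) \<Rightarrow> a \<noteq> 0"
      using V'(4) afold_nonzero by (auto simp: Hfold_def axis_eq_0_iff)
  next
    fix v w :: "real^4" assume vw: "v \<in> cbox 0 1" "w \<in> cbox 0 1"
      and s: "\<forall>(a, b)\<in>Hfold H \<theta> \<sigma>. sgn (a \<bullet> v - b) = sgn (a \<bullet> w - b)"
    have ax: "sgn (v $ i - \<theta>) = sgn (w $ i - \<theta>)" for i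
    proof -
      have "(axis i 1, \<theta>) \<in> Hfold H \<theta> \<sigma>" by (simp add: Hfold_def)
      then have "sgn (axis i 1 \<bullet> v - \<theta>) = sgn (axis i 1 \<bullet> w - \<theta>)" using s by blast
      then show ?thesis by (simp add: inner_axis')
    qed
    have "v $ i \<le> \<theta> \<longleftrightarrow> w $ i \<le> \<theta>" for i using ax[of i] by (auto simp: sgn_if split: if_splits)
    then have cb: "v \<in> cbox 0 (\<chi> i. \<theta>) \<longleftrightarrow> w \<in> cbox 0 (\<chi> i. \<theta>)" using vw by (auto simp: mem_box_cart)
    have "\<forall>(a, b)\<in>H. sgn (a \<bullet> vfold \<sigma> v - b) = sgn (a \<bullet> vfold \<sigma> w - b)"
    proof clarify
      fix a b assume "(a, b) \<in> H"
      then have "(afold \<sigma> a, bfold \<sigma> a b) \<in> Hfold H \<theta> \<sigma>" by (force simp: Hfold_def)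
      then show "sgn (a \<bullet> vfold \<sigma> v - b) = sgn (a \<bullet> vfold \<sigma> w - b)" unfolding inner_vfold using s by blast
    qed
    moreover have "vfold \<sigma> v \<in> cbox 0 1" "vfold \<sigma> w \<in> cbox 0 1" using vw by (simp_all add: vfold_cube)
    ultimately have "vfold \<sigma> v \<in> V \<longleftrightarrow> vfold \<sigma> w \<in> V" using V unfolding cut_by_def by blast
    then show "v \<in> Wfold V \<theta> \<sigma> \<longleftrightarrow> w \<in> Wfold V \<theta> \<sigma>" using cb by (simp add: Wfold_def)
  qed
  have "card (Hfold H \<theta> \<sigma>) \<le> card ((\<lambda>(a, b). (afold \<sigma> a, bfold \<sigma> a b)) ` H) + card (range (\<lambda>i::4. (axis i 1 :: real^4, \<theta>)))"
    unfolding Hfold_def by (rule card_Un_le)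
  also have "\<dots> \<le> card H + card (UNIV :: 4 set)" by (intro add_mono card_image_le V'(3)) simp
  finally show "card (Hfold H \<theta> \<sigma>) \<le> card H + 4" by simp
qed

text \<open>As \<open>\<theta> < 1 / 2\<close>, a coordinate of a reflected point exceeds
  \<open>\<theta>\<close> exactly when it has been reflected, so the images are disjoint. They fill
  \<open>V\<close> except where some coordinate is within \<open>\<delta>\<close> of
  \<open>1 / 2\<close>.\<close>

lemma Wfold_measure:
  assumes V: "cut_by H V" and \<theta>: "0 \<le> \<theta>" and \<delta>: "\<delta> = 1 / 2 - \<theta>" "\<delta> > 0"
  shows "\<bar>(\<Sum>\<sigma>\<in>UNIV. measure lebesgue (Wfold V \<theta> \<sigma>)) - measure lebesgue V\<bar> \<le> 4 * slabC * \<delta>"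
proof -
  have V': "V \<subseteq> cbox 0 1" "compact V" using V by (auto simp: cut_by_def)
  have Vm: "V \<in> lmeasurable" by (rule lmeasurable_compact[OF V'(2)])
  have Wm: "Wfold V \<theta> \<sigma> \<in> lmeasurable" for \<sigma>
    using Wfold_cut(1)[OF V, of \<theta> \<sigma>] \<delta> by (intro lmeasurable_compact) (auto simp: cut_by_def)
  let ?I = "\<lambda>\<sigma>. vfold \<sigma> ` Wfold V \<theta> \<sigma>"
  let ?U = "\<Union>\<sigma>\<in>UNIV. ?I \<sigma>"
  let ?S = "\<lambda>j. slab (axis j 1) (1 / 2) \<delta> \<inter> cbox (-1) 2"
  have Im: "?I \<sigma> \<in> lmeasurable" for \<sigma> by (rule measure_vfold(1)[OF Wm])
  have Sm: "?S j \<in> lmeasurable" for j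
    by (subst Int_commute) (intro lmeasurable_compact compact_Int_closed compact_cbox closed_slab)
  have mem: "v $ i \<le> \<theta> \<longleftrightarrow> i \<notin> \<sigma>" "v \<in> V" if v: "v \<in> ?I \<sigma>" for v \<sigma> i
  proof -
    obtain w where w: "v = vfold \<sigma> w" "w \<in> cbox 0 (\<chi> i. \<theta>)" "vfold \<sigma> w \<in> V" using v by (auto simp: Wfold_def)
    then have "w $ i \<le> \<theta>" by (simp add: mem_box_cart)
    then show "v $ i \<le> \<theta> \<longleftrightarrow> i \<notin> \<sigma>" using \<delta> unfolding w(1) vfold_nth by auto
    show "v \<in> V" using w by simp
  qed
  have "(\<Sum>\<sigma>\<in>UNIV. measure lebesgue (Wfold V \<theta> \<sigma>)) = (\<Sum>\<sigma>\<in>UNIV. measure lebesgue (?I \<sigma>))"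
    by (simp add: measure_vfold(2)[OF Wm])
  also have "\<dots> = measure lebesgue ?U"
  proof (rule measure_UNION'[symmetric])
    show "pairwise (\<lambda>\<sigma> \<sigma>'. disjnt (?I \<sigma>) (?I \<sigma>')) UNIV"
    proof (rule pairwiseI, rule ccontr)
      fix \<sigma> \<sigma>' assume h: "\<sigma> \<noteq> \<sigma>'" "\<not> disjnt (?I \<sigma>) (?I \<sigma>')"
      then obtain v where "v \<in> ?I \<sigma>" "v \<in> ?I \<sigma>'" by (auto simp: disjnt_def)
      then have "i \<in> \<sigma> \<longleftrightarrow> i \<in> \<sigma>'" for i using mem(1) by blast
      then show False using h(1) by blast
    qed
  qed (use Im in auto)
  finally have e: "(\<Sum>\<sigma>\<in>UNIV. measure lebesgue (Wfold V \<theta> \<sigma>)) = measure lebesgue ?U" .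
  have Um: "?U \<in> lmeasurable" using Im by (intro fmeasurable.finite_UN) auto
  have 1: "measure lebesgue ?U \<le> measure lebesgue V"
    by (rule measure_mono_fmeasurable) (use mem(2) Um Vm in auto)
  have Tm: "(\<Union>j\<in>UNIV. ?S j) \<in> lmeasurable" using Sm by (intro fmeasurable.finite_UN) auto
  have "V \<subseteq> ?U \<union> (\<Union>j\<in>UNIV. ?S j)"
  proof
    fix v assume v: "v \<in> V"
    then have vc: "v \<in> cbox 0 1" using V'(1) by blast
    show "v \<in> ?U \<union> (\<Union>j\<in>UNIV. ?S j)"
    proof (cases "\<exists>j. \<bar>v $ j - 1 / 2\<bar> \<le> \<delta>")
      case True
      then show ?thesis using vc cube_subset by (auto simp: slab_axis)
    next
      case False
      define \<sigma> where "\<sigma> = {i. v $ i > 1 / 2}"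
      have "vfold \<sigma> v \<in> cbox 0 (\<chi> i. \<theta>)"
        unfolding mem_box_cart
      proof
        fix i
        have "\<delta> < \<bar>v $ i - 1 / 2\<bar>" using False not_le by blast
        moreover have "0 \<le> v $ i" "v $ i \<le> 1" using vc by (auto simp: mem_box_cart)
        ultimately show "(0 :: real^4) $ i \<le> vfold \<sigma> v $ i \<and> vfold \<sigma> v $ i \<le> (\<chi> i. \<theta>) $ i"
          using \<delta>(1) by (auto simp: vfold_nth \<sigma>_def)
      qed
      then have "vfold \<sigma> v \<in> Wfold V \<theta> \<sigma>" using v by (simp add: Wfold_def vfold_vfold)
      then have "v \<in> ?I \<sigma>" using vfold_vfold[of \<sigma> v] by (metis imageI)
      then show ?thesis by blast
    qed
  qed
  then have "measure lebesgue V \<le> measure lebesgue (?U \<union> (\<Union>j\<in>UNIV. ?S j))"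
    by (rule measure_mono_fmeasurable) (use Um Tm Vm in auto)
  also have "\<dots> \<le> measure lebesgue ?U + measure lebesgue (\<Union>j\<in>UNIV. ?S j)"
    using Um Tm by (intro measure_Un_le) auto
  also have "measure lebesgue (\<Union>j\<in>UNIV. ?S j) \<le> (\<Sum>j\<in>UNIV. measure lebesgue (?S j))"
    using Sm by (intro measure_UNION_le) auto
  also have "\<dots> \<le> (\<Sum>j\<in>(UNIV::4 set). slabC * \<delta>)"
    using \<delta> \<theta> by (intro sum_mono slab_measure) (auto simp: axis_eq_0_iff)
  finally have "measure lebesgue V \<le> measure lebesgue ?U + 4 * slabC * \<delta>" by simp
  then show ?thesis using 1 e by linarith
qed

section \<open>The error of the folded divisor count\<close>

context adm begin

definition form_vals :: "real^2 \<Rightarrow> nat^4" where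
  "form_vals x = (\<chi> i. nat (Lf i x))"

definition points :: "(real^2) set \<Rightarrow> (real^2) set" where
  "points K = {x \<in> \<Lambda> \<inter> K. \<forall>i. Lf i x \<noteq> 0}"

lemma vdivs_form_vals:
  assumes "x \<in> \<Lambda>" "\<And>i. Lf i x > 0"
  shows "e \<in> vdivs (form_vals x) \<longleftrightarrow> x \<in> subl e"
proof -
  have "e $ i dvd nat (Lf i x) \<longleftrightarrow> int (e $ i) dvd Lf i x" for i
    using assms(2)[of i] by (metis int_dvd_int_iff nat_0_le less_imp_le)
  then show ?thesis using assms(1) by (simp add: vdivs_def form_vals_def mem_subl)
qed

lemma Acount_swap:
  assumes fin: "finite (points K)" and pos: "\<And>x i. x \<in> points K \<Longrightarrow> Lf i x > 0" and Q: "finite Q"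
  shows "(\<Sum>x\<in>points K. real (card (vdivs (form_vals x) \<inter> Q))) = (\<Sum>e\<in>Q. Acount K e)"
proof -
  have "(\<Sum>x\<in>points K. real (card (vdivs (form_vals x) \<inter> Q))) = (\<Sum>x\<in>points K. \<Sum>e\<in>Q. if x \<in> subl e then 1 else 0)"
  proof (rule sum.cong[OF refl])
    fix x assume x: "x \<in> points K"
    have "vdivs (form_vals x) \<inter> Q = {e \<in> Q. x \<in> subl e}" using vdivs_form_vals[OF _ pos[OF x]] x by (auto simp: points_def)
    then show "real (card (vdivs (form_vals x) \<inter> Q)) = (\<Sum>e\<in>Q. if x \<in> subl e then 1 else 0)"
      using Q by (simp add: sum.inter_filter[symmetric])
  qed
  also have "\<dots> = (\<Sum>e\<in>Q. \<Sum>x\<in>points K. if x \<in> subl e then 1 else 0)" by (rule sum.swap)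
  also have "\<dots> = (\<Sum>e\<in>Q. Acount K e)"
  proof (rule sum.cong[OF refl])
    fix e
    have "{x \<in> subl e \<inter> K. \<forall>i. Lf i x \<noteq> 0} = {x \<in> points K. x \<in> subl e}" by (auto simp: points_def mem_subl)
    then show "(\<Sum>x\<in>points K. if x \<in> subl e then 1 else 0) = Acount K e"
      using fin by (simp add: Acount_def sum.inter_filter[symmetric])
  qed
  finally show ?thesis .
qed

text \<open>Each count is at most its expected value plus the deviation. The former adds up to a sum
  of \<open>inv_idx\<close> over a slab, the latter to at most \<open>LEV\<close>.\<close>

lemma Acount_sum_le:
  assumes lev: "(\<Sum>d\<in>dbox D'. \<bar>Acount K d - W * inv_idx d\<bar>) \<le> LEV" and W: "W \<ge> 0"
    and Q: "Q \<subseteq> dbox D'" "\<And>e. e \<in> Q \<Longrightarrow> phi l e \<in> slab a b \<delta> \<inter> cbox 0 1"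
    and a: "a \<noteq> 0" and l: "l \<ge> 1" and \<delta>: "0 < \<delta>" "\<delta> \<le> 1"
  shows "(\<Sum>e\<in>Q. Acount K e) \<le> W * (KG * (KH 2 * l ^ 3 + slabC * \<delta> * l ^ 4)) + LEV"
proof -
  have "(\<Sum>e\<in>Q. Acount K e) \<le> (\<Sum>e\<in>Q. W * inv_idx e + \<bar>Acount K e - W * inv_idx e\<bar>)"
    by (intro sum_mono) linarith
  also have "\<dots> = W * (\<Sum>e\<in>Q. inv_idx e) + (\<Sum>e\<in>Q. \<bar>Acount K e - W * inv_idx e\<bar>)"
    by (simp add: sum.distrib sum_distrib_left)
  also have "\<dots> \<le> W * (KG * (KH 2 * l ^ 3 + slabC * \<delta> * l ^ 4)) + LEV"
  proof (intro add_mono mult_left_mono W)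
    have "(\<Sum>e\<in>Q. inv_idx e) \<le> (\<Sum>e | vpos e \<and> phi l e \<in> slab a b \<delta> \<inter> cbox 0 1. inv_idx e)"
    proof (rule sum_mono2)
      show "finite {e. vpos e \<and> phi l e \<in> slab a b \<delta> \<inter> cbox 0 1}" using l by (intro finite_phi_cube) auto
      show "Q \<subseteq> {e. vpos e \<and> phi l e \<in> slab a b \<delta> \<inter> cbox 0 1}" using Q dbox_pos by blast
    qed (simp add: inv_idx_def)
    also have "\<dots> \<le> KG * (KH 2 * l ^ 3 + slabC * \<delta> * l ^ 4)" by (rule h_sum_slab[OF a l \<delta>])
    finally show "(\<Sum>e\<in>Q. inv_idx e) \<le> KG * (KH 2 * l ^ 3 + slabC * \<delta> * l ^ 4)" .
    show "(\<Sum>e\<in>Q. \<bar>Acount K e - W * inv_idx e\<bar>) \<le> LEV"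
      using sum_mono2[OF finite_dbox Q(1), of "\<lambda>e. \<bar>Acount K e - W * inv_idx e\<bar>"] lev by simp
  qed
  finally show ?thesis .
qed

lemma phi_dbox_cube:
  assumes l: "l > 0" and e: "e \<in> dbox D'" and D: "\<And>i. D' i \<le> exp l"
  shows "phi l e \<in> cbox 0 1"
  unfolding mem_box_cart
proof
  fix i
  have ei: "e $ i > 0" "real (e $ i) \<le> D' i" using e by (auto simp: dbox_def)
  then have "ln (real (e $ i)) \<le> ln (exp l)" using D[of i] by (subst ln_le_cancel_iff) auto
  then show "(0 :: real^4) $ i \<le> phi l e $ i \<and> phi l e $ i \<le> (1 :: real^4) $ i"
    using ei l by (simp add: Suc_le_eq)
qed

text \<open>On \<open>Gd\<close> folding replaces each divisor count by 16 counts in the box of side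
  \<open>D\<close>, up to slabs and middle divisors; interchanging the sums turns all of these into
  counts of points in divisor sublattices. Outside \<open>Gd\<close> trivial bounds are used. In the
  constants, 4096 is four times the 1024 for middle divisors, 16 is the number of sets
  \<open>\<sigma>\<close>, and 17 adds the original count to the 16 folded ones.\<close>

lemma sum_card_divisors_error:
  fixes l T Y D :: real
  defines "Y \<equiv> exp l" and "D \<equiv> exp (l / 2) / T" and "\<delta> \<equiv> ln T / l"
  assumes fin: "finite (points K)" and pos: "\<And>x i. x \<in> points K \<Longrightarrow> Lf i x > 0"
    and le: "\<And>x i. x \<in> points K \<Longrightarrow> of_int (Lf i x) \<le> Y"
    and V: "cut_by H V" "card H \<le> N" and l: "l \<ge> 1" and T: "T > 1" "T \<le> exp (l / 2)" and W: "W \<ge> 0"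
    and lev0: "(\<Sum>d\<in>dbox (\<lambda>_. D). \<bar>Acount K d - W * inv_idx d\<bar>) \<le> LEV"
    and lev1: "\<And>j. (\<Sum>d\<in>dbox (\<lambda>i. if i = j then exp (l / 2) else D). \<bar>Acount K d - W * inv_idx d\<bar>) \<le> LEV"
    and good: "\<And>x i. x \<in> Gd \<Longrightarrow> Y \<le> T * of_int (Lf i x)"
      "\<And>x i. x \<in> Gd \<Longrightarrow> tau (form_vals x $ i) \<le> 8 * card {d. d dvd form_vals x $ i \<and> real d \<le> D}"
    and Gd: "Gd \<subseteq> points K" and BAD: "(\<Sum>x\<in>points K - Gd. \<Prod>i\<in>UNIV. tauf (Lf i x)) \<le> BAD"
  shows "\<bar>(\<Sum>x\<in>points K. real (card {d \<in> vdivs (form_vals x). phi l d \<in> V})) - W * (euler_const * l ^ 4 * measure lebesgue V)\<bar>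
    \<le> 17 * BAD + (4112 + 16 * real N) * LEV
      + W * KG * ((4096 + 16 * real N) * (KH 2 * l ^ 3 + slabC * \<delta> * l ^ 4) + 16 * KH (N + 4) * l ^ 3 + 4 * slabC * \<delta> * l ^ 4)"
proof -
  let ?cV = "\<lambda>x. real (card {d \<in> vdivs (form_vals x). phi l d \<in> V})"
  let ?Q = "\<lambda>\<sigma>. {e \<in> dbox (\<lambda>_. D). vfold \<sigma> (phi l e) \<in> V}"
  let ?M = "\<lambda>x. \<Sum>\<sigma>\<in>UNIV. real (card (vdivs (form_vals x) \<inter> ?Q \<sigma>))"
  let ?R = "\<lambda>\<sigma> a b. {e \<in> dbox (\<lambda>_. D). vfold \<sigma> (phi l e) \<in> slab a b \<delta>}"
  let ?E = "\<lambda>x. (\<Sum>j\<in>UNIV. 1024 * real (card (vdivs (form_vals x) \<inter> midset D Y j)))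
       + (\<Sum>\<sigma>\<in>UNIV. \<Sum>(a,b)\<in>H. real (card (vdivs (form_vals x) \<inter> ?R \<sigma> a b)))"
  let ?B1 = "KH 2 * l ^ 3 + slabC * \<delta> * l ^ 4"
  have finH: "finite H" and Hnz: "\<And>a b. (a, b) \<in> H \<Longrightarrow> a \<noteq> 0" and V01: "V \<subseteq> cbox 0 1" using V by (auto simp: cut_by_def)
  have l0: "l > 0" using l by simp
  have lnT: "0 < ln T" "ln T \<le> l / 2"
  proof -
    show "0 < ln T" using T by simp
    have "ln T \<le> ln (exp (l / 2))" using T by (subst ln_le_cancel_iff) auto
    then show "ln T \<le> l / 2" by simp
  qed
  have \<delta>: "0 < \<delta>" "\<delta> \<le> 1 / 2" using lnT l0 by (simp_all add: \<delta>_def field_simps)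
  have eY: "exp (l / 2) * exp (l / 2) = Y" by (simp add: Y_def flip: exp_add)
  have sY: "sqrt Y = exp (l / 2)" using eY by (metis abs_of_pos exp_gt_zero real_sqrt_abs2)
  have D1: "D \<ge> 1" using T by (simp add: D_def)
  have DY: "D \<le> Y" "D \<le> exp (l / 2)" "exp (l / 2) \<le> Y"
  proof -
    show "D \<le> exp (l / 2)" using T by (simp add: D_def divide_le_eq)
    moreover show "exp (l / 2) \<le> Y" unfolding Y_def using l by simp
    ultimately show "D \<le> Y" by linarith
  qed
  have DDT: "D * D * T < Y"
  proof -
    have "D * D * T = Y / T" using T unfolding D_def eY[symmetric] by simp
    also have "\<dots> < Y" using T by (simp add: Y_def divide_less_eq)
    finally show ?thesis .
  qed
  have nvx: "form_vals x $ i = nat (Lf i x)" for x i by (simp add: form_vals_def)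
  have nvp: "vpos (form_vals x)" if "x \<in> points K" for x using pos[OF that] by (simp add: vpos_def form_vals_def)
  have nvr: "real (form_vals x $ i) = of_int (Lf i x)" if "x \<in> points K" for x i
    using pos[OF that, of i] by (simp add: nvx)
  have Yeq: "Y = exp l" and \<delta>eq: "\<delta> = ln T / l" by (simp_all add: Y_def \<delta>_def)
  have ptw: "\<bar>?cV x - ?M x\<bar> \<le> ?E x" if x: "x \<in> Gd" for x
  proof -
    have xP: "x \<in> points K" using x Gd by blast
    have "\<bar>?cV x - (\<Sum>\<sigma>\<in>UNIV. real (card {e \<in> vdivs (form_vals x) \<inter> dbox (\<lambda>_. D). vfold \<sigma> (phi l e) \<in> V}))\<bar>
      \<le> (\<Sum>j\<in>UNIV. 1024 * real (card (vdivs (form_vals x) \<inter> midset D Y j)))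
       + (\<Sum>\<sigma>\<in>UNIV. \<Sum>(a,b)\<in>H. real (card {e \<in> vdivs (form_vals x) \<inter> dbox (\<lambda>_. D). vfold \<sigma> (phi l e) \<in> slab a b \<delta>}))"
    proof (rule card_divisors_folded[OF V(1) l0 Yeq nvp[OF xP] _ _ _ DDT DY(1) \<delta>eq])
      show "real (form_vals x $ i) \<le> Y" for i using le[OF xP] nvr[OF xP] by simp
      show "Y \<le> T * real (form_vals x $ i)" for i using good(1)[OF x] nvr[OF xP] by simp
      show "1 \<le> T" using T by simp
      show "tau (form_vals x $ i) \<le> 8 * card {d. d dvd form_vals x $ i \<and> real d \<le> D}" for i by (rule good(2)[OF x])
    qed
    moreover have "{e \<in> vdivs (form_vals x) \<inter> dbox (\<lambda>_. D). Z e} = vdivs (form_vals x) \<inter> {e \<in> dbox (\<lambda>_. D). Z e}" for Z by auto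
    ultimately show ?thesis by simp
  qed
  have tr: "real (card (vdivs (form_vals x) \<inter> Q)) \<le> (\<Prod>i\<in>UNIV. tauf (Lf i x))" if x: "x \<in> points K" for x Q
  proof -
    have "card (vdivs (form_vals x) \<inter> Q) \<le> card (vdivs (form_vals x))" by (intro card_mono finite_vdivs nvp[OF x]) auto
    also have "\<dots> = (\<Prod>i\<in>UNIV. tau (form_vals x $ i))"
      unfolding vdivs_def using nvp[OF x] by (subst card_vec_set) (auto simp: vpos_def finite_divisors tau_def)
    also have "real \<dots> = (\<Prod>i\<in>UNIV. tauf (Lf i x))"
      by (simp add: tauf_def nvx abs_of_pos[OF pos[OF x]])
    finally show ?thesis by (simp add: of_nat_mono)
  qed
  have badp: "\<bar>?cV x - ?M x\<bar> \<le> 17 * (\<Prod>i\<in>UNIV. tauf (Lf i x))" if x: "x \<in> points K" for x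
  proof -
    have "?cV x \<le> (\<Prod>i\<in>UNIV. tauf (Lf i x))"
      using tr[OF x, of "{d. phi l d \<in> V}"] by (simp add: Int_def)
    moreover have "?M x \<le> (\<Sum>\<sigma>\<in>(UNIV :: 4 set set). \<Prod>i\<in>UNIV. tauf (Lf i x))"
      by (intro sum_mono tr[OF x])
    moreover have "(\<Sum>\<sigma>\<in>(UNIV :: 4 set set). \<Prod>i\<in>UNIV. tauf (Lf i x)) = 16 * (\<Prod>i\<in>UNIV. tauf (Lf i x))"
      by (simp add: card_UNIV_set)
    moreover have "0 \<le> ?cV x" "0 \<le> ?M x" by (auto intro: sum_nonneg)
    ultimately show ?thesis by (simp add: abs_le_iff)
  qed
  have E0: "?E x \<ge> 0" for x by (intro add_nonneg_nonneg sum_nonneg) auto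
  have finB: "finite (points K - Gd)" "finite Gd" using fin Gd finite_subset by auto
  have "\<bar>(\<Sum>x\<in>points K. ?cV x) - (\<Sum>x\<in>points K. ?M x)\<bar> \<le> (\<Sum>x\<in>points K. \<bar>?cV x - ?M x\<bar>)"
    unfolding sum_subtractf[symmetric] by (rule sum_abs)
  also have "\<dots> = (\<Sum>x\<in>points K - Gd. \<bar>?cV x - ?M x\<bar>) + (\<Sum>x\<in>Gd. \<bar>?cV x - ?M x\<bar>)"
    by (rule sum.subset_diff[OF Gd fin])
  also have "\<dots> \<le> (\<Sum>x\<in>points K - Gd. 17 * (\<Prod>i\<in>UNIV. tauf (Lf i x))) + (\<Sum>x\<in>Gd. ?E x)"
    by (intro add_mono sum_mono badp ptw) auto
  also have "(\<Sum>x\<in>points K - Gd. 17 * (\<Prod>i\<in>UNIV. tauf (Lf i x))) \<le> 17 * BAD"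
    using BAD by (simp flip: sum_distrib_left)
  also have "(\<Sum>x\<in>Gd. ?E x) \<le> (\<Sum>x\<in>points K. ?E x)" by (rule sum_mono2[OF fin Gd]) (rule E0)
  also have "(\<Sum>x\<in>points K. ?E x) = (\<Sum>j\<in>UNIV. 1024 * (\<Sum>x\<in>points K. real (card (vdivs (form_vals x) \<inter> midset D Y j))))
      + (\<Sum>\<sigma>\<in>UNIV. \<Sum>(a,b)\<in>H. \<Sum>x\<in>points K. real (card (vdivs (form_vals x) \<inter> ?R \<sigma> a b)))"
  proof -
    have 1: "(\<Sum>x\<in>points K. \<Sum>j\<in>UNIV. 1024 * real (card (vdivs (form_vals x) \<inter> midset D Y j))) = (\<Sum>j\<in>UNIV. 1024 * (\<Sum>x\<in>points K. real (card (vdivs (form_vals x) \<inter> midset D Y j))))"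
      by (subst sum.swap) (simp add: sum_distrib_left)
    have 2: "(\<Sum>x\<in>points K. \<Sum>\<sigma>\<in>UNIV. \<Sum>(a,b)\<in>H. real (card (vdivs (form_vals x) \<inter> ?R \<sigma> a b))) = (\<Sum>\<sigma>\<in>UNIV. \<Sum>(a,b)\<in>H. \<Sum>x\<in>points K. real (card (vdivs (form_vals x) \<inter> ?R \<sigma> a b)))"
    proof -
      have "(\<Sum>x\<in>points K. \<Sum>\<sigma>\<in>UNIV. \<Sum>(a,b)\<in>H. real (card (vdivs (form_vals x) \<inter> ?R \<sigma> a b))) = (\<Sum>\<sigma>\<in>UNIV. \<Sum>x\<in>points K. \<Sum>(a,b)\<in>H. real (card (vdivs (form_vals x) \<inter> ?R \<sigma> a b)))"
        by (rule sum.swap)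
      also have "\<dots> = (\<Sum>\<sigma>\<in>UNIV. \<Sum>(a,b)\<in>H. \<Sum>x\<in>points K. real (card (vdivs (form_vals x) \<inter> ?R \<sigma> a b)))"
        by (intro sum.cong refl) (subst sum.swap, simp add: case_prod_beta)
      finally show ?thesis .
    qed
    show ?thesis unfolding sum.distrib 1 2 ..
  qed
  also have "(\<Sum>j\<in>UNIV. 1024 * (\<Sum>x\<in>points K. real (card (vdivs (form_vals x) \<inter> midset D Y j)))) \<le> (\<Sum>j\<in>(UNIV::4 set). 1024 * (W * (KG * ?B1) + LEV))"
  proof (intro sum_mono mult_left_mono)
    fix j :: 4
    let ?D' = "\<lambda>i. if i = j then exp (l / 2) else D"
    have sub: "midset D Y j \<subseteq> dbox ?D'"
    proof
      fix e assume e: "e \<in> midset D Y j"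
      have "e $ i \<in> {n. 0 < n \<and> real n \<le> ?D' i}" for i
      proof -
        have "e $ i \<in> (if i = j then {d. D < real d \<and> real d \<le> sqrt Y} else {d. 0 < d \<and> real d \<le> D})"
          using e unfolding midset_def by blast
        then show ?thesis using D1 by (cases "i = j") (auto simp: sY intro: Nat.gr0I)
      qed
      then show "e \<in> dbox ?D'" by (simp add: dbox_def)
    qed
    have "(\<Sum>x\<in>points K. real (card (vdivs (form_vals x) \<inter> midset D Y j))) = (\<Sum>e\<in>midset D Y j. Acount K e)"
      by (rule Acount_swap[OF fin pos finite_subset[OF sub finite_dbox]])
    also have "\<dots> \<le> W * (KG * ?B1) + LEV"
    proof (rule Acount_sum_le[OF lev1[of j] W sub _ _ l \<delta>(1)])
      \<comment> \<open>Between \<open>exp (l / 2) / T\<close> and \<open>exp (l / 2)\<close> the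
        logarithmic coordinate runs through \<open>[1 / 2 - \<delta>, 1 / 2]\<close>: middle
        divisors form a slab as well.\<close>
      show "phi l e \<in> slab (axis j 1) (1 / 2) \<delta> \<inter> cbox 0 1" if e: "e \<in> midset D Y j" for e
      proof
        have "phi l e \<in> cbox 0 1" using e sub DY by (intro phi_dbox_cube[OF l0, of e ?D']) (auto simp: Y_def)
        then show "phi l e \<in> cbox 0 1" .
        have ej: "D < real (e $ j)" "real (e $ j) \<le> exp (l / 2)" using e by (auto simp: midset_def sY dest!: spec[of _ j])
        have "ln D < ln (real (e $ j))" using ej D1 by (subst ln_less_cancel_iff) auto
        moreover have "ln D = l / 2 - ln T" using T by (simp add: D_def ln_div)
        moreover have "ln (real (e $ j)) \<le> ln (exp (l / 2))" using ej D1 by (subst ln_le_cancel_iff) auto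
        ultimately have "l / 2 - ln T \<le> ln (real (e $ j))" "ln (real (e $ j)) \<le> l / 2" by simp_all
        then have "(l / 2 - ln T) / l \<le> ln (real (e $ j)) / l" "ln (real (e $ j)) / l \<le> (l / 2) / l"
          using l0 by (intro divide_right_mono; simp)+
        then have "1 / 2 - \<delta> \<le> ln (real (e $ j)) / l" "ln (real (e $ j)) / l \<le> 1 / 2"
          using l0 by (simp_all add: \<delta>_def diff_divide_distrib)
        then show "phi l e \<in> slab (axis j 1) (1 / 2) \<delta>" unfolding slab_axis phi_nth using \<delta> by linarith
      qed
    qed (use \<delta> in \<open>auto simp: axis_eq_0_iff\<close>)
    finally show "(\<Sum>x\<in>points K. real (card (vdivs (form_vals x) \<inter> midset D Y j))) \<le> W * (KG * ?B1) + LEV" .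
  qed simp
  also have "(\<Sum>\<sigma>\<in>UNIV. \<Sum>(a,b)\<in>H. \<Sum>x\<in>points K. real (card (vdivs (form_vals x) \<inter> ?R \<sigma> a b))) \<le> (\<Sum>\<sigma>\<in>(UNIV :: 4 set set). \<Sum>(a,b)\<in>H. W * (KG * ?B1) + LEV)"
  proof (intro sum_mono, clarify)
    fix \<sigma> a b assume ab: "(a, b) \<in> H"
    have sub: "?R \<sigma> a b \<subseteq> dbox (\<lambda>_. D)" by auto
    have "(\<Sum>x\<in>points K. real (card (vdivs (form_vals x) \<inter> ?R \<sigma> a b))) = (\<Sum>e\<in>?R \<sigma> a b. Acount K e)"
      by (rule Acount_swap[OF fin pos finite_subset[OF sub finite_dbox]])
    also have "\<dots> \<le> W * (KG * ?B1) + LEV"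
    proof (rule Acount_sum_le[OF lev0 W sub _ afold_nonzero[OF Hnz[OF ab]] l \<delta>(1)])
      show "phi l e \<in> slab (afold \<sigma> a) (bfold \<sigma> a b) \<delta> \<inter> cbox 0 1" if e: "e \<in> ?R \<sigma> a b" for e
        using e phi_dbox_cube[OF l0, of e "\<lambda>_. D"] DY by (simp add: vfold_slab Y_def)
    qed (use \<delta> in auto)
    finally show "(\<Sum>x\<in>points K. real (card (vdivs (form_vals x) \<inter> ?R \<sigma> a b))) \<le> W * (KG * ?B1) + LEV" .
  qed
  also have "(\<Sum>j\<in>(UNIV::4 set). 1024 * (W * (KG * ?B1) + LEV)) = 4096 * (W * (KG * ?B1) + LEV)" by simp
  also have "(\<Sum>\<sigma>\<in>(UNIV :: 4 set set). \<Sum>(a,b)\<in>H. W * (KG * ?B1) + LEV) = 16 * real (card H) * (W * (KG * ?B1) + LEV)"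
    by (simp add: card_UNIV_set case_prod_beta)
  finally have step1: "\<bar>(\<Sum>x\<in>points K. ?cV x) - (\<Sum>x\<in>points K. ?M x)\<bar>
    \<le> 17 * BAD + (4096 * (W * (KG * ?B1) + LEV) + 16 * real (card H) * (W * (KG * ?B1) + LEV))" by simp
  have LEV0: "LEV \<ge> 0" using lev0 by (meson abs_ge_zero order_trans sum_nonneg)
  have B10: "?B1 \<ge> 0" using l \<delta> slabC_pos by (intro add_nonneg_nonneg mult_nonneg_nonneg) (auto simp: KH_def)
  have hN: "16 * real (card H) * (W * (KG * ?B1) + LEV) \<le> 16 * real N * (W * (KG * ?B1) + LEV)"
    using V(2) add_nonneg_nonneg[OF mult_nonneg_nonneg[OF W mult_nonneg_nonneg[OF KG_nonneg B10]] LEV0]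
    by (intro mult_right_mono) auto
  let ?\<theta> = "1 / 2 - \<delta>"
  have lnD: "ln D / l = ?\<theta>" using T l0 by (simp add: D_def ln_div \<delta>_def diff_divide_distrib)
  \<comment> \<open>As \<open>ln D / l = 1 / 2 - \<delta>\<close>, the box of side \<open>D\<close>
    is exactly the small cube in logarithmic coordinates.\<close>
  have Qeq: "?Q \<sigma> = {e. vpos e \<and> phi l e \<in> Wfold V ?\<theta> \<sigma>}" for \<sigma>
  proof -
    have "e \<in> dbox (\<lambda>_. D) \<longleftrightarrow> vpos e \<and> phi l e \<in> cbox 0 (\<chi> i. ?\<theta>)" for e
    proof -
      have "real (e $ i) \<le> D \<longleftrightarrow> 0 \<le> phi l e $ i \<and> phi l e $ i \<le> ?\<theta>" if p: "e $ i > 0" for i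
      proof -
        have "phi l e $ i \<le> ?\<theta> \<longleftrightarrow> ln (real (e $ i)) \<le> ln D"
          unfolding lnD[symmetric] phi_nth using l0 by (simp add: divide_le_cancel)
        also have "\<dots> \<longleftrightarrow> real (e $ i) \<le> D" using p D1 by (subst ln_le_cancel_iff) auto
        finally show ?thesis using p l0 by (simp add: Suc_le_eq)
      qed
      then show ?thesis by (auto simp: dbox_def vpos_def mem_box_cart simp del: phi_nth)
    qed
    then show ?thesis by (auto simp: Wfold_def)
  qed
  have step2: "(\<Sum>x\<in>points K. ?M x) = (\<Sum>\<sigma>\<in>UNIV. \<Sum>e\<in>?Q \<sigma>. Acount K e)"
  proof -
    have "(\<Sum>x\<in>points K. ?M x) = (\<Sum>\<sigma>\<in>UNIV. \<Sum>x\<in>points K. real (card (vdivs (form_vals x) \<inter> ?Q \<sigma>)))" by (rule sum.swap)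
    also have "\<dots> = (\<Sum>\<sigma>\<in>UNIV. \<Sum>e\<in>?Q \<sigma>. Acount K e)"
      by (intro sum.cong refl Acount_swap fin pos finite_subset[OF _ finite_dbox[of "\<lambda>_. D"]]) auto
    finally show ?thesis .
  qed
  have each: "\<bar>(\<Sum>e\<in>?Q \<sigma>. Acount K e) - W * (euler_const * l ^ 4 * measure lebesgue (Wfold V ?\<theta> \<sigma>))\<bar> \<le> LEV + W * (KG * KH (N + 4) * l ^ 3)" for \<sigma>
  proof -
    have "\<bar>(\<Sum>e\<in>?Q \<sigma>. Acount K e) - W * (\<Sum>e\<in>?Q \<sigma>. inv_idx e)\<bar> \<le> (\<Sum>e\<in>?Q \<sigma>. \<bar>Acount K e - W * inv_idx e\<bar>)"
      unfolding sum_distrib_left sum_subtractf[symmetric] by (rule sum_abs)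
    also have "\<dots> \<le> LEV" using sum_mono2[OF finite_dbox, of "?Q \<sigma>" "\<lambda>_. D" "\<lambda>e. \<bar>Acount K e - W * inv_idx e\<bar>"] lev0 by fastforce
    finally have 1: "\<bar>(\<Sum>e\<in>?Q \<sigma>. Acount K e) - W * (\<Sum>e\<in>?Q \<sigma>. inv_idx e)\<bar> \<le> LEV" .
    have \<theta>1: "?\<theta> \<le> 1" using \<delta> by simp
    have "\<bar>(\<Sum>e\<in>?Q \<sigma>. inv_idx e) - euler_const * l ^ 4 * measure lebesgue (Wfold V ?\<theta> \<sigma>)\<bar> \<le> KG * KH (card (Hfold H ?\<theta> \<sigma>)) * l ^ 3"
      unfolding Qeq by (rule h_sum_asymp[OF Wfold_cut(1)[OF V(1) \<theta>1] l])
    also have "\<dots> \<le> KG * KH (N + 4) * l ^ 3"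
    proof -
      have "card (Hfold H ?\<theta> \<sigma>) \<le> N + 4" using Wfold_cut(2)[OF V(1) \<theta>1, of \<sigma>] V(2) by linarith
      then have "KH (card (Hfold H ?\<theta> \<sigma>)) \<le> KH (N + 4)" using slabC_pos by (simp add: KH_def)
      then show ?thesis using KG_nonneg l by (intro mult_right_mono mult_left_mono) auto
    qed
    finally have "W * \<bar>(\<Sum>e\<in>?Q \<sigma>. inv_idx e) - euler_const * l ^ 4 * measure lebesgue (Wfold V ?\<theta> \<sigma>)\<bar> \<le> W * (KG * KH (N + 4) * l ^ 3)"
      using W by (intro mult_left_mono)
    then have "\<bar>W * (\<Sum>e\<in>?Q \<sigma>. inv_idx e) - W * (euler_const * l ^ 4 * measure lebesgue (Wfold V ?\<theta> \<sigma>))\<bar> \<le> W * (KG * KH (N + 4) * l ^ 3)"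
      using W by (simp add: abs_mult flip: right_diff_distrib)
    then show ?thesis using 1 by linarith
  qed
  let ?W\<sigma> = "\<lambda>\<sigma>. W * (euler_const * l ^ 4 * measure lebesgue (Wfold V ?\<theta> \<sigma>))"
  have "\<bar>(\<Sum>x\<in>points K. ?M x) - (\<Sum>\<sigma>\<in>UNIV. ?W\<sigma> \<sigma>)\<bar> \<le> (\<Sum>\<sigma>\<in>UNIV. \<bar>(\<Sum>e\<in>?Q \<sigma>. Acount K e) - ?W\<sigma> \<sigma>\<bar>)"
    unfolding step2 sum_subtractf[symmetric] by (rule sum_abs)
  also have "\<dots> \<le> (\<Sum>\<sigma>\<in>(UNIV :: 4 set set). LEV + W * (KG * KH (N + 4) * l ^ 3))" by (intro sum_mono each)
  also have "\<dots> = 16 * (LEV + W * (KG * KH (N + 4) * l ^ 3))" by (simp add: card_UNIV_set)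
  finally have step3: "\<bar>(\<Sum>x\<in>points K. ?M x) - (\<Sum>\<sigma>\<in>UNIV. ?W\<sigma> \<sigma>)\<bar> \<le> 16 * (LEV + W * (KG * KH (N + 4) * l ^ 3))" .
  have step4: "\<bar>(\<Sum>\<sigma>\<in>UNIV. ?W\<sigma> \<sigma>) - W * (euler_const * l ^ 4 * measure lebesgue V)\<bar> \<le> W * (KG * l ^ 4 * (4 * slabC * \<delta>))"
  proof -
    have "(\<Sum>\<sigma>\<in>UNIV. ?W\<sigma> \<sigma>) - W * (euler_const * l ^ 4 * measure lebesgue V)
        = W * (euler_const * l ^ 4 * ((\<Sum>\<sigma>\<in>UNIV. measure lebesgue (Wfold V ?\<theta> \<sigma>)) - measure lebesgue V))"
      by (simp add: sum_distrib_left right_diff_distrib)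
    also have "\<bar>\<dots>\<bar> = W * (\<bar>euler_const\<bar> * l ^ 4 * \<bar>(\<Sum>\<sigma>\<in>UNIV. measure lebesgue (Wfold V ?\<theta> \<sigma>)) - measure lebesgue V\<bar>)"
      using W l by (simp add: abs_mult)
    also have "\<dots> \<le> W * (KG * l ^ 4 * (4 * slabC * \<delta>))"
      using W l abs_euler_const_le KG_nonneg \<delta> by (intro mult_left_mono mult_mono Wfold_measure[OF V(1)]) auto
    finally show ?thesis .
  qed
  show ?thesis using step1 hN step3 step4 by (simp add: algebra_simps)
qed

end

section \<open>Exceptional points and the choice of the cut\<close>

context adm begin

lemma points_ball: "K \<subseteq> cball 0 M \<Longrightarrow> points K \<subseteq> ball\<Lambda> M"
  by (auto simp: points_def ball\<Lambda>_def)

text \<open>Points with a value that is small or has many divisors are negligible, by a moment bound for \<open>tau\<close>.\<close>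

lemma bad_sum:
  assumes points: "points K \<subseteq> ball\<Lambda> M" and M: "M \<ge> 1" and pos: "\<And>x i. x \<in> points K \<Longrightarrow> Lf i x > 0"
    and b: "b \<ge> 1" and Z: "Z \<ge> 0"
    and Gd: "\<And>x. x \<in> points K \<Longrightarrow> (\<And>i. tauf (Lf i x) \<le> b) \<Longrightarrow> (\<And>i. Z \<le> of_int (Lf i x)) \<Longrightarrow> x \<in> Gd"
  shows "(\<Sum>x\<in>points K - Gd. \<Prod>i\<in>UNIV. tauf (Lf i x)) \<le> 4 * (M * (6 * cL * M * (1 + ln (cL * M)) ^ 32)) / b + 12 * b ^ 4 * Z * M"
proof -
  have fin: "finite (points K)" using points finite_ball\<Lambda> finite_subset by blast
  have t1: "tauf (Lf i x) \<ge> 1" if "x \<in> points K" for x i using pos[OF that, of i] by (intro tauf_ge1) auto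
  let ?S = "\<lambda>j. {x \<in> points K. of_int (Lf j x) < Z}"
  \<comment> \<open>If some divisor number exceeds \<open>b\<close>, the product is at most the
    fourth power of the largest one, and a fifth power pays for the division by \<open>b\<close>.
    Otherwise all are at most \<open>b\<close> and some value is below \<open>Z\<close>.\<close>
  have each: "(\<Prod>i\<in>UNIV. tauf (Lf i x)) \<le> (\<Sum>i\<in>UNIV. tauf (Lf i x) ^ 5) / b + (\<Sum>j\<in>UNIV. if x \<in> ?S j then b ^ 4 else 0)"
    if x: "x \<in> points K - Gd" for x
  proof (cases "\<exists>j. tauf (Lf j x) > b")
    case True
    have xP: "x \<in> points K" using x by blast
    let ?t = "\<lambda>i. tauf (Lf i x)"
    have "Max (range ?t) \<in> range ?t" by (intro Max_in) auto
    then obtain k where k: "Max (range ?t) = ?t k" by (rule rangeE)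
    have le: "?t i \<le> ?t k" for i using Max_ge[of "range ?t" "?t i"] k by simp
    have kb: "?t k > b" using True le by (meson less_le_trans)
    have k0: "?t k \<ge> 0" using kb b by linarith
    have "(\<Prod>i\<in>UNIV. ?t i) \<le> (\<Prod>i\<in>(UNIV::4 set). ?t k)" using le t1[OF xP] by (intro prod_mono) (auto intro: order_trans[OF zero_le_one])
    also have "\<dots> = ?t k ^ 4" by simp
    finally have "(\<Prod>i\<in>UNIV. ?t i) * b \<le> ?t k ^ 4 * ?t k" using kb b k0 t1[OF xP] by (intro mult_mono) auto
    also have "\<dots> = ?t k ^ 5" by (simp add: power_def numeral_eq_Suc mult_ac)
    also have "\<dots> \<le> (\<Sum>i\<in>UNIV. ?t i ^ 5)"
      by (rule member_le_sum) (use t1[OF xP] in \<open>auto intro: order_trans[OF zero_le_one]\<close>)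
    finally have "(\<Prod>i\<in>UNIV. ?t i) \<le> (\<Sum>i\<in>UNIV. ?t i ^ 5) / b" using b by (simp add: pos_le_divide_eq)
    moreover have "0 \<le> (\<Sum>j\<in>UNIV. if x \<in> ?S j then b ^ 4 else 0)" using b by (intro sum_nonneg) auto
    ultimately show ?thesis by linarith
  next
    case False
    have xP: "x \<in> points K" using x by blast
    have tb: "tauf (Lf i x) \<le> b" for i using False not_le by blast
    have "\<exists>j. of_int (Lf j x) < Z"
    proof (rule ccontr)
      assume "\<not> ?thesis"
      then have "Z \<le> of_int (Lf i x)" for i by (simp add: not_less)
      from Gd[OF xP tb this] show False using x by blast
    qed
    then obtain j where j: "x \<in> ?S j" using xP by blast
    have "(\<Prod>i\<in>UNIV. tauf (Lf i x)) \<le> (\<Prod>i\<in>(UNIV::4 set). b)"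
      using tb t1[OF xP] by (intro prod_mono) (auto intro: order_trans[OF zero_le_one])
    also have "\<dots> = (if x \<in> ?S j then b ^ 4 else 0)" using j by simp
    also have "\<dots> \<le> (\<Sum>j\<in>UNIV. if x \<in> ?S j then b ^ 4 else 0)" by (rule member_le_sum) (use b in auto)
    finally have "(\<Prod>i\<in>UNIV. tauf (Lf i x)) \<le> (\<Sum>j\<in>UNIV. if x \<in> ?S j then b ^ 4 else 0)" .
    moreover have "0 \<le> (\<Sum>i\<in>UNIV. tauf (Lf i x) ^ 5) / b"
      using b t1[OF xP] by (intro divide_nonneg_pos sum_nonneg) (auto intro: order_trans[OF zero_le_one])
    ultimately show ?thesis by linarith
  qed
  have nn: "0 \<le> (\<Sum>i\<in>UNIV. tauf (Lf i x) ^ 5) / b + (\<Sum>j\<in>UNIV. if x \<in> ?S j then b ^ 4 else 0)" for x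
    using b by (intro add_nonneg_nonneg divide_nonneg_pos sum_nonneg) (auto simp: tauf_def)
  have "(\<Sum>x\<in>points K - Gd. \<Prod>i\<in>UNIV. tauf (Lf i x)) \<le> (\<Sum>x\<in>points K - Gd. (\<Sum>i\<in>UNIV. tauf (Lf i x) ^ 5) / b + (\<Sum>j\<in>UNIV. if x \<in> ?S j then b ^ 4 else 0))"
    by (intro sum_mono each)
  also have "\<dots> \<le> (\<Sum>x\<in>points K. (\<Sum>i\<in>UNIV. tauf (Lf i x) ^ 5) / b + (\<Sum>j\<in>UNIV. if x \<in> ?S j then b ^ 4 else 0))"
    by (rule sum_mono2[OF fin Diff_subset nn])
  also have "\<dots> = (\<Sum>i\<in>UNIV. \<Sum>x\<in>points K. tauf (Lf i x) ^ 5) / b + (\<Sum>j\<in>UNIV. \<Sum>x\<in>points K. if x \<in> ?S j then b ^ 4 else 0)"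
    unfolding sum.distrib sum_divide_distrib[symmetric] by (subst (1 2) sum.swap) simp
  also have "\<dots> \<le> (\<Sum>i\<in>(UNIV::4 set). M * (6 * cL * M * (1 + ln (cL * M)) ^ 32)) / b + (\<Sum>j\<in>(UNIV::4 set). b ^ 4 * (3 * Z * M))"
  proof (intro add_mono divide_right_mono sum_mono)
    fix i
    have "(\<Sum>x\<in>points K. tauf (Lf i x) ^ 5) \<le> (\<Sum>x\<in>points K. M * (tauf (Lf i x) ^ 5 / norm x))"
    proof (rule sum_mono)
      fix x assume "x \<in> points K"
      then have x: "norm x \<le> M" "norm x > 0" using points by (auto simp: ball\<Lambda>_def)
      have "tauf (Lf i x) ^ 5 * norm x \<le> tauf (Lf i x) ^ 5 * M" using x by (intro mult_left_mono) (auto simp: tauf_def)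
      then show "tauf (Lf i x) ^ 5 \<le> M * (tauf (Lf i x) ^ 5 / norm x)" using x(2) by (simp add: field_simps)
    qed
    also have "\<dots> \<le> (\<Sum>x\<in>{x \<in> ball\<Lambda> M. Lf i x \<noteq> 0}. M * (tauf (Lf i x) ^ 5 / norm x))"
    proof (rule sum_mono2)
      show "points K \<subseteq> {x \<in> ball\<Lambda> M. Lf i x \<noteq> 0}" using points by (auto simp: points_def)
    qed (use finite_ball\<Lambda> M in \<open>auto simp: tauf_def\<close>)
    also have "\<dots> = M * (\<Sum>x\<in>{x \<in> ball\<Lambda> M. Lf i x \<noteq> 0}. tauf (Lf i x) ^ 5 / norm x)" by (simp add: sum_distrib_left)
    also have "\<dots> \<le> M * (6 * cL * M * (1 + ln (cL * M)) ^ 32)"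
      using sum_tauf[OF M, of i 5] M by (intro mult_left_mono) auto
    finally show "(\<Sum>x\<in>points K. tauf (Lf i x) ^ 5) \<le> M * (6 * cL * M * (1 + ln (cL * M)) ^ 32)" .
  next
    fix j
    \<comment> \<open>Points with a value below \<open>Z\<close> lie on at most \<open>Z\<close>
      fibres, each with at most \<open>3 * M\<close> points.\<close>
    have sub: "?S j \<subseteq> (\<Union>n\<in>{1..nat \<lfloor>Z\<rfloor>}. {x \<in> ball\<Lambda> M. Lf j x = int n})"
    proof
      fix x assume x: "x \<in> ?S j"
      then have p: "Lf j x > 0" "x \<in> ball\<Lambda> M" using pos points by auto
      have "real (nat (Lf j x)) \<le> Z" using x p by simp
      then have "nat (Lf j x) \<le> nat \<lfloor>Z\<rfloor>" by (rule le_nat_floor)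
      then show "x \<in> (\<Union>n\<in>{1..nat \<lfloor>Z\<rfloor>}. {x \<in> ball\<Lambda> M. Lf j x = int n})"
        using p by (intro UN_I[of "nat (Lf j x)"]) auto
    qed
    have "card (?S j) \<le> card (\<Union>n\<in>{1..nat \<lfloor>Z\<rfloor>}. {x \<in> ball\<Lambda> M. Lf j x = int n})"
      using sub finite_ball\<Lambda> by (intro card_mono) auto
    also have "\<dots> \<le> (\<Sum>n\<in>{1..nat \<lfloor>Z\<rfloor>}. card {x \<in> ball\<Lambda> M. Lf j x = int n})" by (rule card_UN_le) simp
    finally have "real (card (?S j)) \<le> (\<Sum>n\<in>{1..nat \<lfloor>Z\<rfloor>}. real (card {x \<in> ball\<Lambda> M. Lf j x = int n}))"
      by (simp flip: of_nat_sum)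
    also have "\<dots> \<le> (\<Sum>n\<in>{1..nat \<lfloor>Z\<rfloor>}. 3 * M)" by (intro sum_mono fiber_card M)
    also have "\<dots> = real (nat \<lfloor>Z\<rfloor>) * (3 * M)" by simp
    also have "\<dots> \<le> Z * (3 * M)" using Z M by (intro mult_right_mono) (auto simp: of_nat_floor)
    finally have "real (card (?S j)) * b ^ 4 \<le> Z * (3 * M) * b ^ 4" using b by (intro mult_right_mono) auto
    moreover have "(\<Sum>x\<in>points K. if x \<in> ?S j then b ^ 4 else 0) = real (card (?S j)) * b ^ 4"
    proof -
      have "(\<Sum>x\<in>points K. if x \<in> ?S j then b ^ 4 else 0) = (\<Sum>x\<in>{x \<in> points K. x \<in> ?S j}. b ^ 4)"
        by (rule sum.inter_filter[OF fin, symmetric])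
      moreover have "{x \<in> points K. x \<in> ?S j} = ?S j" by auto
      ultimately show ?thesis by simp
    qed
    ultimately show "(\<Sum>x\<in>points K. if x \<in> ?S j then b ^ 4 else 0) \<le> b ^ 4 * (3 * Z * M)" by (simp add: mult_ac)
  qed (use b in auto)
  finally show ?thesis by (simp add: mult_ac)
qed

text \<open>The error carries a sixteenth power of \<open>l\<close>. Short vectors have length at
  most of order \<open>1 + exp l / T\<close>, where \<open>T\<close> absorbs this power; the longest
  side \<open>exp (l / 2)\<close> of the box leaves another \<open>exp (l / 2)\<close> to absorb
  it.\<close>

lemma level_of_distribution_simple:
  fixes l T :: real
  assumes K: "nice m len K" "K \<subseteq> cball 0 (2 * exp l)" and l: "l \<ge> 1" and T: "T \<ge> 1"
    and D: "\<And>i. D' i \<ge> 0" "\<And>i. D' i \<le> exp (l / 2)" "(\<Prod>i\<in>UNIV. D' i) \<le> (exp l / T)\<^sup>2"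
    and num: "l ^ 16 \<le> T" "l ^ 16 \<le> exp (l / 2)" and len: "len \<le> C * exp l" "C \<ge> 0"
  shows "(\<Sum>d\<in>dbox D'. \<bar>Acount K d - measure lebesgue K / lattice_det \<Lambda> * inv_idx d\<bar>)
    \<le> (36 * real m + 1 + 144 * real m * C * 24 * cL * (2 + sqrt (2 * lattice_det \<Lambda>)) * (2 + ln (2 * cL * (1 + sqrt (2 * lattice_det \<Lambda>)))) ^ 16
        + 48 * cL * (2 + ln (2 * cL * (1 + sqrt (2 * lattice_det \<Lambda>)))) ^ 16) * (exp l)\<^sup>2"
proof -
  let ?Y = "exp l" and ?s = "sqrt (2 * lattice_det \<Lambda>)" and ?\<Pi> = "\<Prod>i\<in>UNIV. D' i"
  let ?q = "2 + ln (2 * cL * (1 + ?s))"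
  define M where "M = 1 + sqrt (2 * ?\<Pi> * lattice_det \<Lambda>)"
  have Y1: "?Y \<ge> 1" using l by simp
  have s0: "?s \<ge> 0" using lattice_det_pos by simp
  have len0: "len \<ge> 0" using K(1) by (simp add: nice_def)
  have l16: "l ^ 16 \<ge> 1" using l by (rule one_le_power)
  have \<Pi>0: "?\<Pi> \<ge> 0" by (intro prod_nonneg ballI D(1))
  have sq: "sqrt (2 * ?\<Pi> * lattice_det \<Lambda>) \<le> ?s * (?Y / T)"
  proof -
    have "2 * ?\<Pi> * lattice_det \<Lambda> \<le> 2 * (?Y / T)\<^sup>2 * lattice_det \<Lambda>" using D(3) lattice_det_pos by (intro mult_right_mono mult_left_mono) auto
    then have "sqrt (2 * ?\<Pi> * lattice_det \<Lambda>) \<le> sqrt (2 * (?Y / T)\<^sup>2 * lattice_det \<Lambda>)" by (rule real_sqrt_le_mono)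
    also have "\<dots> = sqrt (2 * lattice_det \<Lambda>) * \<bar>?Y / T\<bar>" by (simp add: real_sqrt_mult)
    finally show ?thesis using T by simp
  qed
  have M1: "M \<ge> 1" unfolding M_def using \<Pi>0 lattice_det_pos by simp
  have YT: "?Y / T \<le> ?Y" using T Y1 by (simp add: divide_le_eq)
  have MY: "M \<le> (1 + ?s) * ?Y"
  proof -
    have "?s * (?Y / T) \<le> ?s * ?Y" using YT s0 by (intro mult_left_mono)
    moreover have "(1 + ?s) * ?Y = ?Y + ?s * ?Y" by (simp add: algebra_simps)
    ultimately show ?thesis using sq Y1 unfolding M_def by linarith
  qed
  have cs: "2 * cL * (1 + ?s) \<ge> 1"
  proof -
    have "1 * 1 \<le> (2 * cL) * (1 + ?s)" using cL_ge1 s0 by (intro mult_mono) auto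
    then show ?thesis by simp
  qed
  have ln0: "ln (2 * cL * (1 + ?s)) \<ge> 0" using cs by simp
  have lnb: "(1 + ln z) ^ 16 \<le> ?q ^ 16 * l ^ 16" if z: "z \<ge> 1" "z \<le> 2 * cL * (1 + ?s) * ?Y" for z
  proof -
    have "ln z \<le> ln (2 * cL * (1 + ?s) * ?Y)" using z by (subst ln_le_cancel_iff) linarith+
    also have "\<dots> = ln (2 * cL * (1 + ?s)) + l" using cs by (subst ln_mult) auto
    finally have "1 + ln z \<le> 1 * l + ln (2 * cL * (1 + ?s)) * l + 1 * l"
      using l mult_left_mono[OF l ln0] by simp
    also have "\<dots> = ?q * l" by (simp add: algebra_simps)
    finally have "(1 + ln z) ^ 16 \<le> (?q * l) ^ 16" using z by (intro power_mono) auto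
    then show ?thesis by (simp add: power_mult_distrib)
  qed
  have q0: "?q ^ 16 \<ge> 0" using ln0 by (intro zero_le_power) simp
  have "cL * M \<le> cL * ((1 + ?s) * ?Y)" using MY cL_ge1 by (intro mult_left_mono) auto
  also have "\<dots> \<le> 2 * cL * (1 + ?s) * ?Y" using cL_ge1 s0 by (simp add: mult_ac)
  finally have b1: "(1 + ln (cL * M)) ^ 16 \<le> ?q ^ 16 * l ^ 16"
    using cL_ge1 M1 mult_mono[of 1 cL 1 M] by (intro lnb) auto
  have u2: "cL * (2 * ?Y) \<le> 2 * cL * (1 + ?s) * ?Y" using cL_ge1 s0 by (simp add: algebra_simps)
  have "2 * ?Y \<ge> 1" using Y1 by linarith
  from mult_mono[OF cL_ge1 this] have "1 \<le> cL * (2 * ?Y)" using cL_ge1 by simp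
  then have b2: "(1 + ln (cL * (2 * ?Y))) ^ 16 \<le> ?q ^ 16 * l ^ 16" using u2 by (rule lnb)
  have eY: "exp (l / 2) * exp (l / 2) = ?Y" by (simp flip: exp_add)
  have el: "exp (l / 2) * l ^ 16 \<le> ?Y" unfolding eY[symmetric] using num(2) by (intro mult_left_mono) auto
  have Ml: "(M + exp (l / 2)) * l ^ 16 \<le> (2 + ?s) * ?Y"
  proof -
    have "1 * l ^ 16 \<le> exp (l / 2) * l ^ 16" using l by (intro mult_right_mono) auto
    then have 1: "l ^ 16 \<le> ?Y" using el by linarith
    have "?s * (?Y / T) * l ^ 16 = ?s * ?Y * (l ^ 16 / T)" by simp
    also have "\<dots> \<le> ?s * ?Y * 1" using num(1) T s0 by (intro mult_left_mono) (auto simp: divide_le_eq)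
    finally have 2: "?s * (?Y / T) * l ^ 16 \<le> ?s * ?Y" by simp
    have "(M + exp (l / 2)) * l ^ 16 \<le> (1 + ?s * (?Y / T) + exp (l / 2)) * l ^ 16"
      using sq l16 unfolding M_def by (intro mult_right_mono) auto
    also have "\<dots> = l ^ 16 + ?s * (?Y / T) * l ^ 16 + exp (l / 2) * l ^ 16" by (simp add: algebra_simps)
    also have "\<dots> \<le> ?Y + ?s * ?Y + ?Y" using 1 2 el by linarith
    finally show ?thesis by (simp add: algebra_simps)
  qed
  have alg: "(36 * a + 1) * y\<^sup>2 + 144 * a * (C * y) * (24 * b * (e * y) * q) + 2 * y * (24 * b * y * q)
    = (36 * a + 1 + 144 * a * C * 24 * b * e * q + 48 * b * q) * y\<^sup>2" for a b e q y :: real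
    by (simp add: power2_eq_square algebra_simps)
  have "(\<Sum>d\<in>dbox D'. \<bar>Acount K d - measure lebesgue K / lattice_det \<Lambda> * inv_idx d\<bar>)
    \<le> (36 * real m + 1) * ?\<Pi> + 144 * real m * len * (24 * cL * (M + exp (l / 2)) * (1 + ln (cL * M)) ^ 16)
       + 2 * ?Y * (24 * cL * exp (l / 2) * (1 + ln (cL * (2 * ?Y))) ^ 16)"
    by (rule level_of_distribution[OF K _ D(1,2) M_def]) (use Y1 in linarith)
  also have "\<dots> \<le> (36 * real m + 1) * ?Y\<^sup>2 + 144 * real m * (C * ?Y) * (24 * cL * ((2 + ?s) * ?Y) * ?q ^ 16)
       + 2 * ?Y * (24 * cL * ?Y * ?q ^ 16)"
  proof (intro add_mono)
    have "(?Y / T)\<^sup>2 \<le> ?Y\<^sup>2" using YT T by (intro power_mono) auto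
    then show "(36 * real m + 1) * ?\<Pi> \<le> (36 * real m + 1) * ?Y\<^sup>2" using D(3) by (intro mult_left_mono) auto
    have "24 * cL * (M + exp (l / 2)) * (1 + ln (cL * M)) ^ 16 \<le> 24 * cL * (M + exp (l / 2)) * (?q ^ 16 * l ^ 16)"
      using b1 cL_ge1 M1 by (intro mult_left_mono mult_nonneg_nonneg) auto
    also have "\<dots> = 24 * cL * ((M + exp (l / 2)) * l ^ 16) * ?q ^ 16" by simp
    also have "\<dots> \<le> 24 * cL * ((2 + ?s) * ?Y) * ?q ^ 16"
      using Ml cL_ge1 q0 by (intro mult_right_mono mult_left_mono) auto
    finally have a: "24 * cL * (M + exp (l / 2)) * (1 + ln (cL * M)) ^ 16 \<le> 24 * cL * ((2 + ?s) * ?Y) * ?q ^ 16" .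
    have "0 \<le> 24 * cL * ((2 + ?s) * ?Y) * ?q ^ 16" using cL_ge1 s0 q0 by (intro mult_nonneg_nonneg) auto
    then have "144 * real m * len * (24 * cL * ((2 + ?s) * ?Y) * ?q ^ 16) \<le> 144 * real m * (C * ?Y) * (24 * cL * ((2 + ?s) * ?Y) * ?q ^ 16)"
      using len by (intro mult_right_mono mult_left_mono) auto
    moreover have "144 * real m * len * (24 * cL * (M + exp (l / 2)) * (1 + ln (cL * M)) ^ 16) \<le> 144 * real m * len * (24 * cL * ((2 + ?s) * ?Y) * ?q ^ 16)"
      using a len0 by (intro mult_left_mono) auto
    ultimately show "144 * real m * len * (24 * cL * (M + exp (l / 2)) * (1 + ln (cL * M)) ^ 16) \<le> 144 * real m * (C * ?Y) * (24 * cL * ((2 + ?s) * ?Y) * ?q ^ 16)"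
      by linarith
    have "24 * cL * exp (l / 2) * (1 + ln (cL * (2 * ?Y))) ^ 16 \<le> 24 * cL * exp (l / 2) * (?q ^ 16 * l ^ 16)"
      using b2 cL_ge1 by (intro mult_left_mono) auto
    also have "\<dots> = 24 * cL * (exp (l / 2) * l ^ 16) * ?q ^ 16" by simp
    also have "\<dots> \<le> 24 * cL * ?Y * ?q ^ 16" using el cL_ge1 q0 by (intro mult_right_mono mult_left_mono) auto
    finally show "2 * ?Y * (24 * cL * exp (l / 2) * (1 + ln (cL * (2 * ?Y))) ^ 16) \<le> 2 * ?Y * (24 * cL * ?Y * ?q ^ 16)"
      by (intro mult_left_mono) auto
  qed
  also have "\<dots> = (36 * real m + 1 + 144 * real m * C * 24 * cL * (2 + ?s) * ?q ^ 16 + 48 * cL * ?q ^ 16) * ?Y\<^sup>2"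
    by (rule alg)
  finally show ?thesis .
qed

end

section \<open>The asymptotic formula\<close>

lemma eventually_power_le_exp: "\<forall>\<^sub>F x::real in at_top. C * x ^ n < exp x"
proof -
  have "((\<lambda>x::real. C * (x ^ n / exp x)) \<longlongrightarrow> C * 0) at_top" by (intro tendsto_intros tendsto_power_div_exp_0)
  then have "\<forall>\<^sub>F x::real in at_top. C * (x ^ n / exp x) < 1" by (rule order_tendstoD) simp
  then show ?thesis by eventually_elim (simp add: divide_less_eq)
qed

lemma eventually_ln_sq: "\<forall>\<^sub>F l::real in at_top. C * (ln l)\<^sup>2 < l"
proof -
  have "\<forall>\<^sub>F l::real in at_top. C * (ln l) ^ 2 < exp (ln l)"
    by (rule eventually_compose_filterlim[OF eventually_power_le_exp ln_at_top])
  then show ?thesis using eventually_gt_at_top[of 0] by eventually_elim simp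
qed

lemma eventually_power_le_exp_half: "\<forall>\<^sub>F l::real in at_top. l ^ n \<le> exp (l / 2)"
proof -
  have "\<forall>\<^sub>F l::real in at_top. 2 ^ n * (l / 2) ^ n < exp (l / 2)"
    by (rule eventually_compose_filterlim[OF eventually_power_le_exp])
       (rule filterlim_at_top_mult_tendsto_pos[OF tendsto_const _ filterlim_ident, of "1/2", simplified])
  then show ?thesis by eventually_elim (simp add: power_divide)
qed

text \<open>Here \<open>l ^ 32\<close> is the number of divisors allowed at a good point and \<open>exp l / l ^ 128\<close> the lower bound for its values.\<close>

lemma exists_exponent:
  fixes l :: real
  assumes l: "l \<ge> 1" "ln l \<ge> 1" and big: "26240 * (ln l)\<^sup>2 < l"
  shows "\<exists>k. l ^ 32 < 2 ^ k \<and> ((l ^ 128) ^ 4) ^ k * l ^ 128 < exp l"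
proof -
  let ?u = "ln l"
  \<comment> \<open>With \<open>ln 2 \<ge> 2 / 3\<close> this makes \<open>2 ^ k\<close> at least
    \<open>exp (100 / 3 * ln l)\<close>, which exceeds \<open>l ^ 32\<close>.\<close>
  define k where "k = nat \<lceil>50 * ?u\<rceil>"
  have k: "50 * ?u \<le> real k" "real k \<le> 50 * ?u + 1" using l by (simp_all add: k_def)
  have l0: "l > 0" using l by simp
  have ln2: "ln (2::real) \<ge> 2 / 3" using ln2_ge_two_thirds by simp
  have "32 * ?u < 50 * ?u * (2 / 3)" using l by linarith
  also have "\<dots> \<le> real k * ln 2" using k l ln2 by (intro mult_mono) auto
  finally have "exp (32 * ?u) < exp (real k * ln 2)" by simp
  moreover have "exp (32 * ?u) = l ^ 32" using l0 exp_of_nat_mult[of 32 ?u] by simp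
  moreover have "exp (real k * ln 2) = 2 ^ k" by (simp add: exp_of_nat_mult)
  ultimately have a: "l ^ 32 < 2 ^ k" by simp
  have "((l ^ 128) ^ 4) ^ k * l ^ 128 = l ^ (512 * k + 128)"
    by (simp add: power_add power_mult[symmetric])
  also have "\<dots> = exp (real (512 * k + 128) * ?u)" using l0 by (simp only: exp_of_nat_mult exp_ln)
  also have "\<dots> < exp l"
  proof -
    \<comment> \<open>\<open>26240 = 512 * 51 + 128\<close>, from
      \<open>k \<le> 50 * ln l + 1\<close> and \<open>ln l \<ge> 1\<close>; the 512 is
      \<open>4 * 128\<close>.\<close>
    have "real (512 * k + 128) \<le> 26240 * ?u"
      using k l by simp
    then have "real (512 * k + 128) * ?u \<le> 26240 * ?u * ?u" using l by (intro mult_right_mono) auto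
    then show ?thesis using big by (simp add: power2_eq_square)
  qed
  finally show ?thesis using a by blast
qed

lemma measure_le_square:
  fixes K :: "(real^2) set"
  assumes cK: "compact K" and y: "y \<ge> 0" and sup: "\<And>x j. x \<in> K \<Longrightarrow> \<bar>x $ j\<bar> \<le> y"
  shows "measure lebesgue K \<le> 4 * y\<^sup>2"
proof -
  have "measure lebesgue K \<le> measure lebesgue (cbox (\<chi> i. - y) (\<chi> i. y) :: (real^2) set)"
  proof (intro measure_mono_fmeasurable)
    show "K \<subseteq> cbox (\<chi> i. - y) (\<chi> i. y)"
    proof
      fix x assume "x \<in> K"
      then have "- y \<le> x $ j \<and> x $ j \<le> y" for j using sup[of x j] by linarith
      then show "x \<in> cbox (\<chi> i. - y) (\<chi> i. y)" by (simp add: mem_box_cart)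
    qed
    show "K \<in> sets lebesgue" by (rule fmeasurableD[OF lmeasurable_compact[OF cK]])
  qed simp
  also have "\<dots> = measure lborel (cbox (\<chi> i. - y) (\<chi> i. y) :: (real^2) set)" by (rule measure_completion) simp
  also have "\<dots> = (2 * y)\<^sup>2" using y by (subst content_cbox_cart) (auto simp: interval_eq_empty_cart not_less)
  finally show ?thesis by (simp add: power_mult_distrib)
qed

context adm begin

text \<open>The constant and the threshold for \<open>l\<close> are fixed before the set,
  \<open>V\<close> and its hyperplanes, which is the required uniformity. With
  \<open>T = l ^ 128\<close> every error term is compared with
  \<open>(exp l) ^ 2 * l ^ 3 * ln l\<close>.\<close>

lemma sum_card_divisors_asymptotic:
  assumes C: "C \<ge> 0"
  shows "\<exists>Kc\<ge>0. \<forall>\<^sub>F l in at_top. \<forall>K V H len.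
    nice m len K \<longrightarrow> len \<le> C * exp l \<longrightarrow> (\<forall>x\<in>K. \<forall>j. \<bar>x $ j\<bar> \<le> exp l) \<longrightarrow>
    (\<forall>x\<in>\<Lambda> \<inter> K. \<forall>i. 0 \<le> Lf i x \<and> of_int (Lf i x) \<le> exp l) \<longrightarrow> cut_by H V \<longrightarrow> card H \<le> N \<longrightarrow>
    \<bar>(\<Sum>x\<in>points K. real (card {d \<in> vdivs (form_vals x). phi l d \<in> V})) - measure lebesgue K / lattice_det \<Lambda> * (euler_const * l ^ 4 * measure lebesgue V)\<bar>
      \<le> Kc * ((exp l)\<^sup>2 * l ^ 3 * ln l)"
proof -
  define q2 where "q2 = 2 + ln (2 * cL)"
  define Kb where "Kb = 96 * cL * q2 ^ 32 + 24"
  define KL where "KL = 36 * real m + 1 + 144 * real m * C * 24 * cL * (2 + sqrt (2 * lattice_det \<Lambda>)) * (2 + ln (2 * cL * (1 + sqrt (2 * lattice_det \<Lambda>)))) ^ 16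
        + 48 * cL * (2 + ln (2 * cL * (1 + sqrt (2 * lattice_det \<Lambda>)))) ^ 16"
  define K3 where "K3 = (4096 + 16 * real N) * (KH 2 + 128 * slabC) + 16 * KH (N + 4) + 512 * slabC"
  define Kc where "Kc = 17 * Kb + (4112 + 16 * real N) * KL + 4 / lattice_det \<Lambda> * KG * K3"
  have q20: "q2 \<ge> 0" using cL_ge1 by (simp add: q2_def)
  have KH0: "KH n \<ge> 0" for n using slabC_pos by (simp add: KH_def)
  have Kb0: "Kb \<ge> 0" using q20 cL_ge1 by (simp add: Kb_def)
  have KL0: "KL \<ge> 0"
  proof -
    have "1 * 1 \<le> (2 * cL) * (1 + sqrt (2 * lattice_det \<Lambda>))" using cL_ge1 lattice_det_pos by (intro mult_mono) auto
    then have "0 \<le> ln (2 * cL * (1 + sqrt (2 * lattice_det \<Lambda>)))" by simp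
    then show ?thesis unfolding KL_def using C cL_ge1 lattice_det_pos
      by (intro add_nonneg_nonneg mult_nonneg_nonneg zero_le_power) auto
  qed
  have K30: "K3 \<ge> 0" using KH0 slabC_pos unfolding K3_def by (intro add_nonneg_nonneg mult_nonneg_nonneg) auto
  have Kc0: "Kc \<ge> 0" using Kb0 KL0 K30 KG_nonneg lattice_det_pos unfolding Kc_def
    by (intro add_nonneg_nonneg mult_nonneg_nonneg) auto
  show ?thesis
  proof (intro exI[of _ Kc] conjI Kc0)
    have "\<forall>\<^sub>F l::real in at_top. l \<ge> 1 \<and> ln l \<ge> 1 \<and> 26240 * (ln l)\<^sup>2 < l \<and> l ^ 16 \<le> exp (l / 2) \<and> l ^ 128 \<le> exp (l / 2) \<and> l > 1"
      by (intro eventually_conj eventually_ge_at_top eventually_gt_at_top eventually_ln_sq eventually_power_le_exp_half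
          eventually_compose_filterlim[OF eventually_ge_at_top[of "1::real"] ln_at_top])
    then show "\<forall>\<^sub>F l in at_top. \<forall>K V H len.
      nice m len K \<longrightarrow> len \<le> C * exp l \<longrightarrow> (\<forall>x\<in>K. \<forall>j. \<bar>x $ j\<bar> \<le> exp l) \<longrightarrow>
      (\<forall>x\<in>\<Lambda> \<inter> K. \<forall>i. 0 \<le> Lf i x \<and> of_int (Lf i x) \<le> exp l) \<longrightarrow> cut_by H V \<longrightarrow> card H \<le> N \<longrightarrow>
      \<bar>(\<Sum>x\<in>points K. real (card {d \<in> vdivs (form_vals x). phi l d \<in> V})) - measure lebesgue K / lattice_det \<Lambda> * (euler_const * l ^ 4 * measure lebesgue V)\<bar>
      \<le> Kc * ((exp l)\<^sup>2 * l ^ 3 * ln l)"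
    proof (eventually_elim, intro allI impI)
      fix l :: real and K V H len
      assume ev: "l \<ge> 1 \<and> ln l \<ge> 1 \<and> 26240 * (ln l)\<^sup>2 < l \<and> l ^ 16 \<le> exp (l / 2) \<and> l ^ 128 \<le> exp (l / 2) \<and> l > 1"
      assume K: "nice m len K" "len \<le> C * exp l" and sup: "\<forall>x\<in>K. \<forall>j. \<bar>x $ j\<bar> \<le> exp l"
        and Lfb: "\<forall>x\<in>\<Lambda> \<inter> K. \<forall>i. 0 \<le> Lf i x \<and> of_int (Lf i x) \<le> exp l" and V: "cut_by H V" "card H \<le> N"
      let ?Y = "exp l" and ?T = "l ^ 128" and ?W = "measure lebesgue K / lattice_det \<Lambda>"
      let ?D = "exp (l / 2) / ?T" and ?\<delta> = "ln ?T / l" and ?b = "l ^ 32"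
      have l: "l \<ge> 1" "l > 0" using ev by auto
      have T1: "?T > 1" using ev by (intro one_less_power) auto
      have Y1: "?Y \<ge> 1" using l by simp
      obtain k where k: "?b < 2 ^ k" "(?T ^ 4) ^ k * ?T < ?Y" using exists_exponent ev by blast
      have ball: "K \<subseteq> cball 0 (2 * ?Y)"
      proof
        fix x assume x: "x \<in> K"
        have "norm x \<le> (\<Sum>j\<in>UNIV. \<bar>x $ j\<bar>)" by (rule norm_le_l1_cart)
        also have "\<dots> \<le> (\<Sum>j\<in>(UNIV :: 2 set). ?Y)" using sup x by (intro sum_mono) auto
        finally show "x \<in> cball 0 (2 * ?Y)" by simp
      qed
      have M1: "2 * ?Y \<ge> 1" using Y1 by linarith
      have points: "points K \<subseteq> ball\<Lambda> (2 * ?Y)" by (rule points_ball[OF ball])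
      have fin: "finite (points K)" by (rule finite_subset[OF points finite_ball\<Lambda>])
      have pos: "Lf i x > 0" and le: "of_int (Lf i x) \<le> ?Y" if "x \<in> points K" for x i
        using that Lfb by (auto simp: points_def order.strict_iff_order)
      have cK: "compact K" using K(1) by (simp add: nice_def)
      have mK: "measure lebesgue K \<le> 4 * ?Y\<^sup>2"
        by (rule measure_le_square[OF cK]) (use sup in auto)
      have W: "?W \<ge> 0" "?W \<le> 4 / lattice_det \<Lambda> * ?Y\<^sup>2"
        using mK lattice_det_pos by (auto simp: divide_right_mono)
      define Gd where "Gd = {x \<in> points K. \<forall>i. tauf (Lf i x) \<le> ?b \<and> ?Y / ?T \<le> of_int (Lf i x)}"
      define BAD where "BAD = 4 * (2 * ?Y * (6 * cL * (2 * ?Y) * (1 + ln (cL * (2 * ?Y))) ^ 32)) / ?b + 12 * ?b ^ 4 * (?Y / ?T) * (2 * ?Y)"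
      have b1: "?b \<ge> 1" using l by (intro one_le_power)
      have bad: "(\<Sum>x\<in>points K - Gd. \<Prod>i\<in>UNIV. tauf (Lf i x)) \<le> BAD"
        unfolding BAD_def by (rule bad_sum[OF points M1 pos b1]) (use T1 in \<open>auto simp: Gd_def\<close>)
      have BAD: "BAD \<le> Kb * ?Y\<^sup>2"
      proof -
        have "1 + ln (cL * (2 * ?Y)) \<le> q2 * l"
        proof -
          have "ln (2 * cL * ?Y) = ln (2 * cL) + ln ?Y" using cL_ge1 by (intro ln_mult_pos) auto
          then have "ln (cL * (2 * ?Y)) = ln (2 * cL) + l" by (simp only: ln_exp mult_ac)
          moreover have "ln (2 * cL) * 1 \<le> ln (2 * cL) * l" using cL_ge1 l by (intro mult_left_mono) auto
          ultimately show ?thesis using l by (simp add: q2_def algebra_simps)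
        qed
        moreover have "0 \<le> 1 + ln (cL * (2 * ?Y))" 
          using mult_mono[OF cL_ge1 M1] cL_ge1 by simp
        ultimately have "(1 + ln (cL * (2 * ?Y))) ^ 32 \<le> (q2 * l) ^ 32" by (rule power_mono)
        then have p: "(1 + ln (cL * (2 * ?Y))) ^ 32 / ?b \<le> q2 ^ 32"
          using l by (simp add: power_mult_distrib divide_le_eq)
        \<comment> \<open>The fifth moment of \<open>tau\<close> produces the power
          \<open>2 ^ 5 = 32\<close> of a logarithm, cancelled by the division by
          \<open>l ^ 32\<close>; in the second term the fourth power of \<open>l ^ 32\<close> is
          cancelled by \<open>T\<close>.\<close>
        have "BAD = 96 * cL * ?Y\<^sup>2 * ((1 + ln (cL * (2 * ?Y))) ^ 32 / ?b) + 24 * ?Y\<^sup>2 * (?b ^ 4 / ?T)"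
          by (simp add: BAD_def power2_eq_square)
        also have "?b ^ 4 / ?T = 1" using l by (simp flip: power_mult)
        also have "96 * cL * ?Y\<^sup>2 * ((1 + ln (cL * (2 * ?Y))) ^ 32 / ?b) \<le> 96 * cL * ?Y\<^sup>2 * q2 ^ 32"
          using p cL_ge1 by (intro mult_left_mono) auto
        finally show ?thesis by (simp add: Kb_def algebra_simps)
      qed
      \<comment> \<open>The prime power argument is applied with \<open>Q = T ^ 4\<close>: for
        \<open>n \<le> exp l\<close> the condition \<open>d ^ 4 * T ^ 4 \<le> n ^ 2\<close> implies
        \<open>d \<le> exp (l / 2) / T\<close>, which is the cut.\<close>
      have good2: "tau (form_vals x $ i) \<le> 8 * card {d. d dvd form_vals x $ i \<and> real d \<le> ?D}" if x: "x \<in> Gd" for x i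
      proof -
        have xP: "x \<in> points K" and xb: "tauf (Lf i x) \<le> ?b" "?Y / ?T \<le> of_int (Lf i x)" using x by (auto simp: Gd_def)
        let ?n = "form_vals x $ i"
        have n: "?n > 0" "real ?n = of_int (Lf i x)" using pos[OF xP, of i] by (simp_all add: form_vals_def)
        have "real (tau ?n) = tauf (Lf i x)" using pos[OF xP, of i] by (simp add: form_vals_def tauf_def)
        then have "real (tau ?n) < 2 ^ k" using xb(1) k(1) by linarith
        then have t: "tau ?n < 2 ^ k" by (metis of_nat_less_numeral_power_cancel_iff)
        have "(?T ^ 4) ^ k < ?Y / ?T" by (rule iffD2[OF pos_less_divide_eq[OF less_trans[OF zero_less_one T1]] k(2)])
        then have Qn: "(?T ^ 4) ^ k < real ?n" using xb(2) n(2) by linarith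
        have "tau ?n \<le> 8 * card {d. d dvd ?n \<and> real d ^ 4 * ?T ^ 4 \<le> real ?n ^ 2}"
          by (rule tau_le_small_divisors[OF n(1) _ t Qn]) (rule one_le_power, use T1 in simp)
        also have "\<dots> \<le> 8 * card {d. d dvd ?n \<and> real d \<le> ?D}"
        proof (intro mult_le_mono2 card_mono)
          show "finite {d. d dvd ?n \<and> real d \<le> ?D}" using finite_divisors[OF n(1)] by simp
          show "{d. d dvd ?n \<and> real d ^ 4 * ?T ^ 4 \<le> real ?n ^ 2} \<subseteq> {d. d dvd ?n \<and> real d \<le> ?D}"
          proof (intro subsetI CollectI conjI; elim CollectE conjE)
            fix d assume d: "real d ^ 4 * ?T ^ 4 \<le> real ?n ^ 2"
            have "(real d * ?T) ^ 4 \<le> ?Y ^ 2"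
            proof -
              have "real ?n ^ 2 \<le> ?Y ^ 2" using le[OF xP, of i] n by (intro power_mono) auto
              moreover have "(real d * ?T) ^ 4 \<le> real ?n ^ 2" using d by (simp only: power_mult_distrib)
              ultimately show ?thesis by linarith
            qed
            also have "?Y ^ 2 = exp (l / 2) ^ 4" by (simp flip: exp_of_nat_mult)
            finally have "real d * ?T \<le> exp (l / 2)" by (rule power_le_imp_le_base[of _ 3, simplified]) simp
            then show "real d \<le> ?D" by (rule iffD2[OF pos_le_divide_eq[OF less_trans[OF zero_less_one T1]]])
          qed auto
        qed
        finally show ?thesis .
      qed
      define LEV where "LEV = KL * ?Y\<^sup>2"
      have Tl: "l ^ 16 \<le> ?T" using l by (intro power_increasing) auto
      have eY: "exp (l / 2) * exp (l / 2) = ?Y" by (simp flip: exp_add)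
      have D0: "?D \<ge> 0" "?D \<le> exp (l / 2)" using T1 by (auto simp: divide_le_eq)
      have T1': "?T \<ge> 1" using T1 by simp
      have num: "l ^ 16 \<le> ?T" "l ^ 16 \<le> exp (l / 2)" using Tl ev by auto
      have lev0: "(\<Sum>d\<in>dbox (\<lambda>_. ?D). \<bar>Acount K d - ?W * inv_idx d\<bar>) \<le> LEV"
        unfolding LEV_def KL_def
      proof (rule level_of_distribution_simple[OF K(1) ball l(1) T1' _ _ _ num K(2) C])
        have "?D ^ 4 = (exp (l / 2) * exp (l / 2)) ^ 2 / ?T ^ 4" by (simp add: power_divide power2_eq_square power4_eq_xxxx)
        also have "\<dots> \<le> ?Y ^ 2 / ?T ^ 2" unfolding eY using T1 by (intro divide_left_mono power_increasing) auto
        finally show "(\<Prod>i\<in>(UNIV :: 4 set). ?D) \<le> (?Y / ?T)\<^sup>2" by (simp add: power_divide)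
      qed (use D0 in auto)
      have lev1: "(\<Sum>d\<in>dbox (\<lambda>i. if i = j then exp (l / 2) else ?D). \<bar>Acount K d - ?W * inv_idx d\<bar>) \<le> LEV" for j
        unfolding LEV_def KL_def
      proof (rule level_of_distribution_simple[OF K(1) ball l(1) T1' _ _ _ num K(2) C])
        \<comment> \<open>One side is the full square root, but the other three are cut by
          \<open>T\<close>, so the product is \<open>(exp l) ^ 2 / T ^ 3\<close>.\<close>
        have "(\<Prod>i\<in>(UNIV :: 4 set). if i = j then exp (l / 2) else ?D) = exp (l / 2) * ?D ^ 3"
          by (subst prod.remove[of UNIV j]) (auto simp: card_Diff_subset)
        also have "\<dots> = (exp (l / 2) * exp (l / 2)) ^ 2 / ?T ^ 3" by (simp add: power_divide power2_eq_square power3_eq_cube)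
        also have "\<dots> \<le> ?Y ^ 2 / ?T ^ 2" unfolding eY using T1 by (intro divide_left_mono power_increasing) auto
        finally show "(\<Prod>i\<in>(UNIV :: 4 set). if i = j then exp (l / 2) else ?D) \<le> (?Y / ?T)\<^sup>2" by (simp add: power_divide)
      qed (use D0 in auto)
      have Gd: "Gd \<subseteq> points K" by (auto simp: Gd_def)
      have good1: "?Y \<le> ?T * of_int (Lf i x)" if "x \<in> Gd" for x i
      proof -
        have "?Y / ?T \<le> of_int (Lf i x)" using that by (simp add: Gd_def)
        then show ?thesis by (simp only: pos_divide_le_eq[OF less_trans[OF zero_less_one T1]] mult.commute)
      qed
      have "\<bar>(\<Sum>x\<in>points K. real (card {d \<in> vdivs (form_vals x). phi l d \<in> V})) - ?W * (euler_const * l ^ 4 * measure lebesgue V)\<bar>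
        \<le> 17 * BAD + (4112 + 16 * real N) * LEV
          + ?W * KG * ((4096 + 16 * real N) * (KH 2 * l ^ 3 + slabC * ?\<delta> * l ^ 4) + 16 * KH (N + 4) * l ^ 3 + 4 * slabC * ?\<delta> * l ^ 4)"
        by (rule sum_card_divisors_error[OF fin pos le V l(1) T1 _ W(1) lev0 lev1 good1 good2 Gd bad]) (use ev in auto)
      also have "\<dots> \<le> 17 * (Kb * (?Y\<^sup>2 * l ^ 3 * ln l)) + (4112 + 16 * real N) * (KL * (?Y\<^sup>2 * l ^ 3 * ln l))
          + (4 / lattice_det \<Lambda> * ?Y\<^sup>2) * KG * (K3 * (l ^ 3 * ln l))"
      proof -
        have l3: "l ^ 3 * ln l \<ge> 1"
        proof -
          have "1 * 1 \<le> l ^ 3 * ln l" using ev by (intro mult_mono one_le_power) auto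
          then show ?thesis by simp
        qed
        have Yl: "?Y\<^sup>2 \<le> ?Y\<^sup>2 * l ^ 3 * ln l" using mult_left_mono[OF l3, of "?Y\<^sup>2"] by simp
        have l3ln: "l ^ 3 \<le> l ^ 3 * ln l" using ev l by simp
        \<comment> \<open>The slabs have width \<open>ln T / l = 128 * ln l / l\<close>; this term
          is the origin of the double logarithm.\<close>
        have \<delta>l: "?\<delta> * l ^ 4 = 128 * (l ^ 3 * ln l)"
          using l by (simp add: ln_realpow power4_eq_xxxx power3_eq_cube)
        have 1: "17 * BAD \<le> 17 * (Kb * (?Y\<^sup>2 * l ^ 3 * ln l))"
          using BAD mult_left_mono[OF Yl Kb0] by linarith
        have 2: "(4112 + 16 * real N) * LEV \<le> (4112 + 16 * real N) * (KL * (?Y\<^sup>2 * l ^ 3 * ln l))"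
          unfolding LEV_def by (rule mult_left_mono[OF mult_left_mono[OF Yl KL0]]) simp
        have inner: "(4096 + 16 * real N) * (KH 2 * l ^ 3 + slabC * ?\<delta> * l ^ 4) + 16 * KH (N + 4) * l ^ 3 + 4 * slabC * ?\<delta> * l ^ 4
            \<le> K3 * (l ^ 3 * ln l)"
        proof -
          have "(4096 + 16 * real N) * (KH 2 * l ^ 3 + slabC * (?\<delta> * l ^ 4)) + 16 * KH (N + 4) * l ^ 3 + 4 * slabC * (?\<delta> * l ^ 4)
            \<le> (4096 + 16 * real N) * (KH 2 * (l ^ 3 * ln l) + slabC * (128 * (l ^ 3 * ln l))) + 16 * KH (N + 4) * (l ^ 3 * ln l) + 4 * slabC * (128 * (l ^ 3 * ln l))"
            unfolding \<delta>l using l3ln KH0[of 2] KH0[of "N + 4"] by (intro add_mono mult_left_mono order_refl) auto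
          also have "\<dots> = K3 * (l ^ 3 * ln l)" unfolding K3_def by (simp only: distrib_right distrib_left mult_ac)
          finally show ?thesis by (simp only: mult.assoc)
        qed
        have inner0: "0 \<le> K3 * (l ^ 3 * ln l)" using K30 l3 by (meson mult_nonneg_nonneg order_trans zero_le_one)
        have "?W * KG * ((4096 + 16 * real N) * (KH 2 * l ^ 3 + slabC * ?\<delta> * l ^ 4) + 16 * KH (N + 4) * l ^ 3 + 4 * slabC * ?\<delta> * l ^ 4)
          \<le> ?W * KG * (K3 * (l ^ 3 * ln l))" by (rule mult_left_mono[OF inner mult_nonneg_nonneg[OF W(1) KG_nonneg]])
        also have "\<dots> \<le> (4 / lattice_det \<Lambda> * ?Y\<^sup>2) * KG * (K3 * (l ^ 3 * ln l))"
          by (rule mult_right_mono[OF mult_right_mono[OF W(2) KG_nonneg] inner0])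
        finally show ?thesis using 1 2 by linarith
      qed
      also have "\<dots> = Kc * (?Y\<^sup>2 * l ^ 3 * ln l)" unfolding Kc_def by (simp add: algebra_simps)
      finally show "\<bar>(\<Sum>x\<in>points K. real (card {d \<in> vdivs (form_vals x). phi l d \<in> V})) - ?W * (euler_const * l ^ 4 * measure lebesgue V)\<bar>
        \<le> Kc * (?Y\<^sup>2 * l ^ 3 * ln l)" .
    qed
  qed
qed

end

section \<open>From sets and logarithms to dilated regions and X\<close>

lemma dilate_eq_image: "X > 0 \<Longrightarrow> dilate X R = (*\<^sub>R) X ` R"
proof -
  assume X: "X > 0"
  have "x \<in> (*\<^sub>R) X ` R" if "x /\<^sub>R X \<in> R" for x using that X by (intro image_eqI[of _ _ "x /\<^sub>R X"]) auto
  then show ?thesis using X by (auto simp: dilate_def)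
qed

lemma nice_dilate:
  assumes R: "region m R" and X: "X > 0" and len: "len \<ge> 0" "set_length (frontier (dilate X R)) \<le> ennreal len"
  shows "nice m len (dilate X R)"
proof -
  obtain gs :: "(real \<Rightarrow> real^2) list" where gs: "length gs \<le> m" "\<And>g. g \<in> set gs \<Longrightarrow> g piecewise_differentiable_on {0..1}"
      "frontier R = (\<Union>g\<in>set gs. path_image g)"
    using R by (auto simp: region_def)
  let ?C = "(\<lambda>g. (*\<^sub>R) X ` path_image g) ` set gs"
  have inj: "inj ((*\<^sub>R) X :: real^2 \<Rightarrow> real^2)" using X by (simp add: inj_on_def)
  have "interior ((*\<^sub>R) X ` R) = (*\<^sub>R) X ` interior R"
    by (rule interior_injective_linear_image[OF _ inj]) (rule linear_scale_self)
  then have "frontier (dilate X R) = (*\<^sub>R) X ` frontier R"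
    unfolding dilate_eq_image[OF X] frontier_def closure_scaleR[symmetric] by (simp add: image_set_diff[OF inj])
  then have fr: "frontier (dilate X R) = \<Union>?C" unfolding gs(3) by (simp add: image_UN)
  have "compact (dilate X R)"
    using R X by (simp add: dilate_eq_image compact_scaling region_def)
  moreover have "card ?C \<le> m"
    by (rule order_trans[OF card_image_le order_trans[OF card_length gs(1)]]) simp
  moreover have "connected C" if C: "C \<in> ?C" for C
  proof -
    obtain g where g: "g \<in> set gs" "C = (*\<^sub>R) X ` path_image g" using C by blast
    have "path g" unfolding path_def using gs(2)[OF g(1)] by (rule piecewise_differentiable_on_imp_continuous_on)
    then show ?thesis unfolding g(2) by (intro connected_continuous_image connected_path_image continuous_intros)
  qed
  ultimately show ?thesis unfolding nice_def using fr len
    by (intro conjI exI[of _ ?C]) auto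
qed

lemma region_size_upper:
  assumes R: "compact R" and x: "x \<in> R"
  shows "lform (L $ i) x \<le> region_size L R" "\<bar>x $ j\<bar> \<le> region_size L R"
proof -
  let ?S = "\<Union>x\<in>R. range (\<lambda>i. lform (L $ i) x) \<union> range (\<lambda>j. \<bar>x $ j\<bar>)"
  have S: "?S = (\<Union>i. (\<lambda>x. lform (L $ i) x) ` R) \<union> (\<Union>j. (\<lambda>x. \<bar>x $ j\<bar>) ` R)" by auto
  have "bdd_above ((\<lambda>x. lform (L $ i) x) ` R)" for i
    unfolding lform_def using R
    by (intro bounded_imp_bdd_above compact_imp_bounded compact_continuous_image continuous_intros)
  moreover have "bdd_above ((\<lambda>x. \<bar>x $ j\<bar>) ` R)" for j
    using R by (intro bounded_imp_bdd_above compact_imp_bounded compact_continuous_image continuous_intros)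
  ultimately have "bdd_above ?S" unfolding S by (simp add: bdd_above_UN)
  then show "lform (L $ i) x \<le> region_size L R" "\<bar>x $ j\<bar> \<le> region_size L R"
    unfolding region_size_def using x by (auto intro!: cSup_upper)
qed

lemma cut_out_imp_cut_by:
  assumes "cut_out N B V" "compact V"
  shows "\<exists>H. cut_by H V \<and> card H \<le> N"
proof -
  obtain H :: "((real^4) \<times> real) set" where H: "V \<subseteq> cbox 0 1" "finite H" "card H \<le> N" "\<forall>(a, b)\<in>H. a \<noteq> 0 \<and> (\<forall>i. \<bar>a $ i\<bar> \<le> B) \<and> \<bar>b\<bar> \<le> B"
    "\<forall>v\<in>cbox 0 1. \<forall>w\<in>cbox 0 1. (\<forall>(a, b)\<in>H. sgn (a \<bullet> v - b) = sgn (a \<bullet> w - b)) \<longrightarrow> (v \<in> V \<longleftrightarrow> w \<in> V)"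
    using assms(1) unfolding cut_out_def by (elim conjE exE) (rule that)
  have "\<forall>(a, b)\<in>H. a \<noteq> 0" using H(4) by fast
  then show ?thesis unfolding cut_by_def by (intro exI[of _ H] conjI H(1-3,5) assms(2))
qed

text \<open>Serves the case \<open>r \<le> 0\<close>: all forms vanish at the origin, so no point is
  counted, and the region has measure 0.\<close>

lemma degenerate_region:
  assumes R: "R \<subseteq> {0}" and X: "X > 0"
  shows "divisor_sum \<Lambda> L R X V = 0" "main_term \<Lambda> L R X V = 0"
proof -
  have "{x \<in> \<Lambda> \<inter> dilate X R. \<forall>i. lform (L $ i) x \<noteq> 0} = {}"
    using R by (auto simp: dilate_eq_image[OF X])
  then show "divisor_sum \<Lambda> L R X V = 0" unfolding divisor_sum_def by (simp only: sum.empty)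
  have "negligible R" by (rule negligible_subset[OF _ R]) simp
  then have "measure lebesgue R = 0" by (rule negligible_imp_measure0)
  then show "main_term \<Lambda> L R X V = 0" by (simp add: main_term_def)
qed

context adm begin

lemma local_term_eq: "prime p \<Longrightarrow> local_term \<Lambda> L p k = inv_idx (ppow p k)"
  unfolding local_term_def inv_idx_def ppow_def[symmetric] by (simp add: rho_eq_idx vpos_ppow)

lemma local_factor_eq: "prime p \<Longrightarrow> local_factor \<Lambda> L p = c p"
  unfolding local_factor_def c_def by (simp add: local_term_eq cong: infsum_cong)

lemma at_primes_local_factor: "at_primes (local_factor \<Lambda> L) = at_primes c"
  by (auto simp: at_primes_def local_factor_eq)

lemma at_primes_abs_local_factor: "at_primes (\<lambda>p. \<bar>local_factor \<Lambda> L p\<bar>) = at_primes c"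
  using c_bounds(1) by (auto simp: at_primes_def local_factor_eq less_imp_le)

lemma divisor_sum_eq:
  assumes nn: "\<And>i x. x \<in> \<Lambda> \<inter> dilate X R \<Longrightarrow> Lf i x \<ge> 0"
  shows "divisor_sum \<Lambda> L R X V
    = (\<Sum>x\<in>points (dilate X R). real (card {d \<in> vdivs (form_vals x). phi (ln (region_size L R * X)) d \<in> V}))"
  unfolding divisor_sum_def
proof (rule sum.cong)
  show points: "{x \<in> \<Lambda> \<inter> dilate X R. \<forall>i. lform (L $ i) x \<noteq> 0} = points (dilate X R)"
    by (auto simp: points_def simp flip: Lf)
  fix x assume x: "x \<in> points (dilate X R)"
  have pos: "Lf i x > 0" for i using x nn[of x i] by (auto simp: points_def order.strict_iff_order)
  have "d $ i > 0 \<and> int (d $ i) dvd Lf i x \<longleftrightarrow> d $ i dvd form_vals x $ i" for d :: "nat^4" and i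
    using pos[of i] dvd_pos_nat[of "nat (Lf i x)" "d $ i"] by (auto simp: form_vals_def int_dvd_int_iff[symmetric])
  then have "divisor_quadruples L R X V x = {d \<in> vdivs (form_vals x). phi (ln (region_size L R * X)) d \<in> V}"
    by (simp add: divisor_quadruples_def vdivs_def phi_def Lf_def)
  then show "real (card (divisor_quadruples L R X V x)) = real (card {d \<in> vdivs (form_vals x). phi (ln (region_size L R * X)) d \<in> V})"
    by simp
qed

text \<open>The estimate is available for \<open>l = ln (r * X)\<close>. Replacing \<open>l\<close>
  by \<open>ln X\<close> changes \<open>l ^ 4\<close> by \<open>\<bar>ln r\<bar>\<close> times a
  cubic expression in the logarithms, which a constant depending on \<open>r\<close> absorbs; the
  volumes of \<open>R\<close> and \<open>V\<close> are at most \<open>4 * r ^ 2\<close> and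
  1.\<close>

lemma asymptotic_bound:
  assumes r: "r > 0"
  shows "\<exists>K\<ge>0. \<forall>\<^sub>F X in at_top. \<forall>R V. region m R \<longrightarrow> (\<forall>i. \<forall>x\<in>R. lform (L $ i) x \<ge> 0) \<longrightarrow>
    region_size L R = r \<longrightarrow> set_length (frontier (dilate X R)) \<le> ennreal (C * (r * X)) \<longrightarrow>
    compact V \<longrightarrow> cut_out N B V \<longrightarrow>
    \<bar>divisor_sum \<Lambda> L R X V - main_term \<Lambda> L R X V\<bar> \<le> K * (X\<^sup>2 * (ln X) ^ 3 * ln (ln X))"
proof -
  obtain Kc where Kc: "Kc \<ge> 0" and est: "\<forall>\<^sub>F l in at_top. \<forall>K V H len.
    nice m len K \<longrightarrow> len \<le> max 0 C * exp l \<longrightarrow> (\<forall>x\<in>K. \<forall>j. \<bar>x $ j\<bar> \<le> exp l) \<longrightarrow>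
    (\<forall>x\<in>\<Lambda> \<inter> K. \<forall>i. 0 \<le> Lf i x \<and> of_int (Lf i x) \<le> exp l) \<longrightarrow> cut_by H V \<longrightarrow> card H \<le> N \<longrightarrow>
    \<bar>(\<Sum>x\<in>points K. real (card {d \<in> vdivs (form_vals x). phi l d \<in> V})) - measure lebesgue K / lattice_det \<Lambda> * (euler_const * l ^ 4 * measure lebesgue V)\<bar>
      \<le> Kc * ((exp l)\<^sup>2 * l ^ 3 * ln l)"
    using sum_card_divisors_asymptotic[of "max 0 C" m N] by auto
  define K where "K = 16 * Kc * r\<^sup>2 + 60 * r\<^sup>2 / lattice_det \<Lambda> * KG * \<bar>ln r\<bar>"
  have K0: "K \<ge> 0" using Kc KG_nonneg lattice_det_pos unfolding K_def by (intro add_nonneg_nonneg mult_nonneg_nonneg) auto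
  have lim: "filterlim (\<lambda>X. ln (r * X)) at_top at_top"
    by (rule filterlim_compose[OF ln_at_top]) (rule filterlim_tendsto_pos_mult_at_top[OF tendsto_const r filterlim_ident])
  have lnln: "filterlim (\<lambda>X::real. ln (ln X)) at_top at_top" by (rule filterlim_compose[OF ln_at_top ln_at_top])
  \<comment> \<open>The condition \<open>r \<le> X\<close> yields
    \<open>ln (r * X) \<le> 2 * ln X\<close>, by which all powers of \<open>l\<close> are compared
    with powers of \<open>ln X\<close>.\<close>
  have "\<forall>\<^sub>F X in at_top. 1 \<le> ln (ln X) \<and> 1 \<le> ln (r * X) \<and> r \<le> X \<and> 0 < X \<and> 1 \<le> ln X"
    using filterlim_at_top[THEN iffD1, OF lnln, rule_format, of 1] filterlim_at_top[THEN iffD1, OF lim, rule_format, of 1]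
      filterlim_at_top[THEN iffD1, OF ln_at_top, rule_format, of 1]
    by (intro eventually_conj eventually_ge_at_top eventually_gt_at_top)
  with eventually_compose_filterlim[OF est lim] show ?thesis
  proof (intro exI[of _ K] conjI K0, eventually_elim, intro allI impI)
    fix X R V
    let ?l = "ln (r * X)" and ?y = "ln X"
    assume est: "\<forall>K V H len.
      nice m len K \<longrightarrow> len \<le> max 0 C * exp ?l \<longrightarrow> (\<forall>x\<in>K. \<forall>j. \<bar>x $ j\<bar> \<le> exp ?l) \<longrightarrow>
      (\<forall>x\<in>\<Lambda> \<inter> K. \<forall>i. 0 \<le> Lf i x \<and> of_int (Lf i x) \<le> exp ?l) \<longrightarrow> cut_by H V \<longrightarrow> card H \<le> N \<longrightarrow>
      \<bar>(\<Sum>x\<in>points K. real (card {d \<in> vdivs (form_vals x). phi ?l d \<in> V})) - measure lebesgue K / lattice_det \<Lambda> * (euler_const * ?l ^ 4 * measure lebesgue V)\<bar>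
        \<le> Kc * ((exp ?l)\<^sup>2 * ?l ^ 3 * ln ?l)"
      and big: "1 \<le> ln ?y \<and> 1 \<le> ?l \<and> r \<le> X \<and> 0 < X \<and> 1 \<le> ?y"
      and R: "region m R" and nn: "\<forall>i. \<forall>x\<in>R. lform (L $ i) x \<ge> 0" and rs: "region_size L R = r"
      and len: "set_length (frontier (dilate X R)) \<le> ennreal (C * (r * X))"
      and V: "compact V" "cut_out N B V"
    have X: "X > 0" and rX: "r * X > 0" "exp ?l = r * X" using big r by auto
    have X1: "1 \<le> X" "1 < X" using big X ln_ge_zero_iff[of X] ln_gt_zero_iff[of X] by linarith+
    have cR: "compact R" using R by (simp add: region_def)
    obtain H where H: "cut_by H V" "card H \<le> N" using cut_out_imp_cut_by V by blast
    have nice: "nice m (max 0 C * (r * X)) (dilate X R)"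
    proof (rule nice_dilate[OF R X])
      have "C * (r * X) \<le> max 0 C * (r * X)" using rX by (intro mult_right_mono) auto
      then show "set_length (frontier (dilate X R)) \<le> ennreal (max 0 C * (r * X))"
        using len by (meson ennreal_leI order_trans)
    qed (use rX in auto)
    have sup: "\<bar>x $ j\<bar> \<le> exp ?l" if "x \<in> dilate X R" for x j
      using that X region_size_upper(2)[OF cR, of _ j L] unfolding rX(2) dilate_eq_image[OF X] rs
      by (auto simp: abs_mult)
    have Lf0: "0 \<le> Lf i x" and Lf1: "of_int (Lf i x) \<le> exp ?l" if x: "x \<in> \<Lambda> \<inter> dilate X R" for x i
    proof -
      obtain z where z: "z \<in> R" "x = X *\<^sub>R z" using x X by (auto simp: dilate_eq_image)
      have f: "of_int (Lf i x) = X * lform (L $ i) z" using Lf[of x i] x z by (simp add: lform_scaleR)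
      have "0 \<le> real_of_int (Lf i x)" unfolding f using z nn X by simp
      then show "0 \<le> Lf i x" by simp
      show "of_int (Lf i x) \<le> exp ?l" unfolding f rX(2) using X region_size_upper(1)[OF cR z(1), of L i] rs by simp
    qed
    have "\<bar>divisor_sum \<Lambda> L R X V - measure lebesgue (dilate X R) / lattice_det \<Lambda> * (euler_const * ?l ^ 4 * measure lebesgue V)\<bar>
        \<le> Kc * ((exp ?l)\<^sup>2 * ?l ^ 3 * ln ?l)"
    proof (subst divisor_sum_eq[OF Lf0], assumption, unfold rs, rule est[rule_format, OF nice _ _ _ H])
      show "max 0 C * (r * X) \<le> max 0 C * exp ?l" by (simp only: rX(2))
    qed (use sup Lf0 Lf1 in auto)
    moreover have "measure lebesgue (dilate X R) = X\<^sup>2 * measure lebesgue R"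
      using measure_lebesgue_affine[of X 0 R] X by (simp add: dilate_eq_image)
    ultimately have main: "\<bar>divisor_sum \<Lambda> L R X V - X\<^sup>2 * measure lebesgue R / lattice_det \<Lambda> * (euler_const * ?l ^ 4 * measure lebesgue V)\<bar>
        \<le> Kc * ((r * X)\<^sup>2 * ?l ^ 3 * ln ?l)" by (simp only: rX(2))
    have ly: "?l = ln r + ?y" using r X by (simp add: ln_mult_pos)
    have l2: "1 \<le> ?l" "?l \<le> 2 * ?y" using big r ly by simp_all
    have lnl: "ln ?l \<le> 2 * ln ?y" "0 \<le> ln ?l"
    proof -
      have "ln ?l \<le> ln (2 * ?y)" by (rule ln_mono) (use l2 in linarith)+
      also have "\<dots> = ln 2 + ln ?y" by (rule ln_mult_pos) (use big in linarith)+
      also have "\<dots> \<le> 2 * ln ?y" using big ln_2_less_1 by linarith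
      finally show "ln ?l \<le> 2 * ln ?y" .
      show "0 \<le> ln ?l" using l2 by simp
    qed
    have "?l ^ 3 * ln ?l \<le> (2 * ?y) ^ 3 * (2 * ln ?y)" using l2 lnl X1 by (intro mult_mono power_mono) auto
    then have e1: "Kc * ((r * X)\<^sup>2 * (?l ^ 3 * ln ?l)) \<le> Kc * ((r * X)\<^sup>2 * ((2 * ?y) ^ 3 * (2 * ln ?y)))"
      using Kc by (intro mult_left_mono) auto
    have "\<bar>?l ^ 4 - ?y ^ 4\<bar> = \<bar>ln r\<bar> * (?l ^ 3 + ?l ^ 2 * ?y + ?l * ?y ^ 2 + ?y ^ 3)"
    proof -
      have "?l ^ 4 - ?y ^ 4 = (?l - ?y) * (?l ^ 3 + ?l ^ 2 * ?y + ?l * ?y ^ 2 + ?y ^ 3)"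
        by (simp add: power4_eq_xxxx power3_eq_cube power2_eq_square algebra_simps)
      moreover have "0 \<le> ?l ^ 3 + ?l ^ 2 * ?y + ?l * ?y ^ 2 + ?y ^ 3" using l2 big X1 by (intro add_nonneg_nonneg mult_nonneg_nonneg) auto
      ultimately show ?thesis using ly by (simp add: abs_mult)
    qed
    also have "\<dots> \<le> \<bar>ln r\<bar> * ((2 * ?y) ^ 3 + (2 * ?y) ^ 2 * ?y + (2 * ?y) * ?y ^ 2 + ?y ^ 3)"
      using l2 big X1 by (intro mult_left_mono add_mono mult_right_mono power_mono) auto
    also have "\<dots> = 15 * \<bar>ln r\<bar> * ?y ^ 3" by (simp add: power3_eq_cube power2_eq_square)
    finally have d4: "\<bar>?l ^ 4 - ?y ^ 4\<bar> \<le> 15 * \<bar>ln r\<bar> * ?y ^ 3" .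
    have mR: "measure lebesgue R \<le> 4 * r\<^sup>2"
      by (rule measure_le_square[OF cR]) (use r rs region_size_upper(2)[OF cR, of _ _ L] in auto)
    have mV: "measure lebesgue V \<le> 1" by (rule cut_by_measure_le[OF H(1)])
    let ?F = "X\<^sup>2 * measure lebesgue R / lattice_det \<Lambda> * (euler_const * measure lebesgue V)"
    have F: "\<bar>?F\<bar> \<le> X\<^sup>2 * (4 * r\<^sup>2) / lattice_det \<Lambda> * (KG * 1)"
      using mR mV abs_euler_const_le lattice_det_pos KG_nonneg unfolding abs_mult abs_divide
      by (intro mult_mono divide_mono) auto
    have "\<bar>?F * (?l ^ 4 - ?y ^ 4)\<bar> \<le> (X\<^sup>2 * (4 * r\<^sup>2) / lattice_det \<Lambda> * (KG * 1)) * (15 * \<bar>ln r\<bar> * ?y ^ 3)"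
      unfolding abs_mult[of ?F] using F d4 lattice_det_pos KG_nonneg by (intro mult_mono) auto
    also have "\<dots> \<le> (X\<^sup>2 * (4 * r\<^sup>2) / lattice_det \<Lambda> * (KG * 1)) * (15 * \<bar>ln r\<bar> * (?y ^ 3 * ln ?y))"
      using big lattice_det_pos KG_nonneg X1 by (intro mult_left_mono) (auto simp: mult_le_cancel_left1)
    finally have e2: "\<bar>?F * (?l ^ 4 - ?y ^ 4)\<bar> \<le> \<dots>" .
    have mt: "main_term \<Lambda> L R X V = ?F * ?y ^ 4"
      by (simp add: main_term_def at_primes_local_factor euler_const_def)
    have "\<bar>divisor_sum \<Lambda> L R X V - main_term \<Lambda> L R X V\<bar> \<le> \<bar>divisor_sum \<Lambda> L R X V - ?F * ?l ^ 4\<bar> + \<bar>?F * (?l ^ 4 - ?y ^ 4)\<bar>"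
      unfolding mt right_diff_distrib by linarith
    also have "\<dots> \<le> Kc * ((r * X)\<^sup>2 * ((2 * ?y) ^ 3 * (2 * ln ?y))) + (X\<^sup>2 * (4 * r\<^sup>2) / lattice_det \<Lambda> * (KG * 1)) * (15 * \<bar>ln r\<bar> * (?y ^ 3 * ln ?y))"
    proof (rule add_mono[OF _ e2])
      have "?F * ?l ^ 4 = X\<^sup>2 * measure lebesgue R / lattice_det \<Lambda> * (euler_const * ?l ^ 4 * measure lebesgue V)" by simp
      then show "\<bar>divisor_sum \<Lambda> L R X V - ?F * ?l ^ 4\<bar> \<le> Kc * ((r * X)\<^sup>2 * ((2 * ?y) ^ 3 * (2 * ln ?y)))"
        using main e1 by (simp only: mult.assoc)
    qed
    also have "\<dots> = K * (X\<^sup>2 * ?y ^ 3 * ln ?y)" by (simp add: K_def power_mult_distrib algebra_simps)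
    finally show "\<bar>divisor_sum \<Lambda> L R X V - main_term \<Lambda> L R X V\<bar> \<le> K * (X\<^sup>2 * ?y ^ 3 * ln ?y)" .
  qed
qed

lemma asymptotic:
  "\<exists>K. \<forall>\<^sub>F X in at_top. \<forall>R V. region m R \<longrightarrow> (\<forall>i. \<forall>x\<in>R. lform (L $ i) x \<ge> 0) \<longrightarrow>
    region_size L R = r \<longrightarrow> set_length (frontier (dilate X R)) \<le> ennreal (C * (r * X)) \<longrightarrow>
    compact V \<longrightarrow> cut_out N B V \<longrightarrow>
    \<bar>divisor_sum \<Lambda> L R X V - main_term \<Lambda> L R X V\<bar> \<le> K * (X\<^sup>2 * (ln X) ^ 3 * ln (ln X))"
proof (cases "r > 0")
  case True then show ?thesis using asymptotic_bound by blast
next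
  case False
  have "\<bar>divisor_sum \<Lambda> L R X V - main_term \<Lambda> L R X V\<bar> \<le> 0"
    if "X > 0" "region m R" "region_size L R = r" for R X V
  proof -
    \<comment> \<open>\<open>region_size\<close> bounds every \<open>\<bar>x $ j\<bar>\<close>, so
      for a nonempty region it can be nonpositive only if the region is the origin.\<close>
    have "x $ j = 0" if x: "x \<in> R" for x j
      using region_size_upper(2)[OF _ x, of j L] that False \<open>region m R\<close> \<open>region_size L R = r\<close>
      unfolding region_def by linarith
    then have "R \<subseteq> {0}" by (auto simp: vec_eq_iff)
    then show ?thesis using degenerate_region \<open>X > 0\<close> by simp
  qed
  then show ?thesis by (intro exI[of _ 0] eventually_mono[OF eventually_gt_at_top[of 0]]) auto
qed

end

text \<open>The constant multiplies the one for the polynomial factors at the primes dividing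
  \<open>bad\<close> by an absolute bound for all other primes; as a real number, \<open>bad\<close>
  is \<Delta> times the determinant.\<close>

lemma prod_local_factors_bound:
  assumes "\<epsilon> > 0"
  shows "\<exists>K. \<forall>\<Lambda> L. admissible \<Lambda> L \<longrightarrow> prodinf (at_primes (\<lambda>p. \<bar>local_factor \<Lambda> L p\<bar>))
    \<le> K * (of_int (form_Delta L) * lattice_det \<Lambda>) powr \<epsilon>"
proof -
  obtain K where K: "\<And>n. n > 0 \<Longrightarrow> (\<Prod>p\<in>prime_factors n. (real (multiplicity p n) + 4) ^ 4) \<le> K * real n powr \<epsilon>"
    using prod_multiplicity_bound[OF assms] by blast
  let ?E = "exp (suminf (\<lambda>p. K0 * real p powr (- 5 / 4)))"
  have "prodinf (at_primes (\<lambda>p. \<bar>local_factor \<Lambda> L p\<bar>)) \<le> (K * ?E) * (of_int (form_Delta L) * lattice_det \<Lambda>) powr \<epsilon>"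
    if "admissible \<Lambda> L" for \<Lambda> L
  proof -
    interpret adm \<Lambda> L by unfold_locales (rule that)
    show ?thesis
      using prodinf_c_bound[OF bad_pos refl K[OF bad_pos]]
      by (simp add: at_primes_abs_local_factor bad_eq mult_ac)
  qed
  then show ?thesis by blast
qed

theorem theorem2p1:
  shows "(\<forall>\<Lambda> L. admissible \<Lambda> L \<longrightarrow>
            (\<forall>p. prime p \<longrightarrow> local_term \<Lambda> L p summable_on UNIV) \<and>
            convergent_prod (at_primes (local_factor \<Lambda> L)) \<and>
            (\<forall>(r::real) (c::real) (m::nat) (N::nat) (B::real). \<exists>K::real. \<forall>\<^sub>F X::real in at_top.
               \<forall>R V. region m R \<longrightarrow>
                     (\<forall>i. \<forall>x\<in>R. lform (L $ i) x \<ge> 0) \<longrightarrow>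
                     region_size L R = r \<longrightarrow>
                     set_length (frontier (dilate X R)) \<le> ennreal (c * (r * X)) \<longrightarrow>
                     V \<noteq> {} \<longrightarrow> compact V \<longrightarrow> cut_out N B V \<longrightarrow>
                     \<bar>divisor_sum \<Lambda> L R X V - main_term \<Lambda> L R X V\<bar>
                       \<le> K * (X\<^sup>2 * (ln X) ^ 3 * ln (ln X))))
         \<and> (\<forall>\<epsilon>::real. \<epsilon> > 0 \<longrightarrow>
            (\<exists>K::real. \<forall>\<Lambda> L. admissible \<Lambda> L \<longrightarrow>
               convergent_prod (at_primes (\<lambda>p. \<bar>local_factor \<Lambda> L p\<bar>)) \<and>
               prodinf (at_primes (\<lambda>p. \<bar>local_factor \<Lambda> L p\<bar>))
                 \<le> K * (real_of_int (form_Delta L) * lattice_det \<Lambda>) powr \<epsilon>))"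
proof (intro conjI allI impI)
  fix \<Lambda> L assume "admissible \<Lambda> L"
  then interpret adm \<Lambda> L by unfold_locales
  show "local_term \<Lambda> L p summable_on UNIV" if "prime p" for p
    using h_local(1)[OF that] by (simp add: local_term_eq[OF that, abs_def])
  show "convergent_prod (at_primes (local_factor \<Lambda> L))"
    unfolding at_primes_local_factor by (rule convergent_c)
  fix r C :: real and m N :: nat and B :: real
  obtain K where "\<forall>\<^sub>F X in at_top. \<forall>R V. region m R \<longrightarrow> (\<forall>i. \<forall>x\<in>R. lform (L $ i) x \<ge> 0) \<longrightarrow>
      region_size L R = r \<longrightarrow> set_length (frontier (dilate X R)) \<le> ennreal (C * (r * X)) \<longrightarrow>
      compact V \<longrightarrow> cut_out N B V \<longrightarrow>
      \<bar>divisor_sum \<Lambda> L R X V - main_term \<Lambda> L R X V\<bar> \<le> K * (X\<^sup>2 * (ln X) ^ 3 * ln (ln X))"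
    using asymptotic by blast
  then show "\<exists>K. \<forall>\<^sub>F X in at_top. \<forall>R V. region m R \<longrightarrow> (\<forall>i. \<forall>x\<in>R. lform (L $ i) x \<ge> 0) \<longrightarrow>
      region_size L R = r \<longrightarrow> set_length (frontier (dilate X R)) \<le> ennreal (C * (r * X)) \<longrightarrow>
      V \<noteq> {} \<longrightarrow> compact V \<longrightarrow> cut_out N B V \<longrightarrow>
      \<bar>divisor_sum \<Lambda> L R X V - main_term \<Lambda> L R X V\<bar> \<le> K * (X\<^sup>2 * (ln X) ^ 3 * ln (ln X))"
    by (intro exI[of _ K]) (auto elim!: eventually_mono)
next
  fix \<epsilon> :: real assume "\<epsilon> > 0"
  have "convergent_prod (at_primes (\<lambda>p. \<bar>local_factor \<Lambda> L p\<bar>))" if "admissible \<Lambda> L" for \<Lambda> L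
  proof -
    interpret adm \<Lambda> L by unfold_locales (rule that)
    show ?thesis unfolding at_primes_abs_local_factor by (rule convergent_c)
  qed
  then show "\<exists>K. \<forall>\<Lambda> L. admissible \<Lambda> L \<longrightarrow> convergent_prod (at_primes (\<lambda>p. \<bar>local_factor \<Lambda> L p\<bar>)) \<and>
      prodinf (at_primes (\<lambda>p. \<bar>local_factor \<Lambda> L p\<bar>)) \<le> K * (real_of_int (form_Delta L) * lattice_det \<Lambda>) powr \<epsilon>"
    using prod_local_factors_bound[OF \<open>\<epsilon> > 0\<close>] by blast
qed

end
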